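(* Let $n\ge 1$, $p,q>1$, let $\Theta\subset\mathbb{R}^{n+1}$ be open and bounded, and let $\xi_0\in\partial\Theta$. The point $\xi_0$ is regular (with respect to $\Theta$, for the equation $\partial_t u=\Delta_p^q u$) if and only if there exists a barrier family in $\Theta$ at $\xi_0$.
   Context: Equation. Points of $\mathbb{R}^{n+1}$ are written $(x,t)$, and $\nabla$, $\Delta$, $D^2$ act in $x$ only. The equation is (E): $\partial_t u=\Delta_p^q u$, where for $\nabla u\neq 0$, $\Delta_p^q u=|\nabla u|^{q-p}\operatorname{div}(|\nabla u|^{p-2}\nabla u)=F(\nabla u,D^2u)$ with $F(\eta,X)=|\eta|^{q-2}\operatorname{Tr}\big(X+(p-2)\tfrac{\eta\otimes\eta}{|\eta|^2}X\big)$ for $\eta\in\mathbb{R}^n\setminus\{0\}$ and $X$ a symmetric $n\times n$ matrix. Admissible functions. $\mathcal{F}(F)$ is the set of $f\in C^2([0,\infty))$ with $f(0)=f'(0)=f''(0)=0$, $f''(r)>0$ for all $r>0$, and $\lim_{x\to 0,\,x\ne 0}F(\nabla g(x),D^2g(x))=0$ for $g(x)=f(|x|)$. $\Sigma$ is the set of even $\sigma\in C^1(\mathbb{R})$ with $\sigma(0)=\sigma'(0)=0$ and $\sigma(r)>0$ for $r>0$. A function $\varphi\in C^2(\Theta)$ is admissible at $(x_0,t_0)\in\Theta$ if either $\nabla\varphi(x_0,t_0)\ne0$, or there are $\delta>0$, $f\in\mathcal{F}(F)$, $\sigma\in\Sigma$ such that $|\varphi(x,t)-\varphi(x_0,t_0)-\partial_t\varphi(x_0,t_0)(t-t_0)|\le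 f(|x-x_0|)+\sigma(t-t_0)$ for all $(x,t)\in B_\delta(x_0)\times(t_0-\delta,t_0+\delta)$. Viscosity solutions. $u:\Theta\to\mathbb{R}\cup\{\infty\}$ is a viscosity supersolution of (E) in $\Theta$ if (1) $u$ is lower semicontinuous; (2) $u$ is finite in a dense subset of $\Theta$; (3) whenever $\varphi\in C^2(\Theta)$ is admissible at $\xi\in\Theta$ and touches $u$ at $\xi$ from below (i.e. $\varphi(\xi)=u(\xi)$ and $\varphi<u$ in a punctured neighborhood of $\xi$), then $\partial_t\varphi(\xi)-\Delta_p^q\varphi(\xi)\ge0$ if $\nabla\varphi(\xi)\ne0$, and $\partial_t\varphi(\xi)\ge0$ if $\nabla\varphi(\xi)=0$. $u:\Theta\to\mathbb{R}\cup\{-\infty\}$ is a viscosity subsolution if $-u$ is a viscosity supersolution. Perron solutions and regularity. For bounded $f:\partial\Theta\to\mathbb{R}$, $\mathcal{U}_f$ is the class of viscosity supersolutions $u$ of (E) in $\Theta$ that are bounded from below and satisfy $\liminf_{\Theta\ni\eta\to\xi}u(\eta)\ge f(\xi)$ for all $\xi\in\partial\Theta$; the upper Perron solution is $\overline{H}f(\xi)=\inf_{u\in\mathcal{U}_f}u(\xi)$, $\xi\in\Theta$. A point $\xi_0\in\partial\Theta$ is regular (with respect to $\Theta$) if $\lim_{\Theta\ni\xi\to\xi_0}\overline{H}f(\xi)=f(\xi_0)$ for every $f\in C(\partial\Theta)$. Barrier family. Functions $w_j:\Theta\to(0,\infty]$, $j=1,2,\dots$, form a barrier family in $\Theta$ at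 $\xi_0\in\partial\Theta$ if for each $j$: (a) $w_j$ is a positive viscosity supersolution of (E) in $\Theta$; (b) $\lim_{\Theta\ni\zeta\to\xi_0}w_j(\zeta)=0$; and (c) for each $k=1,2,\dots$ there is a $j$ such that $\liminf_{\Theta\ni\zeta\to\xi}w_j(\zeta)\ge k$ for all $\xi\in\partial\Theta$ with $|\xi-\xi_0|\ge 1/k$. *)

theory Defs
  imports "HOL-Analysis.Analysis"
begin

text \<open>Points \<open>(x, t)\<close> of \<open>(n+1)\<close>-dimensional space are elements of \<open>(real ^ 'n) \<times> real\<close>, whose norm
  is the Euclidean one. Functions on a domain are total functions whose values off the domain are
  never used.\<close>

subsection \<open>The operator\<close>

definition grad :: "(real ^ 'n \<Rightarrow> real) \<Rightarrow> real ^ 'n \<Rightarrow> real ^ 'n" where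
  "grad g x = (THE D. GDERIV g x :> D)"

definition hessian :: "(real ^ 'n \<Rightarrow> real) \<Rightarrow> real ^ 'n \<Rightarrow> real ^ 'n ^ 'n" where
  "hessian g x = jacobian (grad g) (at x)"

definition outer :: "real ^ 'n \<Rightarrow> real ^ 'n \<Rightarrow> real ^ 'n ^ 'n" where
  "outer a b = (\<chi> i j. a $ i * b $ j)"

text \<open>\<open>F(\<eta>, X) = |\<eta>|\<^sup>q\<^sup>-\<^sup>2 Tr(X + (p-2) (\<eta> \<otimes> \<eta> / |\<eta>|\<^sup>2) X)\<close>; only meaningful for \<open>\<eta> \<noteq> 0\<close>, and only used
  there.\<close>

definition pq_operator :: "real \<Rightarrow> real \<Rightarrow> real ^ 'n \<Rightarrow> real ^ 'n ^ 'n \<Rightarrow> real" where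
  "pq_operator p q \<eta> X =
     norm \<eta> powr (q - 2) *
     trace (X + (p - 2) *\<^sub>R (((1 / (norm \<eta>)\<^sup>2) *\<^sub>R outer \<eta> \<eta>) ** X))"

text \<open>For twice differentiable \<open>u\<close> with \<open>\<nabla>u \<noteq> 0\<close> this is the expanded form of
  \<open>|\<nabla>u|\<^sup>q\<^sup>-\<^sup>p div(|\<nabla>u|\<^sup>p\<^sup>-\<^sup>2 \<nabla>u)\<close>.\<close>

definition pq_laplacian :: "real \<Rightarrow> real \<Rightarrow> (real ^ 'n \<Rightarrow> real) \<Rightarrow> real ^ 'n \<Rightarrow> real" where
  "pq_laplacian p q u x = pq_operator p q (grad u x) (hessian u x)"

definition spatial_grad :: "((real ^ 'n) \<times> real \<Rightarrow> real) \<Rightarrow> (real ^ 'n) \<times> real \<Rightarrow> real ^ 'n" where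
  "spatial_grad \<phi> \<xi> = grad (\<lambda>x. \<phi> (x, snd \<xi>)) (fst \<xi>)"

definition spatial_pq_laplacian ::
  "real \<Rightarrow> real \<Rightarrow> ((real ^ 'n) \<times> real \<Rightarrow> real) \<Rightarrow> (real ^ 'n) \<times> real \<Rightarrow> real" where
  "spatial_pq_laplacian p q \<phi> \<xi> = pq_laplacian p q (\<lambda>x. \<phi> (x, snd \<xi>)) (fst \<xi>)"

definition time_deriv :: "((real ^ 'n) \<times> real \<Rightarrow> real) \<Rightarrow> (real ^ 'n) \<times> real \<Rightarrow> real" where
  "time_deriv \<phi> \<xi> = deriv (\<lambda>t. \<phi> (fst \<xi>, t)) (snd \<xi>)"

subsection \<open>Admissible test functions\<close>

text \<open>\<open>C\<^sup>2\<close> on an open set, in the Frechet sense.\<close>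

definition C2_on :: "'a::real_normed_vector set \<Rightarrow> ('a \<Rightarrow> real) \<Rightarrow> bool" where
  "C2_on S \<phi> \<longleftrightarrow>
     (\<exists>(\<phi>' :: 'a \<Rightarrow> 'a \<Rightarrow>\<^sub>L real) (\<phi>'' :: 'a \<Rightarrow> 'a \<Rightarrow>\<^sub>L ('a \<Rightarrow>\<^sub>L real)).
        (\<forall>z\<in>S. (\<phi> has_derivative blinfun_apply (\<phi>' z)) (at z)) \<and>
        (\<forall>z\<in>S. (\<phi>' has_derivative blinfun_apply (\<phi>'' z)) (at z)) \<and>
        continuous_on S \<phi>'')"

text \<open>\<open>radial_class\<close> is \<open>\<F>(F)\<close>, \<open>time_class\<close> is \<open>\<Sigma>\<close>. Derivatives of \<open>f\<close> at \<open>0\<close> are one-sided. The dimension enters only through the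
  limit condition and is therefore passed as a type.\<close>

definition radial_class :: "'n::finite itself \<Rightarrow> real \<Rightarrow> real \<Rightarrow> (real \<Rightarrow> real) set" where
  "radial_class _ p q =
     {f. (\<exists>f' f''.
            (\<forall>r\<ge>0. (f has_real_derivative f' r) (at r within {0..})) \<and>
            (\<forall>r\<ge>0. (f' has_real_derivative f'' r) (at r within {0..})) \<and>
            continuous_on {0..} f'' \<and>
            f 0 = 0 \<and> f' 0 = 0 \<and> f'' 0 = 0 \<and> (\<forall>r>0. f'' r > 0)) \<and>
         ((\<lambda>x :: real ^ 'n. pq_operator p q (grad (\<lambda>y. f (norm y)) x) (hessian (\<lambda>y. f (norm y)) x))
            \<longlongrightarrow> 0) (at 0)}"

definition time_class :: "(real \<Rightarrow> real) set" where
  "time_class =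
     {\<sigma>. (\<forall>r. \<sigma> (- r) = \<sigma> r) \<and> \<sigma> C1_differentiable_on UNIV \<and>
         \<sigma> 0 = 0 \<and> deriv \<sigma> 0 = 0 \<and> (\<forall>r>0. \<sigma> r > 0)}"

definition admissible_at ::
  "real \<Rightarrow> real \<Rightarrow> ((real ^ 'n) \<times> real) set \<Rightarrow> ((real ^ 'n) \<times> real \<Rightarrow> real) \<Rightarrow>
   (real ^ 'n) \<times> real \<Rightarrow> bool" where
  "admissible_at p q \<Theta> \<phi> \<xi> \<longleftrightarrow>
     spatial_grad \<phi> \<xi> \<noteq> 0 \<or>
     (\<exists>\<delta>>0. \<exists>f \<in> radial_class TYPE('n) p q. \<exists>\<sigma> \<in> time_class.
        ball (fst \<xi>) \<delta> \<times> {snd \<xi> - \<delta><..<snd \<xi> + \<delta>} \<subseteq> \<Theta> \<and>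
        (\<forall>x \<in> ball (fst \<xi>) \<delta>. \<forall>t \<in> {snd \<xi> - \<delta><..<snd \<xi> + \<delta>}.
           \<bar>\<phi> (x, t) - \<phi> \<xi> - time_deriv \<phi> \<xi> * (t - snd \<xi>)\<bar>
             \<le> f (norm (x - fst \<xi>)) + \<sigma> (t - snd \<xi>)))"

subsection \<open>Viscosity supersolutions\<close>

definition lsc_on :: "'a::topological_space set \<Rightarrow> ('a \<Rightarrow> ereal) \<Rightarrow> bool" where
  "lsc_on S u \<longleftrightarrow> (\<forall>z\<in>S. u z \<le> Liminf (at z within S) u)"

definition touches_from_below ::
  "'a::topological_space set \<Rightarrow> ('a \<Rightarrow> real) \<Rightarrow> ('a \<Rightarrow> ereal) \<Rightarrow> 'a \<Rightarrow> bool" where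
  "touches_from_below S \<phi> u \<xi> \<longleftrightarrow>
     ereal (\<phi> \<xi>) = u \<xi> \<and> (\<forall>\<^sub>F \<zeta> in at \<xi> within S. ereal (\<phi> \<zeta>) < u \<zeta>)"

definition viscosity_supersolution ::
  "real \<Rightarrow> real \<Rightarrow> ((real ^ 'n) \<times> real) set \<Rightarrow> ((real ^ 'n) \<times> real \<Rightarrow> ereal) \<Rightarrow> bool" where
  "viscosity_supersolution p q \<Theta> u \<longleftrightarrow>
     (\<forall>\<xi>\<in>\<Theta>. u \<xi> \<noteq> -\<infinity>) \<and>
     lsc_on \<Theta> u \<and>
     \<Theta> \<subseteq> closure {\<xi>\<in>\<Theta>. u \<xi> \<noteq> \<infinity>} \<and>
     (\<forall>\<phi>. \<forall>\<xi>\<in>\<Theta>. C2_on \<Theta> \<phi> \<longrightarrow> admissible_at p q \<Theta> \<phi> \<xi> \<longrightarrow> touches_from_below \<Theta> \<phi> u \<xi> \<longrightarrow>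
        (if spatial_grad \<phi> \<xi> \<noteq> 0
         then time_deriv \<phi> \<xi> - spatial_pq_laplacian p q \<phi> \<xi> \<ge> 0
         else time_deriv \<phi> \<xi> \<ge> 0))"

subsection \<open>Perron solutions, regular points and barriers\<close>

text \<open>Boundary data on the compact set \<open>frontier \<Theta>\<close> that are continuous are automatically bounded.\<close>

definition upper_class ::
  "real \<Rightarrow> real \<Rightarrow> ((real ^ 'n) \<times> real) set \<Rightarrow> ((real ^ 'n) \<times> real \<Rightarrow> real) \<Rightarrow>
   ((real ^ 'n) \<times> real \<Rightarrow> ereal) set" where
  "upper_class p q \<Theta> f =
     {u. viscosity_supersolution p q \<Theta> u \<and>
         (\<exists>m::real. \<forall>\<eta>\<in>\<Theta>. ereal m \<le> u \<eta>) \<and>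
         (\<forall>\<xi>\<in>frontier \<Theta>. Liminf (at \<xi> within \<Theta>) u \<ge> ereal (f \<xi>))}"

definition upper_perron ::
  "real \<Rightarrow> real \<Rightarrow> ((real ^ 'n) \<times> real) set \<Rightarrow> ((real ^ 'n) \<times> real \<Rightarrow> real) \<Rightarrow>
   (real ^ 'n) \<times> real \<Rightarrow> ereal" where
  "upper_perron p q \<Theta> f \<xi> = (INF u \<in> upper_class p q \<Theta> f. u \<xi>)"

definition regular_point ::
  "real \<Rightarrow> real \<Rightarrow> ((real ^ 'n) \<times> real) set \<Rightarrow> (real ^ 'n) \<times> real \<Rightarrow> bool" where
  "regular_point p q \<Theta> \<xi>\<^sub>0 \<longleftrightarrow>
     (\<forall>f. continuous_on (frontier \<Theta>) f \<longrightarrow>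
        (upper_perron p q \<Theta> f \<longlongrightarrow> ereal (f \<xi>\<^sub>0)) (at \<xi>\<^sub>0 within \<Theta>))"

text \<open>The family is indexed by \<open>j = 1, 2, \<dots>\<close>; the value \<open>w 0\<close> is irrelevant.\<close>

definition barrier_family ::
  "real \<Rightarrow> real \<Rightarrow> ((real ^ 'n) \<times> real) set \<Rightarrow> (real ^ 'n) \<times> real \<Rightarrow>
   (nat \<Rightarrow> (real ^ 'n) \<times> real \<Rightarrow> ereal) \<Rightarrow> bool" where
  "barrier_family p q \<Theta> \<xi>\<^sub>0 w \<longleftrightarrow>
     (\<forall>j\<ge>1. (\<forall>\<zeta>\<in>\<Theta>. 0 < w j \<zeta>) \<and> viscosity_supersolution p q \<Theta> (w j)) \<and>
     (\<forall>j\<ge>1. (w j \<longlongrightarrow> 0) (at \<xi>\<^sub>0 within \<Theta>)) \<and>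
     (\<forall>k\<ge>1. \<exists>j\<ge>1. \<forall>\<xi>\<in>frontier \<Theta>. dist \<xi> \<xi>\<^sub>0 \<ge> 1 / real k \<longrightarrow>
        Liminf (at \<xi> within \<Theta>) (w j) \<ge> ereal (real k))"

end

theory Submission
  imports Defs
begin

text \<open>A barrier family bounds the upper Perron solution near \<open>\<xi>\<^sub>0\<close> from above, since
  \<open>f \<xi>\<^sub>0 + \<epsilon> + w\<^sub>j\<close> belongs to the upper class, and from below by comparing each member \<open>u\<close> of the upper
  class with \<open>w\<^sub>j - f \<xi>\<^sub>0 + 2\<epsilon>\<close>. The latter is the comparison principle \<open>u + w \<ge> 0\<close> for two supersolutions
  whose boundary values have positive sum (\<open>- w\<close> is a subsolution as the operator is odd). It is proved
  by doubling variables with the penalty \<open>j |x - y|\<^sup>M + j (t - s)\<^sup>2\<close>: at a minimum with \<open>x \<noteq> y\<close> the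
  second-order jets come from inf-convolution and Jensen's lemma, where Rademacher's theorem is applied
  to the gradient map on the contact set, on which it is Lipschitz; while for \<open>x = y\<close> the large exponent \<open>M\<close> makes the test functions admissible.

  Conversely, if \<open>\<xi>\<^sub>0\<close> is regular, take the boundary data
  \<open>A (exp |x - x\<^sub>0|\<^sub>\<infinity> - 1) + B (t - t\<^sub>0)\<^sup>2\<close>, a maximum of strict classical subsolutions
  with non-vanishing gradient when \<open>A\<close> is large compared to \<open>B\<close>. Hence they bound every member of the
  upper class from below, and the lower semicontinuous envelope of the upper Perron solution is
  squeezed between them and the Perron solution; letting \<open>A\<close> and \<open>B\<close> grow gives the barrier family.\<close>

subsection \<open>Vitali coverings and negligible sets\<close>

text \<open>For \<open>q \<noteq> 2\<close> a multiple of a supersolution is in general not a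
  supersolution, so a single barrier cannot be scaled up; only constants can be added. Hence a
  family, with heights \<open>k\<close> that can exceed the oscillation of the data. The obstacle
  throughout is that the operator is undefined at zero gradient, where only the restricted class of
  admissible tests is available. Comparison therefore splits according to whether the penalty has a
  gradient; the supersolution property of envelopes rests on the operator tending to zero along
  radial profiles; and the data of the converse are built from one-dimensional exponentials, whose
  gradient never vanishes. Second-order information comes from the contact set alone. It has
  positive measure because its slopes fill a ball, and at a density point the derivative of the
  slope map gives a lower expansion in all directions and an upper one along the contact set. This
  one-sided information orders the two Hessians. The two gradients are opposite only approximately,
  so a limit, with Hessians in a fixed compact set, precedes the use of the equation.\<close>

text \<open>Disjoint small balls from Vitali's theorem cover almost all of \<open>S\<close> inside
  an open set barely larger than \<open>S\<close>; summing the local bounds would make the measure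
  of \<open>S\<close> at most \<open>\<theta>\<close> times that of the open set, hence less than
  itself. The balls need only contain \<open>x\<close>, which later allows intervals with
  \<open>x\<close> as an endpoint.\<close>

lemma vitali_negligible:
  fixes S :: "'a::euclidean_space set"
  assumes S: "S \<in> lmeasurable" and \<theta>: "0 \<le> \<theta>" "\<theta> < 1"
    and cov: "\<And>x d. x \<in> S \<Longrightarrow> 0 < d \<Longrightarrow> \<exists>a r. 0 < r \<and> r < d \<and> x \<in> cball a r \<and>
      emeasure lebesgue (S \<inter> cball a r) \<le> ennreal \<theta> * emeasure lebesgue (cball a r)"
  shows "negligible S"
proof (rule ccontr)
  assume neg: "\<not> negligible S"
  have Ss: "S \<in> sets lebesgue" using S by (simp add: fmeasurable_def)
  define m where "m = measure lebesgue S"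
  have em: "emeasure lebesgue S = ennreal m"
    using S unfolding m_def by (simp add: emeasure_eq_measure2)
  have m0: "m > 0"
    using neg S unfolding m_def by (simp add: negligible_iff_measure0 zero_less_measure_iff measure_nonneg order_less_le)
  \<comment> \<open>The excess is chosen so that \<open>\<theta> * (m + e) < m\<close>, the
    contradiction aimed at.\<close>
  define e where "e = m * (1 - \<theta>) / 2"
  have e0: "e > 0" using m0 \<theta> by (simp add: e_def)
  have lt: "\<theta> * (m + e) < m"
  proof -
    have "\<theta> * e \<le> e" using \<theta> e0 by (simp add: mult_left_le_one_le)
    moreover have "\<theta> * m + e < m" using m0 \<theta> unfolding e_def by (auto simp: field_simps)
    ultimately show ?thesis by (simp add: algebra_simps)
  qed
  obtain U where U: "open U" "S \<subseteq> U" "U - S \<in> lmeasurable" "emeasure lebesgue (U - S) < ennreal e"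
    using sets_lebesgue_outer_open[OF Ss e0] by blast
  have eU: "emeasure lebesgue U \<le> ennreal (m + e)"
  proof -
    have "emeasure lebesgue U \<le> emeasure lebesgue (S \<union> (U - S))"
      using U Ss by (intro emeasure_mono) (auto simp: fmeasurable_def)
    also have "\<dots> \<le> emeasure lebesgue S + emeasure lebesgue (U - S)"
      using U Ss by (intro emeasure_subadditive) (auto simp: fmeasurable_def)
    also have "\<dots> \<le> ennreal m + ennreal e" using U em by (auto intro!: add_mono simp: less_imp_le)
    finally show ?thesis using m0 e0 by simp
  qed
  define K where "K = {(a,r). 0 < r \<and> cball a r \<subseteq> U \<and>
      emeasure lebesgue (S \<inter> cball a r) \<le> ennreal \<theta> * emeasure lebesgue (cball a r)}"
  have cov': "\<exists>i. i \<in> K \<and> x \<in> cball (fst i) (snd i) \<and> snd i < d" if x: "x \<in> S" and d: "0 < d" for x d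
  proof -
    obtain e' where e': "e' > 0" "ball x e' \<subseteq> U" using U x open_contains_ball by blast
    obtain a r where ar: "0 < r" "r < min d (e'/2)" "x \<in> cball a r"
      "emeasure lebesgue (S \<inter> cball a r) \<le> ennreal \<theta> * emeasure lebesgue (cball a r)"
      using cov[OF x, of "min d (e'/2)"] d e' by auto
    have "cball a r \<subseteq> ball x e'"
    proof
      fix y assume "y \<in> cball a r"
      then have "dist x y \<le> r + r" using ar(3) dist_triangle[of x y a] by (simp add: dist_commute)
      then show "y \<in> ball x e'" using ar(2) by simp
    qed
    then have "(a,r) \<in> K" using ar e' by (auto simp: K_def)
    then show ?thesis using ar by (intro exI[of _ "(a,r)"]) auto
  qed
  have r0: "0 < snd i" if "i \<in> K" for i using that by (auto simp: K_def)
  obtain C where C: "countable C" "C \<subseteq> K"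
    "pairwise (\<lambda>i j. disjnt (cball (fst i) (snd i)) (cball (fst j) (snd j))) C"
    "negligible (S - (\<Union>i\<in>C. cball (fst i) (snd i)))"
    using Vitali_covering_theorem_cballs[of K snd S fst, OF r0 cov'] by blast
  define B where "B i = cball (fst i) (snd i)" for i :: "'a \<times> real"
  have Bm: "B i \<in> sets lebesgue" for i by (simp add: B_def)
  have disj: "disjoint_family_on B C" 
    using C(3) unfolding B_def disjoint_family_on_def pairwise_def disjnt_def by auto
  have disj': "disjoint_family_on (\<lambda>i. S \<inter> B i) C" using disj unfolding disjoint_family_on_def by blast
  have nn: "S - (\<Union>i\<in>C. B i) \<in> sets lebesgue" "(\<Union>i\<in>C. S \<inter> B i) \<in> sets lebesgue"
  proof -
    show "S - (\<Union>i\<in>C. B i) \<in> sets lebesgue" using C(4) by (simp add: B_def negligible_imp_sets)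
    show "(\<Union>i\<in>C. S \<inter> B i) \<in> sets lebesgue" using C(1) Bm Ss by (intro sets.countable_UN') auto
  qed
  have "emeasure lebesgue S \<le> emeasure lebesgue ((S - (\<Union>i\<in>C. B i)) \<union> (\<Union>i\<in>C. S \<inter> B i))"
    using nn by (intro emeasure_mono sets.Un) auto
  also have "\<dots> \<le> emeasure lebesgue (S - (\<Union>i\<in>C. B i)) + emeasure lebesgue (\<Union>i\<in>C. S \<inter> B i)"
    using nn by (intro emeasure_subadditive)
  also have "emeasure lebesgue (S - (\<Union>i\<in>C. B i)) = 0"
    using C(4) negligible_iff_emeasure0 negligible_imp_sets unfolding B_def by blast
  also have "emeasure lebesgue (\<Union>i\<in>C. S \<inter> B i) = (\<integral>\<^sup>+i. emeasure lebesgue (S \<inter> B i) \<partial>count_space C)"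
    using C(1) Bm Ss disj' by (intro emeasure_UN_countable) auto
  also have "\<dots> \<le> (\<integral>\<^sup>+i. ennreal \<theta> * emeasure lebesgue (B i) \<partial>count_space C)"
    using C(2) by (intro nn_integral_mono) (auto simp: K_def B_def)
  also have "\<dots> = ennreal \<theta> * (\<integral>\<^sup>+i. emeasure lebesgue (B i) \<partial>count_space C)"
    by (intro nn_integral_cmult) auto
  also have "(\<integral>\<^sup>+i. emeasure lebesgue (B i) \<partial>count_space C) = emeasure lebesgue (\<Union>i\<in>C. B i)"
    using C(1) Bm disj by (intro emeasure_UN_countable[symmetric]) auto
  also have "\<dots> \<le> emeasure lebesgue U"
  proof (rule emeasure_mono)
    show "(\<Union>i\<in>C. B i) \<subseteq> U" using C(2) unfolding K_def B_def by fastforce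
  qed (use U in auto)
  also have "ennreal \<theta> * emeasure lebesgue U \<le> ennreal \<theta> * ennreal (m + e)"
    using eU by (rule mult_left_mono) simp
  finally have "ennreal m \<le> ennreal (\<theta> * (m + e))"
    using em \<theta> m0 e0 by (simp add: ennreal_mult mult_left_mono)
  then have "m \<le> \<theta> * (m + e)" using m0 e0 \<theta> by (subst (asm) ennreal_le_iff) auto
  then show False using lt by simp
qed

text \<open>The hole around \<open>x + h\<close> misses \<open>A\<close> and lies in
  \<open>cball x (2 * norm h)\<close>, so it removes a fixed fraction of that ball, and
  \<open>vitali_negligible\<close> applies.\<close>

lemma porous_negligible:
  fixes A :: "'a::euclidean_space set"
  assumes A: "closed A" and \<epsilon>: "\<epsilon> > 0"
  shows "negligible {x \<in> A. \<forall>d>0. \<exists>h. norm h < d \<and> (\<forall>y\<in>A. norm (x + h - y) > \<epsilon> * norm h)}" (is "negligible ?P")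
proof -
  \<comment> \<open>Having distance more than \<open>c\<close> from \<open>A\<close> is an open
    condition; this exhibits the porous set as a countable intersection of open sets within
    \<open>A\<close>, hence Borel.\<close>
  have op: "open {x. \<forall>y\<in>A. norm (x + h - y) > c}" for c h
  proof (cases "A = {}")
    case False
    have "{x. \<forall>y\<in>A. norm (x + h - y) > c} = {x. infdist (x + h) A > c}"
    proof (intro Collect_cong iffI ballI)
      fix x assume *: "\<forall>y\<in>A. norm (x + h - y) > c"
      obtain y where "y \<in> A" "infdist (x + h) A = dist (x + h) y"
        using infdist_attains_inf[OF A False] by blast
      then show "infdist (x + h) A > c" using * by (auto simp: dist_norm)
    next
      fix x y assume *: "infdist (x + h) A > c" "y \<in> A"
      then show "norm (x + h - y) > c" using infdist_le[of y A "x+h"] by (auto simp: dist_norm)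
    qed
    also have "open \<dots>" by (intro open_Collect_less continuous_intros)
    finally show ?thesis .
  qed simp
  \<comment> \<open>Capping at 1 keeps the hole inside the ball of radius
    \<open>2 * norm h\<close>.\<close>
  define \<epsilon>' where "\<epsilon>' = min \<epsilon> 1"
  have \<epsilon>': "0 < \<epsilon>'" "\<epsilon>' \<le> 1" "\<epsilon>' \<le> \<epsilon>" using \<epsilon> by (auto simp: \<epsilon>'_def)
  have Peq: "?P = A \<inter> (\<Inter>k::nat. \<Union>h\<in>{h. norm h < 1 / real (Suc k)}. {x. \<forall>y\<in>A. norm (x + h - y) > \<epsilon> * norm h})"
    (is "_ = ?Q")
  proof (intro set_eqI iffI)
    fix x assume "x \<in> ?P" then show "x \<in> ?Q" by auto
  next
    fix x assume x: "x \<in> ?Q"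
    show "x \<in> ?P"
    proof (intro CollectI conjI allI impI)
      show "x \<in> A" using x by simp
      fix d :: real assume "d > 0"
      then obtain k where k: "1 / real (Suc k) < d" using reals_Archimedean[of d] by (auto simp: inverse_eq_divide)
      then obtain h where "norm h < 1 / real (Suc k)" "\<forall>y\<in>A. norm (x + h - y) > \<epsilon> * norm h" using x by blast
      then show "\<exists>h. norm h < d \<and> (\<forall>y\<in>A. norm (x + h - y) > \<epsilon> * norm h)" using k by (intro exI[of _ h]) auto
    qed
  qed
  have Pb: "?P \<in> sets borel" unfolding Peq
  proof (intro sets.Int sets.countable_INT'')
    show "A \<in> sets borel" using A by (rule borel_closed)
    fix k :: nat
    show "(\<Union>h\<in>{h. norm h < 1 / real (Suc k)}. {x. \<forall>y\<in>A. norm (x + h - y) > \<epsilon> * norm h}) \<in> sets borel"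
      using op by (intro borel_open open_UN) blast
  qed auto
  define \<theta> where "\<theta> = 1 - (\<epsilon>' / 2) ^ DIM('a)"
  have \<theta>: "0 \<le> \<theta>" "\<theta> < 1" using \<epsilon>' by (auto simp: \<theta>_def power_le_one)
  have "negligible (?P \<inter> cball 0 (real N))" for N
  proof (rule vitali_negligible[OF _ \<theta>])
    show "?P \<inter> cball 0 (real N) \<in> lmeasurable"
    proof (rule bounded_set_imp_lmeasurable)
      show "bounded (?P \<inter> cball 0 (real N))" by (rule bounded_subset[of "cball 0 (real N)"]) auto
      show "?P \<inter> cball 0 (real N) \<in> sets lebesgue" using Pb by auto
    qed
    fix x :: 'a and d :: real assume x: "x \<in> ?P \<inter> cball 0 (real N)" and d: "0 < d"
    then obtain h where h: "norm h < d / 2" "\<forall>y\<in>A. norm (x + h - y) > \<epsilon> * norm h"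
      by (auto dest!: spec[of _ "d/2"])
    have h0: "norm h > 0" using h(2) x by force
    let ?r = "2 * norm h"
    have sub: "ball (x + h) (\<epsilon>' * norm h) \<subseteq> cball x ?r"
    proof
      fix z assume "z \<in> ball (x + h) (\<epsilon>' * norm h)"
      then have "dist x z \<le> norm h + \<epsilon>' * norm h"
        using dist_triangle[of x z "x+h"] by (simp add: dist_norm)
      also have "\<dots> \<le> ?r" using \<epsilon>' h0 by (simp add: mult_left_le_one_le)
      finally show "z \<in> cball x ?r" by simp
    qed
    have dis: "A \<inter> ball (x + h) (\<epsilon>' * norm h) = {}"
    proof -
      have "\<epsilon>' * norm h \<le> \<epsilon> * norm h" using \<epsilon>' by (simp add: mult_right_mono)
      then show ?thesis using h(2) by (force simp: dist_norm)
    qed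
    have "emeasure lebesgue ((?P \<inter> cball 0 (real N)) \<inter> cball x ?r)
        \<le> emeasure lebesgue (cball x ?r - ball (x + h) (\<epsilon>' * norm h))"
      using dis by (intro emeasure_mono) auto
    also have "\<dots> = ennreal (measure lebesgue (cball x ?r - ball (x + h) (\<epsilon>' * norm h)))"
      by (intro emeasure_eq_measure2) (simp add: fmeasurable.Diff)
    also have "measure lebesgue (cball x ?r - ball (x + h) (\<epsilon>' * norm h))
        = measure lebesgue (cball x ?r) - measure lebesgue (ball (x + h) (\<epsilon>' * norm h))"
      using sub by (intro measurable_measure_Diff) auto
    also have "\<dots> = \<theta> * measure lebesgue (cball x ?r)"
    proof -
      have "measure lebesgue (cball x ?r) = ?r ^ DIM('a) * measure lebesgue (ball (0::'a) 1)"
        using content_ball_conv_unit_ball[of ?r x] by (simp add: content_cball_conv_ball)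
      moreover have "measure lebesgue (ball (x + h) (\<epsilon>' * norm h)) = (\<epsilon>' * norm h) ^ DIM('a) * measure lebesgue (ball (0::'a) 1)"
        using content_ball_conv_unit_ball[of "\<epsilon>' * norm h" "x + h"] \<epsilon>' by simp
      ultimately show ?thesis by (simp only:) (simp add: \<theta>_def power_mult_distrib power_divide algebra_simps)
    qed
    also have "ennreal \<dots> = ennreal \<theta> * emeasure lebesgue (cball x ?r)"
      using \<theta> by (simp add: ennreal_mult emeasure_eq_measure2)
    finally show "\<exists>a r. 0 < r \<and> r < d \<and> x \<in> cball a r \<and>
      emeasure lebesgue ((?P \<inter> cball 0 (real N)) \<inter> cball a r) \<le> ennreal \<theta> * emeasure lebesgue (cball a r)"
      using h0 h(1) by (intro exI[of _ x] exI[of _ ?r]) auto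
  qed
  then have "negligible (\<Union>N. ?P \<inter> cball 0 (real N))" by (intro negligible_countable_Union) auto
  moreover have "?P = (\<Union>N. ?P \<inter> cball 0 (real N))"
    using real_arch_simple by (auto simp: Bex_def) 
  ultimately show ?thesis by simp
qed

text \<open>The density theorem in the form used below: near almost every point of \<open>A\<close>
  a displacement \<open>h\<close> can be corrected, at relative cost \<open>\<epsilon>\<close>, to
  one that ends in \<open>A\<close>.\<close>

lemma density_point_negligible:
  fixes A :: "'a::euclidean_space set"
  assumes A: "closed A"
  shows "negligible {x \<in> A. \<not> (\<forall>\<epsilon>>0. \<exists>d>0. \<forall>h. norm h < d \<longrightarrow> (\<exists>y\<in>A. norm (x + h - y) \<le> \<epsilon> * norm h))}" (is "negligible ?P")
proof -
  let ?Q = "\<lambda>\<epsilon>. {x \<in> A. \<forall>d>0. \<exists>h. norm h < d \<and> (\<forall>y\<in>A. norm (x + h - y) > \<epsilon> * norm h)}"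
  have "?P \<subseteq> (\<Union>k::nat. ?Q (1 / real (Suc k)))"
  proof
    fix x assume x: "x \<in> ?P"
    then obtain \<epsilon> where \<epsilon>: "\<epsilon> > 0" "\<And>d. d > 0 \<Longrightarrow> \<exists>h. norm h < d \<and> (\<forall>y\<in>A. norm (x + h - y) > \<epsilon> * norm h)"
      by (auto simp: not_le)
    obtain k where k: "1 / real (Suc k) < \<epsilon>" using reals_Archimedean[OF \<epsilon>(1)] by (auto simp: inverse_eq_divide)
    have "x \<in> ?Q (1 / real (Suc k))"
    proof (intro CollectI conjI allI impI)
      show "x \<in> A" using x by simp
      fix d :: real assume "d > 0"
      then obtain h where h: "norm h < d" "\<forall>y\<in>A. norm (x + h - y) > \<epsilon> * norm h" using \<epsilon>(2) by blast
      have "1 / real (Suc k) * norm h \<le> \<epsilon> * norm h" using k by (intro mult_right_mono) auto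
      then show "\<exists>h. norm h < d \<and> (\<forall>y\<in>A. norm (x + h - y) > 1 / real (Suc k) * norm h)"
        using h by (intro exI[of _ h]) force
    qed
    then show "x \<in> (\<Union>k::nat. ?Q (1 / real (Suc k)))" by blast
  qed
  moreover have "negligible (\<Union>k::nat. ?Q (1 / real (Suc k)))"
  proof (intro negligible_countable_Union)
    fix Q assume "Q \<in> range (\<lambda>k::nat. ?Q (1 / real (Suc k)))"
    then obtain k :: nat where "Q = ?Q (1 / real (Suc k))" by blast
    then show "negligible Q" using porous_negligible[OF A, of "1 / real (Suc k)"] by simp
  qed simp
  ultimately show ?thesis using negligible_subset by blast
qed

subsection \<open>Rademacher's theorem\<close>

text \<open>Adding a linear function makes \<open>g\<close> monotone, so its increments form a
  measure. Where the difference quotients oscillate across \<open>r < s\<close>, take an interval of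
  mean slope below \<open>r\<close>: the oscillation set inside it is covered, up to a null set, by
  disjoint intervals of slope at least \<open>s\<close>, whose total length is at most
  \<open>r / s\<close> times that of the interval. So \<open>vitali_negligible\<close>
  applies.\<close>

lemma lipschitz_real_AE_differentiable:
  fixes g :: "real \<Rightarrow> real"
  assumes L: "\<And>x y. \<bar>g x - g y\<bar> \<le> L * \<bar>x - y\<bar>"
  shows "negligible {x. \<not> g differentiable (at x)}"
proof -
  have L0: "L \<ge> 0" using L[of 1 0] by simp
  define G where "G x = g x + L * x" for x
  have mono: "G x \<le> G y" if "x \<le> y" for x y
    using L[of x y] that by (simp add: G_def algebra_simps abs_if split: if_splits)
  have cg: "continuous_on UNIV g"
  proof -
    have "L-lipschitz_on UNIV g" using L L0 by (auto simp: lipschitz_on_def dist_real_def)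
    then show ?thesis by (rule lipschitz_on_continuous_on)
  qed
  have cG: "continuous_on UNIV G" unfolding G_def by (intro continuous_intros cg)
  have em: "emeasure (interval_measure G) {a..b} = ennreal (G b - G a)" if "a \<le> b" for a b
    by (rule emeasure_interval_measure_Icc[OF that mono cG])
  define q where "q x y = (G y - G x) / (y - x)" for x y
  have q_pos: "q x y \<ge> 0" for x y
    using mono[of x y] mono[of y x] unfolding q_def
    by (cases "x \<le> y") (auto intro!: divide_nonneg_nonneg divide_nonpos_nonpos)
  have q_le: "q x y \<le> 2 * L" for x y
  proof (cases "x = y")
    case False
    have "\<bar>g y - g x\<bar> \<le> L * \<bar>y - x\<bar>" by (rule L)
    then have "\<bar>(g y - g x) / (y - x)\<bar> \<le> L" using False by (simp add: abs_divide pos_divide_le_eq)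
    moreover have "q x y = (g y - g x) / (y - x) + L" using False by (simp add: q_def G_def field_simps)
    ultimately show ?thesis by linarith
  qed (use L0 in \<open>simp add: q_def\<close>)
  \<comment> \<open>Quotients below \<open>r\<close> and above \<open>s\<close> both occur at every
    scale. As the quotients are bounded, non-differentiability means membership for some rational
    pair.\<close>
  define E where "E r s = {x. (\<forall>d>0. \<exists>y. y \<noteq> x \<and> \<bar>y - x\<bar> < d \<and> q x y < r) \<and>
      (\<forall>d>0. \<exists>y. y \<noteq> x \<and> \<bar>y - x\<bar> < d \<and> q x y > s)}" for r s
  have Ent: "negligible (E r s)" if rs: "0 \<le> r" "r < s" for r s
  proof -
    have op1: "open {x. G (x + h) - G x < c}" "open {x. G (x + h) - G x > c}" for h c
      by (intro open_Collect_less continuous_intros continuous_on_compose2[OF cG] cG; auto)+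
    have opq: "open {x. q x (x + h) < r}" "open {x. q x (x + h) > s}" if "h \<noteq> 0" for h
    proof -
      have "{x. q x (x + h) < r} = (if h > 0 then {x. G (x + h) - G x < r * h} else {x. G (x + h) - G x > r * h})"
        using that by (auto simp: q_def field_simps)
      then show "open {x. q x (x + h) < r}" using op1 by simp
      have "{x. q x (x + h) > s} = (if h > 0 then {x. G (x + h) - G x > s * h} else {x. G (x + h) - G x < s * h})"
        using that by (auto simp: q_def field_simps)
      then show "open {x. q x (x + h) > s}" using op1 by simp
    qed
    have Eeq: "E r s = (\<Inter>k::nat. \<Union>h\<in>{h. h \<noteq> 0 \<and> \<bar>h\<bar> < 1 / real (Suc k)}. {x. q x (x + h) < r}) \<inter>
       (\<Inter>k::nat. \<Union>h\<in>{h. h \<noteq> 0 \<and> \<bar>h\<bar> < 1 / real (Suc k)}. {x. q x (x + h) > s})" (is "_ = ?A \<inter> ?B")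
    proof -
      have *: "(\<forall>d>0. \<exists>y. y \<noteq> x \<and> \<bar>y - x\<bar> < d \<and> P y) \<longleftrightarrow> (\<forall>k::nat. \<exists>h. h \<noteq> 0 \<and> \<bar>h\<bar> < 1 / real (Suc k) \<and> P (x + h))" for P and x::real
      proof (intro iffI allI impI)
        fix k :: nat assume "\<forall>d>0. \<exists>y. y \<noteq> x \<and> \<bar>y - x\<bar> < d \<and> P y"
        then obtain y where "y \<noteq> x" "\<bar>y - x\<bar> < 1 / real (Suc k)" "P y" by (metis of_nat_0_less_iff zero_less_Suc zero_less_divide_1_iff)
        then show "\<exists>h. h \<noteq> 0 \<and> \<bar>h\<bar> < 1 / real (Suc k) \<and> P (x + h)" by (intro exI[of _ "y - x"]) auto
      next
        fix d :: real assume H: "\<forall>k::nat. \<exists>h. h \<noteq> 0 \<and> \<bar>h\<bar> < 1 / real (Suc k) \<and> P (x + h)" and "d > 0"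
        then obtain k where k: "1 / real (Suc k) < d" using reals_Archimedean[of d] by (auto simp: inverse_eq_divide)
        obtain h where "h \<noteq> 0" "\<bar>h\<bar> < 1 / real (Suc k)" "P (x + h)" using H by blast
        then show "\<exists>y. y \<noteq> x \<and> \<bar>y - x\<bar> < d \<and> P y" using k by (intro exI[of _ "x + h"]) auto
      qed
      show ?thesis unfolding E_def by (subst (1 2) *) auto
    qed
    have bor: "E r s \<in> sets borel" unfolding Eeq
      using opq by (intro sets.Int sets.countable_INT'' borel_open open_UN) blast+
    have "negligible (E r s \<inter> {- real N..real N})" for N
    proof (rule vitali_negligible[where \<theta> = "r / s"])
      show "0 \<le> r / s" "r / s < 1" using rs by auto
      show "E r s \<inter> {- real N..real N} \<in> lmeasurable"
      proof (rule bounded_set_imp_lmeasurable)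
        show "bounded (E r s \<inter> {- real N..real N})" by (rule bounded_subset[of "{- real N..real N}"]) auto
        show "E r s \<inter> {- real N..real N} \<in> sets lebesgue" using bor by auto
      qed
      fix x d :: real assume x: "x \<in> E r s \<inter> {- real N..real N}" and d: "0 < d"
      then obtain y where y: "y \<noteq> x" "\<bar>y - x\<bar> < d" "q x y < r" unfolding E_def by blast
      define a b where "a = min x y" and "b = max x y"
      have ab: "a < b" using y by (auto simp: a_def b_def)
      have qab: "G b - G a < r * (b - a)"
        using y(1,3) by (auto simp: q_def a_def b_def min_def max_def field_simps split: if_splits)
      let ?S = "E r s \<inter> {- real N..real N}"
      let ?T = "?S \<inter> {a<..<b}"
      \<comment> \<open>Intervals, given by midpoint and half-length, along which \<open>G\<close>
        rises at least at rate \<open>s\<close>; \<open>cov\<close> finds them with \<open>z\<close>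
        as an endpoint.\<close>
      define K where "K = {(c,\<rho>). 0 < \<rho> \<and> cball c \<rho> \<subseteq> {a..b} \<and> s * (2 * \<rho>) \<le> G (c + \<rho>) - G (c - \<rho>)}"
      have cov: "\<exists>i. i \<in> K \<and> z \<in> cball (fst i) (snd i) \<and> snd i < e" if z: "z \<in> ?T" and e: "0 < e" for z e
      proof -
        define e' where "e' = min e (min (z - a) (b - z))"
        have e': "e' > 0" using z e by (auto simp: e'_def)
        then obtain w where w: "w \<noteq> z" "\<bar>w - z\<bar> < e'" "q z w > s" using z unfolding E_def by blast
        let ?c = "(z + w) / 2" and ?\<rho> = "\<bar>w - z\<bar> / 2"
        have f1: "?c + ?\<rho> = max z w" and f1': "?c - ?\<rho> = min z w" by (auto simp: max_def min_def abs_if field_simps)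
        have f2: "s * (max z w - min z w) \<le> G (max z w) - G (min z w)"
          using w(1,3) by (auto simp: q_def min_def max_def field_simps split: if_splits)
        have f3: "cball ?c ?\<rho> \<subseteq> {a..b}" 
          using w(2) by (auto simp: cball_eq_atLeastAtMost e'_def abs_if field_simps split: if_splits)
        have f4: "z \<in> cball ?c ?\<rho>" by (auto simp: cball_eq_atLeastAtMost abs_if field_simps)
        have f5: "2 * ?\<rho> = max z w - min z w" by (auto simp: max_def min_def abs_if)
        have f6: "s * (2 * ?\<rho>) \<le> G (?c + ?\<rho>) - G (?c - ?\<rho>)" unfolding f1 f1' f5 by (rule f2)
        have f7: "0 < ?\<rho>" "?\<rho> < e" using w(1,2) by (auto simp: e'_def)
        have "(?c, ?\<rho>) \<in> K" unfolding K_def using f3 f6 f7 by blast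
        then show ?thesis using f4 f7 by (intro exI[of _ "(?c, ?\<rho>)"]) (simp only: fst_conv snd_conv)
      qed
      have r0: "0 < snd i" if "i \<in> K" for i using that by (auto simp: K_def)
      obtain C where C: "countable C" "C \<subseteq> K"
        "pairwise (\<lambda>i j. disjnt (cball (fst i) (snd i)) (cball (fst j) (snd j))) C"
        "negligible (?T - (\<Union>i\<in>C. cball (fst i) (snd i)))"
        using Vitali_covering_theorem_cballs[of K snd ?T fst, OF r0 cov] by blast
      define B where "B i = cball (fst i) (snd i)" for i :: "real \<times> real"
      have BI: "B i = {fst i - snd i..fst i + snd i}" for i by (simp add: B_def cball_eq_atLeastAtMost)
      have disj: "disjoint_family_on B C" 
        using C(3) unfolding B_def disjoint_family_on_def pairwise_def disjnt_def by auto
      have B_in: "B i \<in> sets borel" for i by (simp add: B_def)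
      have UNb: "(\<Union>i\<in>C. B i) \<in> sets borel" using C(1) by (intro sets.countable_UN') (auto simp: BI)
      have ng: "negligible (?S \<inter> cball ((a+b)/2) ((b-a)/2) - (\<Union>i\<in>C. B i))"
      proof (rule negligible_subset)
        show "negligible ((?T - (\<Union>i\<in>C. cball (fst i) (snd i))) \<union> {a} \<union> {b})"
          using C(4) by (intro negligible_Un negligible_sing)
        show "?S \<inter> cball ((a+b)/2) ((b-a)/2) - (\<Union>i\<in>C. B i) \<subseteq> (?T - (\<Union>i\<in>C. cball (fst i) (snd i))) \<union> {a} \<union> {b}"
          by (auto simp: B_def cball_eq_atLeastAtMost[of "(a+b)/2"] field_simps)
      qed
      have s0: "s > 0" using rs by simp
      have "emeasure lebesgue (?S \<inter> cball ((a+b)/2) ((b-a)/2)) \<le> 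
        emeasure lebesgue ((?S \<inter> cball ((a+b)/2) ((b-a)/2) - (\<Union>i\<in>C. B i)) \<union> (\<Union>i\<in>C. B i))"
        using UNb ng by (intro emeasure_mono sets.Un) (auto intro: negligible_imp_sets)
      also have "\<dots> \<le> emeasure lebesgue (?S \<inter> cball ((a+b)/2) ((b-a)/2) - (\<Union>i\<in>C. B i)) + emeasure lebesgue (\<Union>i\<in>C. B i)"
        using UNb ng by (intro emeasure_subadditive) (auto intro: negligible_imp_sets)
      also have "emeasure lebesgue (?S \<inter> cball ((a+b)/2) ((b-a)/2) - (\<Union>i\<in>C. B i)) = 0"
        using ng negligible_iff_emeasure0 negligible_imp_sets by blast
      also have "emeasure lebesgue (\<Union>i\<in>C. B i) = (\<integral>\<^sup>+i. emeasure lebesgue (B i) \<partial>count_space C)"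
        using C(1) disj by (intro emeasure_UN_countable) (simp_all add: B_in)
      \<comment> \<open>Length is exchanged for \<open>interval_measure G\<close>, which adds up
        over disjoint intervals and is bounded by the increment of \<open>G\<close> over
        \<open>{a..b}\<close>.\<close>
      also have "\<dots> \<le> (\<integral>\<^sup>+i. ennreal (1/s) * emeasure (interval_measure G) (B i) \<partial>count_space C)"
      proof (intro nn_integral_mono)
        fix i assume "i \<in> space (count_space C)"
        then have i: "i \<in> K" using C(2) by auto
        then have "snd i > 0" "2 * snd i \<le> 1/s * (G (fst i + snd i) - G (fst i - snd i))"
          using s0 by (auto simp: K_def field_simps)
        then show "emeasure lebesgue (B i) \<le> ennreal (1/s) * emeasure (interval_measure G) (B i)"
          using s0 mono by (simp add: BI em ennreal_mult'[symmetric] )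
      qed
      also have "\<dots> = ennreal (1/s) * (\<integral>\<^sup>+i. emeasure (interval_measure G) (B i) \<partial>count_space C)"
        by (intro nn_integral_cmult) auto
      also have "(\<integral>\<^sup>+i. emeasure (interval_measure G) (B i) \<partial>count_space C) = emeasure (interval_measure G) (\<Union>i\<in>C. B i)"
        using C(1) disj by (intro emeasure_UN_countable[symmetric]) (simp_all add: B_in)
      also have "\<dots> \<le> emeasure (interval_measure G) {a..b}"
      proof (rule emeasure_mono)
        show "(\<Union>i\<in>C. B i) \<subseteq> {a..b}" using C(2) unfolding K_def B_def by fastforce
      qed simp
      also have "\<dots> = ennreal (G b - G a)" using ab by (intro em) simp
      also have "ennreal (1/s) * ennreal (G b - G a) \<le> ennreal (1/s) * ennreal (r * (b - a))"
        using qab by (intro mult_left_mono ennreal_leI) auto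
      also have "\<dots> = ennreal (r/s) * emeasure lebesgue (cball ((a+b)/2) ((b-a)/2))"
        using ab s0 rs by (simp add: cball_eq_atLeastAtMost ennreal_mult'[symmetric] field_simps)
      finally have *: "emeasure lebesgue (?S \<inter> cball ((a+b)/2) ((b-a)/2)) \<le> ennreal (r/s) * emeasure lebesgue (cball ((a+b)/2) ((b-a)/2))"
        by (simp add: mult_left_mono)
      show "\<exists>c \<rho>. 0 < \<rho> \<and> \<rho> < d \<and> x \<in> cball c \<rho> \<and>
           emeasure lebesgue (?S \<inter> cball c \<rho>) \<le> ennreal (r/s) * emeasure lebesgue (cball c \<rho>)"
      proof (intro exI conjI)
        show "x \<in> cball ((a+b)/2) ((b-a)/2)" by (auto simp: cball_eq_atLeastAtMost a_def b_def field_simps)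
        show "(b - a)/2 < d" using y(2) d by (auto simp: a_def b_def)
      qed (use ab * in auto)
    qed
    then have "negligible (\<Union>N. E r s \<inter> {- real N..real N})" by (intro negligible_countable_Union) auto
    moreover have "E r s = (\<Union>N. E r s \<inter> {- real N..real N})"
    proof -
      have "\<exists>N::nat. x \<in> {- real N..real N}" for x :: real
      proof -
        obtain N :: nat where "\<bar>x\<bar> \<le> real N" using real_arch_simple by blast
        then show ?thesis by (intro exI[of _ N]) auto
      qed
      then show ?thesis by blast
    qed
    ultimately show ?thesis by simp
  qed
  have sub: "{x. \<not> g differentiable (at x)} \<subseteq> (\<Union>(r,s)\<in>{(r::rat,s::rat). 0 \<le> r \<and> r < s}. E (of_rat r) (of_rat s))"
  proof (intro subsetI, rule ccontr)
    fix x assume nd: "x \<in> {x. \<not> g differentiable (at x)}"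
      and nE: "x \<notin> (\<Union>(r,s)\<in>{(r::rat,s::rat). 0 \<le> r \<and> r < s}. E (of_rat r) (of_rat s))"
    let ?Q = "\<lambda>y. ereal (q x y)"
    have bd: "0 \<le> Liminf (at x) ?Q" "Limsup (at x) ?Q \<le> ereal (2 * L)"
      using q_pos q_le by (auto intro!: Liminf_bounded Limsup_bounded)
    have le: "Liminf (at x) ?Q \<le> Limsup (at x) ?Q" by (rule Liminf_le_Limsup) simp
    have ev: "(\<forall>\<^sub>F y in at x. P y) \<longleftrightarrow> (\<exists>d>0. \<forall>y. y \<noteq> x \<and> \<bar>y - x\<bar> < d \<longrightarrow> P y)" for P
      by (auto simp: eventually_at dist_real_def)
    have "\<not> Liminf (at x) ?Q < Limsup (at x) ?Q"
    proof
      assume "Liminf (at x) ?Q < Limsup (at x) ?Q"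
      then obtain r where r: "Liminf (at x) ?Q < ereal (real_of_rat r)" "ereal (real_of_rat r) < Limsup (at x) ?Q"
        using ereal_dense3 by blast
      then obtain s where s: "ereal (real_of_rat r) < ereal (real_of_rat s)" "ereal (real_of_rat s) < Limsup (at x) ?Q"
        using ereal_dense3 by blast
      have r0: "r \<ge> 0" using le_less_trans[OF bd(1) r(1)] by simp
      have "x \<in> E (of_rat r) (of_rat s)"
      proof -
        have "\<not> (\<forall>\<^sub>F y in at x. real_of_rat r \<le> q x y)"
          using r(1) Liminf_bounded[of "ereal (real_of_rat r)" ?Q "at x"] by auto
        moreover have "\<not> (\<forall>\<^sub>F y in at x. q x y \<le> real_of_rat s)"
          using s(2) Limsup_bounded[of ?Q "ereal (real_of_rat s)" "at x"] by auto
        ultimately show ?thesis unfolding E_def ev by (auto simp: not_le)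
      qed
      moreover have "r < s" using s(1) by (simp add: of_rat_less)
      ultimately show False using nE r0 by auto
    qed
    then have eq: "Liminf (at x) ?Q = Limsup (at x) ?Q" using le by simp
    define z where "z = Liminf (at x) ?Q"
    have "0 \<le> z" "z \<le> ereal (2 * L)" using bd eq by (simp_all add: z_def)
    then obtain l where "z = ereal l" by (cases z) auto
    then have l: "Liminf (at x) ?Q = ereal l" by (simp add: z_def)
    have "(?Q \<longlongrightarrow> ereal l) (at x)" using tendsto_iff_Liminf_eq_Limsup[of "at x" ?Q "ereal l"] eq l by (metis trivial_limit_at)
    then have "((\<lambda>y. q x y) \<longlongrightarrow> l) (at x)" by simp
    then have "(G has_real_derivative l) (at x)" by (simp add: has_field_derivative_iff q_def)
    then have "((\<lambda>y. G y - L * y) has_real_derivative (l - L)) (at x)"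
      by (auto intro!: derivative_eq_intros)
    then have "(g has_real_derivative (l - L)) (at x)" by (simp add: G_def)
    then show False using nd real_differentiable_def by blast
  qed
  have cnt: "countable {(r::rat,s::rat). 0 \<le> r \<and> r < s}" by (rule countable_subset[of _ UNIV]) auto
  have "negligible (\<Union>(r,s)\<in>{(r::rat,s::rat). 0 \<le> r \<and> r < s}. E (of_rat r) (of_rat s))"
    using cnt by (intro negligible_countable_Union) (auto intro!: Ent simp: of_rat_less)
  then show ?thesis using sub negligible_subset by blast
qed

text \<open>The approximating functional may depend on the accuracy \<open>e\<close>: two
  functionals that both approximate \<open>f\<close> near \<open>x\<close> differ by at most the sum
  of their errors, so they form a Cauchy sequence whose limit is the derivative. This permits
  rational slopes chosen anew for each accuracy.\<close>

lemma real_differentiable_approx: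
  fixes f :: "'a::euclidean_space \<Rightarrow> real"
  assumes "\<And>e. e > 0 \<Longrightarrow> \<exists>c d. d > 0 \<and> (\<forall>h. norm h < d \<longrightarrow> \<bar>f (x + h) - f x - c \<bullet> h\<bar> \<le> e * norm h)"
  shows "\<exists>c. (f has_derivative (\<lambda>h. c \<bullet> h)) (at x)"
proof -
  have "\<exists>c. \<forall>n::nat. \<exists>d>0. \<forall>h. norm h < d \<longrightarrow> \<bar>f (x + h) - f x - c n \<bullet> h\<bar> \<le> (1 / Suc n) * norm h"
    using assms[of "1 / Suc n" for n] by (intro choice) auto
  then obtain c where c: "\<And>n::nat. \<exists>d>0. \<forall>h. norm h < d \<longrightarrow> \<bar>f (x + h) - f x - c n \<bullet> h\<bar> \<le> (1 / Suc n) * norm h" by blast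
  have cc: "norm (c n - c m) \<le> 1 / Suc n + 1 / Suc m" for n m
  proof -
    obtain d1 where d1: "d1 > 0" "\<And>h. norm h < d1 \<Longrightarrow> \<bar>f (x + h) - f x - c n \<bullet> h\<bar> \<le> (1 / Suc n) * norm h" using c by blast
    obtain d2 where d2: "d2 > 0" "\<And>h. norm h < d2 \<Longrightarrow> \<bar>f (x + h) - f x - c m \<bullet> h\<bar> \<le> (1 / Suc m) * norm h" using c by blast
    show ?thesis
    proof (cases "c n = c m")
      case False
      define v where "v = c n - c m"
      have v: "norm v > 0" using False by (simp add: v_def)
      define t where "t = min d1 d2 / (2 * norm v)"
      have t: "t > 0" using d1 d2 v by (simp add: t_def)
      have "norm (t *\<^sub>R v) = min d1 d2 / 2" using t v d1(1) d2(1) by (simp add: t_def)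
      then have "norm (t *\<^sub>R v) < d1" "norm (t *\<^sub>R v) < d2" using d1 d2 by auto
      then have "\<bar>f (x + t *\<^sub>R v) - f x - c n \<bullet> (t *\<^sub>R v)\<bar> \<le> (1 / Suc n) * norm (t *\<^sub>R v)"
         "\<bar>f (x + t *\<^sub>R v) - f x - c m \<bullet> (t *\<^sub>R v)\<bar> \<le> (1 / Suc m) * norm (t *\<^sub>R v)" using d1 d2 by blast+
      then have "\<bar>c n \<bullet> (t *\<^sub>R v) - c m \<bullet> (t *\<^sub>R v)\<bar> \<le> (1 / Suc n) * norm (t *\<^sub>R v) + (1 / Suc m) * norm (t *\<^sub>R v)"
        by linarith
      moreover have "c n \<bullet> (t *\<^sub>R v) - c m \<bullet> (t *\<^sub>R v) = t * (v \<bullet> v)" by (simp add: v_def inner_simps algebra_simps)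
      ultimately have "t * (norm v * norm v) \<le> t * ((1 / Suc n + 1 / Suc m) * norm v)"
        using t by (simp add: algebra_simps flip: power2_norm_eq_inner power2_eq_square)
      then have "norm v \<le> 1 / Suc n + 1 / Suc m" using t v by (simp add: mult_le_cancel_left mult_le_cancel_right)
      then show ?thesis by (simp add: v_def)
    qed auto
  qed
  have "Cauchy c"
  proof (rule metric_CauchyI)
    fix e :: real assume "e > 0"
    then obtain N where N: "inverse (real (Suc N)) < e / 2" using reals_Archimedean[of "e/2"] by auto
    have "dist (c m) (c n) < e" if "m \<ge> N" "n \<ge> N" for m n
    proof -
      have "1 / Suc m \<le> 1 / Suc N" "1 / Suc n \<le> 1 / Suc N" using that by (auto intro!: divide_left_mono)
      then show ?thesis using cc[of m n] N by (simp add: dist_norm inverse_eq_divide)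
    qed
    then show "\<exists>M. \<forall>m\<ge>M. \<forall>n\<ge>M. dist (c m) (c n) < e" by blast
  qed
  then obtain C where C: "c \<longlonglongrightarrow> C" using Cauchy_convergent convergent_def by blast
  have cC: "norm (c n - C) \<le> 1 / Suc n" for n
  proof (rule tendsto_upperbound)
    show "(\<lambda>m. norm (c n - c m) - 1 / Suc m) \<longlonglongrightarrow> norm (c n - C)"
      using tendsto_diff[OF tendsto_norm[OF tendsto_diff[OF tendsto_const C]] LIMSEQ_Suc[OF lim_1_over_n]] by simp
    show "\<forall>\<^sub>F m in sequentially. norm (c n - c m) - 1 / Suc m \<le> 1 / Suc n"
      using cc[of n] by (auto intro!: always_eventually simp: algebra_simps)
  qed simp
  have "(f has_derivative (\<lambda>h. C \<bullet> h)) (at x)"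
    unfolding has_derivative_at_alt
  proof (intro conjI allI impI)
    show "bounded_linear ((\<bullet>) C)" by (rule bounded_linear_inner_right)
    fix e :: real assume e: "e > 0"
    then obtain N where N: "inverse (real (Suc N)) < e / 2" using reals_Archimedean[of "e/2"] by auto
    obtain d where d: "d > 0" "\<And>h. norm h < d \<Longrightarrow> \<bar>f (x + h) - f x - c N \<bullet> h\<bar> \<le> (1 / Suc N) * norm h" using c by blast
    have "norm (f y - f x - C \<bullet> (y - x)) \<le> e * norm (y - x)" if "norm (y - x) < d" for y
    proof -
      have "\<bar>f y - f x - c N \<bullet> (y - x)\<bar> \<le> (1 / Suc N) * norm (y - x)" using d(2)[OF that] by simp
      moreover have "\<bar>(c N - C) \<bullet> (y - x)\<bar> \<le> (1 / Suc N) * norm (y - x)"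
        using Cauchy_Schwarz_ineq2[of "c N - C" "y - x"] cC[of N] by (meson mult_right_mono norm_ge_zero order_trans)
      moreover have "(2 / Suc N) * norm (y - x) \<le> e * norm (y - x)" using N by (intro mult_right_mono) (auto simp: field_simps)
      moreover have "(c N - C) \<bullet> (y - x) = c N \<bullet> (y - x) - C \<bullet> (y - x)" by (simp add: inner_diff_left)
      moreover have "(2 / Suc N) * norm (y - x) = (1 / Suc N) * norm (y - x) + (1 / Suc N) * norm (y - x)" by simp
      ultimately show ?thesis unfolding real_norm_def by linarith
    qed
    then show "\<exists>d>0. \<forall>y. norm (y - x) < d \<longrightarrow> norm (f y - f x - C \<bullet> (y - x)) \<le> e * norm (y - x)" using d by blast
  qed
  then show ?thesis by blast
qed

text \<open>On every line in direction \<open>b\<close> the exceptional set is null by the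
  one-dimensional theorem. Rational slopes and scales \<open>1 / Suc k\<close> make it a Borel set,
  so that Fubini applies.\<close>

lemma lipschitz_directional_negligible:
  fixes f :: "'a::euclidean_space \<Rightarrow> real" and b :: 'a
  assumes L: "\<And>x y. \<bar>f x - f y\<bar> \<le> L * norm (x - y)"
  shows "negligible {x. \<not> (\<forall>m::nat. \<exists>k::nat. \<exists>c\<in>\<rat>. \<forall>s. \<bar>s\<bar> < 1 / Suc k \<longrightarrow>
     \<bar>f (x + s *\<^sub>R b) - f x - c * s\<bar> \<le> \<bar>s\<bar> / Suc m)}" (is "negligible (Collect (\<lambda>x. \<not> ?G x))")
proof -
  have L0: "L \<ge> 0" 
  proof -
    obtain v :: 'a where "v \<noteq> 0" using nonempty_Basis nonzero_Basis by blast
    then show ?thesis using L[of v 0] by (metis abs_ge_zero diff_zero order_trans zero_le_mult_iff zero_less_norm_iff not_less)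
  qed
  have cf: "continuous_on UNIV f"
  proof -
    have "L-lipschitz_on UNIV f" using L L0 by (auto simp: lipschitz_on_def dist_norm)
    then show ?thesis by (rule lipschitz_on_continuous_on)
  qed
  have cl: "closed {x. \<forall>s. \<bar>s\<bar> < d \<longrightarrow> \<bar>f (x + s *\<^sub>R b) - f x - c * s\<bar> \<le> \<bar>s\<bar> / e}" for c d e
    by (intro closed_Collect_all closed_Collect_imp closed_Collect_le open_Collect_const continuous_intros continuous_on_compose2[OF cf] cf) auto
  have Geq: "Collect ?G = (\<Inter>m::nat. \<Union>k::nat. \<Union>c\<in>\<rat>. {x. \<forall>s. \<bar>s\<bar> < 1 / Suc k \<longrightarrow>
     \<bar>f (x + s *\<^sub>R b) - f x - c * s\<bar> \<le> \<bar>s\<bar> / Suc m})" by blast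
  have Gb: "Collect ?G \<in> sets borel" unfolding Geq
  proof (rule sets.countable_INT'')
    fix m :: nat
    show "(\<Union>k::nat. \<Union>c\<in>\<rat>. {x. \<forall>s. \<bar>s\<bar> < 1 / Suc k \<longrightarrow>
     \<bar>f (x + s *\<^sub>R b) - f x - c * s\<bar> \<le> \<bar>s\<bar> / Suc m}) \<in> sets borel"
    proof (rule sets.countable_UN)
      have "(\<Union>c\<in>\<rat>. {x. \<forall>s. \<bar>s\<bar> < 1 / Suc k \<longrightarrow> \<bar>f (x + s *\<^sub>R b) - f x - c * s\<bar> \<le> \<bar>s\<bar> / Suc m}) \<in> sets borel" for k :: nat
        using countable_rat by (rule sets.countable_UN') (use borel_closed[OF cl] in blast)
      then show "range (\<lambda>k::nat. \<Union>c\<in>\<rat>. {x. \<forall>s. \<bar>s\<bar> < 1 / Suc k \<longrightarrow> \<bar>f (x + s *\<^sub>R b) - f x - c * s\<bar> \<le> \<bar>s\<bar> / Suc m}) \<subseteq> sets borel"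
        by blast
    qed
  qed simp_all
  define N where "N = - Collect ?G"
  have Nb: "N \<in> sets borel" using Gb by (simp add: N_def Compl_in_sets_lebesgue sets.compl_sets borel_comp)
  have line: "emeasure lborel {s. x + s *\<^sub>R b \<in> N} = 0" for x
  proof -
    define g where "g s = f (x + s *\<^sub>R b)" for s
    have gL: "\<bar>g s - g t\<bar> \<le> (L * norm b) * \<bar>s - t\<bar>" for s t
    proof -
      have "(x + s *\<^sub>R b) - (x + t *\<^sub>R b) = (s - t) *\<^sub>R b" by (simp add: algebra_simps)
      then show ?thesis using L[of "x + s *\<^sub>R b" "x + t *\<^sub>R b"] by (simp add: g_def mult_ac)
    qed
    have "{s. x + s *\<^sub>R b \<in> N} \<subseteq> {s. \<not> g differentiable (at s)}"
    proof (intro subsetI CollectI notI)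
      fix s assume s: "s \<in> {s. x + s *\<^sub>R b \<in> N}" and "g differentiable (at s)"
      then obtain D where D: "(g has_real_derivative D) (at s)" using real_differentiable_def by blast
      have "?G (x + s *\<^sub>R b)"
      proof
        fix m :: nat
        obtain c where c: "c \<in> \<rat>" "D < c" "c < D + 1 / (2 * Suc m)" using Rats_dense_in_real[of D "D + 1 / (2 * Suc m)"] by auto
        have "(g has_derivative (\<lambda>h. h * D)) (at s)" using D unfolding has_field_derivative_def mult.commute[of D] by simp
        then have "\<forall>e>0. \<exists>d>0. \<forall>y. norm (y - s) < d \<longrightarrow> norm (g y - g s - (y - s) * D) \<le> e * norm (y - s)"
          unfolding has_derivative_at_alt by blast
        from this[rule_format, of "1 / (2 * Suc m)"]
        obtain d where d: "d > 0" "\<forall>y. norm (y - s) < d \<longrightarrow> norm (g y - g s - (y - s) * D) \<le> 1 / (2 * Suc m) * norm (y - s)"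
          by auto
        obtain k where k: "1 / Suc k < d" using reals_Archimedean[OF d(1)] by (auto simp: inverse_eq_divide)
        have "\<bar>f (x + s *\<^sub>R b + r *\<^sub>R b) - f (x + s *\<^sub>R b) - c * r\<bar> \<le> \<bar>r\<bar> / Suc m" if "\<bar>r\<bar> < 1 / Suc k" for r
        proof -
          have "\<bar>g (s + r) - g s - r * D\<bar> \<le> 1 / (2 * Suc m) * \<bar>r\<bar>" using d(2)[rule_format, of "s + r"] that k by simp
          moreover have "\<bar>(c - D) * r\<bar> \<le> 1 / (2 * Suc m) * \<bar>r\<bar>" 
            unfolding abs_mult using c by (intro mult_right_mono) auto
          moreover have "1 / (2 * Suc m) * \<bar>r\<bar> + 1 / (2 * Suc m) * \<bar>r\<bar> = \<bar>r\<bar> / Suc m"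
            by (simp only: of_nat_mult) (simp add: field_simps del: of_nat_Suc)
          moreover have "(c - D) * r = c * r - r * D" by (simp add: algebra_simps)
          ultimately have "\<bar>g (s + r) - g s - c * r\<bar> \<le> \<bar>r\<bar> / Suc m" by linarith
          then show ?thesis by (simp add: g_def algebra_simps)
        qed
        then show "\<exists>k::nat. \<exists>c\<in>\<rat>. \<forall>r. \<bar>r\<bar> < 1 / Suc k \<longrightarrow>
            \<bar>f (x + s *\<^sub>R b + r *\<^sub>R b) - f (x + s *\<^sub>R b) - c * r\<bar> \<le> \<bar>r\<bar> / Suc m" using c by blast
      qed
      then show False using s unfolding N_def by blast
    qed
    then have "negligible {s. x + s *\<^sub>R b \<in> N}"
      using lipschitz_real_AE_differentiable[of g "L * norm b", OF gL] negligible_subset by blast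
    moreover have "{s. x + s *\<^sub>R b \<in> N} \<in> sets borel"
    proof -
      have "(\<lambda>s. x + s *\<^sub>R b) \<in> borel_measurable borel" by measurable
      then have "(\<lambda>s. x + s *\<^sub>R b) -` N \<inter> space borel \<in> sets borel" using Nb by (rule measurable_sets)
      then show ?thesis by (simp add: vimage_def)
    qed
    ultimately show ?thesis by (simp add: negligible_iff_emeasure0)
  qed
  \<comment> \<open>The indicator is integrated over all translates by \<open>s *\<^sub>R b\<close>.
    Along lines the inner integral vanishes, whereas by translation invariance the other order gives
    \<open>emeasure lborel N * \<infinity>\<close>; hence \<open>N\<close> is null.\<close>
  have pm: "(\<lambda>(x, s). indicator N (x + s *\<^sub>R b) :: ennreal) \<in> borel_measurable (lborel \<Otimes>\<^sub>M lborel)"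
  proof -
    have "(\<lambda>p::'a \<times> real. fst p + snd p *\<^sub>R b) \<in> borel_measurable (lborel \<Otimes>\<^sub>M lborel)" by measurable
    from measurable_compose[OF this borel_measurable_indicator[OF Nb]]
    have "(\<lambda>p. indicator N (fst p + snd p *\<^sub>R b) :: ennreal) \<in> borel_measurable (lborel \<Otimes>\<^sub>M lborel)" .
    then show ?thesis by (simp add: case_prod_beta')
  qed
  have "(\<integral>\<^sup>+x. (\<integral>\<^sup>+s. indicator N (x + s *\<^sub>R b) \<partial>lborel) \<partial>(lborel::'a measure)) = 0"
  proof -
    have "(\<integral>\<^sup>+s. indicator N (x + s *\<^sub>R b) \<partial>lborel) = 0" for x
    proof -
      have "(\<lambda>s. x + s *\<^sub>R b) \<in> borel_measurable borel" by measurable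
      then have "(\<lambda>s. x + s *\<^sub>R b) -` N \<inter> space borel \<in> sets borel" using Nb by (rule measurable_sets)
      then have m: "{s. x + s *\<^sub>R b \<in> N} \<in> sets lborel" by (simp add: vimage_def)
      have "(\<integral>\<^sup>+s. indicator N (x + s *\<^sub>R b) \<partial>lborel) = (\<integral>\<^sup>+s. indicator {s. x + s *\<^sub>R b \<in> N} s \<partial>lborel)"
        by (intro nn_integral_cong) (simp add: indicator_def)
      also have "\<dots> = emeasure lborel {s. x + s *\<^sub>R b \<in> N}" using m by (rule nn_integral_indicator)
      finally show ?thesis using line by simp
    qed
    then show ?thesis by simp
  qed
  also have "(\<integral>\<^sup>+x. (\<integral>\<^sup>+s. indicator N (x + s *\<^sub>R b) \<partial>lborel) \<partial>(lborel::'a measure)) =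
     (\<integral>\<^sup>+s. (\<integral>\<^sup>+x. indicator N (x + s *\<^sub>R b) \<partial>(lborel::'a measure)) \<partial>lborel)"
    using lborel_pair.Fubini'[OF pm] by simp
  also have "\<dots> = (\<integral>\<^sup>+s. emeasure lborel N \<partial>(lborel::real measure))"
  proof (intro nn_integral_cong)
    fix s :: real
    have "(\<integral>\<^sup>+x. indicator N (x + s *\<^sub>R b) \<partial>(lborel::'a measure)) = (\<integral>\<^sup>+x. indicator N x \<partial>(distr lborel borel ((+) (s *\<^sub>R b))))"
      using Nb by (subst nn_integral_distr) (auto simp: add.commute)
    also have "\<dots> = emeasure lborel N" using Nb by (subst lborel_distr_plus) simp
    finally show "(\<integral>\<^sup>+x. indicator N (x + s *\<^sub>R b) \<partial>(lborel::'a measure)) = emeasure lborel N" .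
  qed
  also have "\<dots> = emeasure lborel N * \<infinity>" by simp
  finally have "emeasure lborel N = 0" by (auto simp: ennreal_mult_eq_top_iff)
  then have "negligible N" using Nb by (simp add: negligible_iff_emeasure0)
  moreover have "N = Collect (\<lambda>x. \<not> ?G x)" unfolding N_def by blast
  ultimately show ?thesis by (simp only:)
qed

text \<open>For a fixed accuracy, \<open>A c k m\<close> collects the points whose partial
  difference quotients stay near the rational vector \<open>c\<close> on a uniform scale. At a
  density point of this set one walks from \<open>x\<close> to \<open>x + h\<close> one coordinate
  at a time; a corner of the path need not lie in the set, but some point of the set is within
  \<open>\<epsilon> * norm h\<close>, and the Lipschitz bound pays for the detour.\<close>

lemma rademacher:
  fixes f :: "'a::euclidean_space \<Rightarrow> real"
  assumes L: "\<And>x y. \<bar>f x - f y\<bar> \<le> L * norm (x - y)"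
  shows "negligible {x. \<not> (\<exists>c. (f has_derivative (\<lambda>h. c \<bullet> h)) (at x))}"
proof -
  have L0: "L \<ge> 0" 
  proof -
    obtain v :: 'a where "v \<noteq> 0" using nonempty_Basis nonzero_Basis by blast
    then show ?thesis using L[of v 0] by (metis abs_ge_zero diff_zero order_trans zero_le_mult_iff zero_less_norm_iff not_less)
  qed
  have cf: "continuous_on UNIV f"
  proof -
    have "L-lipschitz_on UNIV f" using L L0 by (auto simp: lipschitz_on_def dist_norm)
    then show ?thesis by (rule lipschitz_on_continuous_on)
  qed
  define Gd where "Gd b x \<longleftrightarrow> (\<forall>m::nat. \<exists>k::nat. \<exists>c\<in>\<rat>. \<forall>s. \<bar>s\<bar> < 1 / Suc k \<longrightarrow>
     \<bar>f (x + s *\<^sub>R b) - f x - c * s\<bar> \<le> \<bar>s\<bar> / Suc m)" for b x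
  define A where "A c k m = {x. \<forall>b\<in>Basis. \<forall>s. \<bar>s\<bar> < 1 / Suc k \<longrightarrow> \<bar>f (x + s *\<^sub>R b) - f x - c b * s\<bar> \<le> \<bar>s\<bar> / Suc m}"
    for c :: "'a \<Rightarrow> real" and k m :: nat
  have clA: "closed (A c k m)" for c k m unfolding A_def Ball_def
    by (intro closed_Collect_all closed_Collect_imp closed_Collect_le open_Collect_const continuous_intros continuous_on_compose2[OF cf] cf) auto
  define N1 where "N1 = (\<Union>b\<in>Basis. {x. \<not> Gd b x})"
  define nd where "nd c k m = {x \<in> A c k m. \<not> (\<forall>\<epsilon>>0. \<exists>d>0. \<forall>h. norm h < d \<longrightarrow> (\<exists>y\<in>A c k m. norm (x + h - y) \<le> \<epsilon> * norm h))}" for c k m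
  \<comment> \<open>Extensional functions, so that there are only countably many rational slope
    vectors.\<close>
  define Q where "Q = (Basis \<rightarrow>\<^sub>E \<rat> :: ('a \<Rightarrow> real) set)"
  define N2 where "N2 = (\<Union>(c,k,m)\<in>Q \<times> UNIV \<times> UNIV. nd c k m)"
  have "negligible N1" unfolding N1_def Gd_def
  proof (rule negligible_Union)
    fix T assume "T \<in> (\<lambda>b. {x. \<not> (\<forall>m::nat. \<exists>k::nat. \<exists>c\<in>\<rat>. \<forall>s. \<bar>s\<bar> < 1 / Suc k \<longrightarrow>
     \<bar>f (x + s *\<^sub>R b) - f x - c * s\<bar> \<le> \<bar>s\<bar> / Suc m)}) ` Basis"
    then show "negligible T" using lipschitz_directional_negligible[of f L, OF L] by blast
  qed simp
  moreover have "negligible N2" unfolding N2_def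
  proof (intro negligible_countable_Union)
    have "countable Q" unfolding Q_def by (intro countable_PiE countable_rat) auto
    then show "countable ((\<lambda>(c,k,m). nd c k m) ` (Q \<times> UNIV \<times> UNIV))" by (intro countable_image countable_SIGMA) auto
    fix S assume "S \<in> (\<lambda>(c,k,m). nd c k m) ` (Q \<times> UNIV \<times> UNIV)"
    then obtain c k m where "S = nd c k m" by auto
    then show "negligible S" using density_point_negligible[OF clA[of c k m]] by (simp add: nd_def)
  qed
  ultimately have "negligible (N1 \<union> N2)" by (rule negligible_Un)
  moreover have "{x. \<not> (\<exists>c. (f has_derivative (\<lambda>h. c \<bullet> h)) (at x))} \<subseteq> N1 \<union> N2"
  proof (intro subsetI, rule ccontr)
    fix x assume x: "x \<in> {x. \<not> (\<exists>c. (f has_derivative (\<lambda>h. c \<bullet> h)) (at x))}" and nx: "x \<notin> N1 \<union> N2"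
    have "\<exists>c. (f has_derivative (\<lambda>h. c \<bullet> h)) (at x)"
    proof (rule real_differentiable_approx)
      fix e :: real assume e: "e > 0"
      define n where "n = real DIM('a)"
      have n: "n > 0" by (simp add: n_def)
      obtain m :: nat where m: "inverse (real (Suc m)) < e / (2 * n)" using reals_Archimedean[of "e / (2*n)"] e n by auto
      have "\<forall>b\<in>Basis. \<exists>p. snd p \<in> \<rat> \<and> (\<forall>s. \<bar>s\<bar> < 1 / Suc (fst p) \<longrightarrow> \<bar>f (x + s *\<^sub>R b) - f x - snd p * s\<bar> \<le> \<bar>s\<bar> / Suc m)"
      proof
        fix b :: 'a assume "b \<in> Basis"
        then have "Gd b x" using nx by (auto simp: N1_def)
        then obtain k c where "c \<in> \<rat>" "\<forall>s. \<bar>s\<bar> < 1 / Suc k \<longrightarrow> \<bar>f (x + s *\<^sub>R b) - f x - c * s\<bar> \<le> \<bar>s\<bar> / Suc m" unfolding Gd_def by blast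
        then show "\<exists>p. snd p \<in> \<rat> \<and> (\<forall>s. \<bar>s\<bar> < 1 / Suc (fst p) \<longrightarrow> \<bar>f (x + s *\<^sub>R b) - f x - snd p * s\<bar> \<le> \<bar>s\<bar> / Suc m)"
          by (intro exI[of _ "(k,c)"]) auto
      qed
      from bchoice[OF this] obtain P where P: "\<And>b::'a. b \<in> Basis \<Longrightarrow> snd (P b) \<in> \<rat>"
        "\<And>(b::'a) s. b \<in> Basis \<Longrightarrow> \<bar>s\<bar> < 1 / Suc (fst (P b)) \<Longrightarrow> \<bar>f (x + s *\<^sub>R b) - f x - snd (P b) * s\<bar> \<le> \<bar>s\<bar> / Suc m" by blast
      define c where "c = restrict (\<lambda>b. snd (P b)) Basis"
      define k where "k = Max ((\<lambda>b. fst (P b)) ` (Basis :: 'a set))"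
      have kge: "fst (P b) \<le> k" if "b \<in> Basis" for b :: 'a using that by (simp add: k_def)
      have cQ: "c \<in> Q" using P(1) by (auto simp: c_def Q_def)
      have xA: "x \<in> A c k m" unfolding A_def
      proof (intro CollectI ballI allI impI)
        fix b :: 'a and s :: real assume b: "b \<in> Basis" and s: "\<bar>s\<bar> < 1 / real (Suc k)"
        have "1 / real (Suc k) \<le> 1 / real (Suc (fst (P b)))" using kge[OF b] by (intro divide_left_mono) auto
        then show "\<bar>f (x + s *\<^sub>R b) - f x - c b * s\<bar> \<le> \<bar>s\<bar> / real (Suc m)" using P(2)[OF b, of s] s b by (simp add: c_def del: of_nat_Suc)
      qed
      \<comment> \<open>Each of the \<open>n\<close> coordinate steps costs two detours of
        \<open>L * \<epsilon> * norm h\<close>; this choice keeps their total at most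
        \<open>e / 2\<close>, the other half being spent on \<open>n / Suc m\<close>.\<close>
      define \<epsilon> where "\<epsilon> = e / (4 * n * (L + 1))"
      have \<epsilon>: "\<epsilon> > 0" using e n L0 by (simp add: \<epsilon>_def)
      have "x \<notin> nd c k m" using nx cQ by (auto simp: N2_def)
      then obtain d where d: "d > 0" "\<And>h. norm h < d \<Longrightarrow> \<exists>y\<in>A c k m. norm (x + h - y) \<le> \<epsilon> * norm h"
        using xA \<epsilon> unfolding nd_def by blast
      define v where "v = (\<Sum>b\<in>Basis. c b *\<^sub>R b)"
      define d' where "d' = min d (1 / Suc k)"
      have d': "d' > 0" using d by (simp add: d'_def)
      have main: "\<bar>f (x + (\<Sum>b\<in>B. (h \<bullet> b) *\<^sub>R b)) - f x - (\<Sum>b\<in>B. c b * (h \<bullet> b))\<bar> \<le> card B * ((2 * L * \<epsilon> + 1 / Suc m) * norm h)"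
        if h: "norm h < d'" and B: "finite B" "B \<subseteq> Basis" for h :: 'a and B
        using B
      proof (induction B rule: finite_induct)
        case (insert b B)
        let ?hB = "\<Sum>b\<in>B. (h \<bullet> b) *\<^sub>R b"
        have hB: "norm ?hB \<le> norm h"
        proof -
          have "(norm ?hB)\<^sup>2 = (\<Sum>b\<in>Basis. (?hB \<bullet> b)\<^sup>2)" by (simp add: norm_eq_sqrt_inner euclidean_inner[of ?hB ?hB] power2_eq_square sum_nonneg)
          also have "\<dots> \<le> (\<Sum>b\<in>Basis. (h \<bullet> b)\<^sup>2)"
          proof (rule sum_mono)
            fix i :: 'a assume i: "i \<in> Basis"
            have "?hB \<bullet> i = (\<Sum>b\<in>B. if b = i then h \<bullet> b else 0)" unfolding inner_sum_left
              using i insert.prems by (intro sum.cong) (auto simp: inner_Basis)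
            also have "\<dots> = (if i \<in> B then h \<bullet> i else 0)" using insert.hyps(1) by simp
            finally show "(?hB \<bullet> i)\<^sup>2 \<le> (h \<bullet> i)\<^sup>2" by auto
          qed
          also have "\<dots> = (norm h)\<^sup>2" by (simp add: norm_eq_sqrt_inner euclidean_inner[of h h] power2_eq_square sum_nonneg)
          finally show ?thesis by (rule power2_le_imp_le) simp
        qed
        then have "norm ?hB < d" using h by (simp add: d'_def)
        then obtain y where y: "y \<in> A c k m" "norm (x + ?hB - y) \<le> \<epsilon> * norm ?hB" using d(2) by blast
        have y2: "norm (x + ?hB - y) \<le> \<epsilon> * norm h" using y(2) hB \<epsilon> by (meson mult_left_mono less_imp_le order_trans)
        have bB: "b \<in> Basis" using insert.prems by simp
        have hb: "\<bar>h \<bullet> b\<bar> \<le> norm h" using Basis_le_norm[OF bB] by simp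
        then have "\<bar>h \<bullet> b\<bar> < 1 / Suc k" using h by (simp add: d'_def)
        then have 1: "\<bar>f (y + (h \<bullet> b) *\<^sub>R b) - f y - c b * (h \<bullet> b)\<bar> \<le> \<bar>h \<bullet> b\<bar> / Suc m"
          using y(1) bB unfolding A_def by blast
        have 2: "\<bar>f (x + ?hB) - f y\<bar> \<le> L * (\<epsilon> * norm h)"
          using L[of "x + ?hB" y] y2 L0 by (meson mult_left_mono order_trans)
        have e3: "x + ?hB + (h \<bullet> b) *\<^sub>R b - (y + (h \<bullet> b) *\<^sub>R b) = x + ?hB - y" by simp
        have 3: "\<bar>f (x + ?hB + (h \<bullet> b) *\<^sub>R b) - f (y + (h \<bullet> b) *\<^sub>R b)\<bar> \<le> L * (\<epsilon> * norm h)"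
          by (rule order_trans[OF L]) (unfold e3, rule mult_left_mono[OF y2 L0])
        have 4: "\<bar>h \<bullet> b\<bar> / Suc m \<le> 1 / Suc m * norm h" using hb by (simp add: divide_right_mono)
        have IH: "\<bar>f (x + ?hB) - f x - (\<Sum>b\<in>B. c b * (h \<bullet> b))\<bar> \<le> card B * ((2 * L * \<epsilon> + 1 / Suc m) * norm h)"
          using insert by simp
        have s1: "x + (\<Sum>b\<in>insert b B. (h \<bullet> b) *\<^sub>R b) = x + ?hB + (h \<bullet> b) *\<^sub>R b"
          using insert.hyps by (simp add: algebra_simps)
        have s2: "(\<Sum>b\<in>insert b B. c b * (h \<bullet> b)) = c b * (h \<bullet> b) + (\<Sum>b\<in>B. c b * (h \<bullet> b))" using insert.hyps by simp
        have s3: "card (insert b B) * ((2 * L * \<epsilon> + 1 / Suc m) * norm h) = card B * ((2 * L * \<epsilon> + 1 / Suc m) * norm h) + (2 * (L * (\<epsilon> * norm h)) + 1 / Suc m * norm h)"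
          using insert.hyps by (simp add: algebra_simps add_divide_distrib)
        show ?case unfolding s1 s2 s3 using 1 2 3 4 IH by linarith
      qed simp
      have "\<bar>f (x + h) - f x - v \<bullet> h\<bar> \<le> e * norm h" if h: "norm h < d'" for h
      proof -
        have a: "\<bar>f (x + h) - f x - (\<Sum>b\<in>Basis. c b * (h \<bullet> b))\<bar> \<le> n * ((2 * L * \<epsilon> + 1 / Suc m) * norm h)"
          using main[OF h finite_Basis order_refl] by (simp add: euclidean_representation n_def)
        have b: "v \<bullet> h = (\<Sum>b\<in>Basis. c b * (h \<bullet> b))" by (simp add: v_def inner_sum_left inner_commute[of h])
        have "n * (2 * L * \<epsilon>) = e / 2 * (L / (L + 1))" using n L0 by (simp add: \<epsilon>_def divide_simps)
        also have "\<dots> \<le> e / 2" using e L0 by (intro mult_left_le) auto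
        finally have "n * (2 * L * \<epsilon>) \<le> e / 2" .
        moreover have "n * (1 / Suc m) \<le> e / 2" using m n by (simp add: field_simps)
        ultimately have "n * (2 * L * \<epsilon> + 1 / Suc m) \<le> e" by (simp only: distrib_left)
        then have "n * (2 * L * \<epsilon> + 1 / Suc m) * norm h \<le> e * norm h" by (rule mult_right_mono) simp
        then show ?thesis using a b by (simp add: mult.assoc)
      qed
      then show "\<exists>c d. d > 0 \<and> (\<forall>h. norm h < d \<longrightarrow> \<bar>f (x + h) - f x - c \<bullet> h\<bar> \<le> e * norm h)"
        using d' by blast
    qed
    then show False using x by simp
  qed
  ultimately show ?thesis using negligible_subset by blast
qed

subsection \<open>Semiconcave functions: the Jensen--Alexandrov perturbation\<close>

text \<open>A left Riemann sum for the integral of \<open>(p0 + \<tau> s) \<bullet> h\<close> over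
  \<open>0 \<le> \<tau> \<le> 1\<close>, whose value is
  \<open>p0 \<bullet> h + s \<bullet> h / 2\<close>. The term \<open>K / (2 * N)\<close> is the
  discretisation error, the rest comes from nodes and slopes being only approximate. This turns
  first-order inequalities at contact points into second-order expansions.\<close>

lemma riemann_lower_bound:
  fixes k p :: "nat \<Rightarrow> 'a::real_inner"
  assumes N: "N > 0" and k0: "k 0 = 0" and kN: "k N = h"
    and k: "\<And>i. i \<le> N \<Longrightarrow> norm (k i - (real i / N) *\<^sub>R h) \<le> \<epsilon> * r"
    and p: "\<And>i. i < N \<Longrightarrow> norm (p i - p0 - (real i / N) *\<^sub>R s) \<le> \<kappa> * r"
    and h: "norm h \<le> r" and s: "norm s \<le> K * r" and \<epsilon>: "0 \<le> \<epsilon>" "\<epsilon> \<le> 1" and \<kappa>: "0 \<le> \<kappa>" and r: "0 \<le> r"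
    and a: "\<And>i. i < N \<Longrightarrow> a (Suc i) \<ge> a i + p i \<bullet> (k (Suc i) - k i)"
  shows "a N \<ge> a 0 + p0 \<bullet> h + s \<bullet> h / 2 - (K / (2 * real N) + real N * (3 * \<kappa> + 2 * \<epsilon> * K)) * r\<^sup>2"
proof -
  define E where "E = (3 * \<kappa> + 2 * \<epsilon> * K) * r\<^sup>2"
  \<comment> \<open>Together the coefficients of \<open>s \<bullet> h\<close> are
    \<open>i * (i - 1) / (2 * N^2)\<close>, the sum of \<open>l / N^2\<close> over
    \<open>l < i\<close>.\<close>
  have claim: "a i \<ge> a 0 + p0 \<bullet> k i + (real i / N)\<^sup>2 / 2 * (s \<bullet> h) - real i / (2 * (real N)\<^sup>2) * (s \<bullet> h) - i * E" if "i \<le> N" for i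
    using that
  proof (induction i)
    case (Suc i)
    define D where "D = k (Suc i) - k i"
    define d where "d = D - (1 / N) *\<^sub>R h"
    define e where "e = p i - p0 - (real i / N) *\<^sub>R s"
    have iN: "i < N" "i \<le> N" using Suc.prems by auto
    have "d = (k (Suc i) - (real (Suc i) / N) *\<^sub>R h) - (k i - (real i / N) *\<^sub>R h)"
      by (simp add: d_def D_def algebra_simps add_divide_distrib)
    then have dn: "norm d \<le> 2 * \<epsilon> * r"
      using norm_triangle_ineq4[of "k (Suc i) - (real (Suc i) / N) *\<^sub>R h" "k i - (real i / N) *\<^sub>R h"] k[OF Suc.prems] k[OF iN(2)] by simp
    have Dn: "norm D \<le> 3 * r"
    proof -
      have "norm h / N \<le> norm h / 1" using N by (intro divide_left_mono) auto
      then have "norm ((1 / N) *\<^sub>R h) \<le> r" using h by simp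
      moreover have "D = d + (1 / N) *\<^sub>R h" by (simp add: d_def)
      moreover have "2 * \<epsilon> * r \<le> 2 * r" using \<epsilon> r by (simp add: mult_left_le_one_le)
      ultimately show ?thesis using dn norm_triangle_ineq[of d "(1 / N) *\<^sub>R h"] by simp
    qed
    have en: "norm e \<le> \<kappa> * r" unfolding e_def by (rule p[OF iN(1)])
    have "p i \<bullet> D = p0 \<bullet> D + (real i / N) * (s \<bullet> ((1 / N) *\<^sub>R h)) + (real i / N) * (s \<bullet> d) + e \<bullet> D"
      by (simp add: e_def d_def inner_simps algebra_simps)
    moreover have "e \<bullet> D \<ge> - (3 * \<kappa> * r\<^sup>2)"
    proof -
      have "\<bar>e \<bullet> D\<bar> \<le> norm e * norm D" by (rule Cauchy_Schwarz_ineq2)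
      also have "\<dots> \<le> (\<kappa> * r) * (3 * r)" using en Dn \<kappa> r by (intro mult_mono) auto
      finally show ?thesis by (simp add: power2_eq_square algebra_simps)
    qed
    moreover have "(real i / N) * (s \<bullet> d) \<ge> - (2 * \<epsilon> * K * r\<^sup>2)"
    proof -
      have "\<bar>(real i / N) * (s \<bullet> d)\<bar> \<le> 1 * \<bar>s \<bullet> d\<bar>" unfolding abs_mult using iN by (intro mult_right_mono) auto
      moreover have "\<bar>s \<bullet> d\<bar> \<le> norm s * norm d" by (rule Cauchy_Schwarz_ineq2)
      moreover have "norm s * norm d \<le> (K * r) * (2 * \<epsilon> * r)" using s dn order_trans[OF norm_ge_zero s] by (intro mult_mono) auto
      moreover have "(K * r) * (2 * \<epsilon> * r) = 2 * \<epsilon> * K * r\<^sup>2" by (simp add: power2_eq_square)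
      ultimately show ?thesis by linarith
    qed
    ultimately have "p i \<bullet> D \<ge> p0 \<bullet> D + (real i / N) * (s \<bullet> ((1 / N) *\<^sub>R h)) - E"
      by (simp add: E_def algebra_simps)
    moreover have "a (Suc i) \<ge> a i + p i \<bullet> D" using a[OF iN(1)] by (simp add: D_def)
    moreover have "p0 \<bullet> k (Suc i) = p0 \<bullet> k i + p0 \<bullet> D" by (simp add: D_def inner_diff_right)
    moreover have "(real (Suc i) / N)\<^sup>2 / 2 * (s \<bullet> h) - real (Suc i) / (2 * (real N)\<^sup>2) * (s \<bullet> h)
      = (real i / N)\<^sup>2 / 2 * (s \<bullet> h) - real i / (2 * (real N)\<^sup>2) * (s \<bullet> h) + (real i / N) * (s \<bullet> ((1 / N) *\<^sub>R h))"
      using N by (simp add: field_simps power2_eq_square)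
    moreover have "real (Suc i) * E = real i * E + E" by (simp add: algebra_simps)
    ultimately show ?case using Suc.IH[OF iN(2)] by linarith
  qed (simp add: k0)
  have "\<bar>s \<bullet> h\<bar> \<le> K * r\<^sup>2"
  proof -
    have "\<bar>s \<bullet> h\<bar> \<le> norm s * norm h" by (rule Cauchy_Schwarz_ineq2)
    also have "\<dots> \<le> (K * r) * r" using s h order_trans[OF norm_ge_zero s] by (intro mult_mono) auto
    finally show ?thesis by (simp add: power2_eq_square)
  qed
  then have "(s \<bullet> h) / (2 * real N) \<le> K * r\<^sup>2 / (2 * real N)" by (intro divide_right_mono) auto
  moreover have "real N / (2 * (real N)\<^sup>2) * (s \<bullet> h) = (s \<bullet> h) / (2 * real N)" using N by (simp add: power2_eq_square)
  moreover have "(real N / N)\<^sup>2 / 2 * (s \<bullet> h) = s \<bullet> h / 2" using N by simp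
  moreover have "(K / (2 * real N) + real N * (3 * \<kappa> + 2 * \<epsilon> * K)) * r\<^sup>2 = K * r\<^sup>2 / (2 * real N) + N * E" by (simp add: E_def algebra_simps)
  ultimately show ?thesis using claim[OF order_refl, unfolded kN] by linarith
qed

text \<open>The infimum of the cones \<open>f y + L * norm (x - y)\<close>. It extends the
  coordinates of the slope map from the contact set to the whole space, where Rademacher's theorem
  can be applied.\<close>

lemma mcshane_extension:
  fixes f :: "'a::real_normed_vector \<Rightarrow> real"
  assumes C: "C \<noteq> {}" and L: "L \<ge> 0" and f: "\<And>x y. x \<in> C \<Longrightarrow> y \<in> C \<Longrightarrow> \<bar>f x - f y\<bar> \<le> L * norm (x - y)"
  obtains F where "\<And>x y. \<bar>F x - F y\<bar> \<le> L * norm (x - y)" "\<And>x. x \<in> C \<Longrightarrow> F x = f x"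
proof -
  define F where "F x = (INF y\<in>C. f y + L * norm (x - y))" for x
  obtain y0 where y0: "y0 \<in> C" using C by blast
  have bb: "bdd_below ((\<lambda>y. f y + L * norm (x - y)) ` C)" for x
  proof (rule bdd_belowI2)
    fix y assume y: "y \<in> C"
    have "L * norm (y - y0) \<le> L * (norm (x - y) + norm (x - y0))"
      using norm_triangle_ineq4[of "x - y0" "x - y"] L by (intro mult_left_mono) (auto simp: norm_minus_commute)
    then show "f y0 - L * norm (x - y0) \<le> f y + L * norm (x - y)" using f[OF y y0] by (simp add: algebra_simps abs_le_iff)
  qed
  have le: "F x \<le> F y + L * norm (x - y)" for x y
  proof -
    have "F x - L * norm (x - y) \<le> F y" unfolding F_def[of y]
    proof (rule cINF_greatest[OF C])
      fix z assume z: "z \<in> C"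
      have "F x \<le> f z + L * norm (x - z)" unfolding F_def by (rule cINF_lower[OF bb z])
      also have "L * norm (x - z) \<le> L * (norm (x - y) + norm (y - z))"
        using norm_triangle_ineq[of "x - y" "y - z"] L by (intro mult_left_mono) auto
      finally show "F x - L * norm (x - y) \<le> f z + L * norm (y - z)" by (simp add: algebra_simps)
    qed
    then show ?thesis by simp
  qed
  show thesis
  proof
    show "\<bar>F x - F y\<bar> \<le> L * norm (x - y)" for x y using le[of x y] le[of y x] by (simp add: norm_minus_commute abs_le_iff)
    show "F x = f x" if x: "x \<in> C" for x
    proof (rule antisym)
      have "F x \<le> f x + L * norm (x - x)" unfolding F_def by (rule cINF_lower[OF bb x])
      then show "F x \<le> f x" by simp
      show "f x \<le> F x" unfolding F_def
      proof (rule cINF_greatest[OF C])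
        fix z assume "z \<in> C"
        then show "f x \<le> f z + L * norm (x - z)" using f[OF x] by (force simp: abs_le_iff)
      qed
    qed
  qed
qed

text \<open>The function \<open>M / 2 * (norm y)^2 - c y\<close> has a supporting affine function at
  every point, hence is convex and therefore continuous.\<close>

lemma semiconcave_continuous:
  fixes c :: "'a::euclidean_space \<Rightarrow> real" and M :: real
  assumes M: "\<And>y. \<exists>g. \<forall>h. c (y + h) \<le> c y + g \<bullet> h + M / 2 * (norm h)\<^sup>2"
  shows "continuous_on UNIV c"
proof -
  define \<phi> where "\<phi> y = M / 2 * (norm y)\<^sup>2 - c y" for y
  have sub: "\<exists>G. \<forall>z. \<phi> z \<ge> \<phi> y + G \<bullet> (z - y)" for y
  proof -
    obtain g where g: "\<And>h. c (y + h) \<le> c y + g \<bullet> h + M / 2 * (norm h)\<^sup>2" using M by blast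
    have "\<phi> z \<ge> \<phi> y + (M *\<^sub>R y - g) \<bullet> (z - y)" for z
    proof -
      have "(norm z)\<^sup>2 = (norm y)\<^sup>2 + 2 * (y \<bullet> (z - y)) + (norm (z - y))\<^sup>2"
        by (simp add: power2_norm_eq_inner inner_simps inner_commute)
      then have "M / 2 * (norm z)\<^sup>2 = M / 2 * ((norm y)\<^sup>2 + 2 * (y \<bullet> (z - y)) + (norm (z - y))\<^sup>2)" by (simp only:)
      then have "M / 2 * (norm z)\<^sup>2 = M / 2 * (norm y)\<^sup>2 + M * (y \<bullet> (z - y)) + M / 2 * (norm (z - y))\<^sup>2"
        by (simp add: distrib_left)
      moreover have "(M *\<^sub>R y - g) \<bullet> (z - y) = M * (y \<bullet> (z - y)) - g \<bullet> (z - y)" by (simp add: inner_diff_left)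
      moreover have "c z \<le> c y + g \<bullet> (z - y) + M / 2 * (norm (z - y))\<^sup>2" using g[of "z - y"] by simp
      ultimately show ?thesis unfolding \<phi>_def by linarith
    qed
    then show ?thesis by blast
  qed
  have "convex_on UNIV \<phi>"
  proof (rule convex_onI)
    fix t :: real and x y :: 'a assume t: "0 < t" "t < 1"
    let ?z = "(1 - t) *\<^sub>R x + t *\<^sub>R y"
    obtain G where G: "\<And>z. \<phi> z \<ge> \<phi> ?z + G \<bullet> (z - ?z)" using sub by blast
    have "(1 - t) * \<phi> x + t * \<phi> y \<ge> (1 - t) * (\<phi> ?z + G \<bullet> (x - ?z)) + t * (\<phi> ?z + G \<bullet> (y - ?z))"
      using G t by (intro add_mono mult_left_mono) auto
    also have "(1 - t) * (\<phi> ?z + G \<bullet> (x - ?z)) + t * (\<phi> ?z + G \<bullet> (y - ?z)) = \<phi> ?z + G \<bullet> ((1 - t) *\<^sub>R (x - ?z) + t *\<^sub>R (y - ?z))"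
      by (simp add: inner_add_right algebra_simps)
    also have "(1 - t) *\<^sub>R (x - ?z) + t *\<^sub>R (y - ?z) = 0" by (simp add: algebra_simps)
    finally show "\<phi> ?z \<le> (1 - t) * \<phi> x + t * \<phi> y" by simp
  qed simp
  then have "continuous_on UNIV \<phi>" by (intro convex_on_continuous) auto
  then have "continuous_on UNIV (\<lambda>y. M / 2 * (norm y)\<^sup>2 - \<phi> y)" by (intro continuous_intros)
  then show ?thesis by (simp add: \<phi>_def)
qed

lemma has_derivative_lipschitz_bound:
  fixes F :: "'a::real_normed_vector \<Rightarrow> real"
  assumes F: "\<And>x y. \<bar>F x - F y\<bar> \<le> M * norm (x - y)" and d: "(F has_derivative D) (at x)"
  shows "\<bar>D h\<bar> \<le> M * norm h"
proof (cases "h = 0")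
  case True
  then show ?thesis using d linear_0[OF has_derivative_linear[OF d]] by simp
next
  case False
  show ?thesis
  proof (rule field_le_epsilon)
    fix e0 :: real assume e0: "e0 > 0"
    define e where "e = e0 / norm h"
    have e: "e > 0" using e0 False by (simp add: e_def)
    then obtain d' where d': "d' > 0" "\<And>y. norm (y - x) < d' \<Longrightarrow> \<bar>F y - F x - D (y - x)\<bar> \<le> e * norm (y - x)"
      using d unfolding has_derivative_at_alt real_norm_def by meson
    define t where "t = d' / (2 * norm h)"
    have t: "t > 0" using d' False by (simp add: t_def)
    have n: "norm (t *\<^sub>R h) < d'" using d'(1) False t by (simp add: t_def)
    have "\<bar>F (x + t *\<^sub>R h) - F x - D (t *\<^sub>R h)\<bar> \<le> e * norm (t *\<^sub>R h)" using d'(2)[of "x + t *\<^sub>R h"] n by simp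
    moreover have "\<bar>F (x + t *\<^sub>R h) - F x\<bar> \<le> M * norm (t *\<^sub>R h)" using F[of "x + t *\<^sub>R h" x] by simp
    moreover have "D (t *\<^sub>R h) = t * D h" using linear_scale[OF has_derivative_linear[OF d]] by simp
    ultimately have "t * \<bar>D h\<bar> \<le> M * (t * norm h) + e * (t * norm h)" using t by (simp add: abs_mult)
    then have "t * \<bar>D h\<bar> \<le> t * (M * norm h + e * norm h)" by (simp add: algebra_simps)
    then have "\<bar>D h\<bar> \<le> M * norm h + e * norm h" using t by simp
    then show "\<bar>D h\<bar> \<le> M * norm h + e0" using False by (simp add: e_def)
  qed
qed

text \<open>Affine functions of small slope touch \<open>c\<close> from below. By semiconcavity the
  slope is a Lipschitz function of the contact point, and every small slope occurs, so the contact
  set has positive measure and contains a density point at which the extended slope map is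
  differentiable, with derivative \<open>S\<close>. The lower expansion then holds for every
  \<open>h\<close>; the upper one is available only when \<open>y + k\<close> is a contact point,
  whence its form with \<open>k\<close> close to \<open>h\<close>. Symmetry of \<open>S\<close> is
  not part of the conclusion and is arranged later.\<close>

lemma alexandrov_jensen:
  fixes c :: "'a::euclidean_space \<Rightarrow> real" and m M \<delta> :: real
  assumes c0: "c 0 = 0" and m: "m > 0" "\<And>y. c y \<ge> m * (norm y)\<^sup>2"
    and M: "M > 0" "\<And>y. \<exists>g. \<forall>h. c (y + h) \<le> c y + g \<bullet> h + M / 2 * (norm h)\<^sup>2"
    and \<delta>: "\<delta> > 0"
  obtains y p S where "norm y < \<delta>" "norm p < \<delta>" "linear S" "\<And>h. norm (S h) \<le> DIM('a) * M * norm h"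
    "\<And>h. S h \<bullet> h \<ge> 0" "c y \<le> p \<bullet> y"
    "\<And>e. e > 0 \<Longrightarrow> \<exists>d>0. \<forall>h. norm h < d \<longrightarrow> c (y + h) \<ge> c y + p \<bullet> h + S h \<bullet> h / 2 - e * (norm h)\<^sup>2"
    "\<And>e. e > 0 \<Longrightarrow> \<exists>d>0. \<forall>h. norm h < d \<longrightarrow> (\<exists>k. norm (k - h) \<le> e * norm h \<and>
        c (y + k) \<le> c y + p \<bullet> k + S k \<bullet> k / 2 + e * (norm k)\<^sup>2)"
proof -
  have cont: "continuous_on UNIV c" by (rule semiconcave_continuous[OF M(2)])
  define Ct where "Ct y p \<longleftrightarrow> (\<forall>z. c z \<ge> c y + p \<bullet> (z - y))" for y p
  have Ct_ex: "\<exists>y. Ct y p" for p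
  proof -
    \<comment> \<open>Outside this ball \<open>m * (norm z)^2\<close> beats
      \<open>norm p * norm z\<close>, so the minimum over the ball is global.\<close>
    let ?B = "cball (0::'a) (norm p / m)"
    have "continuous_on ?B (\<lambda>y. c y - p \<bullet> y)" by (intro continuous_intros continuous_on_subset[OF cont]) auto
    moreover have "?B \<noteq> {}" using m(1) by (simp add: not_less)
    ultimately have "\<exists>y\<in>?B. \<forall>z\<in>?B. c y - p \<bullet> y \<le> c z - p \<bullet> z" by (intro continuous_attains_inf) auto
    then obtain y where y: "y \<in> ?B" "\<And>z. z \<in> ?B \<Longrightarrow> c y - p \<bullet> y \<le> c z - p \<bullet> z" by blast
    have "c y - p \<bullet> y \<le> c z - p \<bullet> z" for z
    proof (cases "z \<in> ?B")
      case False
      then have nz: "norm p \<le> m * norm z" using m(1) by (simp add: field_simps)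
      have "p \<bullet> z \<le> norm p * norm z" by (rule norm_cauchy_schwarz)
      also have "\<dots> \<le> m * norm z * norm z" using nz by (rule mult_right_mono) simp
      also have "\<dots> \<le> c z" using m(2)[of z] by (simp add: power2_eq_square)
      finally have "0 \<le> c z - p \<bullet> z" by simp
      moreover have "c y - p \<bullet> y \<le> 0" using y(2)[of 0] c0 m(1) by simp
      ultimately show ?thesis by simp
    qed (use y in auto)
    then have "Ct y p" unfolding Ct_def by (force simp: inner_diff_right algebra_simps)
    then show ?thesis by blast
  qed
  have Ct_small: "norm y \<le> norm p / m" "c y \<le> p \<bullet> y" if "Ct y p" for y p
  proof -
    show 1: "c y \<le> p \<bullet> y" using that[unfolded Ct_def, rule_format, of 0] c0 by (simp add: inner_diff_right)
    have "m * (norm y)\<^sup>2 \<le> norm p * norm y" using 1 m(2)[of y] norm_cauchy_schwarz[of p y] by linarith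
    then have "norm y * (m * norm y) \<le> norm y * norm p" by (simp add: power2_eq_square mult_ac)
    then have "m * norm y \<le> norm p" by (cases "y = 0") auto
    then show "norm y \<le> norm p / m" using m(1) by (simp add: field_simps)
  qed
  \<comment> \<open>The affine minorant at \<open>y\<close> is compared with the semiconcave upper
    bound at \<open>y'\<close> in the point \<open>y' + k\<close>, where the shift
    \<open>k = (p - p') / M\<close> gains the quadratic term. Adding the symmetric inequality gives
    cocoercivity of the slopes, hence their Lipschitz bound.\<close>
  have Ct_mono0: "c y + p \<bullet> (y' - y) + (norm (p - p'))\<^sup>2 / (2 * M) \<le> c y'" if "Ct y p" "Ct y' p'" for y p y' p'
  proof -
    obtain g where g: "\<And>h. c (y' + h) \<le> c y' + g \<bullet> h + M / 2 * (norm h)\<^sup>2" using M(2) by blast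
    have gp: "g = p'"
    proof -
      have *: "(p' - g) \<bullet> h \<le> M / 2 * (norm h)\<^sup>2" for h
        using that(2)[unfolded Ct_def, rule_format, of "y' + h"] g[of h] by (simp add: inner_diff_left)
      have "(p' - g) \<bullet> ((1/M) *\<^sub>R (p' - g)) \<le> M / 2 * (norm ((1/M) *\<^sub>R (p' - g)))\<^sup>2" by (rule *)
      then have "(norm (p' - g))\<^sup>2 / M \<le> (norm (p' - g))\<^sup>2 / (2 * M)"
        using M(1) by (simp add: power_mult_distrib power2_norm_eq_inner[symmetric] power2_eq_square[of M] divide_simps)
      then have "(norm (p' - g))\<^sup>2 \<le> 0" using M(1) by (simp add: field_simps)
      then show ?thesis by simp
    qed
    define k where "k = (1/M) *\<^sub>R (p - p')"
    have "c (y' + k) \<le> c y' + p' \<bullet> k + M / 2 * (norm k)\<^sup>2" using g gp by blast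
    moreover have "c (y' + k) \<ge> c y + p \<bullet> (y' + k - y)" using that(1) unfolding Ct_def by blast
    moreover have "p \<bullet> (y' + k - y) = p \<bullet> (y' - y) + p \<bullet> k" by (simp add: inner_simps)
    moreover have "p \<bullet> k - p' \<bullet> k = (norm (p - p'))\<^sup>2 / M"
      unfolding k_def by (simp add: inner_diff_left[symmetric] power2_norm_eq_inner diff_divide_distrib[symmetric])
    moreover have "M / 2 * (norm k)\<^sup>2 = (norm (p - p'))\<^sup>2 / (2 * M)"
      using M(1) by (simp add: k_def power_mult_distrib power2_eq_square[of M] power_divide)
    moreover have "(norm (p - p'))\<^sup>2 / M = (norm (p - p'))\<^sup>2 / (2 * M) + (norm (p - p'))\<^sup>2 / (2 * M)"
      using M(1) by (simp add: field_simps)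
    ultimately show ?thesis by linarith
  qed
  have Ct_mono: "(norm (p - p'))\<^sup>2 / M \<le> (p' - p) \<bullet> (y' - y)" if "Ct y p" "Ct y' p'" for y p y' p'
  proof -
    have "(norm (p - p'))\<^sup>2 / M = (norm (p - p'))\<^sup>2 / (2 * M) + (norm (p' - p))\<^sup>2 / (2 * M)"
      using M(1) by (simp add: field_simps norm_minus_commute)
    then show ?thesis using Ct_mono0[OF that] Ct_mono0[OF that(2,1)] by (simp add: inner_simps)
  qed
  have Ct_lip: "norm (p - p') \<le> M * norm (y - y')" if "Ct y p" "Ct y' p'" for y p y' p'
  proof -
    have "(norm (p - p'))\<^sup>2 / M \<le> norm (p - p') * norm (y - y')"
      using Ct_mono[OF that] norm_cauchy_schwarz[of "p' - p" "y' - y"] by (simp add: norm_minus_commute)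
    then have "norm (p - p') * norm (p - p') \<le> norm (p - p') * (M * norm (y - y'))"
      using M(1) by (simp add: field_simps power2_eq_square)
    then show ?thesis using M(1) by (cases "p = p'") auto
  qed
  \<comment> \<open>A slope of norm at most \<open>\<delta>'\<close> must also force the contact
    point to be small, through \<open>norm y \<le> norm p / m\<close>.\<close>
  define \<delta>' where "\<delta>' = min \<delta> (m * \<delta>) / 2"
  have \<delta>': "\<delta>' > 0" "\<delta>' < \<delta>" "\<delta>' / m < \<delta>" using \<delta> m(1) by (auto simp: \<delta>'_def min_def field_simps)
  define G where "G = {yp. Ct (fst yp) (snd yp) \<and> snd yp \<in> cball 0 \<delta>'}"
  define C where "C = fst ` G"
  have "compact C"
    unfolding C_def
  proof (rule compact_continuous_image)
    have "G = (\<Inter>z. {yp. c (fst yp) + snd yp \<bullet> (z - fst yp) \<le> c z}) \<inter> {yp. norm (snd yp) \<le> \<delta>'}"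
      by (auto simp: G_def Ct_def)
    also have "closed \<dots>"
      by (intro closed_Int closed_INT ballI closed_Collect_le continuous_intros continuous_on_compose2[OF cont]) auto
    finally have "closed G" .
    moreover have "G \<subseteq> cball 0 (\<delta>' / m) \<times> cball 0 \<delta>'"
    proof
      fix yp assume "yp \<in> G"
      then have *: "Ct (fst yp) (snd yp)" "norm (snd yp) \<le> \<delta>'" by (auto simp: G_def)
      have "norm (fst yp) \<le> norm (snd yp) / m" by (rule Ct_small[OF *(1)])
      also have "\<dots> \<le> \<delta>' / m" using *(2) m(1) by (intro divide_right_mono) auto
      finally show "yp \<in> cball 0 (\<delta>' / m) \<times> cball 0 \<delta>'" using * by (simp add: mem_Times_iff)
    qed
    then have "bounded G" by (rule bounded_subset[OF bounded_Times[OF bounded_cball bounded_cball]])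
    ultimately show "compact G" by (simp add: compact_eq_bounded_closed)
  qed (intro continuous_intros)
  then have Ccl: "closed C" by (rule compact_imp_closed)
  define P where "P y = (SOME p. Ct y p \<and> p \<in> cball 0 \<delta>')" for y
  have P: "Ct y (P y)" "norm (P y) \<le> \<delta>'" if "y \<in> C" for y
  proof -
    have "\<exists>p. Ct y p \<and> p \<in> cball 0 \<delta>'" using that by (auto simp: C_def G_def)
    from someI_ex[OF this] show "Ct y (P y)" "norm (P y) \<le> \<delta>'" by (auto simp: P_def)
  qed
  have Plip: "norm (P x - P y) \<le> M * norm (x - y)" if "x \<in> C" "y \<in> C" for x y
    using Ct_lip P that by blast
  \<comment> \<open>A Lipschitz image of a null set is null, yet the image of \<open>C\<close> under
    \<open>P\<close> contains a whole ball of slopes.\<close>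
  have nonneg: "\<not> negligible C"
  proof
    assume "negligible C"
    then have "negligible (P ` C)"
    proof (rule negligible_locally_Lipschitz_image[rotated])
      fix x assume "x \<in> C"
      then show "\<exists>T B. open T \<and> x \<in> T \<and> (\<forall>y \<in> C \<inter> T. norm (P y - P x) \<le> B * norm (y - x))"
        using Plip by (intro exI[of _ UNIV] exI[of _ M]) auto
    qed simp
    moreover have "cball 0 \<delta>' \<subseteq> P ` C"
    proof
      fix p :: 'a assume p: "p \<in> cball 0 \<delta>'"
      obtain y where y: "Ct y p" using Ct_ex by blast
      then have "(y, p) \<in> G" using p by (simp add: G_def)
      then have yC: "y \<in> C" unfolding C_def by (rule image_eqI[rotated]) simp
      have "norm (p - P y) \<le> M * norm (y - y)" using Ct_lip[OF y P(1)[OF yC]] .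
      then show "p \<in> P ` C" using yC by auto
    qed
    ultimately have "negligible (cball (0::'a) \<delta>')" using negligible_subset by blast
    then have "negligible (ball (0::'a) \<delta>')" by (rule negligible_subset) auto
    then show False using \<delta>'(1) open_not_negligible[of "ball (0::'a) \<delta>'"] by auto
  qed
  then have Cne: "C \<noteq> {}" by auto
  have "\<exists>F. \<forall>b\<in>Basis. (\<forall>x y. \<bar>F b x - F b y\<bar> \<le> M * norm (x - y)) \<and> (\<forall>x\<in>C. F b x = P x \<bullet> b)"
  proof (rule bchoice, rule ballI)
    fix b :: 'a assume b: "b \<in> Basis"
    have "\<bar>P x \<bullet> b - P y \<bullet> b\<bar> \<le> M * norm (x - y)" if "x \<in> C" "y \<in> C" for x y
      using Basis_le_norm[OF b, of "P x - P y"] Plip[OF that] by (simp add: inner_diff_left)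
    from mcshane_extension[where f = "\<lambda>x. P x \<bullet> b", OF Cne less_imp_le[OF M(1)] this]
    obtain F where "\<And>x y. \<bar>F x - F y\<bar> \<le> M * norm (x - y)" "\<And>x. x \<in> C \<Longrightarrow> F x = P x \<bullet> b" by blast
    then show "\<exists>F. (\<forall>x y. \<bar>F x - F y\<bar> \<le> M * norm (x - y)) \<and> (\<forall>x\<in>C. F x = P x \<bullet> b)" by blast
  qed
  then obtain F where F: "\<And>b x y. b \<in> Basis \<Longrightarrow> \<bar>F b x - F b y\<bar> \<le> M * norm (x - y)"
    "\<And>b x. b \<in> Basis \<Longrightarrow> x \<in> C \<Longrightarrow> F b x = P x \<bullet> b" by blast
  define bad where "bad = {x \<in> C. \<not> (\<forall>\<epsilon>>0. \<exists>d>0. \<forall>h. norm h < d \<longrightarrow> (\<exists>y\<in>C. norm (x + h - y) \<le> \<epsilon> * norm h))}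
     \<union> (\<Union>b\<in>Basis. {x. \<not> (\<exists>c. (F b has_derivative (\<lambda>h. c \<bullet> h)) (at x))})"
  have "negligible bad" unfolding bad_def
  proof (intro negligible_Un negligible_Union)
    show "negligible {x \<in> C. \<not> (\<forall>\<epsilon>>0. \<exists>d>0. \<forall>h. norm h < d \<longrightarrow> (\<exists>y\<in>C. norm (x + h - y) \<le> \<epsilon> * norm h))}"
      by (rule density_point_negligible[OF Ccl])
    fix T assume "T \<in> (\<lambda>b. {x. \<not> (\<exists>c. (F b has_derivative (\<lambda>h. c \<bullet> h)) (at x))}) ` Basis"
    then show "negligible T" using rademacher F(1) by blast
  qed simp
  then obtain y where y: "y \<in> C" "y \<notin> bad" using nonneg negligible_subset by blast
  have dens: "\<exists>d>0. \<forall>h. norm h < d \<longrightarrow> (\<exists>k. y + k \<in> C \<and> norm (k - h) \<le> \<epsilon> * norm h)" if \<epsilon>: "\<epsilon> > 0" for \<epsilon>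
  proof -
    obtain d where d: "d > 0" "\<And>h. norm h < d \<Longrightarrow> \<exists>z\<in>C. norm (y + h - z) \<le> \<epsilon> * norm h" using y \<epsilon> unfolding bad_def by blast
    have "\<exists>k. y + k \<in> C \<and> norm (k - h) \<le> \<epsilon> * norm h" if h: "norm h < d" for h
    proof -
      obtain z where "z \<in> C" "norm (y + h - z) \<le> \<epsilon> * norm h" using d h by blast
      then show ?thesis by (intro exI[of _ "z - y"]) (simp add: norm_minus_commute algebra_simps)
    qed
    then show ?thesis using d by blast
  qed
  have "\<forall>b\<in>Basis. \<exists>c. (F b has_derivative (\<lambda>h. c \<bullet> h)) (at y)" using y unfolding bad_def by blast
  then obtain D where D: "\<And>b. b \<in> Basis \<Longrightarrow> (F b has_derivative (\<lambda>h. D b \<bullet> h)) (at y)" by metis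
  define S where "S h = (\<Sum>b\<in>Basis. (D b \<bullet> h) *\<^sub>R b)" for h
  have linS: "linear S" unfolding S_def
    by (intro linearI) (simp_all add: inner_add_right scaleR_left_distrib sum.distrib scaleR_right.sum)
  define K where "K = DIM('a) * M"
  have K: "K > 0" using M(1) by (simp add: K_def)
  have Sb: "S h \<bullet> b = D b \<bullet> h" if "b \<in> Basis" for h b unfolding S_def using that by (simp add: inner_sum_left_Basis)
  have SK: "norm (S h) \<le> K * norm h" for h
  proof -
    have "norm (S h) \<le> (\<Sum>b\<in>Basis. \<bar>S h \<bullet> b\<bar>)" by (rule norm_le_l1)
    also have "\<dots> \<le> (\<Sum>b\<in>(Basis::'a set). M * norm h)"
      using has_derivative_lipschitz_bound[OF F(1) D] Sb by (intro sum_mono) auto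
    finally show ?thesis by (simp add: K_def)
  qed
  have Pd: "\<exists>d>0. \<forall>k. norm k < d \<longrightarrow> y + k \<in> C \<longrightarrow> norm (P (y + k) - P y - S k) \<le> \<epsilon> * norm k" if \<epsilon>: "\<epsilon> > 0" for \<epsilon>
  proof -
    define n where "n = real DIM('a)"
    have n: "n > 0" by (simp add: n_def)
    have "\<forall>b\<in>Basis. \<exists>d>0. \<forall>z. norm (z - y) < d \<longrightarrow> \<bar>F b z - F b y - D b \<bullet> (z - y)\<bar> \<le> \<epsilon> / n * norm (z - y)"
    proof
      fix b :: 'a assume "b \<in> Basis"
      then have "\<forall>e>0. \<exists>d>0. \<forall>z. norm (z - y) < d \<longrightarrow> \<bar>F b z - F b y - D b \<bullet> (z - y)\<bar> \<le> e * norm (z - y)"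
        using D unfolding has_derivative_at_alt real_norm_def by blast
      then show "\<exists>d>0. \<forall>z. norm (z - y) < d \<longrightarrow> \<bar>F b z - F b y - D b \<bullet> (z - y)\<bar> \<le> \<epsilon> / n * norm (z - y)"
        using \<epsilon> n by (meson divide_pos_pos)
    qed
    from bchoice[OF this] obtain d where d0: "\<forall>b\<in>Basis. d b > 0 \<and> (\<forall>z. norm (z - y) < d b \<longrightarrow> \<bar>F b z - F b y - D b \<bullet> (z - y)\<bar> \<le> \<epsilon> / n * norm (z - y))" ..
    then have d: "\<And>b. b \<in> Basis \<Longrightarrow> d b > 0"
      "\<And>b z. b \<in> Basis \<Longrightarrow> norm (z - y) < d b \<Longrightarrow> \<bar>F b z - F b y - D b \<bullet> (z - y)\<bar> \<le> \<epsilon> / n * norm (z - y)" by blast+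
    define d' where "d' = Min (d ` Basis)"
    have d': "d' > 0" using d(1) by (simp add: d'_def)
    have d'le: "d' \<le> d b" if "b \<in> Basis" for b using that by (simp add: d'_def)
    have "norm (P (y + k) - P y - S k) \<le> \<epsilon> * norm k" if k: "norm k < d'" "y + k \<in> C" for k
    proof -
      have "norm (P (y + k) - P y - S k) \<le> (\<Sum>b\<in>Basis. \<bar>(P (y + k) - P y - S k) \<bullet> b\<bar>)" by (rule norm_le_l1)
      also have "\<dots> \<le> (\<Sum>b\<in>(Basis::'a set). \<epsilon> / n * norm k)"
      proof (rule sum_mono)
        fix b :: 'a assume b: "b \<in> Basis"
        have "\<bar>F b (y + k) - F b y - D b \<bullet> k\<bar> \<le> \<epsilon> / n * norm k" using d(2)[OF b, of "y + k"] d'le[OF b] k by simp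
        then show "\<bar>(P (y + k) - P y - S k) \<bullet> b\<bar> \<le> \<epsilon> / n * norm k"
          using F(2)[OF b] k(2) y(1) Sb[OF b] by (simp add: inner_diff_left)
      qed
      also have "\<dots> = n * (\<epsilon> / n * norm k)" by (simp add: n_def)
      also have "\<dots> = \<epsilon> * norm k" using n by simp
      finally show ?thesis .
    qed
    then show ?thesis using d' by blast
  qed
  have Sneg: "S (- h) = - S h" "S (h - h') = S h - S h'" "S (h + h') = S h + S h'" "S (t *\<^sub>R h) = t *\<^sub>R S h" for h h' t
    using linS by (simp_all add: linear_neg linear_diff linear_add linear_scale)
  \<comment> \<open>Slopes at contact points are monotone; density supplies a contact point next to
    a small multiple of \<open>h\<close>, at a relative error of order
    \<open>\<epsilon>\<close>.\<close>
  have Spos: "S h \<bullet> h \<ge> 0" for h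
  proof (rule ccontr)
    assume neg: "\<not> S h \<bullet> h \<ge> 0"
    then have h0: "h \<noteq> 0" by auto
    define A where "A = (4 + 3 * K) * (norm h)\<^sup>2"
    have A: "A > 0" using K h0 by (simp add: A_def)
    define \<epsilon> where "\<epsilon> = min 1 (- (S h \<bullet> h) / (2 * A))"
    have \<epsilon>: "0 < \<epsilon>" "\<epsilon> \<le> 1" using neg A by (auto simp: \<epsilon>_def divide_neg_pos)
    obtain d1 where d1: "d1 > 0" "\<And>h. norm h < d1 \<Longrightarrow> \<exists>k. y + k \<in> C \<and> norm (k - h) \<le> \<epsilon> * norm h" using dens[OF \<epsilon>(1)] by blast
    obtain d2 where d2: "d2 > 0" "\<And>k. norm k < d2 \<Longrightarrow> y + k \<in> C \<Longrightarrow> norm (P (y + k) - P y - S k) \<le> \<epsilon> * norm k" using Pd[OF \<epsilon>(1)] by blast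
    define t where "t = min d1 d2 / (3 * norm h)"
    have t: "t > 0" using d1(1) d2(1) h0 by (simp add: t_def)
    define v where "v = t *\<^sub>R h"
    have nv: "norm v = min d1 d2 / 3" "norm v > 0" using t h0 d1(1) d2(1) by (simp_all add: v_def t_def)
    have "norm v < d1" unfolding nv(1) using d1(1) d2(1) by (auto simp: min_def)
    then obtain k where k: "y + k \<in> C" "norm (k - v) \<le> \<epsilon> * norm v" using d1(2) by blast
    have kv: "norm k \<le> 2 * norm v"
    proof -
      have "norm k \<le> norm (k - v) + norm v" using norm_triangle_ineq[of "k - v" v] by simp
      moreover have "\<epsilon> * norm v \<le> 1 * norm v" using \<epsilon> by (intro mult_right_mono) auto
      ultimately show ?thesis using k by simp
    qed
    have "norm k < d2" using kv nv d2(1) d1(1) by (auto simp: min_def split: if_splits)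
    then have e: "norm (P (y + k) - P y - S k) \<le> \<epsilon> * norm k" using d2(2) k(1) by blast
    have "0 \<le> (norm (P y - P (y + k)))\<^sup>2 / M" using M(1) by simp
    also have "\<dots> \<le> (P (y + k) - P y) \<bullet> (y + k - y)" by (rule Ct_mono[OF P(1)[OF y(1)] P(1)[OF k(1)]])
    also have "\<dots> = S k \<bullet> k + (P (y + k) - P y - S k) \<bullet> k" by (simp add: inner_diff_left)
    also have "(P (y + k) - P y - S k) \<bullet> k \<le> (\<epsilon> * norm k) * norm k"
      using norm_cauchy_schwarz[of "P (y + k) - P y - S k" k] mult_right_mono[OF e norm_ge_zero[of k]] by linarith
    also have "\<epsilon> * norm k * norm k \<le> \<epsilon> * (4 * (norm v)\<^sup>2)"
      using mult_mono[OF kv kv] \<epsilon> by (auto simp: power2_eq_square mult.assoc intro!: mult_left_mono)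
    finally have 1: "S k \<bullet> k \<ge> - (\<epsilon> * (4 * (norm v)\<^sup>2))" by simp
    have "S v \<bullet> v = S k \<bullet> k - S (k - v) \<bullet> k - S v \<bullet> (k - v)" by (simp add: Sneg inner_simps)
    moreover have "S (k - v) \<bullet> k \<le> (K * (\<epsilon> * norm v)) * (2 * norm v)"
    proof -
      have "S (k - v) \<bullet> k \<le> norm (S (k - v)) * norm k" by (rule norm_cauchy_schwarz)
      also have "\<dots> \<le> (K * (\<epsilon> * norm v)) * (2 * norm v)"
        using order_trans[OF SK[of "k - v"]] k(2) kv K \<epsilon> by (intro mult_mono) (auto intro: mult_left_mono)
      finally show ?thesis .
    qed
    moreover have "S v \<bullet> (k - v) \<le> (K * norm v) * (\<epsilon> * norm v)"
    proof -
      have "S v \<bullet> (k - v) \<le> norm (S v) * norm (k - v)" by (rule norm_cauchy_schwarz)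
      also have "\<dots> \<le> (K * norm v) * (\<epsilon> * norm v)" using SK k(2) K by (intro mult_mono) auto
      finally show ?thesis .
    qed
    ultimately have "S v \<bullet> v \<ge> - (\<epsilon> * ((4 + 3 * K) * (norm v)\<^sup>2))" using 1 by (simp add: algebra_simps power2_eq_square)
    then have "t\<^sup>2 * (S h \<bullet> h) \<ge> t\<^sup>2 * (- (\<epsilon> * A))"
      by (simp add: v_def Sneg A_def power_mult_distrib power2_eq_square algebra_simps)
    then have "S h \<bullet> h \<ge> - (\<epsilon> * A)" using t by (subst (asm) mult_le_cancel_left_pos) auto
    moreover have "\<epsilon> * A \<le> - (S h \<bullet> h) / (2 * A) * A" using A by (intro mult_right_mono) (auto simp: \<epsilon>_def)
    ultimately show False using neg A by simp
  qed
  \<comment> \<open>The nodes of the Riemann sum are contact points next to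
    \<open>(i / N) h\<close>; there the slope is \<open>P y + (i / N) S h\<close> up to the stated
    error.\<close>
  have nodes: "\<exists>d>0. (\<forall>h. norm h < d \<longrightarrow> (\<exists>k. k 0 = 0 \<and> (\<forall>i<N. y + k i \<in> C \<and> norm (k i - (real i / N) *\<^sub>R h) \<le> \<epsilon> * norm h
       \<and> norm (P (y + k i) - P y - (real i / N) *\<^sub>R S h) \<le> (2 + K) * \<epsilon> * norm h))) \<and>
      (\<forall>h. norm h < d \<longrightarrow> y + h \<in> C \<longrightarrow> norm (P (y + h) - P y - S h) \<le> (2 + K) * \<epsilon> * norm h)"
    if N: "N > 0" and \<epsilon>: "0 < \<epsilon>" "\<epsilon> \<le> 1" for N :: nat and \<epsilon>
  proof -
    obtain d1 where d1: "d1 > 0" "\<And>h. norm h < d1 \<Longrightarrow> \<exists>k. y + k \<in> C \<and> norm (k - h) \<le> \<epsilon> * norm h" using dens[OF \<epsilon>(1)] by blast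
    obtain d2 where d2: "d2 > 0" "\<And>k. norm k < d2 \<Longrightarrow> y + k \<in> C \<Longrightarrow> norm (P (y + k) - P y - S k) \<le> \<epsilon> * norm k" using Pd[OF \<epsilon>(1)] by blast
    define d where "d = min d1 (d2 / 2)"
    have d: "d > 0" using d1(1) d2(1) by (simp add: d_def)
    have A: "\<exists>k. k 0 = 0 \<and> (\<forall>i<N. y + k i \<in> C \<and> norm (k i - (real i / N) *\<^sub>R h) \<le> \<epsilon> * norm h
       \<and> norm (P (y + k i) - P y - (real i / N) *\<^sub>R S h) \<le> (2 + K) * \<epsilon> * norm h)" if h: "norm h < d" for h
    proof -
      have "\<forall>i\<in>{..<N}. \<exists>k. y + k \<in> C \<and> norm (k - (real i / N) *\<^sub>R h) \<le> \<epsilon> * norm ((real i / N) *\<^sub>R h)"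
      proof
        fix i assume i: "i \<in> {..<N}"
        have "norm ((real i / N) *\<^sub>R h) \<le> 1 * norm h" using i unfolding norm_scaleR by (intro mult_right_mono) auto
        then have "norm ((real i / N) *\<^sub>R h) < d1" using h unfolding d_def by linarith
        then show "\<exists>k. y + k \<in> C \<and> norm (k - (real i / N) *\<^sub>R h) \<le> \<epsilon> * norm ((real i / N) *\<^sub>R h)"
          by (rule d1(2))
      qed
      then obtain k where k: "\<And>i. i < N \<Longrightarrow> y + k i \<in> C" "\<And>i. i < N \<Longrightarrow> norm (k i - (real i / N) *\<^sub>R h) \<le> \<epsilon> * norm ((real i / N) *\<^sub>R h)"
        by (metis lessThan_iff)
      have "k 0 = 0" using k(2)[OF N] by simp
      moreover have "norm (k i - (real i / N) *\<^sub>R h) \<le> \<epsilon> * norm h \<and> norm (P (y + k i) - P y - (real i / N) *\<^sub>R S h) \<le> (2 + K) * \<epsilon> * norm h"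
        if i: "i < N" for i
      proof
        have i1: "norm ((real i / N) *\<^sub>R h) \<le> norm h" using i mult_right_mono[of "real i / N" 1 "norm h"] by simp
        show 1: "norm (k i - (real i / N) *\<^sub>R h) \<le> \<epsilon> * norm h"
          using k(2)[OF i] i1 \<epsilon> by (meson mult_left_mono less_imp_le order_trans)
        have "norm (k i) \<le> norm (k i - (real i / N) *\<^sub>R h) + norm ((real i / N) *\<^sub>R h)"
          using norm_triangle_ineq[of "k i - (real i / N) *\<^sub>R h" "(real i / N) *\<^sub>R h"] by simp
        moreover have "\<epsilon> * norm h \<le> 1 * norm h" using \<epsilon> by (intro mult_right_mono) auto
        ultimately have kn: "norm (k i) \<le> 2 * norm h" using 1 i1 by linarith
        then have "norm (k i) < d2" using h by (simp add: d_def)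
        then have "norm (P (y + k i) - P y - S (k i)) \<le> \<epsilon> * norm (k i)" using d2(2) k(1)[OF i] by blast
        also have "\<dots> \<le> \<epsilon> * (2 * norm h)" using kn \<epsilon> by (intro mult_left_mono) auto
        finally have 2: "norm (P (y + k i) - P y - S (k i)) \<le> \<epsilon> * (2 * norm h)" .
        have 3: "norm (S (k i - (real i / N) *\<^sub>R h)) \<le> K * (\<epsilon> * norm h)"
          by (rule order_trans[OF SK mult_left_mono[OF 1]]) (use K in simp)
        have "P (y + k i) - P y - (real i / N) *\<^sub>R S h = (P (y + k i) - P y - S (k i)) + S (k i - (real i / N) *\<^sub>R h)"
          by (simp add: Sneg)
        then have "norm (P (y + k i) - P y - (real i / N) *\<^sub>R S h) \<le> norm (P (y + k i) - P y - S (k i)) + norm (S (k i - (real i / N) *\<^sub>R h))"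
          by (simp only: norm_triangle_ineq)
        then have "norm (P (y + k i) - P y - (real i / N) *\<^sub>R S h) \<le> \<epsilon> * (2 * norm h) + K * (\<epsilon> * norm h)"
          using 2 3 by linarith
        then show "norm (P (y + k i) - P y - (real i / N) *\<^sub>R S h) \<le> (2 + K) * \<epsilon> * norm h" by (simp add: algebra_simps)
      qed
      ultimately show ?thesis using k(1) by blast
    qed
    moreover have "norm (P (y + h) - P y - S h) \<le> (2 + K) * \<epsilon> * norm h" if h: "norm h < d" "y + h \<in> C" for h
    proof -
      have "norm (P (y + h) - P y - S h) \<le> \<epsilon> * norm h" using h d2 by (auto simp: d_def)
      also have "\<dots> \<le> (2 + K) * \<epsilon> * norm h" using K \<epsilon> by (intro mult_right_mono) auto
      finally show ?thesis .
    qed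
    ultimately show ?thesis using d by blast
  qed
  have both: "\<exists>d>0. (\<forall>h. norm h < d \<longrightarrow> c (y + h) \<ge> c y + P y \<bullet> h + S h \<bullet> h / 2 - e * (norm h)\<^sup>2) \<and>
     (\<forall>h. norm h < d \<longrightarrow> y + h \<in> C \<longrightarrow> c (y + h) \<le> c y + P y \<bullet> h + S h \<bullet> h / 2 + e * (norm h)\<^sup>2)" if e: "e > 0" for e
  proof -
    \<comment> \<open>\<open>N\<close> is fixed before \<open>\<epsilon>\<close>: it brings the
      discretisation error below \<open>e / 2\<close>, and \<open>\<epsilon>\<close> is then made
      small relative to \<open>1 / N\<close>. The number \<open>6 + 5 * K\<close> is
      \<open>3 * (2 + K) + 2 * K\<close>.\<close>
    obtain N0 :: nat where N0: "K / e \<le> real N0" using real_arch_simple by blast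
    define N where "N = Suc N0"
    have N: "N > 0" by (simp add: N_def)
    have KN: "K / (2 * real N) \<le> e / 2" using N0 e by (simp add: N_def field_simps)
    define \<epsilon> where "\<epsilon> = min 1 (e / (2 * N * (6 + 5 * K)))"
    have \<epsilon>: "0 < \<epsilon>" "\<epsilon> \<le> 1" using e N K by (auto simp: \<epsilon>_def)
    have "N * (3 * ((2 + K) * \<epsilon>) + 2 * \<epsilon> * K) = (N * (6 + 5 * K)) * \<epsilon>" by (simp add: algebra_simps)
    also have "\<dots> \<le> (N * (6 + 5 * K)) * (e / (2 * N * (6 + 5 * K)))" using N K by (intro mult_left_mono) (auto simp: \<epsilon>_def)
    also have "\<dots> = e / 2"
    proof -
      have "a * (e / (2 * a)) = e / 2" if "a > 0" for a using that by simp
      from this[of "N * (6 + 5 * K)"] show ?thesis using N K by (simp add: mult.assoc)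
    qed
    finally have err: "K / (2 * real N) + real N * (3 * ((2 + K) * \<epsilon>) + 2 * \<epsilon> * K) \<le> e" using KN by simp
    obtain d where d: "d > 0"
      "\<And>h. norm h < d \<Longrightarrow> \<exists>k. k 0 = 0 \<and> (\<forall>i<N. y + k i \<in> C \<and> norm (k i - (real i / N) *\<^sub>R h) \<le> \<epsilon> * norm h
       \<and> norm (P (y + k i) - P y - (real i / N) *\<^sub>R S h) \<le> (2 + K) * \<epsilon> * norm h)"
      "\<And>h. norm h < d \<Longrightarrow> y + h \<in> C \<Longrightarrow> norm (P (y + h) - P y - S h) \<le> (2 + K) * \<epsilon> * norm h"
      using nodes[OF N \<epsilon>] by blast
    have A: "c (y + h) \<ge> c y + P y \<bullet> h + S h \<bullet> h / 2 - e * (norm h)\<^sup>2 \<and>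
       (y + h \<in> C \<longrightarrow> c (y + h) \<le> c y + P y \<bullet> h + S h \<bullet> h / 2 + e * (norm h)\<^sup>2)" if h: "norm h < d" for h
    proof -
      obtain k where k: "k 0 = 0" "\<And>i. i < N \<Longrightarrow> y + k i \<in> C" "\<And>i. i < N \<Longrightarrow> norm (k i - (real i / N) *\<^sub>R h) \<le> \<epsilon> * norm h"
       "\<And>i. i < N \<Longrightarrow> norm (P (y + k i) - P y - (real i / N) *\<^sub>R S h) \<le> (2 + K) * \<epsilon> * norm h" using d(2)[OF h] by blast
      \<comment> \<open>The last node may be \<open>h\<close> itself, whether or not it leads to a
        contact point, since the sum uses slopes only at the nodes before it.\<close>
      define k' where "k' = k(N := h)"
      have k'0: "k' 0 = 0" "k' N = h" using k(1) N by (auto simp: k'_def)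
      have k'k: "k' i = k i" if "i < N" for i using that by (simp add: k'_def)
      have k'e: "norm (k' i - (real i / N) *\<^sub>R h) \<le> \<epsilon> * norm h" if "i \<le> N" for i
        using that k(3)[of i] N \<epsilon> by (cases "i = N") (auto simp: k'_def)
      have err2: "(K / (2 * real N) + real N * (3 * ((2 + K) * \<epsilon>) + 2 * \<epsilon> * K)) * (norm h)\<^sup>2 \<le> e * (norm h)\<^sup>2"
        using err by (rule mult_right_mono) simp
      have "c (y + k' N) \<ge> c (y + k' 0) + P y \<bullet> h + S h \<bullet> h / 2 - (K / (2 * real N) + real N * (3 * ((2 + K) * \<epsilon>) + 2 * \<epsilon> * K)) * (norm h)\<^sup>2"
      proof (rule riemann_lower_bound[where k = k' and p = "\<lambda>i. P (y + k' i)" and a = "\<lambda>i. c (y + k' i)" and s = "S h" and \<kappa> = "(2 + K) * \<epsilon>"])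
        show "norm (P (y + k' i) - P y - (real i / N) *\<^sub>R S h) \<le> (2 + K) * \<epsilon> * norm h" if "i < N" for i
          using k(4)[OF that] k'k[OF that] by simp
        show "c (y + k' i) + P (y + k' i) \<bullet> (k' (Suc i) - k' i) \<le> c (y + k' (Suc i))" if "i < N" for i
          using P(1)[OF k(2)[OF that]] k'k[OF that] unfolding Ct_def by (auto dest: spec[of _ "y + k' (Suc i)"])
      qed (use N k'0 k'e \<epsilon> K SK in auto)
      then have 1: "c (y + h) \<ge> c y + P y \<bullet> h + S h \<bullet> h / 2 - e * (norm h)\<^sup>2" using k'0 err2 by simp
      \<comment> \<open>If \<open>y + h\<close> is a contact point the path can be run backwards
        from \<open>h\<close> to \<open>0\<close>; a lower bound for \<open>c y\<close> is an upper
        bound for \<open>c (y + h)\<close>.\<close>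
      have 2: "c (y + h) \<le> c y + P y \<bullet> h + S h \<bullet> h / 2 + e * (norm h)\<^sup>2" if hC: "y + h \<in> C"
      proof -
        define k2 where "k2 i = k' (N - i) - h" for i
        have Cin: "y + k' i \<in> C" if "i \<le> N" for i using that hC k(2)[of i] by (cases "i = N") (auto simp: k'_def)
        have Pe: "norm (P (y + k' i) - P y - (real i / N) *\<^sub>R S h) \<le> (2 + K) * \<epsilon> * norm h" if "i \<le> N" for i
          using that k(4)[of i] d(3)[OF h hC] N by (cases "i = N") (auto simp: k'_def)
        have frac: "real (N - i) / N = 1 - real i / N" if "i \<le> N" for i using that N by (simp add: of_nat_diff field_simps)
        have "c (y + k' (N - N)) \<ge> c (y + k' (N - 0)) + (P y + S h) \<bullet> (- h) + (- S h) \<bullet> (- h) / 2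
            - (K / (2 * real N) + real N * (3 * ((2 + K) * \<epsilon>) + 2 * \<epsilon> * K)) * (norm h)\<^sup>2"
        proof (rule riemann_lower_bound[where k = k2 and p = "\<lambda>i. P (y + k' (N - i))" and a = "\<lambda>i. c (y + k' (N - i))" and s = "- S h" and \<kappa> = "(2 + K) * \<epsilon>"])
          show "norm (k2 i - (real i / N) *\<^sub>R (- h)) \<le> \<epsilon> * norm h" if "i \<le> N" for i
          proof -
            have "k2 i - (real i / N) *\<^sub>R (- h) = k' (N - i) - (real (N - i) / N) *\<^sub>R h"
              unfolding frac[OF that] by (simp add: k2_def algebra_simps)
            then show ?thesis using k'e[of "N - i"] by simp
          qed
          show "norm (P (y + k' (N - i)) - (P y + S h) - (real i / N) *\<^sub>R (- S h)) \<le> (2 + K) * \<epsilon> * norm h" if "i < N" for i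
          proof -
            have "P (y + k' (N - i)) - (P y + S h) - (real i / N) *\<^sub>R (- S h) = P (y + k' (N - i)) - P y - (real (N - i) / N) *\<^sub>R S h"
              using frac[of i] that by (simp only: less_imp_le) (simp add: algebra_simps scaleR_left_diff_distrib)
            then show ?thesis using Pe[of "N - i"] by (simp only:)
          qed
          show "c (y + k' (N - i)) + P (y + k' (N - i)) \<bullet> (k2 (Suc i) - k2 i) \<le> c (y + k' (N - Suc i))" if "i < N" for i
            using P(1)[OF Cin[of "N - i"]] unfolding Ct_def k2_def by (auto dest: spec[of _ "y + k' (N - Suc i)"])
        qed (use N k'0 \<epsilon> K SK in \<open>auto simp: k2_def\<close>)
        then show ?thesis using k'0 err2 by (simp add: inner_add_left)
      qed
      show ?thesis using 1 2 by blast
    qed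
    then show ?thesis using d(1) by blast
  qed
  show thesis
  proof (rule that[of y "P y" S])
    show "norm y < \<delta>"
    proof -
      have "norm y \<le> norm (P y) / m" by (rule Ct_small(1)[OF P(1)[OF y(1)]])
      also have "\<dots> \<le> \<delta>' / m" using P(2)[OF y(1)] m(1) by (intro divide_right_mono) auto
      finally show ?thesis using \<delta>' by simp
    qed
    show "norm (P y) < \<delta>" using P(2)[OF y(1)] \<delta>' by simp
    show "c y \<le> P y \<bullet> y" by (rule Ct_small(2)[OF P(1)[OF y(1)]])
    show "norm (S h) \<le> real DIM('a) * M * norm h" for h using SK by (simp add: K_def)
    show "\<exists>d>0. \<forall>h. norm h < d \<longrightarrow> c (y + h) \<ge> c y + P y \<bullet> h + S h \<bullet> h / 2 - e * (norm h)\<^sup>2" if "e > 0" for e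
      using both[OF that] by blast
    show "\<exists>d>0. \<forall>h. norm h < d \<longrightarrow> (\<exists>k. norm (k - h) \<le> e * norm h \<and>
        c (y + k) \<le> c y + P y \<bullet> k + S k \<bullet> k / 2 + e * (norm k)\<^sup>2)" if e: "e > 0" for e
    proof -
      obtain d1 where d1: "d1 > 0" "\<And>h. norm h < d1 \<Longrightarrow> y + h \<in> C \<Longrightarrow> c (y + h) \<le> c y + P y \<bullet> h + S h \<bullet> h / 2 + e * (norm h)\<^sup>2"
        using both[OF e] by blast
      define \<epsilon> where "\<epsilon> = min 1 e"
      have \<epsilon>: "\<epsilon> > 0" "\<epsilon> \<le> 1" "\<epsilon> \<le> e" using e by (auto simp: \<epsilon>_def)
      obtain d2 where d2: "d2 > 0" "\<And>h. norm h < d2 \<Longrightarrow> \<exists>k. y + k \<in> C \<and> norm (k - h) \<le> \<epsilon> * norm h" using dens[OF \<epsilon>(1)] by blast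
      have "\<exists>k. norm (k - h) \<le> e * norm h \<and> c (y + k) \<le> c y + P y \<bullet> k + S k \<bullet> k / 2 + e * (norm k)\<^sup>2" if h: "norm h < min d2 (d1 / 2)" for h
      proof -
        obtain k where k: "y + k \<in> C" "norm (k - h) \<le> \<epsilon> * norm h" using d2(2)[of h] h by auto
        have "\<epsilon> * norm h \<le> 1 * norm h" using \<epsilon> by (intro mult_right_mono) auto
        then have "norm k \<le> 2 * norm h" using k(2) norm_triangle_ineq[of "k - h" h] by simp
        then have "norm k < d1" using h by simp
        moreover have "\<epsilon> * norm h \<le> e * norm h" using \<epsilon> by (intro mult_right_mono) auto
        ultimately show ?thesis using d1(2)[of k] k by (intro exI[of _ k]) auto
      qed
      then show ?thesis using d1(1) d2(1) by (intro exI[of _ "min d2 (d1 / 2)"]) auto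
    qed
  qed (use linS Spos in auto)
qed

subsection \<open>Jets for sums of lower semicontinuous functions\<close>

text \<open>Otherwise every \<open>z\<close> has some \<open>g z\<close> with a smaller value, and
  \<open>f > f (g z)\<close> near \<open>z\<close>. In a finite subcover the least of the values
  \<open>f (g z)\<close> is undercut by another one.\<close>

lemma lsc_attains_inf:
  fixes f :: "'a::topological_space \<Rightarrow> 'b::linorder"
  assumes K: "compact K" "K \<noteq> {}" and f: "\<And>z c. z \<in> K \<Longrightarrow> c < f z \<Longrightarrow> \<forall>\<^sub>F w in at z within K. c < f w"
  shows "\<exists>z\<in>K. \<forall>w\<in>K. f z \<le> f w"
proof (rule ccontr)
  assume "\<not> ?thesis"
  then have "\<forall>z\<in>K. \<exists>w. w \<in> K \<and> f w < f z" by (auto simp: not_le)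
  from bchoice[OF this] obtain g where g: "\<And>z. z \<in> K \<Longrightarrow> g z \<in> K" "\<And>z. z \<in> K \<Longrightarrow> f (g z) < f z" by blast
  have "\<forall>z\<in>K. \<exists>V. open V \<and> z \<in> V \<and> (\<forall>w\<in>V \<inter> K. f (g z) < f w)"
  proof
    fix z assume z: "z \<in> K"
    then obtain V where "open V" "z \<in> V" "\<forall>w\<in>V. w \<noteq> z \<longrightarrow> w \<in> K \<longrightarrow> f (g z) < f w"
      using f[OF z g(2)[OF z]] unfolding eventually_at_topological by blast
    then show "\<exists>V. open V \<and> z \<in> V \<and> (\<forall>w\<in>V \<inter> K. f (g z) < f w)" using g(2)[OF z] by (intro exI[of _ V]) auto
  qed
  from bchoice[OF this] obtain V where V: "\<And>z. z \<in> K \<Longrightarrow> open (V z)" "\<And>z. z \<in> K \<Longrightarrow> z \<in> V z"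
    "\<And>z w. z \<in> K \<Longrightarrow> w \<in> V z \<Longrightarrow> w \<in> K \<Longrightarrow> f (g z) < f w" by blast
  have "K \<subseteq> (\<Union>z\<in>K. V z)" using V(2) by blast
  then obtain D where D: "D \<subseteq> K" "finite D" "K \<subseteq> (\<Union>z\<in>D. V z)" using compactE_image[OF K(1), of K V] V(1) by blast
  have Dne: "D \<noteq> {}" using D(3) K(2) by auto
  define z0 where "z0 = arg_min_on (\<lambda>z. f (g z)) D"
  have z0: "z0 \<in> D" "\<And>z. z \<in> D \<Longrightarrow> f (g z0) \<le> f (g z)"
    unfolding z0_def using arg_min_if_finite(1)[OF D(2) Dne] arg_min_least[OF D(2) Dne] by auto
  have "g z0 \<in> K" using g z0 D by blast
  then obtain z where "z \<in> D" "g z0 \<in> V z" using D(3) by blast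
  then have "f (g z) < f (g z0)" using V(3) D(1) \<open>g z0 \<in> K\<close> by blast
  then show False using z0(2)[OF \<open>z \<in> D\<close>] by simp
qed

lemma lsc_add_continuous:
  fixes U g :: "'a::topological_space \<Rightarrow> real"
  assumes U: "\<And>c. c < U z \<Longrightarrow> \<forall>\<^sub>F w in F. c < U w" and g: "(g \<longlongrightarrow> g z) F" and c: "c < U z + g z"
  shows "\<forall>\<^sub>F w in F. c < U w + g w"
proof -
  define e where "e = (U z + g z - c) / 2"
  have e: "e > 0" using c by (simp add: e_def)
  have "\<forall>\<^sub>F w in F. U z - e < U w" using U e by simp
  moreover have "\<forall>\<^sub>F w in F. g z - e < g w" using order_tendstoD(1)[OF g, of "g z - e"] e by simp
  ultimately show ?thesis by eventually_elim (simp add: e_def field_simps)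
qed

text \<open>\<open>Z\<close> selects minimisers for the inf-convolution, with parameter
  \<open>\<mu>\<close>, of \<open>U\<close> plus a small quadratic term; minimising over a closed
  ball keeps everything local.\<close>

lemma quadratic_penalty_attained:
  fixes U :: "'a::euclidean_space \<Rightarrow> real"
  assumes r: "r > 0" and lsc: "\<And>z c. z \<in> cball 0 r \<Longrightarrow> c < U z \<Longrightarrow> \<forall>\<^sub>F w in at z within cball 0 r. c < U w"
  obtains Z where "\<And>y. Z y \<in> cball 0 r" "\<And>y w. w \<in> cball 0 r \<Longrightarrow>
     U (Z y) + \<eta> * (norm (Z y))\<^sup>2 + \<mu> * (norm (y - Z y))\<^sup>2 \<le> U w + \<eta> * (norm w)\<^sup>2 + \<mu> * (norm (y - w))\<^sup>2"
proof -
  have "\<forall>y. \<exists>z\<in>cball 0 r. \<forall>w\<in>cball 0 r. U z + (\<eta> * (norm z)\<^sup>2 + \<mu> * (norm (y - z))\<^sup>2) \<le> U w + (\<eta> * (norm w)\<^sup>2 + \<mu> * (norm (y - w))\<^sup>2)"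
  proof
    fix y
    show "\<exists>z\<in>cball 0 r. \<forall>w\<in>cball 0 r. U z + (\<eta> * (norm z)\<^sup>2 + \<mu> * (norm (y - z))\<^sup>2) \<le> U w + (\<eta> * (norm w)\<^sup>2 + \<mu> * (norm (y - w))\<^sup>2)"
    proof (rule lsc_attains_inf)
      fix z c assume z: "z \<in> cball (0::'a) r" and c: "c < U z + (\<eta> * (norm z)\<^sup>2 + \<mu> * (norm (y - z))\<^sup>2)"
      show "\<forall>\<^sub>F w in at z within cball 0 r. c < U w + (\<eta> * (norm w)\<^sup>2 + \<mu> * (norm (y - w))\<^sup>2)"
        by (rule lsc_add_continuous[where z = z and g = "\<lambda>w. \<eta> * (norm w)\<^sup>2 + \<mu> * (norm (y - w))\<^sup>2", OF lsc[OF z] _ c])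
          (auto intro!: tendsto_intros)
    qed (use r in auto)
  qed
  then obtain Z where "\<And>y. Z y \<in> cball 0 r \<and> (\<forall>w\<in>cball 0 r. U (Z y) + (\<eta> * (norm (Z y))\<^sup>2 + \<mu> * (norm (y - Z y))\<^sup>2) \<le> U w + (\<eta> * (norm w)\<^sup>2 + \<mu> * (norm (y - w))\<^sup>2))"
    by metis
  then show thesis by (intro that[of Z]) (auto simp: add.assoc)
qed

lemma norm_Pair_sq: "(norm (v :: 'a::real_inner \<times> 'b::real_inner))\<^sup>2 = (norm (fst v))\<^sup>2 + (norm (snd v))\<^sup>2"
  by (simp add: norm_prod_def)

text \<open>Symmetrising leaves the quadratic form alone, so the blocks of the possibly nonsymmetric
  \<open>S\<close> can serve as Hessians of test functions. The shift by \<open>c\<close> will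
  absorb the Hessian of the penalty and the error terms.\<close>

lemma symmetric_part:
  fixes T :: "'a::euclidean_space \<Rightarrow> 'a" and c :: real
  assumes T: "linear T" and b: "\<And>h. norm (T h) \<le> K * norm h" and K: "K \<ge> 0"
  obtains X where "linear X" "\<And>h. norm (X h) \<le> (K + \<bar>c\<bar>) * norm h" "\<And>h k. X h \<bullet> k = h \<bullet> X k"
    "\<And>h. X h \<bullet> h = T h \<bullet> h - c * (norm h)\<^sup>2"
proof
  let ?X = "\<lambda>h. (1/2) *\<^sub>R (T h + adjoint T h) - c *\<^sub>R h"
  have lA: "linear (adjoint T)" by (rule adjoint_linear[OF T])
  have ad: "adjoint T x \<bullet> y = x \<bullet> T y" "y \<bullet> adjoint T x = T y \<bullet> x" for x y
    using adjoint_works[OF T] by (simp_all add: inner_commute)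
  show "linear ?X"
    by (intro linear_compose_sub linear_compose_scale_right linear_compose_add T lA linear_scale_self)
  show "?X h \<bullet> k = h \<bullet> ?X k" for h k by (simp add: inner_simps ad)
  show "?X h \<bullet> h = T h \<bullet> h - c * (norm h)\<^sup>2" for h by (simp add: inner_simps ad inner_commute power2_norm_eq_inner)
  have nA: "norm (adjoint T h) \<le> K * norm h" for h
  proof -
    have "(norm (adjoint T h))\<^sup>2 = h \<bullet> T (adjoint T h)" by (simp add: power2_norm_eq_inner ad(1) inner_commute)
    also have "\<dots> \<le> norm h * norm (T (adjoint T h))" by (rule norm_cauchy_schwarz)
    also have "\<dots> \<le> norm h * (K * norm (adjoint T h))" using b by (intro mult_left_mono) auto
    finally have "norm (adjoint T h) * norm (adjoint T h) \<le> norm (adjoint T h) * (K * norm h)"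
      by (simp add: power2_eq_square mult_ac)
    then show ?thesis using K by (cases "adjoint T h = 0") (auto)
  qed
  show "norm (?X h) \<le> (K + \<bar>c\<bar>) * norm h" for h
  proof -
    have "norm (?X h) \<le> norm ((1/2) *\<^sub>R (T h + adjoint T h)) + norm (c *\<^sub>R h)" by (rule norm_triangle_ineq4)
    also have "norm ((1/2) *\<^sub>R (T h + adjoint T h)) \<le> (1/2) * (norm (T h) + norm (adjoint T h))"
      by (simp add: norm_triangle_ineq)
    finally show ?thesis using b[of h] nA[of h] by (simp add: algebra_simps)
  qed
qed

text \<open>The theorem on sums for the penalty \<open>C / 2 * (norm (h - k))^2\<close>.
  Inf-convolution of both functions makes the penalised sum semiconcave on the product space, with a
  strict quadratic minimum at \<open>0\<close>; \<open>alexandrov_jensen\<close> gives jets of the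
  regularised functions, which are jets of \<open>U\<close> and \<open>W\<close> at the minimising
  points. The bound \<open>B\<close> is chosen before \<open>\<delta>\<close>, so the Hessians for
  shrinking \<open>\<delta>\<close> stay in a compact set.\<close>

lemma sum_of_lsc_jets:
  fixes U W :: "'a::euclidean_space \<Rightarrow> real" and r C \<eta> :: real
  assumes r: "r > 0" and C: "C \<ge> 0" and \<eta>: "\<eta> > 0"
    and lscU: "\<And>z c. z \<in> cball 0 r \<Longrightarrow> c < U z \<Longrightarrow> \<forall>\<^sub>F w in at z within cball 0 r. c < U w"
    and lscW: "\<And>z c. z \<in> cball 0 r \<Longrightarrow> c < W z \<Longrightarrow> \<forall>\<^sub>F w in at z within cball 0 r. c < W w"
    and U0: "U 0 = 0" and W0: "W 0 = 0"
    and UW: "\<And>h k. h \<in> cball 0 r \<Longrightarrow> k \<in> cball 0 r \<Longrightarrow> U h + W k \<ge> - (C / 2 * (norm (h - k))\<^sup>2)"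
  shows "\<exists>B. \<forall>\<delta>>0. \<exists>y1 y2 p1 p2 X Y. norm y1 < \<delta> \<and> norm y2 < \<delta> \<and> U y1 < \<delta> \<and> W y2 < \<delta> \<and> norm p1 < \<delta> \<and> norm p2 < \<delta> \<and>
     linear X \<and> linear Y \<and> (\<forall>h. norm (X h) \<le> B * norm h) \<and> (\<forall>h. norm (Y h) \<le> B * norm h) \<and>
     (\<forall>h k. X h \<bullet> k = h \<bullet> X k) \<and> (\<forall>h k. Y h \<bullet> k = h \<bullet> Y k) \<and>
     (\<forall>h. X h \<bullet> h + Y h \<bullet> h \<ge> - (\<eta> * (norm h)\<^sup>2)) \<and>
     (\<exists>d>0. \<forall>h. norm h < d \<longrightarrow> U (y1 + h) \<ge> U y1 + p1 \<bullet> h + X h \<bullet> h / 2) \<and>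
     (\<exists>d>0. \<forall>h. norm h < d \<longrightarrow> W (y2 + h) \<ge> W y2 + p2 \<bullet> h + Y h \<bullet> h / 2)"
proof -
  \<comment> \<open>Each of the two Hessians will lose \<open>4 * \<eta>0\<close>, together
    \<open>\<eta>\<close>.\<close>
  define \<eta>0 where "\<eta>0 = \<eta> / 8"
  have \<eta>0: "\<eta>0 > 0" using \<eta> by (simp add: \<eta>0_def)
  \<comment> \<open>Large enough to absorb, by Young's inequality, the cross term between the
    difference of the minimisers and the displacements \<open>y - Z y\<close>, with a margin of
    \<open>\<eta>0 / 2\<close>.\<close>
  define \<mu> where "\<mu> = \<eta>0 / 2 + 2 * C\<^sup>2 / \<eta>0"
  have \<mu>: "\<mu> > 0" using \<eta>0 by (auto simp: \<mu>_def intro!: add_pos_nonneg)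
  obtain ZU where ZU: "\<And>y. ZU y \<in> cball 0 r" "\<And>y w. w \<in> cball 0 r \<Longrightarrow>
     U (ZU y) + \<eta>0 * (norm (ZU y))\<^sup>2 + \<mu> * (norm (y - ZU y))\<^sup>2 \<le> U w + \<eta>0 * (norm w)\<^sup>2 + \<mu> * (norm (y - w))\<^sup>2"
    using quadratic_penalty_attained[OF r lscU] by blast
  obtain ZW where ZW: "\<And>y. ZW y \<in> cball 0 r" "\<And>y w. w \<in> cball 0 r \<Longrightarrow>
     W (ZW y) + \<eta>0 * (norm (ZW y))\<^sup>2 + \<mu> * (norm (y - ZW y))\<^sup>2 \<le> W w + \<eta>0 * (norm w)\<^sup>2 + \<mu> * (norm (y - w))\<^sup>2"
    using quadratic_penalty_attained[OF r lscW] by blast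
  define a where "a y = U (ZU y) + \<eta>0 * (norm (ZU y))\<^sup>2 + \<mu> * (norm (y - ZU y))\<^sup>2" for y
  define b where "b y = W (ZW y) + \<eta>0 * (norm (ZW y))\<^sup>2 + \<mu> * (norm (y - ZW y))\<^sup>2" for y
  define c where "c y = a (fst y) + b (snd y) + C / 2 * (norm (fst y - snd y))\<^sup>2" for y :: "'a \<times> 'a"
  \<comment> \<open>\<open>Q\<close> measures the distance of the minimisers from \<open>0\<close>,
    \<open>R\<close> their distance from the points they belong to; both are controlled by
    \<open>c\<close> through \<open>cQR\<close>.\<close>
  define Q where "Q y = (norm (ZU (fst y)))\<^sup>2 + (norm (ZW (snd y)))\<^sup>2" for y :: "'a \<times> 'a"
  define R where "R y = (norm (fst y - ZU (fst y)))\<^sup>2 + (norm (snd y - ZW (snd y)))\<^sup>2" for y :: "'a \<times> 'a"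
  have sq_sum: "(norm (u + v))\<^sup>2 \<le> 2 * ((norm u)\<^sup>2 + (norm v)\<^sup>2)" "(norm (u - v))\<^sup>2 \<le> 2 * ((norm u)\<^sup>2 + (norm v)\<^sup>2)" for u v :: 'a
  proof -
    have "(norm (u + v))\<^sup>2 + (norm (u - v))\<^sup>2 = 2 * ((norm u)\<^sup>2 + (norm v)\<^sup>2)"
      by (simp add: power2_norm_eq_inner inner_simps inner_commute)
    then show "(norm (u + v))\<^sup>2 \<le> 2 * ((norm u)\<^sup>2 + (norm v)\<^sup>2)" "(norm (u - v))\<^sup>2 \<le> 2 * ((norm u)\<^sup>2 + (norm v)\<^sup>2)"
      using zero_le_power2[of "norm (u + v)"] zero_le_power2[of "norm (u - v)"] by linarith+
  qed
  have cQR: "c y \<ge> \<eta>0 / 2 * (Q y + R y)" for y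
  proof -
    define z1 z2 where "z1 = ZU (fst y)" and "z2 = ZW (snd y)"
    define d1 d2 where "d1 = fst y - z1" and "d2 = snd y - z2"
    let ?A = "z1 - z2" and ?D = "d1 - d2"
    have e: "fst y - snd y = ?A + ?D" by (simp add: d1_def d2_def)
    have 1: "U z1 + W z2 \<ge> - (C / 2 * (norm ?A)\<^sup>2)" using UW ZU(1) ZW(1) by (simp add: z1_def z2_def)
    have "(norm (?A + ?D))\<^sup>2 = (norm ?A)\<^sup>2 + 2 * (?A \<bullet> ?D) + (norm ?D)\<^sup>2"
      by (simp add: power2_norm_eq_inner inner_simps inner_commute)
    then have "C / 2 * (norm (?A + ?D))\<^sup>2 = C / 2 * ((norm ?A)\<^sup>2 + 2 * (?A \<bullet> ?D) + (norm ?D)\<^sup>2)" by (simp only:)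
    then have 2: "C / 2 * (norm (?A + ?D))\<^sup>2 = C / 2 * (norm ?A)\<^sup>2 + C * (?A \<bullet> ?D) + C / 2 * (norm ?D)\<^sup>2"
      by (simp add: distrib_left)
    have 3: "C * (?A \<bullet> ?D) \<ge> - (\<eta>0 / 4 * (norm ?A)\<^sup>2 + C\<^sup>2 / \<eta>0 * (norm ?D)\<^sup>2)"
    proof -
      have "0 \<le> (norm ((\<eta>0 / 2) *\<^sub>R ?A + C *\<^sub>R ?D))\<^sup>2" by simp
      also have "\<dots> = (\<eta>0 / 2)\<^sup>2 * (norm ?A)\<^sup>2 + \<eta>0 * (C * (?A \<bullet> ?D)) + C\<^sup>2 * (norm ?D)\<^sup>2"
      proof -
        have "(norm (u *\<^sub>R x + v *\<^sub>R w))\<^sup>2 = u\<^sup>2 * (norm x)\<^sup>2 + 2 * u * (v * (x \<bullet> w)) + v\<^sup>2 * (norm w)\<^sup>2" for u v :: real and x w :: 'a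
          by (simp only: power2_norm_eq_inner inner_add_left inner_add_right inner_scaleR_left inner_scaleR_right inner_commute[of w x])
            (simp add: power2_eq_square distrib_left)
        then show ?thesis by simp
      qed
      also have "(\<eta>0 / 2)\<^sup>2 * (norm ?A)\<^sup>2 + \<eta>0 * (C * (?A \<bullet> ?D)) + C\<^sup>2 * (norm ?D)\<^sup>2
          = \<eta>0 * (\<eta>0 / 4 * (norm ?A)\<^sup>2 + C * (?A \<bullet> ?D) + C\<^sup>2 / \<eta>0 * (norm ?D)\<^sup>2)"
        using \<eta>0 by (simp add: distrib_left power2_eq_square)
      finally have "0 \<le> \<eta>0 / 4 * (norm ?A)\<^sup>2 + C * (?A \<bullet> ?D) + C\<^sup>2 / \<eta>0 * (norm ?D)\<^sup>2" using \<eta>0 by (simp only: zero_le_mult_iff) linarith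
      then show ?thesis by linarith
    qed
    have 4: "\<eta>0 / 4 * (norm ?A)\<^sup>2 \<le> \<eta>0 / 2 * Q y"
    proof -
      have "\<eta>0 / 4 * (norm ?A)\<^sup>2 \<le> \<eta>0 / 4 * (2 * Q y)" using sq_sum(2)[of z1 z2] \<eta>0 by (intro mult_left_mono) (auto simp: Q_def z1_def z2_def)
      then show ?thesis by simp
    qed
    have 5: "C\<^sup>2 / \<eta>0 * (norm ?D)\<^sup>2 \<le> 2 * C\<^sup>2 / \<eta>0 * R y"
    proof -
      have "C\<^sup>2 / \<eta>0 * (norm ?D)\<^sup>2 \<le> C\<^sup>2 / \<eta>0 * (2 * R y)" using sq_sum(2)[of d1 d2] \<eta>0
        by (intro mult_left_mono) (auto simp: R_def z1_def z2_def d1_def d2_def)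
      also have "\<dots> = 2 * C\<^sup>2 / \<eta>0 * R y" by simp
      finally show ?thesis .
    qed
    have 6: "C / 2 * (norm ?D)\<^sup>2 \<ge> 0" using C by simp
    have "c y = U z1 + W z2 + \<eta>0 * Q y + \<mu> * R y + C / 2 * (norm (?A + ?D))\<^sup>2"
      unfolding e[symmetric] by (simp add: c_def a_def b_def Q_def R_def z1_def z2_def algebra_simps)
    moreover have "\<mu> * R y = \<eta>0 / 2 * R y + 2 * C\<^sup>2 / \<eta>0 * R y" by (simp add: \<mu>_def distrib_right)
    ultimately show ?thesis using 1 2 3 4 5 6 by (simp only: distrib_left)
  qed
  have QR: "(norm y)\<^sup>2 \<le> 2 * (Q y + R y)" for y
    using sq_sum(1)[of "ZU (fst y)" "fst y - ZU (fst y)"] sq_sum(1)[of "ZW (snd y)" "snd y - ZW (snd y)"]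
    by (simp add: norm_Pair_sq Q_def R_def)
  have c0: "c 0 = 0"
  proof (rule antisym)
    have "a 0 \<le> 0" unfolding a_def using ZU(2)[of 0 0] r U0 by simp
    moreover have "b 0 \<le> 0" unfolding b_def using ZW(2)[of 0 0] r W0 by simp
    ultimately show "c 0 \<le> 0" by (simp add: c_def)
    have "0 \<le> Q 0 + R 0" by (simp add: Q_def R_def)
    then show "0 \<le> c 0" using cQR[of 0] \<eta>0 by (meson order_trans zero_le_mult_iff less_imp_le half_gt_zero)
  qed
  have m: "c y \<ge> \<eta>0 / 4 * (norm y)\<^sup>2" for y
  proof -
    have "\<eta>0 / 4 * (norm y)\<^sup>2 \<le> \<eta>0 / 4 * (2 * (Q y + R y))" using QR[of y] \<eta>0 by (intro mult_left_mono) auto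
    also have "\<dots> = \<eta>0 / 2 * (Q y + R y)" by simp
    finally show ?thesis using cQR[of y] by linarith
  qed
  have sqe: "(norm (u + v))\<^sup>2 = (norm u)\<^sup>2 + 2 * (u \<bullet> v) + (norm v)\<^sup>2" for u v :: 'a
    by (simp add: power2_norm_eq_inner inner_simps inner_commute)
  \<comment> \<open>The minimiser for \<open>x\<close> is a competitor for \<open>x + h\<close>,
    which makes an inf-convolution semiconcave with constant \<open>2 * \<mu>\<close>.\<close>
  have asc: "a (x + h) \<le> a x + (2 * \<mu>) *\<^sub>R (x - ZU x) \<bullet> h + \<mu> * (norm h)\<^sup>2" for x h
  proof -
    have "a (x + h) \<le> U (ZU x) + \<eta>0 * (norm (ZU x))\<^sup>2 + \<mu> * (norm (x - ZU x + h))\<^sup>2"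
      using ZU(2)[OF ZU(1)[of x], of "x + h"] by (simp add: a_def algebra_simps)
    then show ?thesis unfolding sqe by (simp add: a_def algebra_simps)
  qed
  have bsc: "b (x + h) \<le> b x + (2 * \<mu>) *\<^sub>R (x - ZW x) \<bullet> h + \<mu> * (norm h)\<^sup>2" for x h
  proof -
    have "b (x + h) \<le> W (ZW x) + \<eta>0 * (norm (ZW x))\<^sup>2 + \<mu> * (norm (x - ZW x + h))\<^sup>2"
      using ZW(2)[OF ZW(1)[of x], of "x + h"] by (simp add: b_def algebra_simps)
    then show ?thesis unfolding sqe by (simp add: b_def algebra_simps)
  qed
  define M where "M = 2 * (\<mu> + C)"
  have M: "M > 0" using \<mu> C by (simp add: M_def)
  have sc: "\<exists>g. \<forall>h. c (y + h) \<le> c y + g \<bullet> h + M / 2 * (norm h)\<^sup>2" for y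
  proof (intro exI allI)
    fix h :: "'a \<times> 'a"
    let ?d = "fst y - snd y" and ?e = "fst h - snd h"
    have "C / 2 * (norm (?d + ?e))\<^sup>2 \<le> C / 2 * (norm ?d)\<^sup>2 + C * (?d \<bullet> ?e) + C * (norm h)\<^sup>2"
    proof -
      have "C / 2 * (norm ?e)\<^sup>2 \<le> C * (norm h)\<^sup>2"
      proof -
        have "C / 2 * (norm ?e)\<^sup>2 \<le> C / 2 * (2 * (norm h)\<^sup>2)" using sq_sum(2)[of "fst h" "snd h"] C
          by (intro mult_left_mono) (auto simp: norm_Pair_sq)
        then show ?thesis by simp
      qed
      then show ?thesis unfolding sqe by (simp add: distrib_left)
    qed
    moreover have "C / 2 * (norm (fst (y + h) - snd (y + h)))\<^sup>2 = C / 2 * (norm (?d + ?e))\<^sup>2" by (simp add: algebra_simps)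
    moreover have "M / 2 * (norm h)\<^sup>2 = \<mu> * (norm (fst h))\<^sup>2 + \<mu> * (norm (snd h))\<^sup>2 + C * (norm h)\<^sup>2"
      by (simp add: M_def norm_Pair_sq algebra_simps)
    moreover have "c (y + h) = a (fst y + fst h) + b (snd y + snd h) + C / 2 * (norm (fst (y + h) - snd (y + h)))\<^sup>2"
      "c y = a (fst y) + b (snd y) + C / 2 * (norm ?d)\<^sup>2" by (simp_all add: c_def)
    moreover have "((2 * \<mu>) *\<^sub>R (fst y - ZU (fst y)) + C *\<^sub>R ?d, (2 * \<mu>) *\<^sub>R (snd y - ZW (snd y)) - C *\<^sub>R ?d) \<bullet> h
       = (2 * \<mu>) *\<^sub>R (fst y - ZU (fst y)) \<bullet> fst h + (2 * \<mu>) *\<^sub>R (snd y - ZW (snd y)) \<bullet> snd h + C * (?d \<bullet> ?e)"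
      unfolding inner_prod_def fst_conv snd_conv inner_add_left inner_diff_left[of _ "C *\<^sub>R ?d"] inner_diff_right[of ?d] inner_scaleR_left
      by (simp add: right_diff_distrib)
    ultimately show "c (y + h) \<le> c y + ((2 * \<mu>) *\<^sub>R (fst y - ZU (fst y)) + C *\<^sub>R ?d, (2 * \<mu>) *\<^sub>R (snd y - ZW (snd y)) - C *\<^sub>R ?d) \<bullet> h + M / 2 * (norm h)\<^sup>2"
      using asc[of "fst y" "fst h"] bsc[of "snd y" "snd h"] by linarith
  qed
  define K where "K = DIM('a \<times> 'a) * M"
  have K: "K \<ge> 0" using M by (simp add: K_def)
  define B where "B = K + \<bar>C + 4 * \<eta>0\<bar>"
  show ?thesis
  proof (intro exI[of _ B] allI impI)
    fix \<delta> :: real assume \<delta>: "\<delta> > 0"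
    define \<delta>' where "\<delta>' = min (min \<delta> r / 2) (\<delta> / (2 * C + 2 * \<eta>0 + 2))"
    have \<delta>': "\<delta>' > 0" "\<delta>' < \<delta>" "\<delta>' < r" "(2 * C + 2 * \<eta>0 + 1) * \<delta>' < \<delta>"
    proof -
      have "2 * C + 2 * \<eta>0 + 2 > 0" using C \<eta>0 by linarith
      then show "\<delta>' > 0" using \<delta> r by (simp add: \<delta>'_def)
      have "\<delta>' \<le> min \<delta> r / 2" unfolding \<delta>'_def by (rule min.cobounded1)
      moreover have "min \<delta> r / 2 < \<delta>" "min \<delta> r / 2 < r" using \<delta> r by linarith+
      ultimately show "\<delta>' < \<delta>" "\<delta>' < r" by linarith+
      have "\<delta>' \<le> \<delta> / (2 * C + 2 * \<eta>0 + 2)" by (simp add: \<delta>'_def)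
      then have "(2 * C + 2 * \<eta>0 + 2) * \<delta>' \<le> \<delta>" using C \<eta>0 by (simp add: pos_le_divide_eq mult.commute)
      then show "(2 * C + 2 * \<eta>0 + 1) * \<delta>' < \<delta>" using \<open>\<delta>' > 0\<close> by (simp add: algebra_simps)
    qed
    \<comment> \<open>The bounds serve, in turn, the smallness of point and slope, of the minimisers
      (through \<open>cQR\<close>), and of the values \<open>U z1\<close> and
      \<open>W z2\<close>.\<close>
    define \<delta>1 where "\<delta>1 = min \<delta>' (min (\<delta>' * sqrt (\<eta>0 / 2) / 2) (min 1 (\<delta> / (2 * (C / \<eta>0 + 2)))))"
    have \<delta>1: "\<delta>1 > 0" "\<delta>1 \<le> \<delta>'" "\<delta>1 \<le> \<delta>' * sqrt (\<eta>0 / 2) / 2" "\<delta>1 \<le> 1" "(C / \<eta>0 + 1) * \<delta>1 < \<delta>"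
    proof -
      have "C / \<eta>0 + 2 > 0" using C \<eta>0 by (auto intro!: add_nonneg_pos)
      then show "\<delta>1 > 0" using \<delta>' \<eta>0 \<delta> by (simp add: \<delta>1_def)
      show "\<delta>1 \<le> \<delta>'" unfolding \<delta>1_def by (rule min.cobounded1)
      show "\<delta>1 \<le> \<delta>' * sqrt (\<eta>0 / 2) / 2" unfolding \<delta>1_def by (rule min.coboundedI2, rule min.cobounded1)
      show "\<delta>1 \<le> 1" unfolding \<delta>1_def by (rule min.coboundedI2, rule min.coboundedI2, rule min.cobounded1)
      have "\<delta>1 \<le> \<delta> / (2 * (C / \<eta>0 + 2))" by (simp add: \<delta>1_def)
      moreover have p: "C / \<eta>0 + 2 > 0" using C \<eta>0 by (auto intro!: add_nonneg_pos)
      ultimately have "\<delta>1 * (2 * (C / \<eta>0 + 2)) \<le> \<delta>" by (simp add: pos_le_divide_eq)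
      moreover have "(C / \<eta>0 + 1) * \<delta>1 < \<delta>1 * (2 * (C / \<eta>0 + 2))"
      proof -
        have "\<delta>1 * (C / \<eta>0 + 1) < \<delta>1 * (2 * (C / \<eta>0 + 2))"
        proof (rule mult_strict_left_mono[OF _ \<open>\<delta>1 > 0\<close>])
          have "C / \<eta>0 \<ge> 0" using C \<eta>0 by simp
          moreover have "x + 1 < 2 * (x + 2)" if "x \<ge> 0" for x :: real using that by (simp add: distrib_left)
          ultimately show "C / \<eta>0 + 1 < 2 * (C / \<eta>0 + 2)" by blast
        qed
        then show ?thesis by (simp add: mult.commute)
      qed
      ultimately show "(C / \<eta>0 + 1) * \<delta>1 < \<delta>" by linarith
    qed
    have \<eta>4: "\<eta>0 / 4 > 0" using \<eta>0 by simp
    obtain y p S where y: "norm y < \<delta>1" "norm p < \<delta>1" and linS: "linear S" and SK0: "\<And>h. norm (S h) \<le> real DIM('a \<times> 'a) * M * norm h"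
      and Spos: "\<And>h. S h \<bullet> h \<ge> 0" and cp: "c y \<le> p \<bullet> y"
      and low: "\<And>e. e > 0 \<Longrightarrow> \<exists>d>0. \<forall>h. norm h < d \<longrightarrow> c (y + h) \<ge> c y + p \<bullet> h + S h \<bullet> h / 2 - e * (norm h)\<^sup>2"
      and upp: "\<And>e. e > 0 \<Longrightarrow> \<exists>d>0. \<forall>h. norm h < d \<longrightarrow> (\<exists>k. norm (k - h) \<le> e * norm h \<and>
        c (y + k) \<le> c y + p \<bullet> k + S k \<bullet> k / 2 + e * (norm k)\<^sup>2)"
      by (rule alexandrov_jensen[OF c0 \<eta>4 m M sc \<delta>1(1)]) (rule that)
    have SK: "norm (S h) \<le> K * norm h" for h using SK0 by (simp add: K_def)
    define y1 y2 p1 p2 where "y1 = fst y" and "y2 = snd y" and "p1 = fst p" and "p2 = snd p"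
    define z1 z2 where "z1 = ZU y1" and "z2 = ZW y2"
    have py: "c y \<le> \<delta>1\<^sup>2"
    proof -
      have "c y \<le> norm p * norm y" using cp norm_cauchy_schwarz[of p y] by linarith
      also have "\<dots> \<le> \<delta>1 * \<delta>1" using y \<delta>1(1) by (intro mult_mono) auto
      finally show ?thesis by (simp add: power2_eq_square)
    qed
    have QRs: "\<eta>0 / 2 * (Q y + R y) \<le> \<delta>1\<^sup>2" using cQR[of y] py by simp
    have small: "norm z1 < \<delta>'" "norm z2 < \<delta>'"
    proof -
      have *: "norm z < \<delta>'" if "(norm z)\<^sup>2 \<le> Q y + R y" for z :: 'a
      proof -
        have "\<eta>0 / 2 * (norm z)\<^sup>2 \<le> \<eta>0 / 2 * (Q y + R y)" using that \<eta>0 by (intro mult_left_mono) auto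
        also have "\<dots> \<le> \<delta>1\<^sup>2" by (rule QRs)
        also have "\<delta>1\<^sup>2 \<le> (\<delta>' * sqrt (\<eta>0 / 2) / 2)\<^sup>2" using \<delta>1 by (intro power_mono) auto
        also have "\<dots> = \<eta>0 / 2 * (\<delta>' / 2)\<^sup>2" using \<eta>0 by (simp add: power_mult_distrib power_divide)
        finally have "(norm z)\<^sup>2 \<le> (\<delta>' / 2)\<^sup>2" using \<eta>0 by (subst (asm) mult_le_cancel_left_pos) auto
        then have "norm z \<le> \<delta>' / 2" using \<delta>' by (intro power2_le_imp_le[of "norm z"]) auto
        then show ?thesis using \<delta>' by simp
      qed
      show "norm z1 < \<delta>'" "norm z2 < \<delta>'" by (rule *; simp add: Q_def R_def z1_def z2_def y1_def y2_def)+
    qed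
    have cU: "U z1 < \<delta>" "W z2 < \<delta>"
    proof -
      have z: "norm z1 \<le> r" "norm z2 \<le> r" using small \<delta>' by auto
      have U2: "W z2 \<ge> - (C / 2 * (norm z2)\<^sup>2)" using UW[of 0 z2] U0 r z by simp
      have W2: "U z1 \<ge> - (C / 2 * (norm z1)\<^sup>2)" using UW[of z1 0] W0 r z by simp
      have Qs: "C / 2 * Q y \<le> C / \<eta>0 * \<delta>1"
      proof -
        have "R y \<ge> 0" by (simp add: R_def)
        then have "\<eta>0 / 2 * Q y \<le> \<eta>0 / 2 * (Q y + R y)" using \<eta>0 by (intro mult_left_mono) auto
        then have "\<eta>0 / 2 * Q y \<le> \<delta>1\<^sup>2" using QRs by simp
        also have "\<dots> \<le> \<delta>1" using \<delta>1 by (simp add: power2_eq_square mult_left_le)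
        finally have "C / \<eta>0 * (\<eta>0 / 2 * Q y) \<le> C / \<eta>0 * \<delta>1" using C \<eta>0 by (intro mult_left_mono) auto
        then show ?thesis using \<eta>0 by simp
      qed
      have z12: "C / 2 * (norm z1)\<^sup>2 \<le> C / 2 * Q y" "C / 2 * (norm z2)\<^sup>2 \<le> C / 2 * Q y"
        using C by (intro mult_left_mono; simp add: Q_def z1_def z2_def y1_def y2_def)+
      have "U z1 + W z2 \<le> c y"
        using C \<eta>0 \<mu> by (simp add: c_def a_def b_def z1_def z2_def y1_def y2_def)
      also have "\<dots> \<le> \<delta>1"
      proof -
        have "\<delta>1 * \<delta>1 \<le> \<delta>1" using \<delta>1 by (intro mult_left_le) auto
        then show ?thesis using py by (simp add: power2_eq_square)
      qed
      finally have "U z1 + W z2 \<le> \<delta>1" .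
      moreover have "C / \<eta>0 * \<delta>1 + \<delta>1 < \<delta>" using \<delta>1(5) by (simp add: distrib_right)
      ultimately show "U z1 < \<delta>" "W z2 < \<delta>" using U2 W2 Qs z12 by linarith+
    qed
    define q1 q2 where "q1 = p1 - C *\<^sub>R (y1 - y2)" and "q2 = p2 + C *\<^sub>R (y1 - y2)"
    define T1 T2 where "T1 h = fst (S (h, 0))" and "T2 h = snd (S (0, h))" for h
    have lin1: "linear (\<lambda>h::'a. (h, 0::'a))" "linear (\<lambda>h::'a. (0::'a, h))" by (auto intro!: linearI)
    have linT: "linear T1" "linear T2"
    proof -
      have "T1 = fst \<circ> (S \<circ> (\<lambda>h. (h, 0)))" "T2 = snd \<circ> (S \<circ> (\<lambda>h. (0, h)))" by (auto simp: T1_def T2_def fun_eq_iff)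
      then show "linear T1" "linear T2"
        using linear_compose[OF linear_compose[OF lin1(1) linS] linear_fst] linear_compose[OF linear_compose[OF lin1(2) linS] linear_snd]
        by simp_all
    qed
    have Tn: "norm (T1 h) \<le> K * norm h" "norm (T2 h) \<le> K * norm h" for h
    proof -
      have "norm (T1 h) \<le> norm (S (h, 0))" unfolding T1_def by (metis norm_fst_le prod.collapse)
      then show "norm (T1 h) \<le> K * norm h" using SK[of "(h, 0)"] by simp
      have "norm (T2 h) \<le> norm (S (0, h))" unfolding T2_def by (metis norm_snd_le prod.collapse)
      then show "norm (T2 h) \<le> K * norm h" using SK[of "(0, h)"] by simp
    qed
    have TS: "T1 h \<bullet> h = S (h, 0) \<bullet> (h, 0)" "T2 h \<bullet> h = S (0, h) \<bullet> (0, h)" for h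
      by (simp_all add: T1_def T2_def inner_prod_def)
    \<comment> \<open>Freezing the second variable in the expansion of \<open>c\<close> and
      subtracting the penalty, which is exactly quadratic, leaves an expansion of \<open>a\<close>
      alone.\<close>
    have alow: "\<exists>d>0. \<forall>h. norm h < d \<longrightarrow> a (y1 + h) \<ge> a y1 + q1 \<bullet> h + (T1 h \<bullet> h - C * (norm h)\<^sup>2) / 2 - e * (norm h)\<^sup>2" if e: "e > 0" for e
    proof -
      obtain d where d: "d > 0" "\<And>h. norm h < d \<Longrightarrow> c (y + h) \<ge> c y + p \<bullet> h + S h \<bullet> h / 2 - e * (norm h)\<^sup>2" using low[OF e] by blast
      have "a (y1 + h) \<ge> a y1 + q1 \<bullet> h + (T1 h \<bullet> h - C * (norm h)\<^sup>2) / 2 - e * (norm h)\<^sup>2" if h: "norm h < d" for h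
      proof -
        have "c (y + (h, 0)) \<ge> c y + p \<bullet> (h, 0) + S (h, 0) \<bullet> (h, 0) / 2 - e * (norm (h, 0::'a))\<^sup>2" using d(2)[of "(h, 0)"] h by simp
        moreover have "c (y + (h, 0)) = a (y1 + h) + b y2 + C / 2 * (norm ((y1 - y2) + h))\<^sup>2" by (simp add: c_def y1_def y2_def algebra_simps)
        moreover have "c y = a y1 + b y2 + C / 2 * (norm (y1 - y2))\<^sup>2" by (simp add: c_def y1_def y2_def)
        moreover have "p \<bullet> (h, 0) = p1 \<bullet> h" by (simp add: inner_prod_def p1_def)
        moreover have "C / 2 * (norm ((y1 - y2) + h))\<^sup>2 = C / 2 * (norm (y1 - y2))\<^sup>2 + C * ((y1 - y2) \<bullet> h) + C / 2 * (norm h)\<^sup>2"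
          unfolding sqe by (simp add: distrib_left)
        moreover have "q1 \<bullet> h = p1 \<bullet> h - C * ((y1 - y2) \<bullet> h)" by (simp add: q1_def inner_diff_left)
        moreover have "(T1 h \<bullet> h - C * (norm h)\<^sup>2) / 2 = S (h, 0) \<bullet> (h, 0) / 2 - C / 2 * (norm h)\<^sup>2" unfolding TS by (simp add: diff_divide_distrib)
        moreover have "norm (h, 0::'a) = norm h" by simp
        ultimately show ?thesis by (simp only:)
      qed
      then show ?thesis using d(1) by blast
    qed
    have blow: "\<exists>d>0. \<forall>h. norm h < d \<longrightarrow> b (y2 + h) \<ge> b y2 + q2 \<bullet> h + (T2 h \<bullet> h - C * (norm h)\<^sup>2) / 2 - e * (norm h)\<^sup>2" if e: "e > 0" for e
    proof -
      obtain d where d: "d > 0" "\<And>h. norm h < d \<Longrightarrow> c (y + h) \<ge> c y + p \<bullet> h + S h \<bullet> h / 2 - e * (norm h)\<^sup>2" using low[OF e] by blast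
      have "b (y2 + h) \<ge> b y2 + q2 \<bullet> h + (T2 h \<bullet> h - C * (norm h)\<^sup>2) / 2 - e * (norm h)\<^sup>2" if h: "norm h < d" for h
      proof -
        have "c (y + (0, h)) \<ge> c y + p \<bullet> (0, h) + S (0, h) \<bullet> (0, h) / 2 - e * (norm (0::'a, h))\<^sup>2" using d(2)[of "(0, h)"] h by simp
        moreover have "c (y + (0, h)) = a y1 + b (y2 + h) + C / 2 * (norm ((y2 - y1) + h))\<^sup>2"
          by (simp add: c_def y1_def y2_def norm_minus_commute[of "fst y"] algebra_simps)
        moreover have "c y = a y1 + b y2 + C / 2 * (norm (y2 - y1))\<^sup>2" by (simp add: c_def y1_def y2_def norm_minus_commute)
        moreover have "p \<bullet> (0, h) = p2 \<bullet> h" by (simp add: inner_prod_def p2_def)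
        moreover have "C / 2 * (norm ((y2 - y1) + h))\<^sup>2 = C / 2 * (norm (y2 - y1))\<^sup>2 + C * ((y2 - y1) \<bullet> h) + C / 2 * (norm h)\<^sup>2"
          unfolding sqe by (simp add: distrib_left)
        moreover have "q2 \<bullet> h = p2 \<bullet> h - C * ((y2 - y1) \<bullet> h)" by (simp add: q2_def inner_simps algebra_simps)
        moreover have "(T2 h \<bullet> h - C * (norm h)\<^sup>2) / 2 = S (0, h) \<bullet> (0, h) / 2 - C / 2 * (norm h)\<^sup>2" unfolding TS by (simp add: diff_divide_distrib)
        moreover have "norm (0::'a, h) = norm h" by simp
        ultimately show ?thesis by (simp only:)
      qed
      then show ?thesis using d(1) by blast
    qed
    define Z where "Z v = S v \<bullet> v - C * (norm (fst v - snd v))\<^sup>2" for v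
    \<comment> \<open>For a genuine Hessian, removing the penalty would leave a block diagonal
      matrix. Here an inequality survives: the upper expansion of \<open>c\<close> along a direction
      close to \<open>v\<close> is played against the lower expansions of \<open>a\<close> and
      \<open>b\<close>. The direction error disappears as \<open>e\<close> tends to
      \<open>0\<close>, by continuity of \<open>D\<close>.\<close>
    have Zsplit: "Z v \<ge> Z (fst v, 0) + Z (0, snd v)" for v
    proof -
      define D where "D v = Z v - Z (fst v, 0) - Z (0, snd v)" for v
      have contS: "continuous_on UNIV S" by (simp add: linS linear_continuous_on linear_conv_bounded_linear[symmetric])
      have contZ: "continuous_on UNIV Z" unfolding Z_def by (intro continuous_intros contS)
      have contD: "isCont D v" for v
      proof -
        have "continuous_on UNIV D" unfolding D_def
          by (intro continuous_intros continuous_on_compose2[OF contZ] contZ) auto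
        then show ?thesis using continuous_on_eq_continuous_at[OF open_UNIV] by blast
      qed
      have Dn: "\<exists>k. norm (k - v) \<le> e * norm v \<and> D k \<ge> - (4 * e * (norm k)\<^sup>2)" if e: "e > 0" for e
      proof (cases "v = 0")
        case True
        then show ?thesis using linear_0[OF linS] by (intro exI[of _ 0]) (simp add: D_def Z_def zero_prod_def)
      next
        case False
        obtain d1 where d1: "d1 > 0" "\<And>h. norm h < d1 \<Longrightarrow> a (y1 + h) \<ge> a y1 + q1 \<bullet> h + (T1 h \<bullet> h - C * (norm h)\<^sup>2) / 2 - e * (norm h)\<^sup>2" using alow[OF e] by blast
        obtain d2 where d2: "d2 > 0" "\<And>h. norm h < d2 \<Longrightarrow> b (y2 + h) \<ge> b y2 + q2 \<bullet> h + (T2 h \<bullet> h - C * (norm h)\<^sup>2) / 2 - e * (norm h)\<^sup>2" using blow[OF e] by blast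
        obtain d3 where d3: "d3 > 0" "\<And>h. norm h < d3 \<Longrightarrow> (\<exists>k. norm (k - h) \<le> e * norm h \<and>
          c (y + k) \<le> c y + p \<bullet> k + S k \<bullet> k / 2 + e * (norm k)\<^sup>2)" using upp[OF e] by blast
        define t where "t = min d3 (min d1 d2 / (1 + e)) / (2 * norm v)"
        have t: "t > 0" using d1(1) d2(1) d3(1) e False by (simp add: t_def)
        have nt: "norm (t *\<^sub>R v) = min d3 (min d1 d2 / (1 + e)) / 2" using t d1(1) d2(1) d3(1) e False by (simp add: t_def)
        have tv: "norm (t *\<^sub>R v) < d3" "norm (t *\<^sub>R v) * (1 + e) < min d1 d2"
        proof -
          show "norm (t *\<^sub>R v) < d3" unfolding nt using d3(1) by (simp add: min_def)
          have "norm (t *\<^sub>R v) \<le> min d1 d2 / (1 + e) / 2" unfolding nt by (intro divide_right_mono) auto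
          then have "norm (t *\<^sub>R v) * (1 + e) \<le> min d1 d2 / (1 + e) / 2 * (1 + e)" using e by (intro mult_right_mono) auto
          also have "\<dots> = min d1 d2 / 2"
          proof -
            have "x / w / 2 * w = x / 2" if "w > 0" for x w :: real using that by simp
            from this[of "1 + e" "min d1 d2"] show ?thesis using e by linarith
          qed
          also have "\<dots> < min d1 d2" using d1(1) d2(1) by linarith
          finally show "norm (t *\<^sub>R v) * (1 + e) < min d1 d2" .
        qed
        obtain k where k: "norm (k - t *\<^sub>R v) \<le> e * norm (t *\<^sub>R v)" "c (y + k) \<le> c y + p \<bullet> k + S k \<bullet> k / 2 + e * (norm k)\<^sup>2"
          using d3(2)[OF tv(1)] by blast
        have "norm k \<le> norm (k - t *\<^sub>R v) + norm (t *\<^sub>R v)" using norm_triangle_ineq[of "k - t *\<^sub>R v" "t *\<^sub>R v"] by simp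
        then have kn: "norm k < min d1 d2" using k(1) tv(2) by (simp add: algebra_simps)
        have k12: "norm (fst k) < d1" "norm (snd k) < d2"
          using kn norm_fst_le[of "fst k" "snd k"] norm_snd_le[of "snd k" "fst k"] by auto
        have i1: "c (y + k) = a (y1 + fst k) + b (y2 + snd k) + C / 2 * (norm ((y1 - y2) + (fst k - snd k)))\<^sup>2"
          by (simp add: c_def y1_def y2_def algebra_simps)
        have i2: "c y = a y1 + b y2 + C / 2 * (norm (y1 - y2))\<^sup>2" by (simp add: c_def y1_def y2_def)
        have i3: "C / 2 * (norm ((y1 - y2) + (fst k - snd k)))\<^sup>2 = C / 2 * (norm (y1 - y2))\<^sup>2 + C * ((y1 - y2) \<bullet> fst k) - C * ((y1 - y2) \<bullet> snd k) + C / 2 * (norm (fst k - snd k))\<^sup>2"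
          unfolding sqe by (simp add: distrib_left inner_diff_right right_diff_distrib)
        have i4: "p \<bullet> k = p1 \<bullet> fst k + p2 \<bullet> snd k" by (simp add: inner_prod_def p1_def p2_def)
        have i5: "q1 \<bullet> fst k = p1 \<bullet> fst k - C * ((y1 - y2) \<bullet> fst k)" "q2 \<bullet> snd k = p2 \<bullet> snd k + C * ((y1 - y2) \<bullet> snd k)"
          by (simp_all add: q1_def q2_def inner_diff_left inner_add_left)
        have i6: "(T1 (fst k) \<bullet> fst k - C * (norm (fst k))\<^sup>2) / 2 = Z (fst k, 0) / 2" "(T2 (snd k) \<bullet> snd k - C * (norm (snd k))\<^sup>2) / 2 = Z (0, snd k) / 2"
          unfolding TS Z_def by simp_all
        have i7: "S k \<bullet> k / 2 = Z k / 2 + C / 2 * (norm (fst k - snd k))\<^sup>2" by (simp add: Z_def field_simps)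
        have i8: "e * (norm k)\<^sup>2 = e * (norm (fst k))\<^sup>2 + e * (norm (snd k))\<^sup>2" by (simp add: norm_Pair_sq distrib_left)
        have Dk: "D k \<ge> - (4 * e * (norm k)\<^sup>2)"
        proof -
          have "D k = Z k - Z (fst k, 0) - Z (0, snd k)" by (simp add: D_def)
          then show ?thesis using k(2) d1(2)[OF k12(1)] d2(2)[OF k12(2)] i1 i2 i3 i4 i5 i6 i7 i8 by linarith
        qed
        define k' where "k' = (1/t) *\<^sub>R k"
        have kk: "k = t *\<^sub>R k'" using t by (simp add: k'_def)
        have "norm (k' - v) \<le> e * norm v"
        proof -
          have "t * norm (k' - v) = norm (k - t *\<^sub>R v)" using t by (simp add: kk scaleR_diff_right[symmetric])
          also have "\<dots> \<le> t * (e * norm v)" using k(1) t by (simp add: mult_ac)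
          finally show ?thesis using t by simp
        qed
        moreover have "D k' \<ge> - (4 * e * (norm k')\<^sup>2)"
        proof -
          have Zs: "Z (t *\<^sub>R v) = t\<^sup>2 * Z v" for v
          proof -
            have "fst (t *\<^sub>R v) - snd (t *\<^sub>R v) = t *\<^sub>R (fst v - snd v)" by (simp add: scaleR_diff_right)
            then have "(norm (fst (t *\<^sub>R v) - snd (t *\<^sub>R v)))\<^sup>2 = t\<^sup>2 * (norm (fst v - snd v))\<^sup>2" by (simp add: power_mult_distrib)
            moreover have "S (t *\<^sub>R v) \<bullet> (t *\<^sub>R v) = t\<^sup>2 * (S v \<bullet> v)" by (simp add: linear_scale[OF linS] power2_eq_square)
            ultimately show ?thesis unfolding Z_def by (simp add: right_diff_distrib)
          qed
          have "Z (fst k, 0) = t\<^sup>2 * Z (fst k', 0)" "Z (0, snd k) = t\<^sup>2 * Z (0, snd k')" using Zs[of "(fst k', 0)"] Zs[of "(0, snd k')"] by (simp_all add: kk)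
          then have "D k = t\<^sup>2 * D k'" unfolding D_def using Zs[of k'] by (simp add: kk[symmetric] right_diff_distrib)
          moreover have "(norm k)\<^sup>2 = t\<^sup>2 * (norm k')\<^sup>2" by (simp add: kk power_mult_distrib)
          ultimately have "t\<^sup>2 * (- (4 * e * (norm k')\<^sup>2)) \<le> t\<^sup>2 * D k'" using Dk by (simp add: mult_ac)
          then show ?thesis using t by (subst (asm) mult_le_cancel_left_pos) auto
        qed
        ultimately show ?thesis by blast
      qed
      have "\<forall>n::nat. \<exists>k. norm (k - v) \<le> (1 / Suc n) * norm v \<and> D k \<ge> - (4 * (1 / Suc n) * (norm k)\<^sup>2)"
        using Dn[of "1 / Suc n" for n] by simp
      then obtain k where k: "\<And>n::nat. norm (k n - v) \<le> (1 / Suc n) * norm v" "\<And>n::nat. D (k n) \<ge> - (4 * (1 / Suc n) * (norm (k n))\<^sup>2)"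
        by metis
      have lim0: "(\<lambda>n::nat. 1 / real (Suc n)) \<longlonglongrightarrow> 0" using LIMSEQ_Suc[OF lim_1_over_n] by simp
      have "(\<lambda>n. k n - v) \<longlonglongrightarrow> 0"
      proof (rule Lim_null_comparison)
        show "\<forall>\<^sub>F n in sequentially. norm (k n - v) \<le> (1 / Suc n) * norm v" using k(1) by simp
        show "(\<lambda>n. 1 / real (Suc n) * norm v) \<longlonglongrightarrow> 0" using tendsto_mult[OF lim0 tendsto_const[of "norm v"]] by simp
      qed
      then have kv: "k \<longlonglongrightarrow> v" by (simp add: LIM_zero_iff)
      have "D v \<ge> 0"
      proof (rule tendsto_le[OF sequentially_bot])
        show "(\<lambda>n. D (k n)) \<longlonglongrightarrow> D v" by (rule isCont_tendsto_compose[OF contD kv])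
        show "(\<lambda>n. - (4 * (1 / Suc n) * (norm (k n))\<^sup>2)) \<longlonglongrightarrow> 0"
          using tendsto_minus[OF tendsto_mult[OF tendsto_mult[OF tendsto_const[of 4] lim0] tendsto_power[OF tendsto_norm[OF kv], of 2]]] by simp
        show "\<forall>\<^sub>F n in sequentially. - (4 * (1 / Suc n) * (norm (k n))\<^sup>2) \<le> D (k n)" using k(2) by simp
      qed
      then show ?thesis by (simp add: D_def)
    qed
    \<comment> \<open>Parallelogram law for \<open>(h, h)\<close> and \<open>(h, - h)\<close>: the
      penalty vanishes on \<open>(h, h)\<close>, so \<open>Z (h, h)\<close> is nonnegative, and
      \<open>Zsplit\<close> bounds \<open>Z (h, - h)\<close> from below.\<close>
    have Zsum: "Z (h, 0) + Z (0, h) \<ge> 0" for h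
    proof -
      have e1: "(h, h) = (h, 0) + (0, h)" "(h, - h) = (h, 0) - (0, h)" by simp_all
      have "S (h, h) \<bullet> (h, h) + S (h, - h) \<bullet> (h, - h) = 2 * (S (h, 0) \<bullet> (h, 0)) + 2 * (S (0, h) \<bullet> (0, h))"
        unfolding e1 linear_add[OF linS] linear_diff[OF linS] by (simp only: inner_simps)
      moreover have "(norm (h - - h))\<^sup>2 = 4 * (norm h)\<^sup>2"
      proof -
        have "h - - h = 2 *\<^sub>R h" by (simp add: scaleR_2)
        then show ?thesis by (simp only: norm_scaleR) (simp add: power_mult_distrib)
      qed
      ultimately have "Z (h, h) + Z (h, - h) = 2 * Z (h, 0) + 2 * Z (0, h)" by (simp add: Z_def algebra_simps)
      moreover have "Z (h, - h) \<ge> Z (h, 0) + Z (0, h)"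
      proof -
        have "Z (0, - h) = Z (0, h)"
        proof -
          have "S (0, - h) = - S (0, h)" using linear_neg[OF linS, of "(0, h)"] by simp
          then show ?thesis by (simp add: Z_def inner_prod_def)
        qed
        then show ?thesis using Zsplit[of "(h, - h)"] by simp
      qed
      moreover have "Z (h, h) \<ge> 0" using Spos[of "(h, h)"] by (simp add: Z_def)
      ultimately show ?thesis by linarith
    qed
    \<comment> \<open>Besides the \<open>C\<close> of the penalty, the shift contains
      \<open>2 * \<eta>0\<close> for the Hessian of the added quadratic term and
      \<open>2 * \<eta>0\<close> to swallow the error \<open>\<eta>0 * (norm h)^2\<close> of the
      expansion.\<close>
    obtain X where Xp: "linear X" "\<And>h. norm (X h) \<le> B * norm h" "\<And>h k. X h \<bullet> k = h \<bullet> X k"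
      "\<And>h. X h \<bullet> h = T1 h \<bullet> h - (C + 4 * \<eta>0) * (norm h)\<^sup>2"
      using symmetric_part[OF linT(1) Tn(1) K, where c = "C + 4 * \<eta>0"] unfolding B_def by blast
    obtain Y where Yp: "linear Y" "\<And>h. norm (Y h) \<le> B * norm h" "\<And>h k. Y h \<bullet> k = h \<bullet> Y k"
      "\<And>h. Y h \<bullet> h = T2 h \<bullet> h - (C + 4 * \<eta>0) * (norm h)\<^sup>2"
      using symmetric_part[OF linT(2) Tn(2) K, where c = "C + 4 * \<eta>0"] unfolding B_def by blast
    have XY: "X h \<bullet> h + Y h \<bullet> h \<ge> - (\<eta> * (norm h)\<^sup>2)" for h
    proof -
      have "X h \<bullet> h + Y h \<bullet> h = Z (h, 0) + Z (0, h) - 8 * \<eta>0 * (norm h)\<^sup>2"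
        unfolding Xp(4) Yp(4) TS Z_def by (simp add: algebra_simps)
      then show ?thesis using Zsum[of h] by (simp add: \<eta>0_def)
    qed
    have sqd: "\<eta>0 * (norm (z + h))\<^sup>2 = \<eta>0 * (norm z)\<^sup>2 + (2 * \<eta>0) * (z \<bullet> h) + \<eta>0 * (norm h)\<^sup>2" for z h :: 'a
      unfolding sqe by (simp add: distrib_left)
    \<comment> \<open>\<open>z1 + h\<close> competes in the infimum for \<open>a (y1 + h)\<close> at
      an unchanged distance, so the expansion of \<open>a\<close> at \<open>y1\<close> becomes one
      of \<open>U\<close> at \<open>z1\<close>.\<close>
    have jU: "\<exists>d>0. \<forall>h. norm h < d \<longrightarrow> U (z1 + h) \<ge> U z1 + (q1 - (2 * \<eta>0) *\<^sub>R z1) \<bullet> h + X h \<bullet> h / 2"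
    proof -
      obtain d where d: "d > 0" "\<And>h. norm h < d \<Longrightarrow> a (y1 + h) \<ge> a y1 + q1 \<bullet> h + (T1 h \<bullet> h - C * (norm h)\<^sup>2) / 2 - \<eta>0 * (norm h)\<^sup>2"
        using alow[OF \<eta>0] by blast
      have "U (z1 + h) \<ge> U z1 + (q1 - (2 * \<eta>0) *\<^sub>R z1) \<bullet> h + X h \<bullet> h / 2" if h: "norm h < min d (r - \<delta>')" for h
      proof -
        have "norm (z1 + h) \<le> r" using norm_triangle_ineq[of z1 h] small h by simp
        then have "a (y1 + h) \<le> U (z1 + h) + \<eta>0 * (norm (z1 + h))\<^sup>2 + \<mu> * (norm (y1 - z1))\<^sup>2"
          using ZU(2)[of "z1 + h" "y1 + h"] by (simp add: a_def)
        moreover have "a y1 = U z1 + \<eta>0 * (norm z1)\<^sup>2 + \<mu> * (norm (y1 - z1))\<^sup>2" by (simp add: a_def z1_def)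
        moreover have "a (y1 + h) \<ge> a y1 + q1 \<bullet> h + (T1 h \<bullet> h - C * (norm h)\<^sup>2) / 2 - \<eta>0 * (norm h)\<^sup>2" using d(2) h by simp
        moreover have "X h \<bullet> h / 2 = (T1 h \<bullet> h - C * (norm h)\<^sup>2) / 2 - 2 * (\<eta>0 * (norm h)\<^sup>2)" unfolding Xp(4) by (simp add: field_simps)
        moreover have "(q1 - (2 * \<eta>0) *\<^sub>R z1) \<bullet> h = q1 \<bullet> h - (2 * \<eta>0) * (z1 \<bullet> h)" by (simp add: inner_diff_left)
        ultimately show ?thesis using sqd[of z1 h] by linarith
      qed
      then show ?thesis using d(1) \<delta>' by (intro exI[of _ "min d (r - \<delta>')"]) auto
    qed
    have jW: "\<exists>d>0. \<forall>h. norm h < d \<longrightarrow> W (z2 + h) \<ge> W z2 + (q2 - (2 * \<eta>0) *\<^sub>R z2) \<bullet> h + Y h \<bullet> h / 2"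
    proof -
      obtain d where d: "d > 0" "\<And>h. norm h < d \<Longrightarrow> b (y2 + h) \<ge> b y2 + q2 \<bullet> h + (T2 h \<bullet> h - C * (norm h)\<^sup>2) / 2 - \<eta>0 * (norm h)\<^sup>2"
        using blow[OF \<eta>0] by blast
      have "W (z2 + h) \<ge> W z2 + (q2 - (2 * \<eta>0) *\<^sub>R z2) \<bullet> h + Y h \<bullet> h / 2" if h: "norm h < min d (r - \<delta>')" for h
      proof -
        have "norm (z2 + h) \<le> r" using norm_triangle_ineq[of z2 h] small h by simp
        then have "b (y2 + h) \<le> W (z2 + h) + \<eta>0 * (norm (z2 + h))\<^sup>2 + \<mu> * (norm (y2 - z2))\<^sup>2"
          using ZW(2)[of "z2 + h" "y2 + h"] by (simp add: b_def)
        moreover have "b y2 = W z2 + \<eta>0 * (norm z2)\<^sup>2 + \<mu> * (norm (y2 - z2))\<^sup>2" by (simp add: b_def z2_def)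
        moreover have "b (y2 + h) \<ge> b y2 + q2 \<bullet> h + (T2 h \<bullet> h - C * (norm h)\<^sup>2) / 2 - \<eta>0 * (norm h)\<^sup>2" using d(2) h by simp
        moreover have "Y h \<bullet> h / 2 = (T2 h \<bullet> h - C * (norm h)\<^sup>2) / 2 - 2 * (\<eta>0 * (norm h)\<^sup>2)" unfolding Yp(4) by (simp add: field_simps)
        moreover have "(q2 - (2 * \<eta>0) *\<^sub>R z2) \<bullet> h = q2 \<bullet> h - (2 * \<eta>0) * (z2 \<bullet> h)" by (simp add: inner_diff_left)
        ultimately show ?thesis using sqd[of z2 h] by linarith
      qed
      then show ?thesis using d(1) \<delta>' by (intro exI[of _ "min d (r - \<delta>')"]) auto
    qed
    have ny: "norm (y1 - y2) \<le> 2 * \<delta>'"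
    proof -
      have "norm y1 \<le> norm y" "norm y2 \<le> norm y" unfolding y1_def y2_def by (metis norm_fst_le norm_snd_le prod.collapse)+
      then show ?thesis using norm_triangle_ineq4[of y1 y2] y \<delta>1 by linarith
    qed
    have np: "norm p1 \<le> \<delta>'" "norm p2 \<le> \<delta>'"
    proof -
      have "norm p1 \<le> norm p" "norm p2 \<le> norm p" unfolding p1_def p2_def by (metis norm_fst_le norm_snd_le prod.collapse)+
      then show "norm p1 \<le> \<delta>'" "norm p2 \<le> \<delta>'" using y \<delta>1 by linarith+
    qed
    have Cy: "norm (C *\<^sub>R (y1 - y2)) \<le> C * (2 * \<delta>')" using ny C by (simp add: mult_left_mono)
    have Ez: "norm ((2 * \<eta>0) *\<^sub>R z) \<le> 2 * \<eta>0 * \<delta>'" if "norm z < \<delta>'" for z :: 'a using that \<eta>0 by simp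
    have nq: "norm (q1 - (2 * \<eta>0) *\<^sub>R z1) < \<delta>" "norm (q2 - (2 * \<eta>0) *\<^sub>R z2) < \<delta>"
    proof -
      have s: "\<delta>' + C * (2 * \<delta>') + 2 * \<eta>0 * \<delta>' < \<delta>" using \<delta>'(4) by (simp add: algebra_simps)
      have "norm (q1 - (2 * \<eta>0) *\<^sub>R z1) \<le> norm q1 + norm ((2 * \<eta>0) *\<^sub>R z1)" by (rule norm_triangle_ineq4)
      moreover have "norm q1 \<le> norm p1 + norm (C *\<^sub>R (y1 - y2))" unfolding q1_def by (rule norm_triangle_ineq4)
      ultimately show "norm (q1 - (2 * \<eta>0) *\<^sub>R z1) < \<delta>" using s np Cy Ez[OF small(1)] by linarith
      have "norm (q2 - (2 * \<eta>0) *\<^sub>R z2) \<le> norm q2 + norm ((2 * \<eta>0) *\<^sub>R z2)" by (rule norm_triangle_ineq4)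
      moreover have "norm q2 \<le> norm p2 + norm (C *\<^sub>R (y1 - y2))" unfolding q2_def by (rule norm_triangle_ineq)
      ultimately show "norm (q2 - (2 * \<eta>0) *\<^sub>R z2) < \<delta>" using s np Cy Ez[OF small(2)] by linarith
    qed
    show "\<exists>y1 y2 p1 p2 X Y. norm y1 < \<delta> \<and> norm y2 < \<delta> \<and> U y1 < \<delta> \<and> W y2 < \<delta> \<and> norm p1 < \<delta> \<and> norm p2 < \<delta> \<and>
     linear X \<and> linear Y \<and> (\<forall>h. norm (X h) \<le> B * norm h) \<and> (\<forall>h. norm (Y h) \<le> B * norm h) \<and>
     (\<forall>h k. X h \<bullet> k = h \<bullet> X k) \<and> (\<forall>h k. Y h \<bullet> k = h \<bullet> Y k) \<and>
     (\<forall>h. X h \<bullet> h + Y h \<bullet> h \<ge> - (\<eta> * (norm h)\<^sup>2)) \<and>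
     (\<exists>d>0. \<forall>h. norm h < d \<longrightarrow> U (y1 + h) \<ge> U y1 + p1 \<bullet> h + X h \<bullet> h / 2) \<and>
     (\<exists>d>0. \<forall>h. norm h < d \<longrightarrow> W (y2 + h) \<ge> W y2 + p2 \<bullet> h + Y h \<bullet> h / 2)"
      apply (rule exI[of _ z1], rule exI[of _ z2], rule exI[of _ "q1 - (2 * \<eta>0) *\<^sub>R z1"], rule exI[of _ "q2 - (2 * \<eta>0) *\<^sub>R z2"], rule exI[of _ X], rule exI[of _ Y])
      using small \<delta>' cU nq Xp(1,2,3) Yp(1,2,3) XY jU jW by (intro conjI allI) (auto)
  qed
qed

subsection \<open>Calculus of test functions\<close>

text \<open>Gradient and Hessian take values in the space itself instead of spaces of functionals,
  and continuity of the Hessian is asked vector by vector. In finite dimension this amounts to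
  \<open>C2_on\<close> and is easier to compute with.\<close>

definition C2_data :: "'a::euclidean_space set \<Rightarrow> ('a \<Rightarrow> real) \<Rightarrow> ('a \<Rightarrow> 'a) \<Rightarrow> ('a \<Rightarrow> 'a \<Rightarrow> 'a) \<Rightarrow> bool" where
  "C2_data S \<phi> g H \<longleftrightarrow> (\<forall>z\<in>S. (\<phi> has_derivative (\<lambda>h. g z \<bullet> h)) (at z)) \<and>
     (\<forall>z\<in>S. (g has_derivative H z) (at z)) \<and> (\<forall>v. continuous_on S (\<lambda>z. H z v))"

lemma C2_dataD:
  assumes "C2_data S \<phi> g H"
  shows "z \<in> S \<Longrightarrow> (\<phi> has_derivative (\<lambda>h. g z \<bullet> h)) (at z)" "z \<in> S \<Longrightarrow> (g has_derivative H z) (at z)"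
    "continuous_on S (\<lambda>z. H z v)" "z \<in> S \<Longrightarrow> bounded_linear (H z)" "continuous_on S g" "continuous_on S \<phi>"
  using assms unfolding C2_data_def
  by (auto intro: has_derivative_bounded_linear has_derivative_continuous_on continuous_at_imp_continuous_on has_derivative_continuous)

text \<open>Both derivatives are pushed through \<open>R\<close>, the Riesz representation of
  functionals, which is a bounded linear map.\<close>

lemma C2_on_imp_C2_data:
  fixes \<phi> :: "'a::euclidean_space \<Rightarrow> real"
  assumes "C2_on S \<phi>"
  obtains g H where "C2_data S \<phi> g H"
proof -
  obtain \<phi>' :: "'a \<Rightarrow> 'a \<Rightarrow>\<^sub>L real" and \<phi>'' :: "'a \<Rightarrow> 'a \<Rightarrow>\<^sub>L ('a \<Rightarrow>\<^sub>L real)"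
    where d: "\<And>z. z \<in> S \<Longrightarrow> (\<phi> has_derivative blinfun_apply (\<phi>' z)) (at z)"
      "\<And>z. z \<in> S \<Longrightarrow> (\<phi>' has_derivative blinfun_apply (\<phi>'' z)) (at z)" "continuous_on S \<phi>''"
    using assms unfolding C2_on_def by blast
  define R where "R A = (\<Sum>b\<in>Basis. blinfun_apply A b *\<^sub>R b)" for A :: "'a \<Rightarrow>\<^sub>L real"
  have blR: "bounded_linear R" unfolding R_def
    by (intro bounded_linear_sum bounded_linear_scaleR_const blinfun.bounded_linear_left)
  have Ri: "R A \<bullet> h = blinfun_apply A h" for A h
  proof -
    have "blinfun_apply A h = blinfun_apply A (\<Sum>b\<in>Basis. (h \<bullet> b) *\<^sub>R b)" by (simp add: euclidean_representation)
    also have "\<dots> = (\<Sum>b\<in>Basis. (h \<bullet> b) * blinfun_apply A b)" by (simp add: blinfun.sum_right blinfun.scaleR_right)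
    finally show ?thesis by (simp add: R_def inner_sum_left inner_commute[of h] mult.commute)
  qed
  show thesis
  proof (rule that[of "\<lambda>z. R (\<phi>' z)" "\<lambda>z v. R (blinfun_apply (\<phi>'' z) v)"], unfold C2_data_def, intro conjI ballI allI)
    fix z assume z: "z \<in> S"
    show "(\<phi> has_derivative (\<lambda>h. R (\<phi>' z) \<bullet> h)) (at z)" unfolding Ri using d(1)[OF z] by simp
    show "((\<lambda>z. R (\<phi>' z)) has_derivative (\<lambda>v. R (blinfun_apply (\<phi>'' z) v))) (at z)"
      by (rule bounded_linear.has_derivative[OF blR d(2)[OF z]])
  next
    fix v
    show "continuous_on S (\<lambda>z. R (blinfun_apply (\<phi>'' z) v))"
      by (rule bounded_linear.continuous_on[OF blR]) (intro continuous_intros d(3))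
  qed
qed

text \<open>Continuity on each basis vector gives continuity in operator norm, the dimension being
  finite.\<close>

lemma C2_data_imp_C2_on:
  fixes \<phi> :: "'a::euclidean_space \<Rightarrow> real"
  assumes D: "C2_data S \<phi> g H"
  shows "C2_on S \<phi>"
proof -
  define \<phi>'' where "\<phi>'' z = Blinfun (\<lambda>v. blinfun_inner_right (H z v))" for z
  have bl: "bounded_linear (\<lambda>v. blinfun_inner_right (H z v))" if "z \<in> S" for z
    by (rule bounded_linear_compose[OF bounded_linear_blinfun_inner_right C2_dataD(4)[OF D that]])
  have ap: "blinfun_apply (\<phi>'' z) = (\<lambda>v. blinfun_inner_right (H z v))" if "z \<in> S" for z
    unfolding \<phi>''_def by (rule bounded_linear_Blinfun_apply[OF bl[OF that]])
  show ?thesis unfolding C2_on_def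
  proof (intro exI[of _ "\<lambda>z. blinfun_inner_right (g z)"] exI[of _ \<phi>''] conjI ballI)
    fix z assume z: "z \<in> S"
    show "(\<phi> has_derivative blinfun_apply (blinfun_inner_right (g z))) (at z)"
      using C2_dataD(1)[OF D z] by (simp add: blinfun_inner_right.rep_eq)
    show "((\<lambda>z. blinfun_inner_right (g z)) has_derivative blinfun_apply (\<phi>'' z)) (at z)"
      unfolding ap[OF z] by (rule bounded_linear.has_derivative[OF bounded_linear_blinfun_inner_right C2_dataD(2)[OF D z]])
  next
    show "continuous_on S \<phi>''"
    proof (rule continuous_on_blinfun_componentwise)
      fix i :: 'a
      have "continuous_on S (\<lambda>z. blinfun_inner_right (H z i))"
        by (rule bounded_linear.continuous_on[OF bounded_linear_blinfun_inner_right C2_dataD(3)[OF D]])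
      then show "continuous_on S (\<lambda>z. blinfun_apply (\<phi>'' z) i)"
        by (rule continuous_on_eq) (simp add: ap)
    qed
  qed
qed

lemma C2_data_subset: "C2_data T \<phi> g H \<Longrightarrow> S \<subseteq> T \<Longrightarrow> C2_data S \<phi> g H"
  unfolding C2_data_def using continuous_on_subset by blast

lemma C2_data_add:
  assumes 1: "C2_data S \<phi> g H" and 2: "C2_data S \<psi> g' H'"
  shows "C2_data S (\<lambda>z. \<phi> z + \<psi> z) (\<lambda>z. g z + g' z) (\<lambda>z v. H z v + H' z v)"
  unfolding C2_data_def
proof (intro conjI ballI allI)
  fix z assume z: "z \<in> S"
  show "((\<lambda>z. \<phi> z + \<psi> z) has_derivative (\<lambda>h. (g z + g' z) \<bullet> h)) (at z)"
    unfolding inner_add_left by (rule has_derivative_add[OF C2_dataD(1)[OF 1 z] C2_dataD(1)[OF 2 z]])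
  show "((\<lambda>z. g z + g' z) has_derivative (\<lambda>v. H z v + H' z v)) (at z)"
    by (rule has_derivative_add[OF C2_dataD(2)[OF 1 z] C2_dataD(2)[OF 2 z]])
qed (intro continuous_intros C2_dataD(3)[OF 1] C2_dataD(3)[OF 2])

lemma C2_data_scale:
  assumes 1: "C2_data S \<phi> g H"
  shows "C2_data S (\<lambda>z. c * \<phi> z) (\<lambda>z. c *\<^sub>R g z) (\<lambda>z v. c *\<^sub>R H z v)"
  unfolding C2_data_def
proof (intro conjI ballI allI)
  fix z assume z: "z \<in> S"
  show "((\<lambda>z. c * \<phi> z) has_derivative (\<lambda>h. (c *\<^sub>R g z) \<bullet> h)) (at z)"
    unfolding inner_scaleR_left by (rule has_derivative_mult_right[OF C2_dataD(1)[OF 1 z]])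
  show "((\<lambda>z. c *\<^sub>R g z) has_derivative (\<lambda>v. c *\<^sub>R H z v)) (at z)"
    by (rule has_derivative_scaleR_right[OF C2_dataD(2)[OF 1 z]])
qed (intro continuous_intros C2_dataD(3)[OF 1])

lemma C2_data_const: "C2_data S (\<lambda>z. c) (\<lambda>z. 0) (\<lambda>z v. 0)"
  unfolding C2_data_def inner_zero_left by auto

lemma C2_data_shift:
  assumes 1: "C2_data UNIV \<phi> g H"
  shows "C2_data S (\<lambda>z. \<phi> (z - a)) (\<lambda>z. g (z - a)) (\<lambda>z. H (z - a))"
  unfolding C2_data_def
proof (intro conjI ballI allI)
  fix z
  have s: "((\<lambda>z. z - a) has_derivative (\<lambda>h. h)) (at z)" by (auto intro!: derivative_eq_intros)
  show "((\<lambda>z. \<phi> (z - a)) has_derivative (\<lambda>h. g (z - a) \<bullet> h)) (at z)"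
    using has_derivative_compose[OF s C2_dataD(1)[OF 1 UNIV_I]] by simp
  show "((\<lambda>z. g (z - a)) has_derivative H (z - a)) (at z)"
    using has_derivative_compose[OF s C2_dataD(2)[OF 1 UNIV_I]] by simp
next
  fix v
  show "continuous_on S (\<lambda>z. H (z - a) v)"
    by (rule continuous_on_compose2[OF C2_dataD(3)[OF 1]]) (auto intro!: continuous_intros)
qed

lemma C2_data_quadratic:
  assumes X: "linear X" "\<And>h k. X h \<bullet> k = h \<bullet> X k"
  shows "C2_data S (\<lambda>z. c + p \<bullet> (z - y) + X (z - y) \<bullet> (z - y) / 2) (\<lambda>z. p + X (z - y)) (\<lambda>z. X)"
  unfolding C2_data_def
proof (intro conjI ballI allI)
  fix z
  have blX: "bounded_linear X" using X(1) by (simp add: linear_conv_bounded_linear)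
  have dX: "((\<lambda>z. X (z - y)) has_derivative X) (at z)"
    by (rule bounded_linear.has_derivative[OF blX, where g' = "\<lambda>h. h"]) (auto intro!: derivative_eq_intros)
  show "((\<lambda>z. c + p \<bullet> (z - y) + X (z - y) \<bullet> (z - y) / 2) has_derivative (\<lambda>h. (p + X (z - y)) \<bullet> h)) (at z)"
  proof -
    have sh: "((\<lambda>z. z - y) has_derivative (\<lambda>h. h)) (at z)" by (auto intro!: derivative_eq_intros)
    have "((\<lambda>z. c + p \<bullet> (z - y) + X (z - y) \<bullet> (z - y) / 2) has_derivative
       (\<lambda>h. 0 + p \<bullet> h + (X (z - y) \<bullet> h + X h \<bullet> (z - y)) / 2)) (at z)"
      by (intro has_derivative_add has_derivative_const bounded_linear.has_derivative[OF bounded_linear_divide] has_derivative_inner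
        has_derivative_inner_right dX sh)
    moreover have "X h \<bullet> (z - y) = X (z - y) \<bullet> h" for h using X(2)[of h "z - y"] by (simp add: inner_commute)
    ultimately show ?thesis by (simp add: inner_add_left)
  qed
  show "((\<lambda>z. p + X (z - y)) has_derivative X) (at z)" using has_derivative_add[OF has_derivative_const dX] by simp
qed simp

lemma grad_eqI:
  assumes "(f has_derivative (\<lambda>h. D \<bullet> h)) (at x)"
  shows "grad f x = D"
  unfolding grad_def gderiv_def
proof (rule the_equality)
  show "(f has_derivative (\<lambda>h. h \<bullet> D)) (at x)" using assms by (simp only: inner_commute)
  fix D' assume "(f has_derivative (\<lambda>h. h \<bullet> D')) (at x)"
  then have "(\<lambda>h. h \<bullet> D') = (\<lambda>h. D \<bullet> h)" using has_derivative_unique assms by blast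
  then have "h \<bullet> D' = h \<bullet> D" for h by (metis inner_commute)
  then show "D' = D" using vector_eq_ldot by blast
qed

lemma hessian_eqI:
  assumes "open S" "x \<in> S" "\<And>z. z \<in> S \<Longrightarrow> (f has_derivative (\<lambda>h. g z \<bullet> h)) (at z)" "(g has_derivative L) (at x)"
  shows "hessian f x = matrix L"
proof -
  have "(grad f has_derivative L) (at x)"
    by (rule has_derivative_transform_within_open[OF assms(4,1,2)]) (simp add: grad_eqI[OF assms(3)])
  then have "frechet_derivative (grad f) (at x) = L" by (rule frechet_derivative_at[symmetric])
  then show ?thesis by (simp add: hessian_def jacobian_def)
qed

section \<open>Gradient, time derivative and operator of space-time test functions\<close>

text \<open>The spatial block of a Hessian on space-time, the only part that the operator
  sees.\<close>

definition space_hess :: "('a::real_normed_vector \<times> real \<Rightarrow> 'a \<times> real) \<Rightarrow> 'a \<Rightarrow> 'a" where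
  "space_hess L x = fst (L (x, 0))"

lemma C2_data_operators:
  fixes \<phi> :: "(real ^ 'n) \<times> real \<Rightarrow> real"
  assumes D: "C2_data S \<phi> g H" and S: "open S" "z \<in> S"
  shows "spatial_grad \<phi> z = fst (g z)" "time_deriv \<phi> z = snd (g z)"
    "spatial_pq_laplacian p q \<phi> z = pq_operator p q (fst (g z)) (matrix (space_hess (H z)))"
proof -
  obtain x t where z: "z = (x, t)" by (cases z)
  have dx: "((\<lambda>x. (x, t)) has_derivative (\<lambda>h. (h, 0))) (at x')" for x' :: "real ^ 'n" by (auto intro!: derivative_eq_intros)
  have dt: "((\<lambda>t. (x, t)) has_derivative (\<lambda>h. (0, h))) (at t)" by (auto intro!: derivative_eq_intros)
  have gx: "((\<lambda>x. \<phi> (x, t)) has_derivative (\<lambda>h. fst (g (x', t)) \<bullet> h)) (at x')" if "(x', t) \<in> S" for x'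
    using has_derivative_compose[OF dx C2_dataD(1)[OF D that]] by (simp add: inner_prod_def)
  show sg: "spatial_grad \<phi> z = fst (g z)" unfolding spatial_grad_def using S z by (auto intro!: grad_eqI gx)
  have "((\<lambda>t. \<phi> (x, t)) has_derivative (\<lambda>h. snd (g (x, t)) * h)) (at t)"
    using has_derivative_compose[OF dt C2_dataD(1)[OF D]] S z by (simp add: inner_prod_def)
  then have "((\<lambda>t. \<phi> (x, t)) has_field_derivative snd (g (x, t))) (at t)" unfolding has_field_derivative_def by simp
  then show "time_deriv \<phi> z = snd (g z)" by (simp add: time_deriv_def z DERIV_imp_deriv)
  have op: "open {x'. (x', t) \<in> S}"
    using open_vimage[OF S(1), of "\<lambda>x. (x, t)"] by (simp add: vimage_def continuous_intros)
  have "((\<lambda>x. fst (g (x, t))) has_derivative space_hess (H (x, t))) (at x)"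
    unfolding space_hess_def using has_derivative_fst[OF has_derivative_compose[OF dx C2_dataD(2)[OF D]]] S z by simp
  then have "hessian (\<lambda>x. \<phi> (x, t)) x = matrix (space_hess (H (x, t)))"
    using S z by (intro hessian_eqI[OF op, where g = "\<lambda>x. fst (g (x, t))"]) (auto intro: gx)
  then show "spatial_pq_laplacian p q \<phi> z = pq_operator p q (fst (g z)) (matrix (space_hess (H z)))"
    using sg by (simp add: spatial_pq_laplacian_def pq_laplacian_def spatial_grad_def z)
qed

section \<open>Algebra of the operator\<close>

lemma pq_operator_alt:
  "pq_operator p q \<eta> X = norm \<eta> powr (q - 2) * (trace X + (p - 2) * (\<eta> \<bullet> (X *v \<eta>)) / (norm \<eta>)\<^sup>2)"
proof -
  have 1: "trace (outer \<eta> \<eta> ** X) = \<eta> \<bullet> (X *v \<eta>)"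
  proof -
    have "trace (outer \<eta> \<eta> ** X) = (\<Sum>i\<in>UNIV. \<Sum>k\<in>UNIV. \<eta> $ i * \<eta> $ k * X $ k $ i)"
      by (simp add: trace_def matrix_matrix_mult_def outer_def)
    also have "\<dots> = (\<Sum>k\<in>UNIV. \<Sum>i\<in>UNIV. \<eta> $ i * \<eta> $ k * X $ k $ i)" by (rule sum.swap)
    also have "\<dots> = \<eta> \<bullet> (X *v \<eta>)" by (simp add: inner_vec_def matrix_vector_mult_def sum_distrib_left mult_ac)
    finally show ?thesis .
  qed
  have 2: "trace (c *\<^sub>R A) = c * trace A" for c and A :: "real ^ 'n ^ 'n" by (simp add: trace_def sum_distrib_left)
  have 3: "(c *\<^sub>R A) ** B = c *\<^sub>R (A ** B)" for c and A B :: "real ^ 'n ^ 'n"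
    by (simp add: matrix_matrix_mult_def vec_eq_iff sum_distrib_left mult_ac)
  show ?thesis unfolding pq_operator_def by (simp add: trace_add 2 3 1)
qed

text \<open>With additivity in the matrix this is the oddness that lets two supersolutions with
  opposite gradients be treated by one inequality for the sum of their Hessians.\<close>

lemma pq_operator_minus: "pq_operator p q (- \<eta>) X = pq_operator p q \<eta> X"
  by (simp add: pq_operator_alt linear_neg[OF matrix_vector_mul_linear])

lemma pq_operator_add: "pq_operator p q \<eta> (X + Y) = pq_operator p q \<eta> X + pq_operator p q \<eta> Y"
  by (simp add: pq_operator_alt trace_add matrix_vector_mult_add_rdistrib inner_add_right distrib_left add_divide_distrib)

text \<open>Homogeneity of degree \<open>q - 1\<close>; it makes the radial class invariant under
  positive multiples.\<close>

lemma pq_operator_scale: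
  assumes "c > 0"
  shows "pq_operator p q (c *\<^sub>R \<eta>) (c *\<^sub>R X) = c powr (q - 1) * pq_operator p q \<eta> X"
proof -
  have 2: "trace (c *\<^sub>R X) = c * trace X" by (simp add: trace_def sum_distrib_left)
  have 3: "(c *\<^sub>R \<eta>) \<bullet> ((c *\<^sub>R X) *v (c *\<^sub>R \<eta>)) / (norm (c *\<^sub>R \<eta>))\<^sup>2 = c * ((\<eta> \<bullet> (X *v \<eta>)) / (norm \<eta>)\<^sup>2)"
    using assms by (simp add: scaleR_matrix_vector_assoc[symmetric] matrix_vector_mult_scaleR power2_eq_square)
  have 4: "c powr (q - 1) = c powr (q - 2) * c" using assms by (simp add: powr_diff power2_eq_square)
  show ?thesis unfolding pq_operator_alt 2 times_divide_eq_right[symmetric] 3 4 using assms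
    by (simp add: powr_mult algebra_simps)
qed

text \<open>The operator splits into the form at the unit vector \<open>e\<close> along
  \<open>\<eta>\<close>, with weight \<open>p - 1 > 0\<close>, and the sum of the form over the
  projections \<open>P i\<close> of the axes orthogonal to \<open>e\<close>, each of norm at most
  1.\<close>

lemma pq_operator_lower_bound:
  fixes X :: "real ^ 'n ^ 'n" and p q s :: real
  assumes p: "p > 1" and \<eta>: "\<eta> \<noteq> 0" and X: "\<And>\<xi>. \<xi> \<bullet> (X *v \<xi>) \<ge> - (s * (norm \<xi>)\<^sup>2)" and s: "s \<ge> 0"
  shows "pq_operator p q \<eta> X \<ge> - (norm \<eta> powr (q - 2) * (s * (CARD('n) + p - 1)))"
proof -
  define e where "e = (1 / norm \<eta>) *\<^sub>R \<eta>"
  have ne: "norm e = 1" using \<eta> by (simp add: e_def)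
  have ee: "\<eta> \<bullet> (X *v \<eta>) / (norm \<eta>)\<^sup>2 = e \<bullet> (X *v e)"
    using \<eta> by (simp add: e_def matrix_vector_mult_scaleR power2_eq_square)
  have tr: "trace X = (\<Sum>i\<in>UNIV. axis i 1 \<bullet> (X *v axis i 1))"
    by (simp add: trace_def inner_axis' matrix_vector_mult_basis column_def)
  define P where "P i = axis i 1 - (e $ i) *\<^sub>R e" for i :: 'n
  have e1: "(\<Sum>i\<in>UNIV. e $ i * e $ i) = 1" using ne by (simp add: norm_eq_1 inner_vec_def)
  have s1: "(\<Sum>i\<in>UNIV. (e $ i) *\<^sub>R axis i 1) = e" using basis_expansion[of e] by (simp add: scalar_mult_eq_scaleR)
  have "(\<Sum>i\<in>UNIV. P i \<bullet> (X *v P i)) = trace X - e \<bullet> (X *v e)"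
  proof -
    have "P i \<bullet> (X *v P i) = axis i 1 \<bullet> (X *v axis i 1) - ((e $ i) *\<^sub>R axis i 1) \<bullet> (X *v e) - e \<bullet> (X *v ((e $ i) *\<^sub>R axis i 1)) + (e $ i * e $ i) * (e \<bullet> (X *v e))" for i
      by (simp add: P_def matrix_vector_mult_diff_distrib matrix_vector_mult_scaleR inner_diff_left inner_diff_right algebra_simps)
    then have "(\<Sum>i\<in>UNIV. P i \<bullet> (X *v P i)) = trace X - (\<Sum>i\<in>UNIV. (e $ i) *\<^sub>R axis i 1) \<bullet> (X *v e)
       - e \<bullet> (X *v (\<Sum>i\<in>UNIV. (e $ i) *\<^sub>R axis i 1)) + (\<Sum>i\<in>UNIV. e $ i * e $ i) * (e \<bullet> (X *v e))"
      by (simp add: tr sum.distrib sum_subtractf inner_sum_left inner_sum_right sum_distrib_right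
        linear_sum[OF matrix_vector_mul_linear] del: scaleR_conv_of_real)
    then show ?thesis by (simp add: s1 e1)
  qed
  moreover have "(\<Sum>i\<in>UNIV. P i \<bullet> (X *v P i)) \<ge> (\<Sum>i\<in>(UNIV :: 'n set). - s)"
  proof (rule sum_mono)
    fix i :: 'n
    have "(norm (P i))\<^sup>2 = 1 - (e $ i)\<^sup>2"
    proof -
      have "(norm (P i))\<^sup>2 = (norm (axis i (1::real) :: real ^ 'n))\<^sup>2 - 2 * (e $ i) * (axis i 1 \<bullet> e) + (e $ i)\<^sup>2 * (norm e)\<^sup>2"
        unfolding P_def power2_norm_eq_inner by (simp add: inner_diff_left inner_diff_right inner_commute power2_eq_square algebra_simps)
      then show ?thesis using ne by (simp add: inner_axis' power2_eq_square)
    qed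
    then have "(norm (P i))\<^sup>2 \<le> 1" by simp
    then have "s * (norm (P i))\<^sup>2 \<le> s" using s by (simp add: mult_left_le)
    then show "- s \<le> P i \<bullet> (X *v P i)" using X[of "P i"] by linarith
  qed
  ultimately have 1: "trace X - e \<bullet> (X *v e) \<ge> - (s * CARD('n))" by (simp add: mult.commute)
  have "e \<bullet> (X *v e) \<ge> - s" using X[of e] ne by simp
  then have "(p - 1) * (e \<bullet> (X *v e)) \<ge> (p - 1) * (- s)" using p by (intro mult_left_mono) auto
  then have 2: "trace X + (p - 2) * (e \<bullet> (X *v e)) \<ge> - (s * (CARD('n) + p - 1))" using 1 by (simp add: algebra_simps)
  have "pq_operator p q \<eta> X = norm \<eta> powr (q - 2) * (trace X + (p - 2) * (e \<bullet> (X *v e)))"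
    unfolding pq_operator_alt times_divide_eq_right[symmetric] ee ..
  then show ?thesis using mult_left_mono[OF 2, of "norm \<eta> powr (q - 2)"] by simp
qed

section \<open>Radial functions\<close>

locale radial_profile =
  fixes f f' f'' :: "real \<Rightarrow> real"
  assumes f1: "\<And>r. r \<ge> 0 \<Longrightarrow> (f has_real_derivative f' r) (at r within {0..})"
    and f2: "\<And>r. r \<ge> 0 \<Longrightarrow> (f' has_real_derivative f'' r) (at r within {0..})"
    and f2c: "continuous_on {0..} f''"
    and f0: "f 0 = 0" "f' 0 = 0" "f'' 0 = 0"
begin

definition radial_grad :: "'a::euclidean_space \<Rightarrow> 'a" where
  "radial_grad x = (f' (norm x) / norm x) *\<^sub>R x"

text \<open>Tangential eigenvalue \<open>f' / r\<close>, radial eigenvalue \<open>f''\<close>. At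
  the origin division by zero makes the formula \<open>0\<close>, which is correct because
  \<open>f'' 0 = 0\<close>.\<close>

definition radial_hess :: "'a::euclidean_space \<Rightarrow> 'a \<Rightarrow> 'a" where
  "radial_hess x v = (f' (norm x) / norm x) *\<^sub>R v + ((f'' (norm x) - f' (norm x) / norm x) / (norm x)\<^sup>2 * (x \<bullet> v)) *\<^sub>R x"

lemma radial_at_0 [simp]: "radial_grad 0 = 0" "radial_hess 0 v = 0"
  by (simp_all add: radial_grad_def radial_hess_def)

lemma linear_radial_hess: "linear (radial_hess x)"
proof -
  have "linear (\<lambda>v. a *\<^sub>R v + (k * (x \<bullet> v)) *\<^sub>R x)" for a k
    by (intro linearI) (simp_all add: inner_add_right distrib_left scaleR_add_left scaleR_add_right mult_ac)
  then show ?thesis unfolding radial_hess_def by blast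
qed

lemma radial_deriv_at: assumes "r > 0" shows "(f has_real_derivative f' r) (at r)" "(f' has_real_derivative f'' r) (at r)"
proof -
  have "r \<in> interior {0..}" using assms by simp
  then have "at r within {0..} = at r" by (rule at_within_interior)
  then show "(f has_real_derivative f' r) (at r)" "(f' has_real_derivative f'' r) (at r)" using f1[of r] f2[of r] assms by simp_all
qed

lemma radial_cont: "continuous_on {0..} f" "continuous_on {0..} f'"
  using f1 f2 by (auto intro!: DERIV_continuous_on)

lemma little_o_at_0:
  fixes g :: "real \<Rightarrow> real"
  assumes "(g has_real_derivative 0) (at 0 within {0..})" "g 0 = 0" "e > 0"
  shows "\<exists>d>0. \<forall>r\<ge>0. r < d \<longrightarrow> \<bar>g r\<bar> \<le> e * r"
proof -
  have "\<forall>e>0. \<exists>d>0. \<forall>y\<in>{0..}. norm (y - 0) < d \<longrightarrow> norm (g y - g 0 - 0 * (y - 0)) \<le> e * norm (y - 0)"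
    using assms(1) unfolding has_field_derivative_def has_derivative_within_alt by blast
  then obtain d where "d > 0" "\<forall>y\<in>{0..}. norm (y - 0) < d \<longrightarrow> norm (g y - g 0 - 0 * (y - 0)) \<le> e * norm (y - 0)"
    using assms(3) by blast
  then show ?thesis using assms(2) by (intro exI[of _ d]) auto
qed

text \<open>The origin is the delicate point: the one-sided derivatives vanish there, so
  \<open>f\<close> and \<open>f'\<close> are \<open>o(r)\<close>, and the Hessian is bounded by
  \<open>2 * |f' / r| + |f''|\<close>, which tends to \<open>0\<close>.\<close>

lemma C2_data_radial: "C2_data UNIV (\<lambda>x::'a::euclidean_space. f (norm x)) radial_grad radial_hess"
  unfolding C2_data_def
proof (intro conjI ballI allI)
  fix x :: 'a
  show "((\<lambda>x. f (norm x)) has_derivative (\<lambda>h. radial_grad x \<bullet> h)) (at x)"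
  proof (cases "x = 0")
    case True
    have "((\<lambda>x::'a. f (norm x)) has_derivative (\<lambda>h. 0)) (at 0)"
      unfolding has_derivative_at_alt
    proof (intro conjI allI impI)
      fix e :: real assume "e > 0"
      then obtain d where "d > 0" "\<forall>r\<ge>0. r < d \<longrightarrow> \<bar>f r\<bar> \<le> e * r"
        using little_o_at_0[of f e] f1[of 0] f0 by auto
      then show "\<exists>d>0. \<forall>y::'a. norm (y - 0) < d \<longrightarrow> norm (f (norm y) - f (norm (0::'a)) - 0) \<le> e * norm (y - 0)"
        using f0 by (intro exI[of _ d]) auto
    qed auto
    then show ?thesis using True by simp
  next
    case False
    then have "(f has_derivative (\<lambda>h. f' (norm x) * h)) (at (norm x))"
      using radial_deriv_at(1)[of "norm x"] by (simp add: has_field_derivative_def)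
    from has_derivative_compose[OF has_derivative_norm[OF False] this]
    show ?thesis by (simp add: radial_grad_def sgn_div_norm inner_commute divide_inverse mult_ac)
  qed
  show "(radial_grad has_derivative radial_hess x) (at x)"
  proof (cases "x = 0")
    case True
    have "(radial_grad has_derivative (\<lambda>h. 0)) (at (0::'a))"
      unfolding has_derivative_at_alt
    proof (intro conjI allI impI)
      fix e :: real assume "e > 0"
      then obtain d where d: "d > 0" "\<forall>r\<ge>0. r < d \<longrightarrow> \<bar>f' r\<bar> \<le> e * r"
        using little_o_at_0[of f' e] f2[of 0] f0 by auto
      have "norm (radial_grad y) \<le> \<bar>f' (norm y)\<bar>" for y :: 'a
        by (cases "y = 0") (simp_all add: radial_grad_def)
      then have "norm (radial_grad y) \<le> e * norm y" if "norm y < d" for y :: 'a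
        using d(2)[rule_format, OF norm_ge_zero that] by (rule order_trans)
      then show "\<exists>d>0. \<forall>y::'a. norm (y - 0) < d \<longrightarrow> norm (radial_grad y - radial_grad 0 - 0) \<le> e * norm (y - 0)"
        using d(1) by (intro exI[of _ d]) simp
    qed auto
    moreover have "radial_hess x = (\<lambda>h. 0)" using True by (simp add: fun_eq_iff)
    ultimately show ?thesis using True by simp
  next
    case False
    let ?r = "norm x"
    have r: "?r > 0" using False by simp
    have "((\<lambda>r. f' r / r) has_real_derivative (f'' ?r * ?r - f' ?r) / (?r * ?r)) (at ?r)"
      using r by (auto intro!: derivative_eq_intros radial_deriv_at(2) simp: field_simps)
    then have "((\<lambda>r. f' r / r) has_derivative (\<lambda>h. (f'' ?r * ?r - f' ?r) / (?r * ?r) * h)) (at ?r)"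
      unfolding has_field_derivative_def .
    from has_derivative_compose[OF has_derivative_norm[OF False] this]
    have 1: "((\<lambda>x. f' (norm x) / norm x) has_derivative (\<lambda>h. (f'' ?r * ?r - f' ?r) / (?r * ?r) * (h \<bullet> sgn x))) (at x)" .
    have "((\<lambda>x. (f' (norm x) / norm x) *\<^sub>R x) has_derivative
       (\<lambda>h. (f' ?r / ?r) *\<^sub>R h + ((f'' ?r * ?r - f' ?r) / (?r * ?r) * (h \<bullet> sgn x)) *\<^sub>R x)) (at x)"
      by (rule has_derivative_scaleR[OF 1 has_derivative_ident])
    moreover have "(f'' ?r * ?r - f' ?r) / (?r * ?r) * (h \<bullet> sgn x) = (f'' ?r - f' ?r / ?r) / ?r\<^sup>2 * (x \<bullet> h)" for h
      using r by (simp add: sgn_div_norm inner_commute field_simps power2_eq_square)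
    ultimately show ?thesis unfolding radial_hess_def[abs_def] radial_grad_def[abs_def] by simp
  qed
next
  fix v :: 'a
  have 1: "continuous_on (- {0}) (\<lambda>z::'a. radial_hess z v)" unfolding radial_hess_def
    by (intro continuous_intros continuous_on_compose2[OF radial_cont(2)] continuous_on_compose2[OF f2c]) auto
  have "isCont (\<lambda>z. radial_hess z v) z" for z :: 'a
  proof (cases "z = 0")
    case False
    then show ?thesis using 1 continuous_on_eq_continuous_at[of "- {0}"] by (auto simp: open_Compl)
  next
    case True
    have b: "norm (radial_hess z v) \<le> (2 * \<bar>f' (norm z) / norm z\<bar> + \<bar>f'' (norm z)\<bar>) * norm v" for z :: 'a
    proof (cases "z = 0")
      case False
      let ?a = "f' (norm z) / norm z"
      have "norm (((f'' (norm z) - ?a) / (norm z)\<^sup>2 * (z \<bullet> v)) *\<^sub>R z) = \<bar>f'' (norm z) - ?a\<bar> / (norm z)\<^sup>2 * (\<bar>z \<bullet> v\<bar> * norm z)"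
        by (simp add: abs_mult)
      also have "\<dots> \<le> \<bar>f'' (norm z) - ?a\<bar> / (norm z)\<^sup>2 * ((norm z * norm v) * norm z)"
        by (intro mult_left_mono mult_right_mono Cauchy_Schwarz_ineq2) auto
      also have "\<dots> = \<bar>f'' (norm z) - ?a\<bar> * norm v" using False by (simp add: power2_eq_square)
      also have "\<dots> \<le> (\<bar>f'' (norm z)\<bar> + \<bar>?a\<bar>) * norm v" by (rule mult_right_mono[OF abs_triangle_ineq4]) simp
      finally have "norm (((f'' (norm z) - ?a) / (norm z)\<^sup>2 * (z \<bullet> v)) *\<^sub>R z) \<le> (\<bar>f'' (norm z)\<bar> + \<bar>?a\<bar>) * norm v" .
      moreover have "norm (radial_hess z v) \<le> norm (?a *\<^sub>R v) + norm (((f'' (norm z) - ?a) / (norm z)\<^sup>2 * (z \<bullet> v)) *\<^sub>R z)"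
        unfolding radial_hess_def by (rule norm_triangle_ineq)
      moreover have "norm (?a *\<^sub>R v) = \<bar>?a\<bar> * norm v" by simp
      moreover have "(2 * \<bar>?a\<bar> + \<bar>f'' (norm z)\<bar>) * norm v = \<bar>?a\<bar> * norm v + (\<bar>f'' (norm z)\<bar> + \<bar>?a\<bar>) * norm v"
        by (simp only: distrib_right)
      ultimately show ?thesis by linarith
    qed simp
    have "((\<lambda>z::'a. radial_hess z v) \<longlongrightarrow> 0) (at 0)"
    proof (rule tendstoI)
      fix e :: real assume e: "e > 0"
      define e' where "e' = e / (4 * (norm v + 1))"
      have e': "e' > 0" using e by (simp add: e'_def add_nonneg_pos)
      obtain d1 where d1: "d1 > 0" "\<forall>r\<ge>0. r < d1 \<longrightarrow> \<bar>f' r\<bar> \<le> e' * r" using little_o_at_0[of f' e'] f2[of 0] f0 e' by auto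
      have "(f'' \<longlongrightarrow> f'' 0) (at 0 within {0..})" using f2c by (simp add: continuous_on_def)
      then have "\<forall>\<^sub>F r in at 0 within {0..}. dist (f'' r) 0 < e'" using e' f0 by (auto dest!: tendstoD)
      then obtain d2 where d2: "d2 > 0" "\<forall>r\<in>{0..}. r \<noteq> 0 \<and> dist r 0 < d2 \<longrightarrow> \<bar>f'' r\<bar> < e'"
        unfolding eventually_at by auto
      have "dist (radial_hess z v) 0 < e" if z: "z \<noteq> 0" "norm z < min d1 d2" for z :: 'a
      proof -
        have "\<bar>f' (norm z) / norm z\<bar> \<le> e'" using d1 z by (simp add: abs_divide pos_divide_le_eq)
        moreover have "\<bar>f'' (norm z)\<bar> \<le> e'" using d2 z by (auto intro: less_imp_le)
        ultimately have "norm (radial_hess z v) \<le> (3 * e') * norm v" 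
          by (intro order_trans[OF b mult_right_mono]) auto
        also have "\<dots> < 4 * (norm v + 1) * e'" using e' by (simp add: algebra_simps) (intro add_nonneg_pos mult_nonneg_nonneg, auto)
        also have "\<dots> = e" by (simp add: e'_def) (smt (verit) norm_ge_zero)
        finally show ?thesis by simp
      qed
      then show "\<forall>\<^sub>F z in at 0. dist (radial_hess z v) 0 < e"
        unfolding eventually_at using d1(1) d2(1) by (intro exI[of _ "min d1 d2"]) auto
    qed
    then show ?thesis using True by (simp add: isCont_def)
  qed
  then show "continuous_on UNIV (\<lambda>z::'a. radial_hess z v)" by (simp add: continuous_at_imp_continuous_on)
qed

lemma radial_grad_hess:
  fixes x :: "real ^ 'n"
  shows "grad (\<lambda>y. f (norm y)) x = radial_grad x" "hessian (\<lambda>y. f (norm y)) x = matrix (radial_hess x)"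
  using C2_dataD(1,2)[OF C2_data_radial] by (auto intro!: grad_eqI hessian_eqI[OF open_UNIV])

text \<open>\<open>x\<close> is an eigenvector of the Hessian with eigenvalue \<open>f''\<close>;
  the other \<open>n - 1\<close> eigenvalues are \<open>f' / r\<close>.\<close>

lemma radial_pq_operator:
  fixes x :: "real ^ 'n" and p q :: real
  assumes x: "x \<noteq> 0" and f': "f' (norm x) > 0"
  shows "pq_operator p q (radial_grad x) (matrix (radial_hess x)) =
    f' (norm x) powr (q - 2) * ((real CARD('n) - 1) * (f' (norm x) / norm x) + (p - 1) * f'' (norm x))"
proof -
  let ?r = "norm x"
  let ?a = "f' ?r / ?r"
  have r: "?r > 0" using x by simp
  have n: "norm (radial_grad x) = f' ?r" using f' r by (simp add: radial_grad_def)
  have mv: "matrix (radial_hess x) *v v = radial_hess x v" for v by (simp add: matrix_works linear_radial_hess)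
  have hx: "radial_hess x (c *\<^sub>R x) = f'' ?r *\<^sub>R (c *\<^sub>R x)" for c
  proof -
    have "radial_hess x (c *\<^sub>R x) = (?a * c + (f'' ?r - ?a) / ?r\<^sup>2 * (c * ?r\<^sup>2)) *\<^sub>R x"
      by (simp add: radial_hess_def scaleR_add_left power2_norm_eq_inner)
    moreover have "?a * c + (f'' ?r - ?a) / ?r\<^sup>2 * (c * ?r\<^sup>2) = f'' ?r * c"
    proof -
      have "(f'' ?r - ?a) / ?r\<^sup>2 * (c * ?r\<^sup>2) = (f'' ?r - ?a) * c" using r by simp
      then show ?thesis by (simp only: left_diff_distrib)
    qed
    ultimately show ?thesis by simp
  qed
  have e: "radial_grad x \<bullet> (matrix (radial_hess x) *v radial_grad x) / (norm (radial_grad x))\<^sup>2 = f'' ?r"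
  proof -
    have "radial_grad x \<bullet> (matrix (radial_hess x) *v radial_grad x) = f'' ?r * (norm (radial_grad x))\<^sup>2"
      unfolding mv unfolding radial_grad_def hx power2_norm_eq_inner by simp
    then show ?thesis using n f' by simp
  qed
  have tr: "trace (matrix (radial_hess x)) = (real CARD('n) - 1) * ?a + f'' ?r"
  proof -
    have "trace (matrix (radial_hess x)) = (\<Sum>i\<in>UNIV. ?a + (f'' ?r - ?a) / ?r\<^sup>2 * (x $ i * x $ i))"
      by (simp add: trace_def matrix_def radial_hess_def inner_axis mult.assoc)
    also have "\<dots> = real CARD('n) * ?a + (f'' ?r - ?a) / ?r\<^sup>2 * (x \<bullet> x)"
      by (simp add: sum.distrib sum_distrib_left inner_vec_def)
    also have "\<dots> = real CARD('n) * ?a + (f'' ?r - ?a)" using r by (simp add: power2_norm_eq_inner[symmetric])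
    finally show ?thesis unfolding left_diff_distrib by linarith
  qed
  have "pq_operator p q (radial_grad x) (matrix (radial_hess x)) =
     norm (radial_grad x) powr (q - 2) * (trace (matrix (radial_hess x)) +
       (p - 2) * (radial_grad x \<bullet> (matrix (radial_hess x) *v radial_grad x) / (norm (radial_grad x))\<^sup>2))"
    by (simp only: pq_operator_alt times_divide_eq_right)
  also have "\<dots> = f' ?r powr (q - 2) * ((real CARD('n) - 1) * ?a + f'' ?r + (p - 2) * f'' ?r)"
    by (simp only: e tr) (simp only: n)
  finally show ?thesis by (simp add: algebra_simps)
qed

end

text \<open>Positivity of \<open>f'\<close> and then of \<open>f\<close> on \<open>r > 0\<close>
  follows from \<open>f'' > 0\<close> by the mean value theorem.\<close>

lemma radial_classE:
  assumes "f \<in> radial_class TYPE('n::finite) p q"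
  obtains f' f'' where "radial_profile f f' f''" "\<And>r. r > 0 \<Longrightarrow> f'' r > 0" "\<And>r. r > 0 \<Longrightarrow> f' r > 0" "\<And>r. r > 0 \<Longrightarrow> f r > 0"
    "((\<lambda>x :: real ^ 'n. pq_operator p q (radial_profile.radial_grad f' x) (matrix (radial_profile.radial_hess f' f'' x))) \<longlongrightarrow> 0) (at 0)"
proof -
  obtain f' f'' where *: "\<forall>r\<ge>0. (f has_real_derivative f' r) (at r within {0..})"
    "\<forall>r\<ge>0. (f' has_real_derivative f'' r) (at r within {0..})" "continuous_on {0..} f''"
    "f 0 = 0" "f' 0 = 0" "f'' 0 = 0" and pos: "\<forall>r>0. f'' r > 0"
    and lim: "((\<lambda>x :: real ^ 'n. pq_operator p q (grad (\<lambda>y. f (norm y)) x) (hessian (\<lambda>y. f (norm y)) x)) \<longlongrightarrow> 0) (at 0)"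
    using assms unfolding radial_class_def by blast
  interpret radial_profile f f' f'' by standard (use * in auto)
  have f'pos: "f' r > 0" if r: "r > 0" for r
  proof -
    obtain l z where z: "0 < z" "z < r" "DERIV f' z :> l" "f' r - f' 0 = (r - 0) * l"
      using MVT[OF r continuous_on_subset[OF radial_cont(2)]] radial_deriv_at(2) by (force simp: real_differentiable_def)
    then have "l = f'' z" using radial_deriv_at(2) DERIV_unique by blast
    then show ?thesis using z pos r f0 by simp
  qed
  have fpos: "f r > 0" if r: "r > 0" for r
  proof -
    obtain l z where z: "0 < z" "z < r" "DERIV f z :> l" "f r - f 0 = (r - 0) * l"
      using MVT[OF r continuous_on_subset[OF radial_cont(1)]] radial_deriv_at(1) by (force simp: real_differentiable_def)
    then have "l = f' z" using radial_deriv_at(1) DERIV_unique by blast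
    then show ?thesis using z f'pos r f0 by simp
  qed
  show thesis
    using that[OF radial_profile_axioms _ f'pos fpos] pos lim unfolding radial_grad_hess by blast
qed

lemma radial_class_scale:
  fixes p q c :: real
  assumes f: "f \<in> radial_class TYPE('n::finite) p q" and c: "c > 0"
  shows "(\<lambda>r. c * f r) \<in> radial_class TYPE('n) p q"
proof -
  obtain f' f'' where rp: "radial_profile f f' f''" and pos: "\<And>r. r > 0 \<Longrightarrow> f'' r > 0"
    and lim: "((\<lambda>x :: real ^ 'n. pq_operator p q (radial_profile.radial_grad f' x) (matrix (radial_profile.radial_hess f' f'' x))) \<longlongrightarrow> 0) (at 0)"
    using radial_classE[OF f] by metis
  interpret radial_profile f f' f'' by (rule rp)
  interpret c: radial_profile "\<lambda>r. c * f r" "\<lambda>r. c * f' r" "\<lambda>r. c * f'' r"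
    using f1 f2 f2c f0 by unfold_locales (auto intro!: DERIV_cmult continuous_intros)
  have s: "c.radial_grad x = c *\<^sub>R radial_grad x" "matrix (c.radial_hess x) = c *\<^sub>R matrix (radial_hess x)" for x :: "real ^ 'n"
  proof -
    show "c.radial_grad x = c *\<^sub>R radial_grad x" by (simp add: c.radial_grad_def radial_grad_def)
    have "c.radial_hess x v = c *\<^sub>R radial_hess x v" for v
    proof -
      have "c * f'' (norm x) - c * f' (norm x) / norm x = c * (f'' (norm x) - f' (norm x) / norm x)" by (simp add: algebra_simps)
      then show ?thesis unfolding c.radial_hess_def radial_hess_def by (simp add: scaleR_add_right)
    qed
    then show "matrix (c.radial_hess x) = c *\<^sub>R matrix (radial_hess x)" by (simp add: matrix_def vec_eq_iff)
  qed
  have "((\<lambda>x :: real ^ 'n. pq_operator p q (c.radial_grad x) (matrix (c.radial_hess x))) \<longlongrightarrow> 0) (at 0)"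
    unfolding s pq_operator_scale[OF c] using tendsto_mult_right_zero[OF lim] by simp
  then show ?thesis unfolding radial_class_def
    using c.f1 c.f2 c.f2c c.f0 pos c c.radial_grad_hess[where 'n = 'n] 
    by (intro CollectI conjI exI[of _ "\<lambda>r. c * f' r"] exI[of _ "\<lambda>r. c * f'' r"]) auto
qed

lemma radial_profile_power:
  assumes "m \<ge> 3"
  shows "radial_profile (\<lambda>r. r ^ m) (\<lambda>r. real m * r ^ (m - 1)) (\<lambda>r. real m * (real (m - 1) * r ^ (m - 2)))"
proof
  fix r :: real
  show "((\<lambda>r. r ^ m) has_real_derivative real m * r ^ (m - 1)) (at r within {0..})" by (auto intro!: derivative_eq_intros)
  show "((\<lambda>r. real m * r ^ (m - 1)) has_real_derivative real m * (real (m - 1) * r ^ (m - 2))) (at r within {0..})"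
    by (auto intro!: derivative_eq_intros simp: numeral_2_eq_2)
qed (use assms in \<open>auto intro!: continuous_intros\<close>)

text \<open>The operator of the power is a constant times \<open>norm x powr s\<close> with
  \<open>s = (m - 1) * (q - 1) - 1\<close>, and the hypothesis on \<open>m\<close> says
  \<open>s > 0\<close>. For \<open>q\<close> near 1 this forces a large exponent.\<close>

lemma power_in_radial_class:
  fixes p q :: real
  assumes m: "m \<ge> 3" and mq: "(real m - 1) * (q - 1) > 1"
  shows "(\<lambda>r. r ^ m) \<in> radial_class TYPE('n::finite) p q"
proof -
  interpret radial_profile "\<lambda>r. r ^ m" "\<lambda>r. real m * r ^ (m - 1)" "\<lambda>r. real m * (real (m - 1) * r ^ (m - 2))"
    by (rule radial_profile_power[OF m])
  define K where "K = real m powr (q - 2) * ((real CARD('n) - 1) * m + (p - 1) * (real m * real (m - 1)))"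
  define s where "s = (real m - 1) * (q - 1) - 1"
  have eq: "pq_operator p q (radial_grad x) (matrix (radial_hess x)) = K * norm x powr s" if x: "x \<noteq> 0" for x :: "real ^ 'n"
  proof -
    let ?r = "norm x"
    have r: "?r > 0" using x by simp
    have m1: "?r ^ (m - 1) = ?r * ?r ^ (m - 2)" 
    proof -
      have "m - 1 = Suc (m - 2)" using m by simp
      then show ?thesis by (simp only: power_Suc)
    qed
    have "pq_operator p q (radial_grad x) (matrix (radial_hess x)) =
      (real m * ?r ^ (m - 1)) powr (q - 2) * ((real CARD('n) - 1) * (real m * ?r ^ (m - 1) / ?r) + (p - 1) * (real m * (real (m - 1) * ?r ^ (m - 2))))"
      using r m by (intro radial_pq_operator[OF x]) simp
    also have "\<dots> = K * ((?r ^ (m - 1)) powr (q - 2) * ?r ^ (m - 2))"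
    proof -
      let ?P = "?r ^ (m - 2)"
      have 1: "real m * (?r * ?P) / ?r = real m * ?P" using r by simp
      have 2: "(real m * (?r * ?P)) powr (q - 2) = real m powr (q - 2) * (?r * ?P) powr (q - 2)" by (simp add: powr_mult)
      have "A * B * (n1 * (m' * P) + p1 * (m' * (m1 * P))) = (A * (n1 * m' + p1 * (m' * m1))) * (B * P)"
        for A B n1 m' P p1 m1 :: real by (simp add: algebra_simps)
      then show ?thesis unfolding m1 1 2 K_def .
    qed
    also have "(?r ^ (m - 1)) powr (q - 2) * ?r ^ (m - 2) = ?r powr s"
    proof -
      have 1: "?r ^ (m - 1) = ?r powr (real m - 1)" using powr_realpow[OF r, of "m - 1"] m by (simp add: of_nat_diff)
      have 2: "?r ^ (m - 2) = ?r powr (real m - 2)" using powr_realpow[OF r, of "m - 2"] m by (simp add: of_nat_diff)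
      have "(real m - 1) * (q - 2) + (real m - 2) = s" by (simp add: s_def algebra_simps)
      then show ?thesis by (simp only: 1 2 powr_powr powr_add[symmetric])
    qed
    finally show ?thesis .
  qed
  have s0: "s > 0" using mq by (simp add: s_def)
  have "((\<lambda>x::real ^ 'n. norm x) \<longlongrightarrow> 0) (at 0)" by (rule tendsto_norm_zero) simp
  then have "((\<lambda>x::real ^ 'n. norm x powr s) \<longlongrightarrow> 0) (at 0)"
    using s0 by (intro tendsto_zero_powrI[where g = "\<lambda>_. s" and b = s] tendsto_const always_eventually) auto
  then have "((\<lambda>x::real ^ 'n. K * norm x powr s) \<longlongrightarrow> K * 0) (at 0)" by (rule tendsto_mult_left)
  then have "((\<lambda>x :: real ^ 'n. pq_operator p q (radial_grad x) (matrix (radial_hess x))) \<longlongrightarrow> 0) (at 0)"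
  proof (subst tendsto_cong[where g = "\<lambda>x. K * norm x powr s"])
    show "\<forall>\<^sub>F x :: real ^ 'n in at 0. pq_operator p q (radial_grad x) (matrix (radial_hess x)) = K * norm x powr s"
      by (rule eventually_mono[OF eventually_neq_at_within eq])
  qed simp
  then show ?thesis unfolding radial_class_def
    using f1 f2 f2c f0 radial_grad_hess[where 'n = 'n] m
    by (intro CollectI conjI exI[of _ "\<lambda>r. real m * r ^ (m - 1)"] exI[of _ "\<lambda>r. real m * (real (m - 1) * r ^ (m - 2))"]) auto
qed

section \<open>Test functions that separate space and time\<close>

lemma C2_data_fst:
  assumes 1: "C2_data UNIV \<phi> g H"
  shows "C2_data S (\<lambda>z::'a::euclidean_space \<times> 'b::euclidean_space. \<phi> (fst z)) (\<lambda>z. (g (fst z), 0)) (\<lambda>z v. (H (fst z) (fst v), 0))"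
  unfolding C2_data_def
proof (intro conjI ballI allI)
  fix z :: "'a \<times> 'b"
  have f: "(fst has_derivative fst) (at z)" by (rule bounded_linear_imp_has_derivative[OF bounded_linear_fst])
  show "((\<lambda>z. \<phi> (fst z)) has_derivative (\<lambda>h. (g (fst z), 0) \<bullet> h)) (at z)"
    using has_derivative_compose[OF f C2_dataD(1)[OF 1 UNIV_I]] by (simp add: inner_prod_def)
  show "((\<lambda>z. (g (fst z), 0::'b)) has_derivative (\<lambda>v. (H (fst z) (fst v), 0))) (at z)"
    by (intro has_derivative_Pair has_derivative_compose[OF f C2_dataD(2)[OF 1 UNIV_I]] has_derivative_const)
next
  fix v :: "'a \<times> 'b"
  show "continuous_on S (\<lambda>z. (H (fst z) (fst v), 0::'b))"
    by (intro continuous_intros continuous_on_compose2[OF C2_dataD(3)[OF 1]]) auto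
qed

lemma C2_data_snd_real:
  fixes \<rho> \<rho>' \<rho>'' :: "real \<Rightarrow> real"
  assumes "\<And>t. (\<rho> has_real_derivative \<rho>' t) (at t)" "\<And>t. (\<rho>' has_real_derivative \<rho>'' t) (at t)" "continuous_on UNIV \<rho>''"
  shows "C2_data S (\<lambda>z::'a::euclidean_space \<times> real. \<rho> (snd z)) (\<lambda>z. (0, \<rho>' (snd z))) (\<lambda>z v. (0, \<rho>'' (snd z) * snd v))"
  unfolding C2_data_def
proof (intro conjI ballI allI)
  fix z :: "'a \<times> real"
  have f: "(snd has_derivative snd) (at z)" by (rule bounded_linear_imp_has_derivative[OF bounded_linear_snd])
  have 1: "(\<rho> has_derivative (\<lambda>h. \<rho>' (snd z) * h)) (at (snd z))" "(\<rho>' has_derivative (\<lambda>h. \<rho>'' (snd z) * h)) (at (snd z))"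
    using assms(1,2) unfolding has_field_derivative_def .
  show "((\<lambda>z. \<rho> (snd z)) has_derivative (\<lambda>h. (0, \<rho>' (snd z)) \<bullet> h)) (at z)"
    using has_derivative_compose[OF f 1(1)] by (simp add: inner_prod_def)
  show "((\<lambda>z. (0::'a, \<rho>' (snd z))) has_derivative (\<lambda>v. (0, \<rho>'' (snd z) * snd v))) (at z)"
    by (intro has_derivative_Pair has_derivative_compose[OF f 1(2)] has_derivative_const)
next
  fix v :: "'a \<times> real"
  show "continuous_on S (\<lambda>z. (0::'a, \<rho>'' (snd z) * snd v))"
    by (intro continuous_intros continuous_on_compose2[OF assms(3)]) auto
qed

text \<open>Makes the time part of a test function admissible: its remainder is dominated by
  \<open>D * r^2\<close>, a member of \<open>time_class\<close>.\<close>

lemma quadratic_remainder_at: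
  fixes h h' :: "real \<Rightarrow> real"
  assumes h: "\<And>t. (h has_real_derivative h' t) (at t)" and h': "(h' has_real_derivative d) (at t1)"
  shows "\<exists>\<delta>>0. \<exists>D>0. \<forall>t. \<bar>t - t1\<bar> < \<delta> \<longrightarrow> \<bar>h t - h t1 - h' t1 * (t - t1)\<bar> \<le> D * (t - t1)\<^sup>2"
proof -
  have "\<forall>e>0. \<exists>d'>0. \<forall>y. norm (y - t1) < d' \<longrightarrow> norm (h' y - h' t1 - d * (y - t1)) \<le> e * norm (y - t1)"
    using h' unfolding has_field_derivative_def has_derivative_at_alt by blast
  from this[rule_format, of 1] obtain \<delta> where \<delta>: "\<delta> > 0" "\<And>y. \<bar>y - t1\<bar> < \<delta> \<Longrightarrow> \<bar>h' y - h' t1 - d * (y - t1)\<bar> \<le> \<bar>y - t1\<bar>" by auto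
  define D where "D = \<bar>d\<bar> + 1"
  have lip: "\<bar>h' y - h' t1\<bar> \<le> D * \<bar>y - t1\<bar>" if "\<bar>y - t1\<bar> < \<delta>" for y
  proof -
    have "\<bar>d * (y - t1)\<bar> = \<bar>d\<bar> * \<bar>y - t1\<bar>" by (rule abs_mult)
    then show ?thesis using \<delta>(2)[OF that] by (simp add: D_def distrib_right)
  qed
  have "\<bar>h t - h t1 - h' t1 * (t - t1)\<bar> \<le> D * (t - t1)\<^sup>2" if t: "\<bar>t - t1\<bar> < \<delta>" for t
  proof -
    have "\<exists>z. \<bar>z - t1\<bar> \<le> \<bar>t - t1\<bar> \<and> h t - h t1 = (t - t1) * h' z"
    proof (cases t t1 rule: linorder_cases)
      case less
      from MVT2[OF this, of h h'] h obtain z where "t < z" "z < t1" "h t1 - h t = (t1 - t) * h' z" by blast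
      then show ?thesis by (intro exI[of _ z]) (auto simp: algebra_simps)
    next
      case greater
      from MVT2[OF this, of h h'] h obtain z where "t1 < z" "z < t" "h t - h t1 = (t - t1) * h' z" by blast
      then show ?thesis by (intro exI[of _ z]) auto
    qed auto
    then obtain z where z: "\<bar>z - t1\<bar> \<le> \<bar>t - t1\<bar>" "h t - h t1 = (t - t1) * h' z" by blast
    have "h t - h t1 - h' t1 * (t - t1) = (t - t1) * (h' z - h' t1)" by (simp only: z(2)) (simp add: algebra_simps)
    also have "\<bar>\<dots>\<bar> \<le> \<bar>t - t1\<bar> * (D * \<bar>t - t1\<bar>)"
    proof -
      have "\<bar>h' z - h' t1\<bar> \<le> D * \<bar>z - t1\<bar>" using lip z t by simp
      also have "\<dots> \<le> D * \<bar>t - t1\<bar>" using z by (intro mult_left_mono) (auto simp: D_def)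
      finally show ?thesis unfolding abs_mult by (intro mult_left_mono) auto
    qed
    also have "\<dots> = D * (t - t1)\<^sup>2" by (simp add: power2_eq_square mult_ac flip: abs_mult)
    finally show ?thesis .
  qed
  then show ?thesis using \<delta>(1) by (intro exI[of _ \<delta>] conjI exI[of _ D]) (auto simp: D_def)
qed

lemma quadratic_in_time_class: "D > 0 \<Longrightarrow> (\<lambda>r. D * r\<^sup>2) \<in> time_class"
proof -
  assume D: "D > 0"
  have d: "((\<lambda>r. D * r\<^sup>2) has_real_derivative 2 * D * r) (at r)" for r by (auto intro!: derivative_eq_intros)
  have "(\<lambda>r. D * r\<^sup>2) C1_differentiable_on UNIV"
    unfolding C1_differentiable_on_def
  proof (intro exI conjI ballI)
    show "((\<lambda>r. D * r\<^sup>2) has_vector_derivative 2 * D * r) (at r)" for r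
      using d by (simp add: has_real_derivative_iff_has_vector_derivative)
  qed (intro continuous_intros)
  then show ?thesis unfolding time_class_def using D d[of 0] by (auto dest: DERIV_imp_deriv)
qed

section \<open>Testing a supersolution with nonstrict contact\<close>

context
  fixes p q :: real and \<Theta> :: "((real ^ 'n) \<times> real) set" and u :: "(real ^ 'n) \<times> real \<Rightarrow> ereal"
  assumes sol: "viscosity_supersolution p q \<Theta> u" and op: "open \<Theta>"
begin

text \<open>Subtracting \<open>norm (z - y) ^ 4\<close> makes the contact strict without changing
  gradient or Hessian at \<open>y\<close>, and a constant adjusts the height.\<close>

lemma supersolution_touched:
  assumes D: "C2_data \<Theta> \<phi> g H" and y: "y \<in> \<Theta>" "u y = ereal a"
    and touch: "\<forall>\<^sub>F z in at y. ereal (\<phi> z - \<phi> y + a) \<le> u z" and nz: "fst (g y) \<noteq> 0"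
  shows "pq_operator p q (fst (g y)) (matrix (space_hess (H y))) \<le> snd (g y)"
proof -
  interpret radial_profile "\<lambda>r. r ^ 4" "\<lambda>r. real 4 * r ^ (4 - 1)" "\<lambda>r. real 4 * (real (4 - 1) * r ^ (4 - 2))"
    by (rule radial_profile_power) simp
  define \<psi> where "\<psi> z = \<phi> z + - 1 * norm (z - y) ^ 4 + (a - \<phi> y)" for z
  define g' where "g' z = g z + (- 1) *\<^sub>R radial_grad (z - y) + 0" for z
  define H' where "H' z v = H z v + (- 1) *\<^sub>R radial_hess (z - y) v + 0" for z v
  have D': "C2_data \<Theta> \<psi> g' H'" unfolding \<psi>_def g'_def H'_def
    by (intro C2_data_add D C2_data_scale C2_data_const C2_data_shift C2_data_radial)
  have gy: "g' y = g y" unfolding g'_def by (simp only: diff_self radial_at_0 scaleR_zero_right add_0_right)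
  have Hy: "space_hess (H' y) = space_hess (H y)" 
    unfolding fun_eq_iff space_hess_def H'_def by (intro allI) (simp only: diff_self radial_at_0 scaleR_zero_right add_0_right)
  note ops = C2_data_operators[OF D' op y(1), unfolded gy Hy]
  have "touches_from_below \<Theta> \<psi> u y" unfolding touches_from_below_def
  proof
    show "ereal (\<psi> y) = u y" using y by (simp add: \<psi>_def)
    have "\<forall>\<^sub>F z in at y within \<Theta>. ereal (\<phi> z - \<phi> y + a) \<le> u z"
      using touch by (rule filter_leD[OF at_le[OF subset_UNIV]])
    moreover have "\<forall>\<^sub>F z in at y within \<Theta>. z \<noteq> y" by (rule eventually_neq_at_within)
    ultimately show "\<forall>\<^sub>F z in at y within \<Theta>. ereal (\<psi> z) < u z"
    proof eventually_elim
      case (elim z)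
      have "\<psi> z < \<phi> z - \<phi> y + a" using elim(2) by (simp add: \<psi>_def)
      then show ?case using elim(1) by (metis ereal_less_eq(3) less_le_trans less_ereal.simps(1))
    qed
  qed
  moreover have "admissible_at p q \<Theta> \<psi> y" using nz ops(1) by (simp add: admissible_at_def)
  ultimately have "time_deriv \<psi> y - spatial_pq_laplacian p q \<psi> y \<ge> 0"
    using sol y(1) C2_data_imp_C2_on[OF D'] nz ops(1) unfolding viscosity_supersolution_def by (metis (no_types, lifting))
  then show ?thesis using ops by simp
qed

text \<open>The test function has zero spatial gradient at \<open>x0\<close>. Doubling
  \<open>f\<close> and subtracting \<open>(t - t1)^2\<close> makes the contact strict, and the
  result is admissible since \<open>2 * f\<close> is again in the radial class.\<close>

lemma supersolution_touched_degenerate: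
  assumes f: "f \<in> radial_class TYPE('n) p q"
    and \<rho>: "\<And>t. (\<rho> has_real_derivative \<rho>' t) (at t)" "\<And>t. (\<rho>' has_real_derivative \<rho>'' t) (at t)" "continuous_on UNIV \<rho>''"
    and y: "(x0, t1) \<in> \<Theta>" "u (x0, t1) = ereal a"
    and touch: "\<forall>\<^sub>F z in at (x0, t1). ereal (\<rho> (snd z) - \<rho> t1 - f (norm (fst z - x0)) + a) \<le> u z"
  shows "\<rho>' t1 \<ge> 0"
proof -
  obtain f' f'' where rp: "radial_profile f f' f''" and fpos: "\<And>r. r > 0 \<Longrightarrow> f r > 0"
    using radial_classE[OF f] by metis
  interpret radial_profile f f' f'' by (rule rp)
  have f2: "(\<lambda>r. 2 * f r) \<in> radial_class TYPE('n) p q" by (rule radial_class_scale[OF f]) simp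
  define \<rho>2 where "\<rho>2 t = \<rho> t - (t - t1)\<^sup>2" for t
  have \<rho>2: "(\<rho>2 has_real_derivative \<rho>' t - 2 * (t - t1)) (at t)" "((\<lambda>t. \<rho>' t - 2 * (t - t1)) has_real_derivative \<rho>'' t - 2) (at t)" for t
    unfolding \<rho>2_def by (auto intro!: derivative_eq_intros \<rho>)
  have \<rho>2c: "continuous_on UNIV (\<lambda>t. \<rho>'' t - 2)" by (intro continuous_intros \<rho>)
  define \<psi> where "\<psi> z = (- 2) * f (norm (fst z - x0)) + \<rho>2 (snd z) + (a - \<rho> t1)" for z :: "(real ^ 'n) \<times> real"
  define g where "g z = (- 2) *\<^sub>R (radial_grad (fst z - x0), 0) + (0, \<rho>' (snd z) - 2 * (snd z - t1)) + 0" for z :: "(real ^ 'n) \<times> real"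
  define H where "H z v = (- 2) *\<^sub>R (radial_hess (fst z - x0) (fst v), 0) + (0, (\<rho>'' (snd z) - 2) * snd v) + 0" for z v :: "(real ^ 'n) \<times> real"
  have D: "C2_data \<Theta> \<psi> g H" unfolding \<psi>_def g_def H_def
    by (intro C2_data_add C2_data_scale C2_data_const C2_data_snd_real \<rho>2 \<rho>2c
      C2_data_fst[where \<phi> = "\<lambda>x. f (norm (x - x0))" and g = "\<lambda>x. radial_grad (x - x0)" and H = "\<lambda>x. radial_hess (x - x0)"]
      C2_data_shift C2_data_radial)
  have gy: "g (x0, t1) = (0, \<rho>' t1)" by (simp add: g_def zero_prod_def)
  note ops = C2_data_operators[OF D op y(1), unfolded gy fst_conv snd_conv]
  have \<psi>y: "\<psi> (x0, t1) = a" by (simp add: \<psi>_def f0 \<rho>2_def)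
  have "touches_from_below \<Theta> \<psi> u (x0, t1)" unfolding touches_from_below_def
  proof
    show "ereal (\<psi> (x0, t1)) = u (x0, t1)" using y \<psi>y by simp
    have "\<forall>\<^sub>F z in at (x0, t1) within \<Theta>. ereal (\<rho> (snd z) - \<rho> t1 - f (norm (fst z - x0)) + a) \<le> u z"
      using touch by (rule filter_leD[OF at_le[OF subset_UNIV]])
    moreover have "\<forall>\<^sub>F z in at (x0, t1) within \<Theta>. z \<noteq> (x0, t1)" by (rule eventually_neq_at_within)
    ultimately show "\<forall>\<^sub>F z in at (x0, t1) within \<Theta>. ereal (\<psi> z) < u z"
    proof eventually_elim
      case (elim z)
      have "f (norm (fst z - x0)) + (snd z - t1)\<^sup>2 > 0"
      proof (cases "fst z = x0")
        case True
        then show ?thesis using elim(2) f0 by (auto simp: prod_eq_iff)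
      qed (use fpos[of "norm (fst z - x0)"] in \<open>auto intro: add_pos_nonneg\<close>)
      then have "\<psi> z < \<rho> (snd z) - \<rho> t1 - f (norm (fst z - x0)) + a" by (simp add: \<psi>_def \<rho>2_def)
      then show ?case using elim(1) by (metis less_le_trans less_ereal.simps(1))
    qed
  qed
  moreover have "admissible_at p q \<Theta> \<psi> (x0, t1)"
  proof -
    obtain \<delta>1 D1 where d1: "\<delta>1 > 0" "D1 > 0" "\<And>t. \<bar>t - t1\<bar> < \<delta>1 \<Longrightarrow> \<bar>\<rho>2 t - \<rho>2 t1 - (\<rho>' t1 - 2 * (t1 - t1)) * (t - t1)\<bar> \<le> D1 * (t - t1)\<^sup>2"
      using quadratic_remainder_at[OF \<rho>2] by blast
    obtain A B where AB: "open A" "open B" "(x0, t1) \<in> A \<times> B" "A \<times> B \<subseteq> \<Theta>" using open_prod_elim[OF op y(1)] by blast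
    obtain e1 where e1: "e1 > 0" "ball x0 e1 \<subseteq> A" using AB open_contains_ball by blast
    obtain e2 where e2: "e2 > 0" "ball t1 e2 \<subseteq> B" using AB open_contains_ball by blast
    define \<delta> where "\<delta> = min \<delta>1 (min e1 e2)"
    show ?thesis unfolding admissible_at_def fst_conv snd_conv
    proof (intro disjI2 exI[of _ \<delta>] conjI bexI[OF _ f2] bexI[OF _ quadratic_in_time_class[OF d1(2)]] ballI)
      show "\<delta> > 0" using d1 e1 e2 by (simp add: \<delta>_def)
      have "{t1 - \<delta><..<t1 + \<delta>} \<subseteq> ball t1 e2" by (auto simp: \<delta>_def dist_real_def)
      show "ball x0 \<delta> \<times> {t1 - \<delta><..<t1 + \<delta>} \<subseteq> \<Theta>" 
      proof -
        have "ball x0 \<delta> \<subseteq> ball x0 e1" by (rule subset_ball) (simp add: \<delta>_def)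
        then have "ball x0 \<delta> \<subseteq> A" using e1 by blast
        then show ?thesis using \<open>{t1 - \<delta><..<t1 + \<delta>} \<subseteq> ball t1 e2\<close> e2 AB(4) by blast
      qed
      fix x t assume x: "x \<in> ball x0 \<delta>" and t: "t \<in> {t1 - \<delta><..<t1 + \<delta>}"
      have "\<bar>t - t1\<bar> < \<delta>1" using t by (auto simp: \<delta>_def abs_less_iff)
      from d1(3)[OF this] have 1: "\<bar>\<rho>2 t - \<rho>2 t1 - \<rho>' t1 * (t - t1)\<bar> \<le> D1 * (t - t1)\<^sup>2" by simp
      have 2: "f (norm (x - x0)) \<ge> 0" using fpos[of "norm (x - x0)"] f0 by (cases "x = x0") (auto intro: less_imp_le)
      have "\<psi> (x, t) - \<psi> (x0, t1) - time_deriv \<psi> (x0, t1) * (t - t1) = - (2 * f (norm (x - x0))) + (\<rho>2 t - \<rho>2 t1 - \<rho>' t1 * (t - t1))"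
        unfolding \<psi>y ops(2) by (simp add: \<psi>_def \<rho>2_def)
      then show "\<bar>\<psi> (x, t) - \<psi> (x0, t1) - time_deriv \<psi> (x0, t1) * (t - t1)\<bar> \<le> 2 * f (norm (x - x0)) + D1 * (t - t1)\<^sup>2"
        using 1 2 by linarith
    qed
  qed
  ultimately have "time_deriv \<psi> (x0, t1) \<ge> 0"
    using sol y(1) C2_data_imp_C2_on[OF D] ops(1) unfolding viscosity_supersolution_def by (metis (no_types, lifting))
  then show ?thesis using ops(2) by simp
qed

end

subsection \<open>The comparison principle\<close>

text \<open>Allows the power penalty to be replaced, near a given difference vector, by a quadratic
  one.\<close>

lemma C2_data_upper_quadratic:
  assumes D: "C2_data UNIV \<phi> g H"
  shows "\<exists>r>0. \<exists>C\<ge>0. \<forall>h. norm h < r \<longrightarrow> \<phi> (z + h) \<le> \<phi> z + g z \<bullet> h + C * (norm h)\<^sup>2"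
proof -
  have dg: "(g has_derivative H z) (at z)" using C2_dataD(2)[OF D] by simp
  then have "\<forall>e>0. \<exists>d>0. \<forall>y. norm (y - z) < d \<longrightarrow> norm (g y - g z - H z (y - z)) \<le> e * norm (y - z)"
    unfolding has_derivative_at_alt by blast
  from this[rule_format, of 1] obtain r where r: "r > 0" "\<And>y. norm (y - z) < r \<Longrightarrow> norm (g y - g z - H z (y - z)) \<le> norm (y - z)" by auto
  obtain K where K: "K > 0" "\<And>v. norm (H z v) \<le> norm v * K" using bounded_linear.pos_bounded[OF C2_dataD(4)[OF D UNIV_I]] by blast
  have "\<phi> (z + h) \<le> \<phi> z + g z \<bullet> h + (K + 1) * (norm h)\<^sup>2" if h: "norm h < r" for h
  proof -
    have d: "((\<lambda>t. \<phi> (z + t *\<^sub>R h)) has_real_derivative g (z + t *\<^sub>R h) \<bullet> h) (at t)" for t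
    proof -
      have "((\<lambda>t. z + t *\<^sub>R h) has_derivative (\<lambda>s. s *\<^sub>R h)) (at t)" by (auto intro!: derivative_eq_intros)
      from has_derivative_compose[OF this C2_dataD(1)[OF D UNIV_I]]
      show ?thesis by (simp add: has_field_derivative_def mult_commute_abs)
    qed
    from MVT2[of 0 1 "\<lambda>t. \<phi> (z + t *\<^sub>R h)" "\<lambda>t. g (z + t *\<^sub>R h) \<bullet> h"] d
    obtain t where t: "0 < t" "t < 1" "\<phi> (z + h) - \<phi> z = g (z + t *\<^sub>R h) \<bullet> h" by auto
    let ?y = "z + t *\<^sub>R h"
    have th: "norm (t *\<^sub>R h) \<le> norm h" using t by (simp add: mult_left_le_one_le)
    have "norm (g ?y - g z) \<le> norm (g ?y - g z - H z (t *\<^sub>R h)) + norm (H z (t *\<^sub>R h))"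
      using norm_triangle_ineq[of "g ?y - g z - H z (t *\<^sub>R h)" "H z (t *\<^sub>R h)"] by simp
    also have "\<dots> \<le> norm (t *\<^sub>R h) + norm (t *\<^sub>R h) * K"
      using r(2)[of ?y] th h K(2)[of "t *\<^sub>R h"] by (intro add_mono) auto
    also have "\<dots> = (K + 1) * norm (t *\<^sub>R h)" by (simp add: algebra_simps)
    also have "\<dots> \<le> (K + 1) * norm h" using th K by (intro mult_left_mono) auto
    finally have 1: "norm (g ?y - g z) \<le> (K + 1) * norm h" .
    have "g ?y \<bullet> h = g z \<bullet> h + (g ?y - g z) \<bullet> h" by (simp add: inner_diff_left)
    also have "(g ?y - g z) \<bullet> h \<le> norm (g ?y - g z) * norm h" by (rule norm_cauchy_schwarz)
    also have "\<dots> \<le> (K + 1) * norm h * norm h" using 1 by (intro mult_right_mono) auto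
    finally show ?thesis using t(3) by (simp add: power2_eq_square mult.assoc)
  qed
  then show ?thesis using r(1) K(1) by (intro exI[of _ r] conjI exI[of _ "K + 1"]) auto
qed

lemma pq_operator_tendsto:
  fixes A :: "'c \<Rightarrow> real ^ 'n ^ 'n"
  assumes e: "(e \<longlongrightarrow> \<nu>) F" and A: "(A \<longlongrightarrow> A0) F" and \<nu>: "\<nu> \<noteq> 0"
  shows "((\<lambda>x. pq_operator p q (e x) (A x)) \<longlongrightarrow> pq_operator p q \<nu> A0) F"
proof -
  have mv: "((\<lambda>x. A x *v e x) \<longlongrightarrow> A0 *v \<nu>) F"
    unfolding matrix_vector_mult_def by (intro tendsto_intros e A)
  have tr: "((\<lambda>x. trace (A x)) \<longlongrightarrow> trace A0) F" unfolding trace_def by (intro tendsto_intros A)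
  show ?thesis unfolding pq_operator_alt using \<nu>
    by (intro tendsto_intros mv tr e) auto
qed

text \<open>The two gradients are opposite only up to \<open>\<epsilon>\<close>, and the operator is
  nonlinear in the gradient, so the inequalities cannot be added at once. The common bound
  \<open>R\<close> gives convergent subsequences of the matrices; in the limit oddness and
  additivity merge the inequalities into one for \<open>A0 + B0\<close>.\<close>

lemma pq_operator_limit:
  fixes \<nu> :: "real ^ 'n" and p q R \<eta> S1 S2 :: real
  assumes p: "p > 1" and \<nu>: "\<nu> \<noteq> 0" and \<eta>: "\<eta> \<ge> 0"
    and ex: "\<And>\<epsilon>. \<epsilon> > 0 \<Longrightarrow> \<exists>e1 s1 A e2 s2 B. norm (e1 + \<nu>) < \<epsilon> \<and> \<bar>s1 - S1\<bar> < \<epsilon> \<and> norm (e2 - \<nu>) < \<epsilon> \<and> \<bar>s2 - S2\<bar> < \<epsilon> \<and>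
      norm A \<le> R \<and> norm B \<le> R \<and> (\<forall>\<xi>. \<xi> \<bullet> ((A + B) *v \<xi>) \<ge> - (\<eta> * (norm \<xi>)\<^sup>2)) \<and>
      pq_operator p q e1 A \<le> s1 \<and> pq_operator p q e2 B \<le> s2"
  shows "S1 + S2 \<ge> - (norm \<nu> powr (q - 2) * (\<eta> * (CARD('n) + p - 1)))"
proof -
  have "\<forall>n::nat. \<exists>e1 s1 A e2 s2 B. norm (e1 + \<nu>) < 1 / Suc n \<and> \<bar>s1 - S1\<bar> < 1 / Suc n \<and> norm (e2 - \<nu>) < 1 / Suc n \<and> \<bar>s2 - S2\<bar> < 1 / Suc n \<and>
      norm A \<le> R \<and> norm B \<le> R \<and> (\<forall>\<xi>. \<xi> \<bullet> ((A + B) *v \<xi>) \<ge> - (\<eta> * (norm \<xi>)\<^sup>2)) \<and>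
      pq_operator p q e1 A \<le> s1 \<and> pq_operator p q e2 B \<le> s2"
    by (intro allI ex) simp
  then obtain e1 s1 A e2 s2 B where *: "\<forall>n::nat. norm (e1 n + \<nu>) < 1 / Suc n \<and> \<bar>s1 n - S1\<bar> < 1 / Suc n \<and> norm (e2 n - \<nu>) < 1 / Suc n \<and> \<bar>s2 n - S2\<bar> < 1 / Suc n \<and>
      norm (A n) \<le> R \<and> norm (B n) \<le> R \<and> (\<forall>\<xi>. \<xi> \<bullet> ((A n + B n) *v \<xi>) \<ge> - (\<eta> * (norm \<xi>)\<^sup>2)) \<and>
      pq_operator p q (e1 n) (A n) \<le> s1 n \<and> pq_operator p q (e2 n) (B n) \<le> s2 n"
    by metis
  have lim0: "(\<lambda>n::nat. 1 / real (Suc n)) \<longlonglongrightarrow> 0" using LIMSEQ_Suc[OF lim_1_over_n] by simp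
  have le1: "e1 \<longlonglongrightarrow> - \<nu>"
  proof -
    have "(\<lambda>n. e1 n + \<nu>) \<longlonglongrightarrow> 0"
      by (rule Lim_null_comparison[OF _ lim0]) (use * in \<open>auto intro!: always_eventually less_imp_le\<close>)
    then show ?thesis using LIM_zero_iff[of e1 "- \<nu>"] by simp
  qed
  have le2: "e2 \<longlonglongrightarrow> \<nu>"
  proof -
    have "(\<lambda>n. e2 n - \<nu>) \<longlonglongrightarrow> 0"
      by (rule Lim_null_comparison[OF _ lim0]) (use * in \<open>auto intro!: always_eventually less_imp_le\<close>)
    then show ?thesis by (simp add: LIM_zero_iff)
  qed
  have ls: "s1 \<longlonglongrightarrow> S1" "s2 \<longlonglongrightarrow> S2"
  proof -
    have "(\<lambda>n. s1 n - S1) \<longlonglongrightarrow> 0" "(\<lambda>n. s2 n - S2) \<longlonglongrightarrow> 0"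
      by (rule Lim_null_comparison[OF _ lim0]; use * in \<open>auto intro!: always_eventually less_imp_le\<close>)+
    then show "s1 \<longlonglongrightarrow> S1" "s2 \<longlonglongrightarrow> S2" by (simp_all add: LIM_zero_iff)
  qed
  have AB: "\<forall>n. (A n, B n) \<in> cball 0 R \<times> cball 0 R" using * by simp
  have sc: "seq_compact (cball (0::real ^ 'n ^ 'n) R \<times> cball (0::real ^ 'n ^ 'n) R)"
    by (intro compact_imp_seq_compact compact_Times compact_cball)
  obtain l \<sigma> where \<sigma>: "strict_mono \<sigma>" "((\<lambda>n. (A n, B n)) \<circ> \<sigma>) \<longlonglongrightarrow> l"
    by (rule seq_compactE[OF sc AB]) (rule that)
  obtain A0 B0 where l: "l = (A0, B0)" by (cases l)
  have lA: "(\<lambda>n. A (\<sigma> n)) \<longlonglongrightarrow> A0" using tendsto_fst[OF \<sigma>(2)] by (simp add: l o_def)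
  have lB: "(\<lambda>n. B (\<sigma> n)) \<longlonglongrightarrow> B0" using tendsto_snd[OF \<sigma>(2)] by (simp add: l o_def)
  have sub: "(\<lambda>n. e1 (\<sigma> n)) \<longlonglongrightarrow> - \<nu>" "(\<lambda>n. e2 (\<sigma> n)) \<longlonglongrightarrow> \<nu>" "(\<lambda>n. s1 (\<sigma> n)) \<longlonglongrightarrow> S1" "(\<lambda>n. s2 (\<sigma> n)) \<longlonglongrightarrow> S2"
    using LIMSEQ_subseq_LIMSEQ[OF le1 \<sigma>(1)] LIMSEQ_subseq_LIMSEQ[OF le2 \<sigma>(1)] LIMSEQ_subseq_LIMSEQ[OF ls(1) \<sigma>(1)] LIMSEQ_subseq_LIMSEQ[OF ls(2) \<sigma>(1)]
    by (simp_all add: o_def)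
  have "pq_operator p q (- \<nu>) A0 \<le> S1"
    by (rule tendsto_le[OF sequentially_bot sub(3) pq_operator_tendsto[OF sub(1) lA]]) (use \<nu> * in auto)
  moreover have "pq_operator p q \<nu> B0 \<le> S2"
    by (rule tendsto_le[OF sequentially_bot sub(4) pq_operator_tendsto[OF sub(2) lB \<nu>]]) (use * in auto)
  ultimately have "pq_operator p q \<nu> (A0 + B0) \<le> S1 + S2" by (simp add: pq_operator_add pq_operator_minus)
  moreover have "pq_operator p q \<nu> (A0 + B0) \<ge> - (norm \<nu> powr (q - 2) * (\<eta> * (CARD('n) + p - 1)))"
  proof (rule pq_operator_lower_bound[OF p \<nu> _ \<eta>])
    fix \<xi> :: "real ^ 'n"
    show "- (\<eta> * (norm \<xi>)\<^sup>2) \<le> \<xi> \<bullet> ((A0 + B0) *v \<xi>)"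
    proof (rule tendsto_le[OF sequentially_bot _ tendsto_const])
      show "(\<lambda>n. \<xi> \<bullet> ((A (\<sigma> n) + B (\<sigma> n)) *v \<xi>)) \<longlonglongrightarrow> \<xi> \<bullet> ((A0 + B0) *v \<xi>)"
        unfolding matrix_vector_mult_def by (intro tendsto_intros lA lB)
    qed (use * in auto)
  qed
  ultimately show ?thesis by linarith
qed

section \<open>Truncation of extended-valued functions\<close>

definition lsc_real_on :: "'a::topological_space set \<Rightarrow> ('a \<Rightarrow> real) \<Rightarrow> bool" where
  "lsc_real_on S U \<longleftrightarrow> (\<forall>z\<in>S. \<forall>c. c < U z \<longrightarrow> (\<exists>V. open V \<and> z \<in> V \<and> (\<forall>w\<in>V \<inter> S. c < U w)))"

text \<open>Makes supersolutions real valued for minimisation; a contact at a value below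
  \<open>N\<close> is a contact with the original function.\<close>

definition truncate_at :: "real \<Rightarrow> ereal \<Rightarrow> real" where
  "truncate_at N x = real_of_ereal (min x (ereal N))"

lemma truncate_at:
  assumes "ereal m \<le> x" "m \<le> N"
  shows "ereal (truncate_at N x) \<le> x" "m \<le> truncate_at N x" "truncate_at N x \<le> N"
    "truncate_at N x < N \<Longrightarrow> x = ereal (truncate_at N x)"
    "c < truncate_at N x \<longleftrightarrow> c < N \<and> ereal c < x"
proof -
  consider (real) y where "x = ereal y" "m \<le> y" | (infinite) "x = \<infinity>"
    using assms(1) by (cases x) auto
  then have "ereal (truncate_at N x) \<le> x \<and> m \<le> truncate_at N x \<and> truncate_at N x \<le> N
    \<and> (truncate_at N x < N \<longrightarrow> x = ereal (truncate_at N x)) \<and> (c < truncate_at N x \<longleftrightarrow> c < N \<and> ereal c < x)"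
  proof cases
    case real
    then have "truncate_at N x = min y N" by (simp add: truncate_at_def min_def)
    then show ?thesis using real assms(2) by (auto simp: min_def)
  next
    case infinite
    then have "truncate_at N x = N" by (simp add: truncate_at_def)
    then show ?thesis using infinite assms(2) by simp
  qed
  then show "ereal (truncate_at N x) \<le> x" "m \<le> truncate_at N x" "truncate_at N x \<le> N"
    "truncate_at N x < N \<Longrightarrow> x = ereal (truncate_at N x)"
    "c < truncate_at N x \<longleftrightarrow> c < N \<and> ereal c < x" by simp_all
qed

lemma lsc_truncate:
  assumes l: "lsc_on S u" and m: "\<And>z. z \<in> S \<Longrightarrow> ereal m \<le> u z" "m \<le> N"
  shows "lsc_real_on S (\<lambda>z. truncate_at N (u z))"
  unfolding lsc_real_on_def
proof (intro ballI allI impI)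
  fix z c assume z: "z \<in> S" and c: "c < truncate_at N (u z)"
  then have c': "c < N" "ereal c < u z" using truncate_at(5)[OF m(1)[OF z] m(2)] by auto
  then have "ereal c < Liminf (at z within S) u" using l z unfolding lsc_on_def by (meson less_le_trans)
  then have "\<forall>\<^sub>F w in at z within S. ereal c < u w" by (rule less_LiminfD)
  then obtain V where V: "open V" "z \<in> V" "\<forall>w\<in>V. w \<noteq> z \<longrightarrow> w \<in> S \<longrightarrow> ereal c < u w" unfolding eventually_at_topological by blast
  then show "\<exists>V. open V \<and> z \<in> V \<and> (\<forall>w\<in>V \<inter> S. c < truncate_at N (u w))"
    using c' truncate_at(5)[OF m(1) m(2)] by (intro exI[of _ V]) auto
qed

lemma lsc_real_on_translate:
  fixes U :: "'a::real_normed_vector \<Rightarrow> real"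
  assumes "lsc_real_on S U" "\<And>h. h \<in> T \<Longrightarrow> z0 + h \<in> S" "z \<in> T" "c < U (z0 + z)"
  shows "\<forall>\<^sub>F h in at z within T. c < U (z0 + h)"
proof -
  obtain V where V: "open V" "z0 + z \<in> V" "\<forall>w\<in>V \<inter> S. c < U w" using assms unfolding lsc_real_on_def by blast
  have "open ((\<lambda>h. z0 + h) -` V)" by (intro open_vimage V continuous_intros)
  then show ?thesis unfolding eventually_at_topological using V assms(2) by (intro exI[of _ "(\<lambda>h. z0 + h) -` V"]) auto
qed

text \<open>The crude entrywise norm bound serves to keep the matrices in a fixed compact
  ball.\<close>

lemma matrix_space_hess:
  fixes X :: "(real ^ 'n) \<times> real \<Rightarrow> (real ^ 'n) \<times> real"
  assumes X: "linear X"
  shows "matrix (space_hess X) *v \<xi> = space_hess X \<xi>" "\<xi> \<bullet> (matrix (space_hess X) *v \<xi>) = X (\<xi>, 0) \<bullet> (\<xi>, 0)"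
    "(\<And>h. norm (X h) \<le> B * norm h) \<Longrightarrow> norm (matrix (space_hess X)) \<le> real CARD('n) * (real CARD('n) * B)"
proof -
  have "linear (\<lambda>x::real ^ 'n. (x, 0::real))" by (auto intro!: linearI)
  from linear_compose[OF linear_compose[OF this X] linear_fst]
  have l: "linear (space_hess X)" by (simp add: space_hess_def[abs_def] o_def)
  then show 1: "matrix (space_hess X) *v \<xi> = space_hess X \<xi>" by (simp add: matrix_works)
  show "\<xi> \<bullet> (matrix (space_hess X) *v \<xi>) = X (\<xi>, 0) \<bullet> (\<xi>, 0)"
    unfolding 1 by (simp add: space_hess_def inner_prod_def inner_commute)
  assume B: "\<And>h. norm (X h) \<le> B * norm h"
  let ?A = "matrix (space_hess X)"
  have e: "\<bar>?A $ i $ k\<bar> \<le> B" for i k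
  proof -
    have "\<bar>?A $ i $ k\<bar> \<le> norm (space_hess X (axis k 1))" unfolding matrix_def using component_le_norm_cart by simp
    also have "\<dots> \<le> norm (X (axis k 1, 0))" unfolding space_hess_def by (metis norm_fst_le prod.collapse)
    also have "\<dots> \<le> B * norm (axis k (1::real) :: real ^ 'n, 0::real)" by (rule B)
    finally show ?thesis by simp
  qed
  have "norm ?A \<le> (\<Sum>i\<in>UNIV. norm (?A $ i))" unfolding norm_vec_def by (rule L2_set_le_sum) simp
  also have "\<dots> \<le> (\<Sum>i\<in>(UNIV::'n set). real CARD('n) * B)"
  proof (rule sum_mono)
    fix i
    have "norm (?A $ i) \<le> (\<Sum>k\<in>UNIV. \<bar>?A $ i $ k\<bar>)" by (rule norm_le_l1_cart)
    also have "\<dots> \<le> (\<Sum>k\<in>(UNIV::'n set). B)" using e by (intro sum_mono) auto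
    finally show "norm (?A $ i) \<le> real CARD('n) * B" by simp
  qed
  finally show "norm ?A \<le> real CARD('n) * (real CARD('n) * B)" by simp
qed

text \<open>The term \<open>\<kappa> * (snd z1 + T)\<close> makes the time inequality strict. At a
  negative minimum of the penalised sum, which is interior, the time slopes add up to
  \<open>- \<kappa>\<close>, whereas the two supersolution tests require the sum to be nonnegative
  on the spatial diagonal and at least \<open>- (Q * \<eta>)\<close> off it.\<close>

theorem comparison:
  fixes p q m :: real and \<Theta> :: "((real ^ 'n) \<times> real) set"
  assumes p: "p > 1" and q: "q > 1" and op: "open \<Theta>" and bd: "bounded \<Theta>"
    and u: "viscosity_supersolution p q \<Theta> u" and w: "viscosity_supersolution p q \<Theta> w"
    and um: "\<And>z. z \<in> \<Theta> \<Longrightarrow> ereal m \<le> u z" and wm: "\<And>z. z \<in> \<Theta> \<Longrightarrow> ereal m \<le> w z"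
    and bnd: "\<And>\<xi>. \<xi> \<in> frontier \<Theta> \<Longrightarrow> \<exists>a b. 0 < a + b \<and> ereal a \<le> Liminf (at \<xi> within \<Theta>) u \<and> ereal b \<le> Liminf (at \<xi> within \<Theta>) w"
    and \<zeta>: "\<zeta> \<in> \<Theta>"
  shows "0 \<le> u \<zeta> + w \<zeta>"
proof (rule ccontr)
  assume neg0: "\<not> 0 \<le> u \<zeta> + w \<zeta>"
  \<comment> \<open>With \<open>N + m > 0\<close>, a truncated value of one function already makes
    the sum positive, the other being at least \<open>m\<close>.\<close>
  define N where "N = \<bar>m\<bar> + 1"
  have N: "m \<le> N" "N + m > 0" by (auto simp: N_def)
  define U W where "U z = truncate_at N (u z)" and "W z = truncate_at N (w z)" for z
  have Up: "ereal (U z) \<le> u z" "m \<le> U z" "U z < N \<Longrightarrow> u z = ereal (U z)" if "z \<in> \<Theta>" for z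
    using truncate_at[OF um[OF that] N(1)] by (auto simp: U_def)
  have Wp: "ereal (W z) \<le> w z" "m \<le> W z" "W z < N \<Longrightarrow> w z = ereal (W z)" if "z \<in> \<Theta>" for z
    using truncate_at[OF wm[OF that] N(1)] by (auto simp: W_def)
  have lU: "lsc_real_on \<Theta> U" unfolding U_def by (rule lsc_truncate[OF _ um N(1)]) (use u in \<open>auto simp: viscosity_supersolution_def\<close>)
  have lW: "lsc_real_on \<Theta> W" unfolding W_def by (rule lsc_truncate[OF _ wm N(1)]) (use w in \<open>auto simp: viscosity_supersolution_def\<close>)
  have UWneg: "U \<zeta> + W \<zeta> < 0"
  proof -
    have "ereal (U \<zeta> + W \<zeta>) \<le> u \<zeta> + w \<zeta>" using add_mono[OF Up(1)[OF \<zeta>] Wp(1)[OF \<zeta>]] by simp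
    also have "u \<zeta> + w \<zeta> < 0" using neg0 by simp
    finally show ?thesis by simp
  qed
  obtain T where T: "\<And>z. z \<in> \<Theta> \<Longrightarrow> norm z \<le> T" using bd bounded_iff by blast
  have T': "\<bar>snd z\<bar> \<le> T" if "z \<in> \<Theta>" for z using T[OF that] norm_snd_le[of "snd z" "fst z"] by simp
  \<comment> \<open>As \<open>snd \<zeta> + T \<le> 2 * (T + 1)\<close>, the time term consumes at
    most half of the negative value at \<open>\<zeta>\<close>.\<close>
  define \<kappa> where "\<kappa> = - (U \<zeta> + W \<zeta>) / (4 * (T + 1))"
  have T0: "T \<ge> 0" using T[OF \<zeta>] norm_ge_zero order_trans by blast
  have \<kappa>: "\<kappa> > 0" using UWneg T0 by (auto simp: \<kappa>_def intro!: divide_neg_pos)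
  \<comment> \<open>Large enough for \<open>power_in_radial_class\<close>.\<close>
  define M :: nat where "M = nat \<lceil>1 / (q - 1)\<rceil> + 3"
  have M3: "M \<ge> 3" by (simp add: M_def)
  have Mq: "(real M - 1) * (q - 1) > 1"
  proof -
    have "1 / (q - 1) \<le> real (nat \<lceil>1 / (q - 1)\<rceil>)" by (rule real_nat_ceiling_ge)
    moreover have "real M = real (nat \<lceil>1 / (q - 1)\<rceil>) + 3" by (simp add: M_def)
    ultimately have "real M - 1 > 1 / (q - 1)" by linarith
    then show ?thesis using q by (simp add: pos_divide_less_eq)
  qed
  text \<open>Near the diagonal of the boundary the sum is positive; elsewhere off the diagonal the penalty wins.\<close>
  have near: "\<exists>V. open V \<and> \<xi> \<in> V \<and> (\<forall>z1\<in>V \<inter> \<Theta>. \<forall>z2\<in>V \<inter> \<Theta>. U z1 + W z2 > 0)" if \<xi>: "\<xi> \<in> frontier \<Theta>" for \<xi>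
  proof -
    obtain a b where ab: "0 < a + b" "ereal a \<le> Liminf (at \<xi> within \<Theta>) u" "ereal b \<le> Liminf (at \<xi> within \<Theta>) w" using bnd[OF \<xi>] by blast
    define e where "e = (a + b) / 4"
    have e: "e > 0" using ab by (simp add: e_def)
    have "ereal (a - e) < Liminf (at \<xi> within \<Theta>) u" by (rule less_le_trans[OF _ ab(2)]) (use e in simp)
    from less_LiminfD[OF this, unfolded eventually_at_topological]
    obtain V1 where V1: "open V1" "\<xi> \<in> V1" "\<forall>z\<in>V1. z \<noteq> \<xi> \<longrightarrow> z \<in> \<Theta> \<longrightarrow> ereal (a - e) < u z" by blast
    have "ereal (b - e) < Liminf (at \<xi> within \<Theta>) w" by (rule less_le_trans[OF _ ab(3)]) (use e in simp)
    from less_LiminfD[OF this, unfolded eventually_at_topological]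
    obtain V2 where V2: "open V2" "\<xi> \<in> V2" "\<forall>z\<in>V2. z \<noteq> \<xi> \<longrightarrow> z \<in> \<Theta> \<longrightarrow> ereal (b - e) < w z" by blast
    have n\<xi>: "\<xi> \<notin> \<Theta>" using \<xi> op by (simp add: frontier_def interior_open)
    have "U z1 + W z2 > 0" if z: "z1 \<in> V1 \<inter> V2 \<inter> \<Theta>" "z2 \<in> V1 \<inter> V2 \<inter> \<Theta>" for z1 z2
    proof -
      have 1: "U z1 \<ge> N \<or> U z1 > a - e"
      proof (cases "U z1 < N")
        case True
        have "z1 \<noteq> \<xi>" using z n\<xi> by auto
        then have "ereal (a - e) < u z1" using V1 z by blast
        then show ?thesis using Up(3)[OF _ True] z by simp
      qed simp
      have 2: "W z2 \<ge> N \<or> W z2 > b - e"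
      proof (cases "W z2 < N")
        case True
        have "z2 \<noteq> \<xi>" using z n\<xi> by auto
        then have "ereal (b - e) < w z2" using V2 z by blast
        then show ?thesis using Wp(3)[OF _ True] z by simp
      qed simp
      have "U z1 \<ge> m" "W z2 \<ge> m" using Up Wp z by auto
      moreover have "a + b = 4 * e" by (simp add: e_def)
      ultimately show ?thesis using 1 2 N e by linarith
    qed
    then show ?thesis using V1 V2 by (intro exI[of _ "V1 \<inter> V2"]) auto
  qed
  \<comment> \<open>Compactness of the diagonal over the boundary turns the neighbourhoods of
    \<open>near\<close> into a uniform distance \<open>e\<close>.\<close>
  define G where "G = \<Union>{V \<times> V | V. open V \<and> (\<forall>z1\<in>V \<inter> \<Theta>. \<forall>z2\<in>V \<inter> \<Theta>. U z1 + W z2 > 0)}"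
  have oG: "open G" unfolding G_def by (intro open_Union) (auto intro: open_Times)
  have cD: "compact ((\<lambda>\<xi>. (\<xi>, \<xi>)) ` frontier \<Theta>)"
    by (intro compact_continuous_image compact_frontier_bounded bd continuous_intros)
  have "(\<lambda>\<xi>. (\<xi>, \<xi>)) ` frontier \<Theta> \<subseteq> G"
  proof
    fix z assume "z \<in> (\<lambda>\<xi>. (\<xi>, \<xi>)) ` frontier \<Theta>"
    then obtain \<xi> where \<xi>: "\<xi> \<in> frontier \<Theta>" "z = (\<xi>, \<xi>)" by blast
    from near[OF \<xi>(1)] obtain V where V: "open V" "\<xi> \<in> V" "\<forall>z1\<in>V \<inter> \<Theta>. \<forall>z2\<in>V \<inter> \<Theta>. U z1 + W z2 > 0" by blast
    then have "V \<times> V \<in> {V \<times> V | V. open V \<and> (\<forall>z1\<in>V \<inter> \<Theta>. \<forall>z2\<in>V \<inter> \<Theta>. U z1 + W z2 > 0)}" by blast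
    then show "z \<in> G" unfolding G_def \<xi>(2) using V(2) by (intro UnionI) auto
  qed
  from compact_subset_open_imp_ball_epsilon_subset[OF cD oG this]
  obtain e where e: "e > 0" "(\<Union>x\<in>(\<lambda>\<xi>. (\<xi>, \<xi>)) ` frontier \<Theta>. ball x e) \<subseteq> G" by blast
  have pos: "U z1 + W z2 > 0" if "\<xi> \<in> frontier \<Theta>" "z1 \<in> \<Theta>" "z2 \<in> \<Theta>" "dist z1 \<xi> < e / 2" "dist z2 \<xi> < e / 2" for \<xi> z1 z2
  proof -
    have "dist (\<xi>, \<xi>) (z1, z2) \<le> dist z1 \<xi> + dist z2 \<xi>"
      unfolding dist_Pair_Pair by (rule order_trans[OF sqrt_sum_squares_le_sum]) (auto simp: dist_commute)
    then have "(z1, z2) \<in> ball (\<xi>, \<xi>) e" using that by simp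
    then have "(z1, z2) \<in> G" using e(2) that(1) by blast
    then show ?thesis using that unfolding G_def by blast
  qed
  define K where "K = {z \<in> closure \<Theta>. \<forall>\<xi>\<in>frontier \<Theta>. e / 4 \<le> dist z \<xi>}"
  have Ksub: "K \<subseteq> \<Theta>"
  proof
    fix z assume z: "z \<in> K"
    then have "z \<notin> frontier \<Theta>" using e(1) by (force simp: K_def)
    then show "z \<in> \<Theta>" using z op by (auto simp: K_def frontier_def interior_open)
  qed
  have Kc: "compact K"
  proof -
    have "K = closure \<Theta> \<inter> (\<Inter>\<xi>\<in>frontier \<Theta>. {z. e / 4 \<le> dist z \<xi>})" by (auto simp: K_def)
    moreover have "closed (\<Inter>\<xi>\<in>frontier \<Theta>. {z. e / 4 \<le> dist z \<xi>})" by (intro closed_INT ballI closed_Collect_le continuous_intros)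
    ultimately show ?thesis using bd by (simp add: compact_Int_closed compact_closure)
  qed
  \<comment> \<open>Points at distance at least \<open>e / 4\<close> differ by at least
    \<open>e / 8\<close> in space or in time, so their penalty is at least \<open>j * c\<close>,
    which by the choice of \<open>j\<close> exceeds \<open>2 * |m|\<close>.\<close>
  define c where "c = min ((e / 8) ^ M) ((e / 8)\<^sup>2)"
  have c: "c > 0" using e by (simp add: c_def)
  define j where "j = (2 * \<bar>m\<bar> + 1) / c"
  have j: "j > 0" using c by (simp add: j_def add_nonneg_pos)
  define Pen where "Pen z1 z2 = j * (norm (fst z1 - fst z2) ^ M + (snd z1 - snd z2)\<^sup>2)" for z1 z2 :: "(real ^ 'n) \<times> real"
  have Pen0: "Pen z1 z2 \<ge> 0" for z1 z2 using j by (simp add: Pen_def)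
  define F where "F z1 z2 = U z1 + W z2 + (\<kappa> * (snd z1 + T) + Pen z1 z2)" for z1 z2
  have \<Gamma>: "\<kappa> * (snd z + T) \<ge> 0" if "z \<in> \<Theta>" for z using \<kappa> T'[OF that] by simp
  have out: "F z1 z2 \<ge> 0" if z: "z1 \<in> \<Theta>" "z2 \<in> \<Theta>" "\<not> (z1 \<in> K \<and> z2 \<in> K)" for z1 z2
  proof (cases "dist z1 z2 < e / 4")
    case True
    obtain \<xi> where \<xi>: "\<xi> \<in> frontier \<Theta>" "dist z1 \<xi> < e / 4 \<or> dist z2 \<xi> < e / 4"
      using z closure_subset by (fastforce simp: K_def not_le)
    then have "dist z1 \<xi> < e / 2" "dist z2 \<xi> < e / 2"
      using True e(1) dist_triangle[of z1 \<xi> z2] dist_triangle[of z2 \<xi> z1] by (auto simp: dist_commute)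
    then have "U z1 + W z2 > 0" using pos \<xi>(1) z by blast
    then show ?thesis using \<Gamma>[OF z(1)] Pen0[of z1 z2] by (simp add: F_def)
  next
    case False
    have "dist z1 z2 \<le> norm (fst z1 - fst z2) + \<bar>snd z1 - snd z2\<bar>"
      using sqrt_sum_squares_le_sum[of "norm (fst z1 - fst z2)" "\<bar>snd z1 - snd z2\<bar>"] by (simp add: dist_norm norm_prod_def)
    then consider "norm (fst z1 - fst z2) \<ge> e / 8" | "\<bar>snd z1 - snd z2\<bar> \<ge> e / 8" using False by linarith
    then have "norm (fst z1 - fst z2) ^ M + (snd z1 - snd z2)\<^sup>2 \<ge> c"
    proof cases
      case 1
      then have "(e / 8) ^ M \<le> norm (fst z1 - fst z2) ^ M" using e(1) by (intro power_mono) auto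
      then show ?thesis unfolding c_def using zero_le_power2[of "snd z1 - snd z2"] by linarith
    next
      case 2
      then have "(e / 8)\<^sup>2 \<le> \<bar>snd z1 - snd z2\<bar>\<^sup>2" using e(1) by (intro power_mono) auto
      then have "(e / 8)\<^sup>2 \<le> (snd z1 - snd z2)\<^sup>2" by simp
      moreover have "norm (fst z1 - fst z2) ^ M \<ge> 0" by simp
      ultimately show ?thesis unfolding c_def by linarith
    qed
    then have "j * c \<le> Pen z1 z2" unfolding Pen_def using j by (intro mult_left_mono) auto
    moreover have "j * c = 2 * \<bar>m\<bar> + 1" using c by (simp add: j_def)
    ultimately show ?thesis using Up(2)[OF z(1)] Wp(2)[OF z(2)] \<Gamma>[OF z(1)] unfolding F_def by linarith
  qed
  have F\<zeta>: "F \<zeta> \<zeta> < 0"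
  proof -
    have "\<kappa> * (snd \<zeta> + T) \<le> \<kappa> * (2 * (T + 1))" using \<kappa> T'[OF \<zeta>] T0 by (intro mult_left_mono) auto
    also have "\<dots> = - (U \<zeta> + W \<zeta>) / 2"
    proof -
      have "x / (4 * y) * (2 * y) = x / 2" if "y > 0" for x y :: real using that by simp
      from this[of "T + 1"] show ?thesis unfolding \<kappa>_def using T0 by simp
    qed
    finally have "\<kappa> * (snd \<zeta> + T) \<le> - (U \<zeta> + W \<zeta>) / 2" .
    moreover have "Pen \<zeta> \<zeta> = 0" using M3 by (simp add: Pen_def zero_power)
    ultimately show ?thesis using UWneg unfolding F_def by argo
  qed
  have \<zeta>K: "\<zeta> \<in> K" using out[OF \<zeta> \<zeta>] F\<zeta> by force
  have contP: "continuous_on UNIV (\<lambda>z. \<kappa> * (snd (fst z) + T) + Pen (fst z) (snd z))" unfolding Pen_def by (intro continuous_intros)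
  have "\<exists>z\<in>K \<times> K. \<forall>z'\<in>K \<times> K. F (fst z) (snd z) \<le> F (fst z') (snd z')"
  proof (rule lsc_attains_inf)
    show "compact (K \<times> K)" by (intro compact_Times Kc)
    show "K \<times> K \<noteq> {}" using \<zeta>K by auto
    fix z c assume z: "z \<in> K \<times> K" and c: "c < F (fst z) (snd z)"
    define d where "d = (F (fst z) (snd z) - c) / 4"
    have d: "d > 0" using c by (simp add: d_def)
    have z12: "fst z \<in> \<Theta>" "snd z \<in> \<Theta>" using z Ksub by auto
    obtain V1 where V1: "open V1" "fst z \<in> V1" "\<forall>y\<in>V1 \<inter> \<Theta>. U (fst z) - d < U y"
      using lU[unfolded lsc_real_on_def, rule_format, OF z12(1), of "U (fst z) - d"] d by auto
    obtain V2 where V2: "open V2" "snd z \<in> V2" "\<forall>y\<in>V2 \<inter> \<Theta>. W (snd z) - d < W y"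
      using lW[unfolded lsc_real_on_def, rule_format, OF z12(2), of "W (snd z) - d"] d by auto
    have "\<forall>\<^sub>F y in at z within K \<times> K. y \<in> V1 \<times> V2"
      using V1 V2 by (intro topological_tendstoD[OF tendsto_ident_at]) (auto simp: open_Times mem_Times_iff)
    moreover have "\<forall>\<^sub>F y in at z within K \<times> K. y \<in> K \<times> K" by (simp add: eventually_at_filter)
    moreover have "\<forall>\<^sub>F y in at z within K \<times> K. \<kappa> * (snd (fst z) + T) + Pen (fst z) (snd z) - d < \<kappa> * (snd (fst y) + T) + Pen (fst y) (snd y)"
    proof (rule order_tendstoD(1))
      show "((\<lambda>y. \<kappa> * (snd (fst y) + T) + Pen (fst y) (snd y)) \<longlongrightarrow> \<kappa> * (snd (fst z) + T) + Pen (fst z) (snd z)) (at z within K \<times> K)"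
        using continuous_on_subset[OF contP subset_UNIV] z unfolding continuous_on_def by blast
    qed (use d in simp)
    ultimately show "\<forall>\<^sub>F y in at z within K \<times> K. c < F (fst y) (snd y)"
    proof eventually_elim
      case (elim y)
      then have "U (fst z) - d < U (fst y)" "W (snd z) - d < W (snd y)" using V1 V2 Ksub by (auto simp: mem_Times_iff)
      moreover have "F (fst z) (snd z) = c + 4 * d" unfolding d_def by argo
      ultimately show ?case using elim(3) d unfolding F_def by argo
    qed
  qed
  then obtain z1 z2 where zK: "z1 \<in> K" "z2 \<in> K" and min0: "\<And>y1 y2. y1 \<in> K \<Longrightarrow> y2 \<in> K \<Longrightarrow> F z1 z2 \<le> F y1 y2" by fastforce
  have Fneg: "F z1 z2 < 0" using min0[OF \<zeta>K \<zeta>K] F\<zeta> by simp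
  have mn: "F z1 z2 \<le> F y1 y2" if "y1 \<in> \<Theta>" "y2 \<in> \<Theta>" for y1 y2
    using min0[of y1 y2] out[OF that] Fneg by (cases "y1 \<in> K \<and> y2 \<in> K") auto
  have z12: "z1 \<in> \<Theta>" "z2 \<in> \<Theta>" using zK Ksub by auto
  have UN: "U z1 < N" "W z2 < N"
    using Fneg \<Gamma>[OF z12(1)] Pen0[of z1 z2] Up(2)[OF z12(1)] Wp(2)[OF z12(2)] N unfolding F_def by linarith+
  have uz: "u z1 = ereal (U z1)" "w z2 = ereal (W z2)" using Up(3)[OF z12(1) UN(1)] Wp(3)[OF z12(2) UN(2)] by auto
  have in\<Theta>: "\<forall>\<^sub>F z in at z1. z \<in> \<Theta>" "\<forall>\<^sub>F z in at z2. z \<in> \<Theta>" using op z12 by (auto intro: eventually_at_in_open')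
  show False
  proof (cases "fst z1 = fst z2")
    case True
    define x0 t1 t2 where "x0 = fst z1" and "t1 = snd z1" and "t2 = snd z2"
    have ze: "z1 = (x0, t1)" "z2 = (x0, t2)" using True by (auto simp: x0_def t1_def t2_def prod_eq_iff)
    have fr: "(\<lambda>r. j * r ^ M) \<in> radial_class TYPE('n) p q" by (rule radial_class_scale[OF power_in_radial_class[OF M3 Mq] j])
    have M0: "(0::real) ^ M = 0" using M3 by simp
    \<comment> \<open>The spatial gradient of the penalty is \<open>0\<close> here, so the
      degenerate test is applied to both functions with radial profile \<open>j * r ^ M\<close>. The
      two time slopes add up to \<open>- \<kappa>\<close>.\<close>
    have "0 \<le> - \<kappa> - 2 * j * (t1 - t2)"
    proof (rule supersolution_touched_degenerate[OF u op fr, where \<rho> = "\<lambda>t. - \<kappa> * t - j * (t - t2)\<^sup>2" and \<rho>' = "\<lambda>t. - \<kappa> - 2 * j * (t - t2)" and \<rho>'' = "\<lambda>t. - 2 * j"])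
      show "(x0, t1) \<in> \<Theta>" "u (x0, t1) = ereal (U z1)" using z12 uz ze by auto
      show "\<forall>\<^sub>F z in at (x0, t1). ereal ((- \<kappa> * snd z - j * (snd z - t2)\<^sup>2) - (- \<kappa> * t1 - j * (t1 - t2)\<^sup>2) - j * norm (fst z - x0) ^ M + U z1) \<le> u z"
        using in\<Theta>(1) unfolding ze(1)
      proof eventually_elim
        case (elim z)
        have "F z1 z2 \<le> F z z2" using mn elim z12 ze by simp
        then have "(- \<kappa> * snd z - j * (snd z - t2)\<^sup>2) - (- \<kappa> * t1 - j * (t1 - t2)\<^sup>2) - j * norm (fst z - x0) ^ M + U z1 \<le> U z"
          by (simp add: F_def Pen_def ze M0 algebra_simps)
        then show ?case by (intro order_trans[OF _ Up(1)[OF elim]]) (simp only: ereal_less_eq(3) ze(1))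
      qed
    qed (auto intro!: derivative_eq_intros)
    moreover have "0 \<le> - 2 * j * (t2 - t1)"
    proof (rule supersolution_touched_degenerate[OF w op fr, where \<rho> = "\<lambda>t. - j * (t - t1)\<^sup>2" and \<rho>' = "\<lambda>t. - 2 * j * (t - t1)" and \<rho>'' = "\<lambda>t. - 2 * j"])
      show "(x0, t2) \<in> \<Theta>" "w (x0, t2) = ereal (W z2)" using z12 uz ze by auto
      show "\<forall>\<^sub>F z in at (x0, t2). ereal ((- j * (snd z - t1)\<^sup>2) - (- j * (t2 - t1)\<^sup>2) - j * norm (fst z - x0) ^ M + W z2) \<le> w z"
        using in\<Theta>(2) unfolding ze(2)
      proof eventually_elim
        case (elim z)
        have "F z1 z2 \<le> F z1 z" using mn elim z12 ze by simp
        then have "(- j * (snd z - t1)\<^sup>2) - (- j * (t2 - t1)\<^sup>2) - j * norm (fst z - x0) ^ M + W z2 \<le> W z"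
          by (simp add: F_def Pen_def ze M0 algebra_simps norm_minus_commute power2_commute)
        then show ?case by (intro order_trans[OF _ Wp(1)[OF elim]]) (simp only: ereal_less_eq(3) ze(2))
      qed
    qed (auto intro!: derivative_eq_intros)
    ultimately show False using \<kappa> by (simp add: algebra_simps)
  next
    case False
    define d0 \<tau> where "d0 = fst z1 - fst z2" and "\<tau> = snd z1 - snd z2"
    have d0: "d0 \<noteq> 0" using False by (simp add: d0_def)
    interpret radial_profile "\<lambda>r. r ^ M" "\<lambda>r. real M * r ^ (M - 1)" "\<lambda>r. real M * (real (M - 1) * r ^ (M - 2))"
      by (rule radial_profile_power[OF M3])
    define \<nu>0 :: "real ^ 'n" where "\<nu>0 = radial_grad d0"
    have \<nu>00: "\<nu>0 \<noteq> 0" using d0 M3 unfolding \<nu>0_def radial_grad_def by simp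
    \<comment> \<open>A quadratic upper bound for the penalty near \<open>d0\<close>, the form that
      \<open>sum_of_lsc_jets\<close> accepts.\<close>
    obtain rr C0 where rr: "rr > 0" "C0 \<ge> 0" "\<And>h. norm h < rr \<Longrightarrow> norm (d0 + h) ^ M \<le> norm d0 ^ M + \<nu>0 \<bullet> h + C0 * (norm h)\<^sup>2"
      using C2_data_upper_quadratic[OF C2_data_radial, of d0] unfolding \<nu>0_def by blast
    define \<nu> where "\<nu> = j *\<^sub>R \<nu>0"
    have \<nu>: "\<nu> \<noteq> 0" using \<nu>00 j by (simp add: \<nu>_def)
    define C where "C = 2 * (j * C0 + j)"
    have C: "C \<ge> 0" using j rr by (simp add: C_def)
    obtain r1 where r1: "r1 > 0" "ball z1 r1 \<subseteq> \<Theta>" using op z12 open_contains_ball by blast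
    obtain r2 where r2: "r2 > 0" "ball z2 r2 \<subseteq> \<Theta>" using op z12 open_contains_ball by blast
    define r where "r = min (min r1 r2) rr / 4"
    have r: "r > 0" "r < r1" "r < r2" "2 * r < rr" using r1(1) r2(1) rr(1) by (auto simp: r_def)
    have in1: "z1 + h \<in> \<Theta>" if "h \<in> cball 0 r" for h
      using that r by (intro subsetD[OF r1(2)]) (simp add: dist_norm)
    have in2: "z2 + h \<in> \<Theta>" if "h \<in> cball 0 r" for h
      using that r by (intro subsetD[OF r2(2)]) (simp add: dist_norm)
    \<comment> \<open>The derivatives of penalty and time term in the two variables. With them moved
      into \<open>U1\<close> and \<open>W1\<close>, minimality reads as the purely quadratic lower
      bound \<open>UW\<close>.\<close>
    define l1 l2 where "l1 = (\<nu>, \<kappa> + 2 * j * \<tau>)" and "l2 = (- \<nu>, - (2 * j * \<tau>))"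
    define U1 W1 where "U1 h = U (z1 + h) + (l1 \<bullet> h - U z1)" and "W1 h = W (z2 + h) + (l2 \<bullet> h - W z2)" for h
    have UW: "U1 h + W1 k \<ge> - (C / 2 * (norm (h - k))\<^sup>2)" if h: "h \<in> cball 0 r" and k: "k \<in> cball 0 r" for h k
    proof -
      let ?e = "fst h - fst k" and ?s = "snd h - snd k"
      have "norm (fst (h - k)) \<le> norm (h - k)" using norm_fst_le[of "fst (h - k)" "snd (h - k)"] by (simp only: prod.collapse)
      then have "norm ?e \<le> norm (h - k)" by simp
      also have "\<dots> \<le> 2 * r" using norm_triangle_ineq4[of h k] h k by simp
      finally have ne: "norm ?e < rr" using r by simp
      have "F z1 z2 \<le> F (z1 + h) (z2 + k)" by (rule mn[OF in1[OF h] in2[OF k]])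
      then have 1: "U z1 + W z2 + Pen z1 z2 \<le> U (z1 + h) + W (z2 + k) + \<kappa> * snd h + Pen (z1 + h) (z2 + k)"
        by (simp add: F_def algebra_simps)
      have 2: "Pen (z1 + h) (z2 + k) = j * norm (d0 + ?e) ^ M + j * (\<tau> + ?s)\<^sup>2"
        by (simp add: Pen_def d0_def \<tau>_def algebra_simps)
      have 3: "Pen z1 z2 = j * norm d0 ^ M + j * \<tau>\<^sup>2" by (simp add: Pen_def d0_def \<tau>_def algebra_simps)
      have 4: "j * norm (d0 + ?e) ^ M \<le> j * norm d0 ^ M + \<nu> \<bullet> ?e + j * C0 * (norm ?e)\<^sup>2"
        using mult_left_mono[OF rr(3)[OF ne], of j] j by (simp add: \<nu>_def distrib_left mult.assoc)
      have 5: "j * (\<tau> + ?s)\<^sup>2 = j * \<tau>\<^sup>2 + 2 * j * \<tau> * ?s + j * ?s\<^sup>2" by (simp add: power2_eq_square algebra_simps)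
      have 6: "C / 2 * (norm (h - k))\<^sup>2 = (j * C0 + j) * (norm ?e)\<^sup>2 + (j * C0 + j) * ?s\<^sup>2"
      proof -
        have "C / 2 = j * C0 + j" by (simp add: C_def)
        then show ?thesis by (simp only: norm_Pair_sq fst_diff snd_diff distrib_left real_norm_def power2_abs)
      qed
      have 7: "j * C0 * (norm ?e)\<^sup>2 \<le> (j * C0 + j) * (norm ?e)\<^sup>2" "j * ?s\<^sup>2 \<le> (j * C0 + j) * ?s\<^sup>2"
        using j rr by (auto intro!: mult_right_mono)
      have 8: "l1 \<bullet> h + l2 \<bullet> k = \<nu> \<bullet> ?e + \<kappa> * snd h + 2 * j * \<tau> * ?s"
        by (simp only: l1_def l2_def inner_prod_def fst_conv snd_conv inner_diff_right inner_minus_left inner_real_def) argo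
      show ?thesis unfolding U1_def W1_def using 1 2 3 4 5 6 7 8 by linarith
    qed
    have lsc1: "\<forall>\<^sub>F h in at z within cball 0 r. c < U1 h" if "z \<in> cball 0 r" "c < U1 z" for z c
      unfolding U1_def
    proof (rule lsc_add_continuous[where U = "\<lambda>h. U (z1 + h)" and g = "\<lambda>h. l1 \<bullet> h - U z1" and z = z])
      show "\<forall>\<^sub>F h in at z within cball 0 r. c < U (z1 + h)" if "c < U (z1 + z)" for c
        using lsc_real_on_translate[OF lU in1 \<open>z \<in> cball 0 r\<close> that] .
    qed (use that in \<open>auto simp: U1_def intro!: tendsto_intros\<close>)
    have lsc2: "\<forall>\<^sub>F h in at z within cball 0 r. c < W1 h" if "z \<in> cball 0 r" "c < W1 z" for z c
      unfolding W1_def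
    proof (rule lsc_add_continuous[where U = "\<lambda>h. W (z2 + h)" and g = "\<lambda>h. l2 \<bullet> h - W z2" and z = z])
      show "\<forall>\<^sub>F h in at z within cball 0 r. c < W (z2 + h)" if "c < W (z2 + z)" for c
        using lsc_real_on_translate[OF lW in2 \<open>z \<in> cball 0 r\<close> that] .
    qed (use that in \<open>auto simp: W1_def intro!: tendsto_intros\<close>)
    define Q where "Q = norm \<nu> powr (q - 2) * (CARD('n) + p - 1)"
    have Q: "Q \<ge> 0" using p by (simp add: Q_def)
    \<comment> \<open>Chosen so that \<open>Q * \<eta> < \<kappa>\<close>: the defect in the order
      of the Hessians cannot compensate the strict time slope.\<close>
    define \<eta> where "\<eta> = \<kappa> / (2 * (Q + 1))"
    have \<eta>: "\<eta> > 0" using \<kappa> Q by (simp add: \<eta>_def)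
    have "U1 0 = 0" "W1 0 = 0" by (simp_all add: U1_def W1_def)
    from sum_of_lsc_jets[OF r(1) C \<eta> lsc1 lsc2 this UW]
    obtain B where B: "\<forall>\<delta>>0. \<exists>y1 y2 p1 p2 X Y. norm y1 < \<delta> \<and> norm y2 < \<delta> \<and> U1 y1 < \<delta> \<and> W1 y2 < \<delta> \<and> norm p1 < \<delta> \<and> norm p2 < \<delta> \<and>
     linear X \<and> linear Y \<and> (\<forall>h. norm (X h) \<le> B * norm h) \<and> (\<forall>h. norm (Y h) \<le> B * norm h) \<and>
     (\<forall>h k. X h \<bullet> k = h \<bullet> X k) \<and> (\<forall>h k. Y h \<bullet> k = h \<bullet> Y k) \<and>
     (\<forall>h. X h \<bullet> h + Y h \<bullet> h \<ge> - (\<eta> * (norm h)\<^sup>2)) \<and>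
     (\<exists>d>0. \<forall>h. norm h < d \<longrightarrow> U1 (y1 + h) \<ge> U1 y1 + p1 \<bullet> h + X h \<bullet> h / 2) \<and>
     (\<exists>d>0. \<forall>h. norm h < d \<longrightarrow> W1 (y2 + h) \<ge> W1 y2 + p2 \<bullet> h + Y h \<bullet> h / 2)" by blast
    define R where "R = real CARD('n) * (real CARD('n) * B)"
    \<comment> \<open>One argument for both functions: the quadratic jet corrected by the linear
      form \<open>l\<close> touches \<open>V\<close> from below, and \<open>N1\<close> ensures that
      \<open>V\<close> is not truncated at the contact point.\<close>
    have touched: "pq_operator p q (fst (p1 - l)) (matrix (space_hess X)) \<le> snd (p1 - l)"
      if v: "viscosity_supersolution p q \<Theta> v" and V: "\<And>z. z \<in> \<Theta> \<Longrightarrow> ereal (V z) \<le> v z" "\<And>z. z \<in> \<Theta> \<Longrightarrow> V z < N \<Longrightarrow> v z = ereal (V z)"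
        and zi: "\<And>h. h \<in> cball 0 r \<Longrightarrow> z + h \<in> \<Theta>" and y1: "norm y1 < r" and N1: "V (z + y1) < N"
        and X: "linear X" "\<And>h k. X h \<bullet> k = h \<bullet> X k"
        and d: "d > 0" "\<And>h. norm h < d \<Longrightarrow> V (z + (y1 + h)) + l \<bullet> (y1 + h) \<ge> V (z + y1) + l \<bullet> y1 + p1 \<bullet> h + X h \<bullet> h / 2"
        and nz: "fst (p1 - l) \<noteq> 0"
      for v V z y1 X d p1 l
    proof -
      define y where "y = z + y1"
      have y: "y \<in> \<Theta>" using zi y1 by (simp add: y_def)
      define c where "c = V y"
      have X0: "X 0 = 0" by (rule linear_0[OF X(1)])
      define g where "g z' = (p1 - l) + X (z' - y)" for z'
      have gy: "g y = p1 - l" by (simp add: g_def X0)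
      have D: "C2_data \<Theta> (\<lambda>z'. c + (p1 - l) \<bullet> (z' - y) + X (z' - y) \<bullet> (z' - y) / 2) g (\<lambda>z'. X)"
        unfolding g_def by (rule C2_data_quadratic[OF X])
      have "pq_operator p q (fst (g y)) (matrix (space_hess X)) \<le> snd (g y)"
      proof (rule supersolution_touched[OF v op D y, where a = c])
        show "v y = ereal c" using V(2)[OF y] N1 by (simp add: c_def y_def)
        show "fst (g y) \<noteq> 0" using nz by (simp add: gy)
        have "\<forall>\<^sub>F z' in at y. z' \<in> \<Theta>" using op y by (auto intro: eventually_at_in_open')
        moreover have "\<forall>\<^sub>F z' in at y. norm (z' - y) < d" unfolding eventually_at using d(1) by (auto simp: dist_norm)
        ultimately show "\<forall>\<^sub>F z' in at y. ereal ((c + (p1 - l) \<bullet> (z' - y) + X (z' - y) \<bullet> (z' - y) / 2) - (c + (p1 - l) \<bullet> (y - y) + X (y - y) \<bullet> (y - y) / 2) + c) \<le> v z'"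
        proof eventually_elim
          case (elim z')
          have "V z' + l \<bullet> (y1 + (z' - y)) \<ge> c + l \<bullet> y1 + p1 \<bullet> (z' - y) + X (z' - y) \<bullet> (z' - y) / 2"
            using d(2)[OF elim(2)] by (simp add: y_def c_def algebra_simps)
          then have "(c + (p1 - l) \<bullet> (z' - y) + X (z' - y) \<bullet> (z' - y) / 2) - (c + (p1 - l) \<bullet> (y - y) + X (y - y) \<bullet> (y - y) / 2) + c \<le> V z'"
            by (simp add: inner_add_right inner_diff_left)
          then show ?case by (intro order_trans[OF _ V(1)[OF elim(1)]]) (simp only: ereal_less_eq(3))
        qed
      qed
      then show ?thesis by (simp add: gy)
    qed
    have "- (\<kappa> + 2 * j * \<tau>) + 2 * j * \<tau> \<ge> - (norm \<nu> powr (q - 2) * (\<eta> * (CARD('n) + p - 1)))"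
    proof (rule pq_operator_limit[OF p \<nu> less_imp_le[OF \<eta>], where R = R])
      fix \<epsilon> :: real assume \<epsilon>: "\<epsilon> > 0"
      \<comment> \<open>Keeps the contact points in the ball, the gradients nonzero (hence
        \<open>norm \<nu>\<close>), and the values below the truncation level
        \<open>N\<close>.\<close>
      define \<delta> where "\<delta> = min (min \<epsilon> r) (min (norm \<nu>) (min ((N - U z1) / (1 + norm l1)) ((N - W z2) / (1 + norm l2))))"
      have ln: "1 + norm l1 > 0" "1 + norm l2 > 0" by (auto intro: add_pos_nonneg)
      have \<delta>: "\<delta> > 0" using \<epsilon> r \<nu> UN ln by (simp add: \<delta>_def)
      have \<delta>le: "\<delta> \<le> \<epsilon>" "\<delta> \<le> r" "\<delta> \<le> norm \<nu>" by (auto simp: \<delta>_def)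
      have "\<delta> \<le> (N - U z1) / (1 + norm l1)" "\<delta> \<le> (N - W z2) / (1 + norm l2)" by (auto simp: \<delta>_def)
      then have \<delta>N: "\<delta> + \<delta> * norm l1 \<le> N - U z1" "\<delta> + \<delta> * norm l2 \<le> N - W z2" using ln by (simp_all add: pos_le_divide_eq distrib_left)
      obtain y1 y2 p1 p2 X Y where jets: "norm y1 < \<delta> \<and> norm y2 < \<delta> \<and> U1 y1 < \<delta> \<and> W1 y2 < \<delta> \<and> norm p1 < \<delta> \<and> norm p2 < \<delta> \<and>
     linear X \<and> linear Y \<and> (\<forall>h. norm (X h) \<le> B * norm h) \<and> (\<forall>h. norm (Y h) \<le> B * norm h) \<and>
     (\<forall>h k. X h \<bullet> k = h \<bullet> X k) \<and> (\<forall>h k. Y h \<bullet> k = h \<bullet> Y k) \<and>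
     (\<forall>h. X h \<bullet> h + Y h \<bullet> h \<ge> - (\<eta> * (norm h)\<^sup>2)) \<and>
     (\<exists>d>0. \<forall>h. norm h < d \<longrightarrow> U1 (y1 + h) \<ge> U1 y1 + p1 \<bullet> h + X h \<bullet> h / 2) \<and>
     (\<exists>d>0. \<forall>h. norm h < d \<longrightarrow> W1 (y2 + h) \<ge> W1 y2 + p2 \<bullet> h + Y h \<bullet> h / 2)"
        using B[THEN spec, THEN mp, OF \<delta>] by (elim exE) (rule that)
      have y: "norm y1 < \<delta>" "norm y2 < \<delta>" "U1 y1 < \<delta>" "W1 y2 < \<delta>" "norm p1 < \<delta>" "norm p2 < \<delta>"
        using jets by - (elim conjE, assumption)+
      have X: "linear X" "\<And>h. norm (X h) \<le> B * norm h" "\<And>h k. X h \<bullet> k = h \<bullet> X k"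
        using jets by - (elim conjE, (assumption | erule spec | (drule spec, erule spec)))+
      have Y: "linear Y" "\<And>h. norm (Y h) \<le> B * norm h" "\<And>h k. Y h \<bullet> k = h \<bullet> Y k"
        using jets by - (elim conjE, (assumption | erule spec | (drule spec, erule spec)))+
      have XY: "\<And>h. X h \<bullet> h + Y h \<bullet> h \<ge> - (\<eta> * (norm h)\<^sup>2)"
        using jets by - (elim conjE, erule spec)
      have jU: "\<exists>d>0. \<forall>h. norm h < d \<longrightarrow> U1 (y1 + h) \<ge> U1 y1 + p1 \<bullet> h + X h \<bullet> h / 2"
        and jW: "\<exists>d>0. \<forall>h. norm h < d \<longrightarrow> W1 (y2 + h) \<ge> W1 y2 + p2 \<bullet> h + Y h \<bullet> h / 2"
        using jets by - (elim conjE, assumption)+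
      have fp: "norm (fst p1) < \<delta>" "\<bar>snd p1\<bar> < \<delta>" "norm (fst p2) < \<delta>" "\<bar>snd p2\<bar> < \<delta>"
        using y(5,6) norm_fst_le[of "fst p1" "snd p1"] norm_snd_le[of "snd p1" "fst p1"] norm_fst_le[of "fst p2" "snd p2"] norm_snd_le[of "snd p2" "fst p2"] by simp_all
      have ly: "\<bar>l1 \<bullet> y1\<bar> \<le> \<delta> * norm l1" "\<bar>l2 \<bullet> y2\<bar> \<le> \<delta> * norm l2"
      proof -
        have "\<bar>l1 \<bullet> y1\<bar> \<le> norm l1 * norm y1" "\<bar>l2 \<bullet> y2\<bar> \<le> norm l2 * norm y2" by (rule Cauchy_Schwarz_ineq2)+
        moreover have "norm l1 * norm y1 \<le> norm l1 * \<delta>" "norm l2 * norm y2 \<le> norm l2 * \<delta>" using y by (auto intro!: mult_left_mono)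
        ultimately show "\<bar>l1 \<bullet> y1\<bar> \<le> \<delta> * norm l1" "\<bar>l2 \<bullet> y2\<bar> \<le> \<delta> * norm l2" by (simp_all add: mult.commute)
      qed
      have N1: "U (z1 + y1) < N" "W (z2 + y2) < N" using y(3,4) ly \<delta>N unfolding U1_def W1_def by linarith+
      have t1: "pq_operator p q (fst (p1 - l1)) (matrix (space_hess X)) \<le> snd (p1 - l1)"
      proof -
        obtain d where d: "d > 0" "\<And>h. norm h < d \<Longrightarrow> U1 (y1 + h) \<ge> U1 y1 + p1 \<bullet> h + X h \<bullet> h / 2" using jU by blast
        show ?thesis
        proof (rule touched[OF u Up(1,3) in1 _ N1(1) X(1,3) d(1)])
          show "norm y1 < r" using y \<delta>le by simp
          show "U (z1 + (y1 + h)) + l1 \<bullet> (y1 + h) \<ge> U (z1 + y1) + l1 \<bullet> y1 + p1 \<bullet> h + X h \<bullet> h / 2" if "norm h < d" for h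
            using d(2)[OF that] by (simp add: U1_def)
          show "fst (p1 - l1) \<noteq> 0" using fp \<delta>le by (auto simp: l1_def)
        qed
      qed
      have t2: "pq_operator p q (fst (p2 - l2)) (matrix (space_hess Y)) \<le> snd (p2 - l2)"
      proof -
        obtain d where d: "d > 0" "\<And>h. norm h < d \<Longrightarrow> W1 (y2 + h) \<ge> W1 y2 + p2 \<bullet> h + Y h \<bullet> h / 2" using jW by blast
        show ?thesis
        proof (rule touched[OF w Wp(1,3) in2 _ N1(2) Y(1,3) d(1)])
          show "norm y2 < r" using y \<delta>le by simp
          show "W (z2 + (y2 + h)) + l2 \<bullet> (y2 + h) \<ge> W (z2 + y2) + l2 \<bullet> y2 + p2 \<bullet> h + Y h \<bullet> h / 2" if "norm h < d" for h
            using d(2)[OF that] by (simp add: W1_def)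
          have "fst p2 \<noteq> - \<nu>" using fp \<delta>le by auto
          then show "fst (p2 - l2) \<noteq> 0" by (simp add: l2_def eq_neg_iff_add_eq_0)
        qed
      qed
      have ineqs: "norm (fst (p1 - l1) + \<nu>) < \<epsilon>" "\<bar>snd (p1 - l1) - (- (\<kappa> + 2 * j * \<tau>))\<bar> < \<epsilon>"
        "norm (fst (p2 - l2) - \<nu>) < \<epsilon>" "\<bar>snd (p2 - l2) - 2 * j * \<tau>\<bar> < \<epsilon>"
        using fp \<delta>le by (simp_all add: l1_def l2_def)
      have nA: "norm (matrix (space_hess X)) \<le> R" "norm (matrix (space_hess Y)) \<le> R"
        unfolding R_def using matrix_space_hess(3)[OF X(1,2)] matrix_space_hess(3)[OF Y(1,2)] by auto
      have qf: "\<xi> \<bullet> ((matrix (space_hess X) + matrix (space_hess Y)) *v \<xi>) \<ge> - (\<eta> * (norm \<xi>)\<^sup>2)" for \<xi>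
        using XY[of "(\<xi>, 0)"] by (simp add: matrix_vector_mult_add_rdistrib inner_add_right matrix_space_hess(2)[OF X(1)] matrix_space_hess(2)[OF Y(1)])
      show "\<exists>e1 s1 A e2 s2 B. norm (e1 + \<nu>) < \<epsilon> \<and> \<bar>s1 - - (\<kappa> + 2 * j * \<tau>)\<bar> < \<epsilon> \<and> norm (e2 - \<nu>) < \<epsilon> \<and> \<bar>s2 - 2 * j * \<tau>\<bar> < \<epsilon> \<and>
        norm A \<le> R \<and> norm B \<le> R \<and> (\<forall>\<xi>. \<xi> \<bullet> ((A + B) *v \<xi>) \<ge> - (\<eta> * (norm \<xi>)\<^sup>2)) \<and>
        pq_operator p q e1 A \<le> s1 \<and> pq_operator p q e2 B \<le> s2"
        using ineqs nA qf t1 t2 by blast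
    qed
    then have "\<kappa> \<le> Q * \<eta>" by (simp add: Q_def mult_ac)
    moreover have "Q * \<eta> < \<kappa>"
    proof -
      have "Q * \<eta> \<le> (Q + 1) * \<eta>" using \<eta> by simp
      also have "(Q + 1) * \<eta> = \<kappa> / 2"
      proof -
        have "x * (\<kappa> / (2 * x)) = \<kappa> / 2" if "x > 0" for x :: real using that by simp
        from this[of "Q + 1"] show ?thesis using Q by (simp only: \<eta>_def)
      qed
      finally show ?thesis using \<kappa> by simp
    qed
    ultimately show False by simp
  qed
qed

subsection \<open>Lower envelopes of families of supersolutions\<close>

lemma truncated_minimum:
  fixes u :: "'a::euclidean_space \<Rightarrow> ereal"
  assumes l: "lsc_on S u" and m: "\<And>z. z \<in> S \<Longrightarrow> ereal m \<le> u z" "m \<le> N"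
    and K: "compact K" "K \<noteq> {}" "K \<subseteq> S" and \<psi>: "continuous_on K \<psi>"
  shows "\<exists>y\<in>K. \<forall>z\<in>K. truncate_at N (u y) - \<psi> y \<le> truncate_at N (u z) - \<psi> z"
proof (rule lsc_attains_inf[OF K(1,2)])
  fix z c assume z: "z \<in> K" and c: "c < truncate_at N (u z) - \<psi> z"
  have lsc: "\<forall>\<^sub>F h in at z within K. c < truncate_at N (u h)" if "c < truncate_at N (u z)" for c
    using lsc_real_on_translate[OF lsc_truncate[OF l m], where T = K and ?z0.0 = 0 and z = z and c = c] z K(3) that by auto
  have "\<forall>\<^sub>F h in at z within K. c < truncate_at N (u h) + (- \<psi> h)"
  proof (rule lsc_add_continuous[where z = z])
    show "((\<lambda>h. - \<psi> h) \<longlongrightarrow> - \<psi> z) (at z within K)"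
      using \<psi> z by (intro tendsto_intros) (simp add: continuous_on_def)
  qed (use lsc c in simp_all)
  then show "\<forall>\<^sub>F h in at z within K. c < truncate_at N (u h) - \<psi> h" by simp
qed

text \<open>The minimum of the difference over the compact set is attained, hence positive;
  truncating above all values of \<open>\<psi>\<close> preserves the strict inequality.\<close>

lemma lsc_gap:
  fixes u :: "'a::euclidean_space \<Rightarrow> ereal"
  assumes l: "lsc_on S u" and m: "\<And>z. z \<in> S \<Longrightarrow> ereal m \<le> u z"
    and K: "compact K" "K \<subseteq> S" and \<psi>: "continuous_on K \<psi>" and less: "\<And>z. z \<in> K \<Longrightarrow> ereal (\<psi> z) < u z"
  shows "\<exists>\<mu>>0. \<forall>z\<in>K. ereal (\<psi> z + \<mu>) \<le> u z"
proof (cases "K = {}")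
  case True
  then show ?thesis by (intro exI[of _ 1]) simp
next
  case False
  obtain b where b: "\<And>z. z \<in> K \<Longrightarrow> \<psi> z \<le> b"
    using continuous_attains_sup[OF K(1) False \<psi>] by blast
  define N where "N = max m (b + 1)"
  have N: "m \<le> N" by (simp add: N_def)
  obtain y where y: "y \<in> K" "\<And>z. z \<in> K \<Longrightarrow> truncate_at N (u y) - \<psi> y \<le> truncate_at N (u z) - \<psi> z"
    using truncated_minimum[OF l m N K(1) False K(2) \<psi>] by blast
  define \<mu> where "\<mu> = truncate_at N (u y) - \<psi> y"
  have "y \<in> S" using y K by auto
  moreover have "\<psi> y < N" using b[OF y(1)] by (simp add: N_def)
  ultimately have "\<mu> > 0" using truncate_at(5)[OF m N, of y "\<psi> y"] less[OF y(1)] by (simp add: \<mu>_def)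
  moreover have "ereal (\<psi> z + \<mu>) \<le> u z" if z: "z \<in> K" for z
  proof -
    have zS: "z \<in> S" using z K by auto
    have "\<psi> z + \<mu> \<le> truncate_at N (u z)" using y(2)[OF z] by (simp add: \<mu>_def)
    then show ?thesis by (intro order_trans[OF _ truncate_at(1)[OF m[OF zS] N]]) simp
  qed
  ultimately show ?thesis by blast
qed

section \<open>Lower semicontinuous envelopes\<close>

text \<open>The minimum with \<open>h z\<close> enters because \<open>Liminf (at z within S)\<close>
  ignores the value at \<open>z\<close> itself.\<close>

definition lsc_envelope :: "'a::topological_space set \<Rightarrow> ('a \<Rightarrow> ereal) \<Rightarrow> 'a \<Rightarrow> ereal" where
  "lsc_envelope S h z = min (h z) (Liminf (at z within S) h)"

lemma lsc_envelope_le: "lsc_envelope S h z \<le> h z"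
  by (simp add: lsc_envelope_def)

lemma lsc_envelope_ge:
  assumes "open V" "z \<in> V" "z \<in> S" "\<And>y. y \<in> V \<Longrightarrow> y \<in> S \<Longrightarrow> c \<le> h y"
  shows "c \<le> lsc_envelope S h z"
proof -
  have "\<forall>\<^sub>F y in at z within S. c \<le> h y" unfolding eventually_at_topological using assms by (intro exI[of _ V]) auto
  then show ?thesis unfolding lsc_envelope_def using assms by (simp add: Liminf_bounded)
qed

lemma lsc_envelope_nbhd:
  assumes c: "c < lsc_envelope S h z"
  obtains V where "open V" "z \<in> V" "\<And>y. y \<in> V \<Longrightarrow> y \<in> S \<Longrightarrow> c < h y"
proof -
  have "c < h z" "c < Liminf (at z within S) h" using c by (auto simp: lsc_envelope_def)
  then have "\<forall>\<^sub>F y in at z within S. c < h y" using less_LiminfD by blast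
  then obtain V where "open V" "z \<in> V" "\<forall>y\<in>V. y \<noteq> z \<longrightarrow> y \<in> S \<longrightarrow> c < h y" unfolding eventually_at_topological by (elim exE conjE)
  then show ?thesis using that[of V] \<open>c < h z\<close> by (cases "z \<in> S") metis+
qed

lemma lsc_on_envelope: "lsc_on S (lsc_envelope S h)"
  unfolding lsc_on_def le_Liminf_iff
proof (intro ballI allI impI)
  fix z c assume z: "z \<in> S" and c: "c < lsc_envelope S h z"
  obtain c' where c': "c < c'" "c' < lsc_envelope S h z" using dense[OF c] by blast
  obtain V where V: "open V" "z \<in> V" "\<And>y. y \<in> V \<Longrightarrow> y \<in> S \<Longrightarrow> c' < h y"
    by (rule lsc_envelope_nbhd[OF c'(2)]) (rule that)
  have "c < lsc_envelope S h y" if "y \<in> V" "y \<in> S" for y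
    using less_le_trans[OF c'(1) lsc_envelope_ge[OF V(1) that less_imp_le[OF V(3)]]] .
  then show "\<forall>\<^sub>F y in at z within S. c < lsc_envelope S h y"
    unfolding eventually_at_topological using V by (intro exI[of _ V]) simp
qed

lemma lsc_envelope_ge_continuous:
  fixes g :: "'a::topological_space \<Rightarrow> real"
  assumes S: "open S" "z \<in> S" and g: "continuous_on S g" and le: "\<And>y. y \<in> S \<Longrightarrow> ereal (g y) \<le> h y"
  shows "ereal (g z) \<le> lsc_envelope S h z"
proof (rule ereal_le_epsilon2)
  fix e :: real assume e: "e > 0"
  have "open (S \<inter> g -` {g z - e<..})" using S(1) g by (intro continuous_open_preimage) auto
  then have "ereal (g z - e) \<le> lsc_envelope S h z"
  proof (rule lsc_envelope_ge)
    fix y assume "y \<in> S \<inter> g -` {g z - e<..}" "y \<in> S"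
    then show "ereal (g z - e) \<le> h y" using le[of y] by (intro order_trans[OF _ le[of y]]) auto
  qed (use S e in auto)
  then show "ereal (g z) \<le> lsc_envelope S h z + ereal e" by (cases "lsc_envelope S h z") auto
qed

lemma lsc_envelope_approx:
  fixes h :: "'a::metric_space \<Rightarrow> ereal"
  assumes a: "lsc_envelope S h z = ereal a" and e: "e > 0" "d > 0" and z: "z \<in> S"
  obtains y where "y \<in> S" "dist z y < d" "h y < ereal (a + e)"
proof -
  have "\<exists>y. y \<in> S \<and> dist z y < d \<and> h y < ereal (a + e)"
  proof (rule ccontr)
    assume "\<not> ?thesis"
    then have "ereal (a + e) \<le> h y" if "y \<in> ball z d" "y \<in> S" for y using that by (auto simp: not_less)
    then have "ereal (a + e) \<le> lsc_envelope S h z" using e z by (intro lsc_envelope_ge[of "ball z d"]) auto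
    then show False using a e by simp
  qed
  then show ?thesis using that by blast
qed

section \<open>The envelope of a family of supersolutions is a supersolution\<close>

text \<open>The constant member bounds the envelope from above, so that it is finite on all of
  \<open>\<Theta>\<close>.\<close>

locale supersolution_family =
  fixes p q m c :: real and \<Theta> :: "((real ^ 'n) \<times> real) set" and \<U> :: "((real ^ 'n) \<times> real \<Rightarrow> ereal) set"
  assumes open_dom: "open \<Theta>"
    and super: "\<And>u. u \<in> \<U> \<Longrightarrow> viscosity_supersolution p q \<Theta> u"
    and lower: "\<And>u z. u \<in> \<U> \<Longrightarrow> z \<in> \<Theta> \<Longrightarrow> ereal m \<le> u z"
    and upper: "(\<lambda>z. ereal c) \<in> \<U>"
begin

definition env :: "(real ^ 'n) \<times> real \<Rightarrow> ereal" where
  "env = lsc_envelope \<Theta> (\<lambda>z. INF u\<in>\<U>. u z)"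

lemma env_bounds:
  assumes z: "z \<in> \<Theta>"
  shows "ereal m \<le> env z" "u \<in> \<U> \<Longrightarrow> env z \<le> u z" "env z = ereal (real_of_ereal (env z))"
proof -
  show 1: "ereal m \<le> env z" unfolding env_def by (rule lsc_envelope_ge[OF open_dom z z]) (auto intro!: INF_greatest lower)
  show 2: "env z \<le> u z" if "u \<in> \<U>" for u
    unfolding env_def by (rule order_trans[OF lsc_envelope_le]) (rule INF_lower[OF that])
  show "env z = ereal (real_of_ereal (env z))" using 1 2[OF upper] by (cases "env z") auto
qed

lemma lsc_env: "lsc_on \<Theta> env"
  unfolding env_def by (rule lsc_on_envelope)

text \<open>A member that nearly attains the infimum close to \<open>\<xi>\<close> comes within
  \<open>\<mu> / 2\<close> of \<open>\<psi>\<close> there, while on the sphere it stays at least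
  \<open>\<mu>\<close> above. So the minimum of \<open>u - \<psi>\<close> over the ball is interior,
  and a vertical translate of \<open>\<psi>\<close> touches \<open>u\<close> at it.\<close>

lemma env_touch:
  assumes r: "r > 0" "cball \<xi> r \<subseteq> \<Theta>" and \<psi>: "continuous_on (cball \<xi> r) \<psi>" and \<mu>: "\<mu> > 0"
    and sphere: "\<And>z. z \<in> sphere \<xi> r \<Longrightarrow> ereal (\<psi> z + \<mu>) \<le> env z" and eq: "env \<xi> = ereal (\<psi> \<xi>)"
  obtains u y a where "u \<in> \<U>" "y \<in> ball \<xi> r" "u y = ereal a" "\<forall>\<^sub>F z in at y. ereal (\<psi> z - \<psi> y + a) \<le> u z"
proof -
  have \<xi>: "\<xi> \<in> \<Theta>" using r by auto
  have K: "compact (cball \<xi> r)" "cball \<xi> r \<noteq> {}" using r by auto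
  obtain b where b: "\<And>z. z \<in> cball \<xi> r \<Longrightarrow> \<psi> z \<le> b" using continuous_attains_sup[OF K \<psi>] by blast
  define N where "N = max m (b + \<mu>)"
  have N: "m \<le> N" by (simp add: N_def)
  have "\<exists>d>0. \<forall>z\<in>cball \<xi> r. dist z \<xi> < d \<longrightarrow> dist (\<psi> z) (\<psi> \<xi>) < \<mu> / 4"
    using \<psi>[unfolded continuous_on_iff, rule_format, of \<xi> "\<mu> / 4"] \<mu> r(1) by simp
  then obtain d where d: "d > 0" "\<And>z. z \<in> cball \<xi> r \<Longrightarrow> dist z \<xi> < d \<Longrightarrow> dist (\<psi> z) (\<psi> \<xi>) < \<mu> / 4" by blast
  have "\<mu> / 4 > 0" "min d r > 0" using \<mu> d r by auto
  obtain y0 where y0: "y0 \<in> \<Theta>" "dist \<xi> y0 < min d r" "(INF u\<in>\<U>. u y0) < ereal (\<psi> \<xi> + \<mu> / 4)"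
    by (rule lsc_envelope_approx[OF eq[unfolded env_def] \<open>\<mu> / 4 > 0\<close> \<open>min d r > 0\<close> \<xi>]) (rule that)
  obtain u where u: "u \<in> \<U>" "u y0 < ereal (\<psi> \<xi> + \<mu> / 4)" using y0(3) unfolding INF_less_iff by blast
  have uS: "lsc_on \<Theta> u" using super[OF u(1)] by (simp add: viscosity_supersolution_def)
  note lb = lower[OF u(1)]
  obtain y where y: "y \<in> cball \<xi> r" "\<And>z. z \<in> cball \<xi> r \<Longrightarrow> truncate_at N (u y) - \<psi> y \<le> truncate_at N (u z) - \<psi> z"
    using truncated_minimum[OF uS lb N K r(2) \<psi>] by blast
  have y\<Theta>: "y \<in> \<Theta>" using y r by auto
  have y0r: "y0 \<in> cball \<xi> r" using y0 by simp
  have "truncate_at N (u y0) < \<psi> \<xi> + \<mu> / 4"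
    using order.strict_trans1[OF truncate_at(1)[OF lb[OF y0(1)] N] u(2)] by simp
  moreover have "\<bar>\<psi> y0 - \<psi> \<xi>\<bar> < \<mu> / 4" using d(2)[OF y0r] y0 by (simp add: dist_commute dist_real_def abs_minus_commute)
  ultimately have ty: "truncate_at N (u y) < \<psi> y + \<mu>" using y(2)[OF y0r] \<mu> by linarith
  have bN: "\<psi> y + \<mu> \<le> N" using b[OF y(1)] by (simp add: N_def)
  have uy: "u y = ereal (truncate_at N (u y))" using truncate_at(4)[OF lb[OF y\<Theta>] N] ty bN by simp
  have "y \<notin> sphere \<xi> r"
  proof
    assume "y \<in> sphere \<xi> r"
    then have "ereal (\<psi> y + \<mu>) \<le> u y" using sphere env_bounds(2)[OF y\<Theta> u(1)] by (blast intro: order_trans)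
    moreover have "u y < ereal (\<psi> y + \<mu>)" by (subst uy) (use ty in simp)
    ultimately show False by simp
  qed
  then have yb: "y \<in> ball \<xi> r" using y(1) by auto
  have "\<forall>\<^sub>F z in at y. z \<in> ball \<xi> r" by (rule eventually_at_in_open'[OF open_ball yb])
  then have "\<forall>\<^sub>F z in at y. ereal (\<psi> z - \<psi> y + truncate_at N (u y)) \<le> u z"
  proof eventually_elim
    case (elim z)
    then have z: "z \<in> cball \<xi> r" "z \<in> \<Theta>" using r(2) by auto
    have "\<psi> z - \<psi> y + truncate_at N (u y) \<le> truncate_at N (u z)" using y(2)[OF z(1)] by simp
    then show ?case by (intro order_trans[OF _ truncate_at(1)[OF lb[OF z(2)] N]]) simp
  qed
  then show ?thesis using that[OF u(1) yb uy] by simp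
qed

text \<open>If the inequality failed at \<open>\<xi>\<close> it would fail on a whole ball, by
  continuity of the operator at nonzero gradients; \<open>env_touch\<close> produces a contact with
  a member inside that ball.\<close>

lemma env_test_nondegenerate:
  assumes D: "C2_data \<Theta> \<phi> g H" and \<xi>: "\<xi> \<in> \<Theta>" and eq: "env \<xi> = ereal (\<phi> \<xi>)"
    and below: "\<forall>\<^sub>F z in at \<xi>. ereal (\<phi> z) < env z" and nz: "fst (g \<xi>) \<noteq> 0"
  shows "pq_operator p q (fst (g \<xi>)) (matrix (space_hess (H \<xi>))) \<le> snd (g \<xi>)"
proof (rule ccontr)
  assume neg: "\<not> ?thesis"
  have cg: "(g \<longlongrightarrow> g \<xi>) (at \<xi>)"
    using C2_dataD(5)[OF D] \<xi> open_dom by (simp add: continuous_on_eq_continuous_at isCont_def)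
  have cH: "((\<lambda>z. H z v) \<longlongrightarrow> H \<xi> v) (at \<xi>)" for v
    using C2_dataD(3)[OF D, of v] \<xi> open_dom by (simp add: continuous_on_eq_continuous_at isCont_def)
  have cM: "((\<lambda>z. matrix (space_hess (H z))) \<longlongrightarrow> matrix (space_hess (H \<xi>))) (at \<xi>)"
    unfolding matrix_def space_hess_def by (intro tendsto_vec_lambda tendsto_vec_nth tendsto_fst cH)
  have "((\<lambda>z. pq_operator p q (fst (g z)) (matrix (space_hess (H z))) - snd (g z)) \<longlongrightarrow>
      pq_operator p q (fst (g \<xi>)) (matrix (space_hess (H \<xi>))) - snd (g \<xi>)) (at \<xi>)"
    by (intro tendsto_diff pq_operator_tendsto tendsto_fst tendsto_snd cg cM nz)
  then have "\<forall>\<^sub>F z in at \<xi>. 0 < pq_operator p q (fst (g z)) (matrix (space_hess (H z))) - snd (g z)"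
    by (rule order_tendstoD(1)) (use neg in simp)
  moreover have "\<forall>\<^sub>F z in at \<xi>. fst (g z) \<noteq> 0"
    using tendsto_imp_eventually_ne[OF tendsto_fst[OF cg] nz] .
  moreover have "\<forall>\<^sub>F z in at \<xi>. z \<in> \<Theta>" by (rule eventually_at_in_open'[OF open_dom \<xi>])
  ultimately have "\<forall>\<^sub>F z in at \<xi>. snd (g z) < pq_operator p q (fst (g z)) (matrix (space_hess (H z))) \<and> fst (g z) \<noteq> 0 \<and> z \<in> \<Theta> \<and> ereal (\<phi> z) < env z"
    using below by eventually_elim simp
  then obtain d where d: "d > 0" "\<And>z. z \<noteq> \<xi> \<Longrightarrow> dist z \<xi> < d \<Longrightarrow> snd (g z) < pq_operator p q (fst (g z)) (matrix (space_hess (H z))) \<and> fst (g z) \<noteq> 0 \<and> z \<in> \<Theta> \<and> ereal (\<phi> z) < env z"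
    unfolding eventually_at by blast
  define r where "r = d / 2"
  have r: "r > 0" "r < d" using d by (auto simp: r_def)
  have all: "snd (g z) < pq_operator p q (fst (g z)) (matrix (space_hess (H z))) \<and> fst (g z) \<noteq> 0 \<and> z \<in> \<Theta>" if "z \<in> cball \<xi> r" for z
    using d(2)[of z] that r \<xi> nz neg by (cases "z = \<xi>") (auto simp: dist_commute)
  have sub: "cball \<xi> r \<subseteq> \<Theta>" "sphere \<xi> r \<subseteq> \<Theta>" using all by auto
  have cont: "continuous_on \<Theta> \<phi>" by (rule C2_dataD(6)[OF D])
  have "\<exists>\<mu>>0. \<forall>z\<in>sphere \<xi> r. ereal (\<phi> z + \<mu>) \<le> env z"
  proof (rule lsc_gap[OF lsc_env env_bounds(1)])
    show "ereal (\<phi> z) < env z" if "z \<in> sphere \<xi> r" for z using d(2)[of z] that r by (auto simp: dist_commute)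
  qed (use sub continuous_on_subset[OF cont] in auto)
  then obtain \<mu> where \<mu>: "\<mu> > 0" "\<And>z. z \<in> sphere \<xi> r \<Longrightarrow> ereal (\<phi> z + \<mu>) \<le> env z" by blast
  obtain u y a where uy: "u \<in> \<U>" "y \<in> ball \<xi> r" "u y = ereal a" "\<forall>\<^sub>F z in at y. ereal (\<phi> z - \<phi> y + a) \<le> u z"
    by (rule env_touch[OF r(1) sub(1) continuous_on_subset[OF cont sub(1)] \<mu> eq]; (assumption | rule that))
  have y: "y \<in> cball \<xi> r" using uy(2) by simp
  have "pq_operator p q (fst (g y)) (matrix (space_hess (H y))) \<le> snd (g y)"
    using all[OF y] by (intro supersolution_touched[OF super[OF uy(1)] open_dom D _ uy(3,4)]) auto
  then show False using all[OF y] by simp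
qed

text \<open>\<open>B\<close> stands for minus the time derivative. At points near
  \<open>\<xi>\<close> the gradient of \<open>\<phi>\<close> may vanish without
  \<open>\<phi>\<close> being admissible, so \<open>\<phi>\<close> itself cannot be tested there. It
  is replaced by a separated function \<open>- f + \<rho>\<close>: at a contact point over
  \<open>x0\<close> the degenerate test applies; elsewhere the gradient is nonzero, and the limit
  condition of the radial class makes the operator small against \<open>B\<close>.\<close>

lemma env_test_degenerate:
  assumes D: "C2_data \<Theta> \<phi> g H" and \<xi>: "\<xi> \<in> \<Theta>" and eq: "env \<xi> = ereal (\<phi> \<xi>)"
    and below: "\<forall>\<^sub>F z in at \<xi>. ereal (\<phi> z) < env z"
    and f: "f \<in> radial_class TYPE('n) p q" and \<sigma>: "\<sigma> \<in> time_class" and \<delta>: "\<delta> > 0"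
    and bound: "\<And>z. norm (fst z - fst \<xi>) < \<delta> \<Longrightarrow> \<bar>snd z - snd \<xi>\<bar> < \<delta> \<Longrightarrow>
      \<phi> \<xi> - B * (snd z - snd \<xi>) - f (norm (fst z - fst \<xi>)) - \<sigma> (snd z - snd \<xi>) \<le> \<phi> z"
  shows "B \<le> 0"
proof (rule ccontr)
  assume "\<not> B \<le> 0"
  then have B: "B > 0" by simp
  obtain f' f'' where prof: "radial_profile f f' f''" and fpos: "\<And>r. r > 0 \<Longrightarrow> f' r > 0"
    and lim: "((\<lambda>x :: real ^ 'n. pq_operator p q (radial_profile.radial_grad f' x) (matrix (radial_profile.radial_hess f' f'' x))) \<longlongrightarrow> 0) (at 0)"
    by (rule radial_classE[OF f]) (rule that)
  interpret radial_profile f f' f'' by (rule prof)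
  define x0 t0 where "x0 = fst \<xi>" and "t0 = snd \<xi>"
  have "\<forall>\<^sub>F x in at (0 :: real ^ 'n). \<bar>pq_operator p q (radial_grad x) (matrix (radial_hess x))\<bar> < B / 4"
    using tendstoD[OF lim, of "B / 4"] B by (simp add: dist_real_def)
  then obtain d1 where d1: "d1 > 0" "\<And>x :: real ^ 'n. x \<noteq> 0 \<Longrightarrow> norm x < d1 \<Longrightarrow> \<bar>pq_operator p q (radial_grad x) (matrix (radial_hess x))\<bar> < B / 4"
    unfolding eventually_at by (auto simp: dist_norm)
  \<comment> \<open>\<open>\<sigma>\<close> is only C1 and cannot enter a test function; what is
    kept of it is that it is \<open>o(|\<tau>|)\<close>.\<close>
  obtain d2 where d2: "d2 > 0" "\<And>\<tau>. \<bar>\<tau>\<bar> < d2 \<Longrightarrow> \<sigma> \<tau> \<le> B / 4 * \<bar>\<tau>\<bar>"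
  proof -
    have \<sigma>0: "\<sigma> 0 = 0" "deriv \<sigma> 0 = 0" "\<sigma> C1_differentiable_on UNIV" using \<sigma> by (auto simp: time_class_def)
    then have "\<sigma> differentiable at 0" by (simp add: C1_differentiable_on_eq)
    then have "(\<sigma> has_real_derivative 0) (at 0)"
      using \<sigma>0(2) by (metis DERIV_deriv_iff_real_differentiable)
    then have "((\<lambda>h. \<sigma> h / h) \<longlongrightarrow> 0) (at 0)" by (simp add: DERIV_def \<sigma>0(1))
    then have "\<forall>\<^sub>F h in at 0. dist (\<sigma> h / h) 0 < B / 4" by (rule tendstoD) (use B in simp)
    then obtain d where d: "d > 0" "\<And>h. h \<noteq> 0 \<Longrightarrow> dist h 0 < d \<Longrightarrow> dist (\<sigma> h / h) 0 < B / 4"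
      unfolding eventually_at by blast
    have "\<sigma> \<tau> \<le> B / 4 * \<bar>\<tau>\<bar>" if "\<bar>\<tau>\<bar> < d" for \<tau>
    proof (cases "\<tau> = 0")
      case False
      then have "\<bar>\<sigma> \<tau>\<bar> / \<bar>\<tau>\<bar> < B / 4" using d(2)[OF False] that by (simp add: dist_real_def)
      then have "\<bar>\<sigma> \<tau>\<bar> < B / 4 * \<bar>\<tau>\<bar>" using False by (simp add: pos_divide_less_eq)
      then show ?thesis by simp
    qed (simp add: \<sigma>0)
    then show ?thesis using that d(1) by blast
  qed
  obtain d3 where d3: "d3 > 0" "\<And>z. z \<noteq> \<xi> \<Longrightarrow> dist z \<xi> < d3 \<Longrightarrow> ereal (\<phi> z) < env z"
    using below unfolding eventually_at by blast
  obtain d4 where d4: "d4 > 0" "ball \<xi> d4 \<subseteq> \<Theta>" using open_dom \<xi> open_contains_ball by blast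
  define r where "r = min (min d1 d2) (min (min d3 d4) \<delta>) / 2"
  have r: "r > 0" "r < d1" "r < d2" "r < d3" "r < d4" "r < \<delta>" using d1(1) d2(1) d3(1) d4(1) \<delta> by (auto simp: r_def)
  have sub: "cball \<xi> r \<subseteq> \<Theta>" using d4(2) r by (auto simp: subset_iff)
  have near: "norm (fst z - x0) \<le> r" "\<bar>snd z - t0\<bar> \<le> r" if "z \<in> cball \<xi> r" for z
  proof -
    have "dist (fst z) x0 \<le> dist z \<xi>" "dist (snd z) t0 \<le> dist z \<xi>" unfolding x0_def t0_def by (rule dist_fst_le dist_snd_le)+
    moreover have "dist z \<xi> \<le> r" using that by (simp add: dist_commute)
    ultimately show "norm (fst z - x0) \<le> r" "\<bar>snd z - t0\<bar> \<le> r" by (simp_all add: dist_norm)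
  qed
  have cont: "continuous_on \<Theta> \<phi>" by (rule C2_dataD(6)[OF D])
  have "\<exists>\<mu>>0. \<forall>z\<in>sphere \<xi> r. ereal (\<phi> z + \<mu>) \<le> env z"
  proof (rule lsc_gap[OF lsc_env env_bounds(1)])
    show "ereal (\<phi> z) < env z" if "z \<in> sphere \<xi> r" for z using d3(2)[of z] that r by (auto simp: dist_commute)
    show "sphere \<xi> r \<subseteq> \<Theta>" using sub by auto
    then show "continuous_on (sphere \<xi> r) \<phi>" by (rule continuous_on_subset[OF cont])
  qed auto
  then obtain \<mu> where \<mu>: "\<mu> > 0" "\<And>z. z \<in> sphere \<xi> r \<Longrightarrow> ereal (\<phi> z + \<mu>) \<le> env z" by blast
  \<comment> \<open>\<open>S\<close> is a smooth majorant of \<open>|t - t0|\<close> with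
    \<open>S t0 = s\<close>. Since \<open>B / 4 * s = \<mu> / 2\<close>, the constant
    \<open>\<mu> / 2\<close> in \<open>\<psi>\<close> restores the value \<open>\<phi> \<xi>\<close>
    at \<open>\<xi>\<close>.\<close>
  define s where "s = 2 * \<mu> / B"
  have s: "s > 0" "B / 4 * s = \<mu> / 2" using \<mu> B by (auto simp: s_def)
  define S where "S t = sqrt ((t - t0)\<^sup>2 + s\<^sup>2)" for t
  have S: "S t > 0" "S t \<ge> \<bar>t - t0\<bar>" "(S t)\<^sup>2 = (t - t0)\<^sup>2 + s\<^sup>2" for t
    using s by (auto simp: S_def intro!: add_nonneg_pos real_le_rsqrt)
  define \<rho> where "\<rho> t = - (B * (t - t0)) - B / 4 * S t" for t
  define \<rho>' where "\<rho>' t = - B - B / 4 * ((t - t0) / S t)" for t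
  define \<rho>'' where "\<rho>'' t = - (B / 4 * (s\<^sup>2 / (S t) ^ 3))" for t
  have dS: "(S has_real_derivative (t - t0) / S t) (at t)" for t
  proof -
    have pos: "(t - t0)\<^sup>2 + s\<^sup>2 > 0" using s by (simp add: add_nonneg_pos)
    have "((\<lambda>t. (t - t0)\<^sup>2 + s\<^sup>2) has_real_derivative 2 * (t - t0)) (at t)" by (auto intro!: derivative_eq_intros)
    from DERIV_chain2[OF DERIV_real_sqrt[OF pos] this]
    have dS: "(S has_real_derivative inverse (S t) / 2 * (2 * (t - t0))) (at t)" unfolding S_def[abs_def] .
    have "inverse X / 2 * (2 * y) = y / X" for X y :: real by (cases "X = 0") (simp_all add: field_simps)
    from dS[unfolded this[of "S t" "t - t0"]] show ?thesis .
  qed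
  have \<rho>1: "(\<rho> has_real_derivative \<rho>' t) (at t)" for t
    unfolding \<rho>_def \<rho>'_def by (auto intro!: derivative_eq_intros dS)
  have \<rho>2: "(\<rho>' has_real_derivative \<rho>'' t) (at t)" for t
  proof -
    have nz: "S t \<noteq> 0" using S(1)[of t] by simp
    have "((\<lambda>t. (t - t0) / S t) has_real_derivative (1 * S t - (t - t0) * ((t - t0) / S t)) / (S t * S t)) (at t)"
      by (rule DERIV_divide[OF _ dS nz]) (auto intro!: derivative_eq_intros)
    moreover have "(1 * S t - (t - t0) * ((t - t0) / S t)) / (S t * S t) = ((S t)\<^sup>2 - (t - t0)\<^sup>2) / (S t) ^ 3"
      using nz by (simp add: field_simps power2_eq_square power3_eq_cube)
    ultimately have "((\<lambda>t. (t - t0) / S t) has_real_derivative s\<^sup>2 / (S t) ^ 3) (at t)" by (simp add: S(3))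
    from DERIV_diff[OF DERIV_const DERIV_cmult[OF this], of "- B" "B / 4"]
    show ?thesis unfolding \<rho>'_def \<rho>''_def by simp
  qed
  have \<rho>3: "continuous_on UNIV \<rho>''"
  proof -
    have "continuous_on UNIV S" unfolding S_def[abs_def] by (intro continuous_intros)
    moreover have "\<forall>t\<in>UNIV. S t ^ 3 \<noteq> 0" using S(1) by (metis less_irrefl power_not_zero)
    ultimately show ?thesis unfolding \<rho>''_def[abs_def] by (intro continuous_intros)
  qed
  have \<rho>'neg: "\<rho>' t \<le> - (3 / 4 * B)" for t
  proof -
    have 1: "- ((t - t0) / S t) \<le> 1" using S(1,2)[of t] by (simp add: minus_divide_left pos_divide_le_eq)
    have "- (b * y) \<le> b" if "b > 0" "- y \<le> 1" for b y :: real using mult_left_mono[OF that(2), of b] that(1) by simp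
    from this[OF _ 1, of "B / 4"] show ?thesis unfolding \<rho>'_def using B by argo
  qed
  define \<psi> where "\<psi> z = (\<phi> \<xi> + \<mu> / 2) + (- 1 * f (norm (fst z - x0)) + \<rho> (snd z))" for z
  define g1 where "g1 z = 0 + (- 1 *\<^sub>R (radial_grad (fst z - x0), 0) + (0, \<rho>' (snd z)))" for z :: "(real ^ 'n) \<times> real"
  define H1 where "H1 z v = 0 + (- 1 *\<^sub>R (radial_hess (fst z - x0) (fst v), 0) + (0, \<rho>'' (snd z) * snd v))" for z v :: "(real ^ 'n) \<times> real"
  have D1: "C2_data \<Theta> \<psi> g1 H1"
    unfolding \<psi>_def[abs_def] g1_def[abs_def] H1_def[abs_def]
    by (intro C2_data_add C2_data_const C2_data_scale C2_data_fst[OF C2_data_shift[OF C2_data_radial]] C2_data_snd_real \<rho>1 \<rho>2 \<rho>3)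
  have \<psi>\<xi>: "env \<xi> = ereal (\<psi> \<xi>)"
    using s eq by (simp add: \<psi>_def x0_def[symmetric] t0_def[symmetric] \<rho>_def S_def f0)
  \<comment> \<open>Half of the gap \<open>\<mu>\<close> is spent on that constant, half remains for
    \<open>env_touch\<close>.\<close>
  have \<psi>sphere: "ereal (\<psi> z + \<mu> / 2) \<le> env z" if z: "z \<in> sphere \<xi> r" for z
  proof -
    have zc: "z \<in> cball \<xi> r" using z by simp
    let ?\<tau> = "snd z - t0"
    have 1: "norm (fst z - fst \<xi>) < \<delta>" "\<bar>snd z - snd \<xi>\<bar> < \<delta>" "\<bar>?\<tau>\<bar> < d2" using near[OF zc] r by (auto simp: x0_def t0_def)
    have "\<phi> \<xi> - B * ?\<tau> - f (norm (fst z - x0)) - \<sigma> ?\<tau> \<le> \<phi> z"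
      using bound[OF 1(1,2)] by (simp only: x0_def t0_def)
    moreover have "\<sigma> ?\<tau> \<le> B / 4 * \<bar>?\<tau>\<bar>" by (rule d2(2)[OF 1(3)])
    moreover have "B / 4 * \<bar>?\<tau>\<bar> \<le> B / 4 * S (snd z)" using B S(2) by (intro mult_left_mono) auto
    ultimately have "\<psi> z \<le> \<phi> z + \<mu> / 2" unfolding \<psi>_def \<rho>_def by argo
    then have "ereal (\<psi> z + \<mu> / 2) \<le> ereal (\<phi> z + \<mu>)" by simp
    then show ?thesis using \<mu>(2)[OF z] by (rule order_trans)
  qed
  have "\<mu> / 2 > 0" using \<mu> by simp
  obtain u y a where uy: "u \<in> \<U>" "y \<in> ball \<xi> r" "u y = ereal a" "\<forall>\<^sub>F z in at y. ereal (\<psi> z - \<psi> y + a) \<le> u z"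
    by (rule env_touch[OF r(1) sub continuous_on_subset[OF C2_dataD(6)[OF D1] sub] \<open>\<mu> / 2 > 0\<close> \<psi>sphere \<psi>\<xi>]; (assumption | rule that))
  have yc: "y \<in> cball \<xi> r" and y\<Theta>: "y \<in> \<Theta>" using uy(2) sub by auto
  show False
  proof (cases "fst y = x0")
    case True
    have yp: "y = (x0, snd y)" using True by (simp add: prod_eq_iff)
    have "0 \<le> \<rho>' (snd y)"
    proof (rule supersolution_touched_degenerate[OF super[OF uy(1)] open_dom f \<rho>1 \<rho>2 \<rho>3])
      show "(x0, snd y) \<in> \<Theta>" "u (x0, snd y) = ereal a" using y\<Theta> uy(3) yp by simp_all
      have "ereal (\<psi> z - \<psi> y + a) = ereal (\<rho> (snd z) - \<rho> (snd y) - f (norm (fst z - x0)) + a)" for z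
        using True by (simp add: \<psi>_def f0)
      then show "\<forall>\<^sub>F z in at (x0, snd y). ereal (\<rho> (snd z) - \<rho> (snd y) - f (norm (fst z - x0)) + a) \<le> u z"
        using uy(4) yp by simp
    qed
    then show False using \<rho>'neg[of "snd y"] B by simp
  next
    case False
    define e where "e = fst y - x0"
    have e: "e \<noteq> 0" "norm e < d1" using False near[OF yc] r by (auto simp: e_def)
    have ge: "fst (g1 y) = - radial_grad e" "snd (g1 y) = \<rho>' (snd y)" by (simp_all add: g1_def e_def)
    have "f' (norm e) > 0" using fpos e by simp
    then have "radial_grad e \<noteq> 0" using e by (simp add: radial_grad_def)
    then have "pq_operator p q (fst (g1 y)) (matrix (space_hess (H1 y))) \<le> snd (g1 y)"
      by (intro supersolution_touched[OF super[OF uy(1)] open_dom D1 y\<Theta> uy(3,4)]) (simp add: ge)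
    moreover have "matrix (space_hess (H1 y)) = - matrix (radial_hess e)"
      by (simp add: matrix_def space_hess_def H1_def e_def vec_eq_iff)
    moreover have "pq_operator p q (- radial_grad e) (- matrix (radial_hess e)) = - pq_operator p q (radial_grad e) (matrix (radial_hess e))"
    proof -
      have "pq_operator p q (radial_grad e) 0 = 0" by (simp add: pq_operator_alt trace_def)
      then show ?thesis
        using pq_operator_add[of p q "radial_grad e" "matrix (radial_hess e)" "- matrix (radial_hess e)"]
        by (simp add: pq_operator_minus)
    qed
    ultimately have "- pq_operator p q (radial_grad e) (matrix (radial_hess e)) \<le> \<rho>' (snd y)" by (simp add: ge)
    then show False using d1(2)[OF e] \<rho>'neg[of "snd y"] B by linarith
  qed
qed

theorem env_supersolution: "viscosity_supersolution p q \<Theta> env"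
  unfolding viscosity_supersolution_def
proof (intro conjI ballI allI impI)
  fix \<xi> assume \<xi>: "\<xi> \<in> \<Theta>"
  show "env \<xi> \<noteq> - \<infinity>" using env_bounds(3)[OF \<xi>] by auto
next
  have "{\<xi> \<in> \<Theta>. env \<xi> \<noteq> \<infinity>} = \<Theta>"
  proof (intro set_eqI iffI CollectI conjI)
    show "env \<xi> \<noteq> \<infinity>" if "\<xi> \<in> \<Theta>" for \<xi> using env_bounds(3)[OF that] by auto
  qed auto
  then show "\<Theta> \<subseteq> closure {\<xi> \<in> \<Theta>. env \<xi> \<noteq> \<infinity>}" by (simp add: closure_subset)
next
  fix \<phi> \<xi>
  assume \<xi>: "\<xi> \<in> \<Theta>" and C2: "C2_on \<Theta> \<phi>" and adm: "admissible_at p q \<Theta> \<phi> \<xi>" and touch: "touches_from_below \<Theta> \<phi> env \<xi>"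
  obtain g H where D: "C2_data \<Theta> \<phi> g H" using C2_on_imp_C2_data[OF C2] .
  note ops = C2_data_operators[OF D open_dom \<xi>]
  have eq: "env \<xi> = ereal (\<phi> \<xi>)" and below: "\<forall>\<^sub>F z in at \<xi>. ereal (\<phi> z) < env z"
    using touch at_within_open[OF \<xi> open_dom] by (auto simp: touches_from_below_def)
  show "if spatial_grad \<phi> \<xi> \<noteq> 0 then time_deriv \<phi> \<xi> - spatial_pq_laplacian p q \<phi> \<xi> \<ge> 0 else time_deriv \<phi> \<xi> \<ge> 0"
  proof (cases "spatial_grad \<phi> \<xi> = 0")
    case False
    then show ?thesis using env_test_nondegenerate[OF D \<xi> eq below] by (simp add: ops)
  next
    case True
    then obtain \<delta> f \<sigma> where a: "\<delta> > 0" "f \<in> radial_class TYPE('n) p q" "\<sigma> \<in> time_class"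
      and b: "\<forall>x \<in> ball (fst \<xi>) \<delta>. \<forall>t \<in> {snd \<xi> - \<delta><..<snd \<xi> + \<delta>}.
           \<bar>\<phi> (x, t) - \<phi> \<xi> - time_deriv \<phi> \<xi> * (t - snd \<xi>)\<bar> \<le> f (norm (x - fst \<xi>)) + \<sigma> (t - snd \<xi>)"
      using adm unfolding admissible_at_def by blast
    have "- time_deriv \<phi> \<xi> \<le> 0"
    proof (rule env_test_degenerate[OF D \<xi> eq below a(2,3,1)])
      fix z :: "(real ^ 'n) \<times> real"
      assume "norm (fst z - fst \<xi>) < \<delta>" "\<bar>snd z - snd \<xi>\<bar> < \<delta>"
      then have "fst z \<in> ball (fst \<xi>) \<delta>" "snd z \<in> {snd \<xi> - \<delta><..<snd \<xi> + \<delta>}"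
        by (auto simp: dist_norm norm_minus_commute abs_less_iff)
      from b[rule_format, OF this]
      have "\<bar>\<phi> z - \<phi> \<xi> - time_deriv \<phi> \<xi> * (snd z - snd \<xi>)\<bar> \<le> f (norm (fst z - fst \<xi>)) + \<sigma> (snd z - snd \<xi>)" by simp
      then show "\<phi> \<xi> - - time_deriv \<phi> \<xi> * (snd z - snd \<xi>) - f (norm (fst z - fst \<xi>)) - \<sigma> (snd z - snd \<xi>) \<le> \<phi> z"
        by simp
    qed
    then show ?thesis using True by simp
  qed
qed (rule lsc_env)

end

subsection \<open>Barriers and regularity\<close>

text \<open>A function touching a constant from below has a local maximum there, so its whole
  space-time gradient vanishes.\<close>

lemma constant_supersolution:
  assumes op: "open (\<Theta> :: ((real ^ 'n) \<times> real) set)"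
  shows "viscosity_supersolution p q \<Theta> (\<lambda>z. ereal c)"
  unfolding viscosity_supersolution_def
proof (intro conjI ballI allI impI)
  show "lsc_on \<Theta> (\<lambda>z. ereal c)" unfolding lsc_on_def by (auto intro!: Liminf_bounded)
  show "\<Theta> \<subseteq> closure {\<xi> \<in> \<Theta>. ereal c \<noteq> \<infinity>}" by (simp add: closure_subset)
next
  fix \<phi> \<xi>
  assume \<xi>: "\<xi> \<in> \<Theta>" and C2: "C2_on \<Theta> \<phi>" and touch: "touches_from_below \<Theta> \<phi> (\<lambda>z. ereal c) \<xi>"
  obtain g H where D: "C2_data \<Theta> \<phi> g H" using C2_on_imp_C2_data[OF C2] .
  have "\<forall>\<^sub>F z in at \<xi>. \<phi> z < c" "\<phi> \<xi> = c"
    using touch at_within_open[OF \<xi> op] by (auto simp: touches_from_below_def)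
  then have "\<forall>\<^sub>F z in at \<xi>. \<phi> z \<le> \<phi> \<xi>" by (auto elim: eventually_mono)
  from has_derivative_local_max[OF C2_dataD(1)[OF D \<xi>] this]
  have "g \<xi> \<bullet> g \<xi> = 0" by (rule fun_cong)
  then have "g \<xi> = 0" by simp
  then show "if spatial_grad \<phi> \<xi> \<noteq> 0 then time_deriv \<phi> \<xi> - spatial_pq_laplacian p q \<phi> \<xi> \<ge> 0 else time_deriv \<phi> \<xi> \<ge> 0"
    by (simp add: C2_data_operators[OF D op \<xi>])
qed simp

text \<open>The test function is lowered by \<open>c\<close>; its derivatives and its admissibility
  are unaffected.\<close>

lemma supersolution_add_const:
  assumes op: "open (\<Theta> :: ((real ^ 'n) \<times> real) set)" and u: "viscosity_supersolution p q \<Theta> u"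
  shows "viscosity_supersolution p q \<Theta> (\<lambda>z. ereal c + u z)"
  unfolding viscosity_supersolution_def
proof (intro conjI ballI allI impI)
  have U: "\<And>\<xi>. \<xi> \<in> \<Theta> \<Longrightarrow> u \<xi> \<noteq> -\<infinity>" "lsc_on \<Theta> u" "\<Theta> \<subseteq> closure {\<xi>\<in>\<Theta>. u \<xi> \<noteq> \<infinity>}"
    and test: "\<And>\<phi> \<xi>. \<xi> \<in> \<Theta> \<Longrightarrow> C2_on \<Theta> \<phi> \<Longrightarrow> admissible_at p q \<Theta> \<phi> \<xi> \<Longrightarrow> touches_from_below \<Theta> \<phi> u \<xi> \<Longrightarrow>
        (if spatial_grad \<phi> \<xi> \<noteq> 0 then time_deriv \<phi> \<xi> - spatial_pq_laplacian p q \<phi> \<xi> \<ge> 0 else time_deriv \<phi> \<xi> \<ge> 0)"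
    using u unfolding viscosity_supersolution_def by blast+
  show "ereal c + u \<xi> \<noteq> -\<infinity>" if "\<xi> \<in> \<Theta>" for \<xi> using U(1)[OF that] by simp
  have shift: "b < ereal c + x \<longleftrightarrow> b - ereal c < x" for b x by (cases b; cases x) auto
  show "lsc_on \<Theta> (\<lambda>z. ereal c + u z)"
    using U(2) unfolding lsc_on_def le_Liminf_iff shift by simp
  have "{\<xi>\<in>\<Theta>. ereal c + u \<xi> \<noteq> \<infinity>} = {\<xi>\<in>\<Theta>. u \<xi> \<noteq> \<infinity>}" by auto
  then show "\<Theta> \<subseteq> closure {\<xi>\<in>\<Theta>. ereal c + u \<xi> \<noteq> \<infinity>}" using U(3) by simp
  fix \<phi> \<xi>
  assume \<xi>: "\<xi> \<in> \<Theta>" and C2: "C2_on \<Theta> \<phi>" and adm: "admissible_at p q \<Theta> \<phi> \<xi>"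
    and touch: "touches_from_below \<Theta> \<phi> (\<lambda>z. ereal c + u z) \<xi>"
  obtain g H where D: "C2_data \<Theta> \<phi> g H" using C2_on_imp_C2_data[OF C2] .
  define \<psi> where "\<psi> z = \<phi> z + - c" for z
  have D': "C2_data \<Theta> \<psi> g H" using C2_data_add[OF D C2_data_const[of \<Theta> "- c"]] by (simp add: \<psi>_def[abs_def])
  note ops = C2_data_operators[OF D op \<xi>] C2_data_operators[OF D' op \<xi>]
  have eq: "spatial_grad \<psi> \<xi> = spatial_grad \<phi> \<xi>" "time_deriv \<psi> \<xi> = time_deriv \<phi> \<xi>"
    "spatial_pq_laplacian p q \<psi> \<xi> = spatial_pq_laplacian p q \<phi> \<xi>" by (simp_all add: ops)
  have diff: "\<psi> y - \<psi> \<xi> = \<phi> y - \<phi> \<xi>" for y by (simp add: \<psi>_def)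
  have "admissible_at p q \<Theta> \<psi> \<xi>" using adm unfolding admissible_at_def eq diff .
  moreover have "touches_from_below \<Theta> \<psi> u \<xi>"
  proof -
    have less: "ereal (\<psi> z) < u z \<longleftrightarrow> ereal (\<phi> z) < ereal c + u z" for z by (cases "u z") (auto simp: \<psi>_def)
    have "ereal (\<psi> \<xi>) = u \<xi> \<longleftrightarrow> ereal (\<phi> \<xi>) = ereal c + u \<xi>" by (cases "u \<xi>") (auto simp: \<psi>_def)
    then show ?thesis using touch unfolding touches_from_below_def less by simp
  qed
  ultimately show "if spatial_grad \<phi> \<xi> \<noteq> 0 then time_deriv \<phi> \<xi> - spatial_pq_laplacian p q \<phi> \<xi> \<ge> 0 else time_deriv \<phi> \<xi> \<ge> 0"
    using test[OF \<xi> C2_data_imp_C2_on[OF D']] unfolding eq by simp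
qed

text \<open>As \<open>\<psi>\<close> is smooth with nonvanishing gradient it is itself a test
  function: at a negative minimum of \<open>u - \<psi>\<close>, necessarily interior, it would touch
  \<open>u\<close> and contradict strictness.\<close>

lemma strict_subsolution_le:
  fixes \<Theta> :: "((real ^ 'n) \<times> real) set" and m :: real
  assumes op: "open \<Theta>" and bd: "bounded \<Theta>" and u: "viscosity_supersolution p q \<Theta> u"
    and m: "\<And>z. z \<in> \<Theta> \<Longrightarrow> ereal m \<le> u z"
    and bnd: "\<And>\<xi>. \<xi> \<in> frontier \<Theta> \<Longrightarrow> ereal (\<psi> \<xi>) \<le> Liminf (at \<xi> within \<Theta>) u"
    and D: "C2_data UNIV \<psi> g H"
    and sub: "\<And>z. z \<in> \<Theta> \<Longrightarrow> fst (g z) \<noteq> 0 \<and> snd (g z) < pq_operator p q (fst (g z)) (matrix (space_hess (H z)))"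
    and \<zeta>: "\<zeta> \<in> \<Theta>"
  shows "ereal (\<psi> \<zeta>) \<le> u \<zeta>"
proof (rule ccontr)
  assume "\<not> ?thesis"
  then have neg: "u \<zeta> < ereal (\<psi> \<zeta>)" by simp
  have K: "compact (closure \<Theta>)" "closure \<Theta> \<noteq> {}" using bd \<zeta> closure_subset by (auto simp: compact_closure)
  have cont: "continuous_on UNIV \<psi>" by (rule C2_dataD(6)[OF D])
  obtain b where b: "\<And>z. z \<in> closure \<Theta> \<Longrightarrow> \<psi> z \<le> b"
    using continuous_attains_sup[OF K continuous_on_subset[OF cont subset_UNIV]] by blast
  define N where "N = max m b"
  have N: "m \<le> N" by (simp add: N_def)
  have \<psi>N: "\<psi> z \<le> N" if "z \<in> \<Theta>" for z using b[of z] closure_subset that by (auto simp: N_def le_max_iff_disj)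
  have us: "lsc_on \<Theta> u" using u by (simp add: viscosity_supersolution_def)
  \<comment> \<open>The value \<open>0\<close> off \<open>\<Theta>\<close> keeps \<open>h\<close>
    lower semicontinuous on the closure, because the boundary condition gives
    \<open>u - \<psi>\<close> a nonnegative lower limit; so a negative minimum lies inside.\<close>
  define h where "h z = (if z \<in> \<Theta> then truncate_at N (u z) - \<psi> z else 0)" for z
  have tend: "(\<psi> \<longlongrightarrow> \<psi> z) (at z within S)" for z S
    using cont by (metis UNIV_I continuous_on_def tendsto_within_subset subset_UNIV)
  have hneg: "h z < d" if z: "z \<in> \<Theta>" and "u z < ereal (\<psi> z + d)" for z d
  proof -
    have "ereal (truncate_at N (u z)) < ereal (\<psi> z + d)" by (rule order.strict_trans1[OF truncate_at(1)[OF m[OF z] N] that(2)])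
    then show ?thesis using z by (simp add: h_def)
  qed
  have "\<exists>y\<in>closure \<Theta>. \<forall>z\<in>closure \<Theta>. h y \<le> h z"
  proof (rule lsc_attains_inf[OF K])
    fix z c assume z: "z \<in> closure \<Theta>" and c: "c < h z"
    show "\<forall>\<^sub>F w in at z within closure \<Theta>. c < h w"
    proof (cases "z \<in> \<Theta>")
      case True
      have lsc: "\<forall>\<^sub>F h in at z within \<Theta>. c < truncate_at N (u h)" if "c < truncate_at N (u z)" for c
        using lsc_real_on_translate[OF lsc_truncate[OF us m N], where T = \<Theta> and ?z0.0 = 0 and z = z and c = c] True that by auto
      have "\<forall>\<^sub>F w in at z within \<Theta>. c < truncate_at N (u w) + (- \<psi> w)"
      proof (rule lsc_add_continuous[where z = z])
        show "((\<lambda>w. - \<psi> w) \<longlongrightarrow> - \<psi> z) (at z within \<Theta>)" by (intro tendsto_minus tend)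
      qed (use lsc c True in \<open>simp_all add: h_def\<close>)
      moreover have "\<forall>\<^sub>F w in at z. w \<in> \<Theta>" by (rule eventually_at_in_open'[OF op True])
      ultimately have "\<forall>\<^sub>F w in at z. c < h w"
        unfolding at_within_open[OF True op] by eventually_elim (simp add: h_def)
      then show ?thesis by (rule filter_leD[OF at_le[OF subset_UNIV]])
    next
      case False
      then have zf: "z \<in> frontier \<Theta>" using z op by (simp add: frontier_def interior_open)
      have c0: "c < 0" using c False by (simp add: h_def)
      have "ereal (\<psi> z + c / 2) < ereal (\<psi> z)" using c0 by simp
      then have "ereal (\<psi> z + c / 2) < Liminf (at z within \<Theta>) u" by (rule less_le_trans[OF _ bnd[OF zf]])
      then have e1: "\<forall>\<^sub>F w in at z within \<Theta>. ereal (\<psi> z + c / 2) < u w" by (rule less_LiminfD)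
      have e2: "\<forall>\<^sub>F w in at z within \<Theta>. \<psi> w < \<psi> z - c / 2" by (rule order_tendstoD(2)[OF tend]) (use c0 in simp)
      have "\<forall>\<^sub>F w in at z within \<Theta>. w \<in> \<Theta>" by (simp add: eventually_at_filter)
      with e1 e2 have "\<forall>\<^sub>F w in at z within \<Theta>. c < h w"
      proof eventually_elim
        case (elim w)
        have "ereal (\<psi> w + c) < ereal (\<psi> z + c / 2)" using elim(2) by simp
        then have "ereal (\<psi> w + c) < u w" using elim(1) by (rule less_trans)
        moreover have "\<psi> w + c < N" using \<psi>N[OF elim(3)] c0 by simp
        ultimately have "\<psi> w + c < truncate_at N (u w)" using truncate_at(5)[OF m[OF elim(3)] N] by simp
        then show ?case using elim(3) by (simp add: h_def)
      qed
      then have "\<forall>\<^sub>F w in nhds z. w \<noteq> z \<longrightarrow> w \<in> \<Theta> \<longrightarrow> c < h w" unfolding eventually_at_filter .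
      then show ?thesis unfolding eventually_at_filter
        by (rule eventually_mono) (use c0 in \<open>auto simp: h_def\<close>)
    qed
  qed
  then obtain y where y: "y \<in> closure \<Theta>" "\<And>z. z \<in> closure \<Theta> \<Longrightarrow> h y \<le> h z" by blast
  have "h \<zeta> < 0" using hneg[OF \<zeta>, of 0] neg by simp
  moreover have "\<zeta> \<in> closure \<Theta>" using \<zeta> closure_subset by blast
  ultimately have hy: "h y < 0" using y(2)[of \<zeta>] by simp
  then have y\<Theta>: "y \<in> \<Theta>" by (auto simp: h_def split: if_splits)
  have "truncate_at N (u y) < N" using hy y\<Theta> \<psi>N[OF y\<Theta>] by (simp add: h_def)
  from truncate_at(4)[OF m[OF y\<Theta>] N this] have uy: "u y = ereal (truncate_at N (u y))" .
  have "\<forall>\<^sub>F z in at y. z \<in> \<Theta>" by (rule eventually_at_in_open'[OF op y\<Theta>])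
  then have "\<forall>\<^sub>F z in at y. ereal (\<psi> z - \<psi> y + truncate_at N (u y)) \<le> u z"
  proof eventually_elim
    case (elim z)
    have "z \<in> closure \<Theta>" using elim closure_subset by blast
    then have "\<psi> z - \<psi> y + truncate_at N (u y) \<le> truncate_at N (u z)" using y(2)[of z] elim y\<Theta> by (simp add: h_def)
    then show ?case by (intro order_trans[OF _ truncate_at(1)[OF m[OF elim] N]]) simp
  qed
  then have "pq_operator p q (fst (g y)) (matrix (space_hess (H y))) \<le> snd (g y)"
    by (intro supersolution_touched[OF u op C2_data_subset[OF D subset_UNIV] y\<Theta> uy]) (use sub[OF y\<Theta>] in auto)
  then show False using sub[OF y\<Theta>] by simp
qed

section \<open>Exponential boundary data\<close>

lemma C2_data_exponential:
  fixes e :: "'a::euclidean_space"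
  shows "C2_data UNIV (\<lambda>x. exp (e \<bullet> x)) (\<lambda>x. exp (e \<bullet> x) *\<^sub>R e) (\<lambda>x v. (exp (e \<bullet> x) * (e \<bullet> v)) *\<^sub>R e)"
  unfolding C2_data_def
  by (auto intro!: derivative_eq_intros continuous_intros simp: fun_eq_iff scaleR_scaleR mult_ac)

text \<open>The case of an exponential in direction \<open>e\<close>, with gradient
  \<open>a e\<close> and Hessian \<open>a e \<otimes> e\<close>. For \<open>p > 1\<close> the
  operator is positive and grows with \<open>a\<close> when \<open>q > 1\<close>.\<close>

lemma pq_operator_rank_one:
  fixes e :: "real ^ 'n"
  assumes e: "norm e = 1" and a: "a > 0"
  shows "pq_operator p q (a *\<^sub>R e) (matrix (\<lambda>v. (a * (e \<bullet> v)) *\<^sub>R e)) = (p - 1) * a powr (q - 1)"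
proof -
  let ?L = "\<lambda>v. (a * (e \<bullet> v)) *\<^sub>R e"
  have ee: "e \<bullet> e = 1" using e by (simp add: norm_eq_1)
  have lin: "linear ?L" by (rule linearI) (simp_all add: inner_add_right distrib_left scaleR_add_left)
  have "trace (matrix ?L) = a * (\<Sum>i\<in>UNIV. e $ i * e $ i)"
    by (simp add: trace_def matrix_def inner_axis sum_distrib_left mult.assoc)
  then have "trace (matrix ?L) = a" using ee by (simp add: inner_vec_def)
  moreover have "matrix ?L *v (a *\<^sub>R e) = (a * a) *\<^sub>R e" using lin by (simp add: matrix_works ee)
  ultimately have "pq_operator p q (a *\<^sub>R e) (matrix ?L) = a powr (q - 2) * (a + (p - 2) * a)"
    using e a by (simp add: pq_operator_alt ee power2_eq_square)
  also have "\<dots> = (p - 1) * (a powr (q - 2) * a)" by (simp add: algebra_simps)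
  also have "a powr (q - 2) * a = a powr (q - 1)" using powr_add[of a "q - 2" 1] a by simp
  finally show ?thesis .
qed

text \<open>With the maximum norm, the exponential of the norm is the maximum of the smooth
  functions \<open>exp (e \<bullet> x)\<close> over the signed axes \<open>e\<close>.\<close>

definition barrier_profile :: "real \<Rightarrow> real \<Rightarrow> (real ^ 'n) \<times> real \<Rightarrow> (real ^ 'n) \<times> real \<Rightarrow> real" where
  "barrier_profile A B \<xi> z = A * (exp (infnorm (fst z - fst \<xi>)) - 1) + B * (snd z - snd \<xi>)\<^sup>2"

text \<open>For given \<open>z\<close>, the exponential along the axis that realises the norm agrees
  with the profile at \<open>z\<close> and lies below it elsewhere, so the bound for that one
  function suffices. The hypothesis \<open>large\<close> says that the operator at gradient size
  \<open>A * exp (- d)\<close>, the least that occurs, exceeds the bound \<open>2 * B * d\<close> on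
  the time derivative.\<close>

lemma barrier_profile_le_supersolution:
  fixes \<Theta> :: "((real ^ 'n) \<times> real) set" and \<xi>\<^sub>0 :: "(real ^ 'n) \<times> real"
  assumes p: "p > 1" and op: "open \<Theta>" and bd: "bounded \<Theta>" and A: "A > 0" and B: "B > 0"
    and d: "\<And>z. z \<in> \<Theta> \<Longrightarrow> dist z \<xi>\<^sub>0 \<le> d" and large: "2 * B * d < (p - 1) * (A * exp (- d)) powr (q - 1)" and q: "q > 1"
    and u: "u \<in> upper_class p q \<Theta> (barrier_profile A B \<xi>\<^sub>0)" and z: "z \<in> \<Theta>"
  shows "ereal (barrier_profile A B \<xi>\<^sub>0 z) \<le> u z"
proof -
  have sol: "viscosity_supersolution p q \<Theta> u"
    and bnd: "\<And>\<xi>. \<xi> \<in> frontier \<Theta> \<Longrightarrow> ereal (barrier_profile A B \<xi>\<^sub>0 \<xi>) \<le> Liminf (at \<xi> within \<Theta>) u"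
    using u by (auto simp: upper_class_def)
  obtain m where m: "\<And>z. z \<in> \<Theta> \<Longrightarrow> ereal m \<le> u z" using u unfolding upper_class_def by blast
  have "infnorm (fst z - fst \<xi>\<^sub>0) \<in> {\<bar>(fst z - fst \<xi>\<^sub>0) \<bullet> b\<bar> |b. b \<in> Basis}"
    unfolding infnorm_Max infnorm_set_image by (rule Max_in) auto
  then obtain b :: "real ^ 'n" where b: "b \<in> Basis" "infnorm (fst z - fst \<xi>\<^sub>0) = \<bar>(fst z - fst \<xi>\<^sub>0) \<bullet> b\<bar>" by blast
  define e where "e = (if (fst z - fst \<xi>\<^sub>0) \<bullet> b \<ge> 0 then b else - b)"
  have e: "infnorm (fst z - fst \<xi>\<^sub>0) = e \<bullet> (fst z - fst \<xi>\<^sub>0)" "norm e = 1"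
    using b by (auto simp: e_def inner_commute)
  have e_le: "e \<bullet> x \<le> infnorm x" for x
    using Basis_le_infnorm[OF b(1), of x] by (auto simp: e_def inner_commute abs_le_iff)
  define \<psi> where "\<psi> y = - A + (A * exp (e \<bullet> fst (y - \<xi>\<^sub>0)) + B * (snd y - snd \<xi>\<^sub>0)\<^sup>2)" for y
  define g where "g y = 0 + (A *\<^sub>R (exp (e \<bullet> fst (y - \<xi>\<^sub>0)) *\<^sub>R e, 0) + (0, B * (2 * (snd y - snd \<xi>\<^sub>0))))" for y :: "(real ^ 'n) \<times> real"
  define H where "H y v = 0 + (A *\<^sub>R ((exp (e \<bullet> fst (y - \<xi>\<^sub>0)) * (e \<bullet> fst v)) *\<^sub>R e, 0) + (0, B * 2 * snd v))" for y v :: "(real ^ 'n) \<times> real"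
  have D: "C2_data UNIV \<psi> g H"
    unfolding \<psi>_def[abs_def] g_def[abs_def] H_def[abs_def]
  proof (intro C2_data_add C2_data_const C2_data_scale)
    show "C2_data UNIV (\<lambda>y. exp (e \<bullet> fst (y - \<xi>\<^sub>0))) (\<lambda>y. (exp (e \<bullet> fst (y - \<xi>\<^sub>0)) *\<^sub>R e, 0)) (\<lambda>y v. ((exp (e \<bullet> fst (y - \<xi>\<^sub>0)) * (e \<bullet> fst v)) *\<^sub>R e, 0))"
      by (rule C2_data_shift[OF C2_data_fst[OF C2_data_exponential]])
    show "C2_data UNIV (\<lambda>y. B * (snd y - snd \<xi>\<^sub>0)\<^sup>2) (\<lambda>y. (0, B * (2 * (snd y - snd \<xi>\<^sub>0)))) (\<lambda>y v. (0 :: real ^ 'n, B * 2 * snd v))"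
      by (rule C2_data_snd_real[where \<rho> = "\<lambda>t. B * (t - snd \<xi>\<^sub>0)\<^sup>2" and \<rho>' = "\<lambda>t. B * (2 * (t - snd \<xi>\<^sub>0))" and \<rho>'' = "\<lambda>t. B * 2"])
        (auto intro!: derivative_eq_intros)
  qed
  have \<psi>_le: "\<psi> y \<le> barrier_profile A B \<xi>\<^sub>0 y" for y
    using e_le[of "fst (y - \<xi>\<^sub>0)"] A by (simp add: \<psi>_def barrier_profile_def right_diff_distrib)
  have "ereal (\<psi> z) \<le> u z"
  proof (rule strict_subsolution_le[OF op bd sol m _ D _ z])
    show "ereal (\<psi> \<xi>) \<le> Liminf (at \<xi> within \<Theta>) u" if "\<xi> \<in> frontier \<Theta>" for \<xi>
      using \<psi>_le[of \<xi>] by (intro order_trans[OF _ bnd[OF that]]) simp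
    fix y assume y: "y \<in> \<Theta>"
    define a where "a = A * exp (e \<bullet> fst (y - \<xi>\<^sub>0))"
    have a: "a > 0" using A by (simp add: a_def)
    have ga: "fst (g y) = a *\<^sub>R e" "snd (g y) = 2 * B * (snd y - snd \<xi>\<^sub>0)" by (simp_all add: g_def a_def)
    have Ha: "space_hess (H y) = (\<lambda>v. (a * (e \<bullet> v)) *\<^sub>R e)" by (simp add: space_hess_def[abs_def] H_def a_def mult.assoc)
    have "\<bar>e \<bullet> fst (y - \<xi>\<^sub>0)\<bar> \<le> norm (fst (y - \<xi>\<^sub>0))" using Cauchy_Schwarz_ineq2[of e "fst (y - \<xi>\<^sub>0)"] e by simp
    also have "\<dots> \<le> d" using dist_fst_le[of y \<xi>\<^sub>0] d[OF y] by (simp add: dist_norm)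
    finally have "A * exp (- d) \<le> a" using A by (simp add: a_def abs_le_iff)
    then have "(A * exp (- d)) powr (q - 1) \<le> a powr (q - 1)" using A q by (intro powr_mono2) auto
    then have "(p - 1) * (A * exp (- d)) powr (q - 1) \<le> (p - 1) * a powr (q - 1)" using p by (intro mult_left_mono) auto
    moreover have "2 * B * (snd y - snd \<xi>\<^sub>0) \<le> 2 * B * d"
      using dist_snd_le[of y \<xi>\<^sub>0] d[OF y] B by (intro mult_left_mono) (auto simp: dist_real_def abs_le_iff)
    ultimately show "fst (g y) \<noteq> 0 \<and> snd (g y) < pq_operator p q (fst (g y)) (matrix (space_hess (H y)))"
      unfolding ga Ha pq_operator_rank_one[OF e(2) a] using large a e(2) by auto
  qed
  moreover have "\<psi> z = barrier_profile A B \<xi>\<^sub>0 z"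
    using e(1) by (simp add: \<psi>_def barrier_profile_def right_diff_distrib)
  ultimately show ?thesis by simp
qed

lemma barrier_profile_pos:
  assumes "A > 0" "B > 0" "z \<noteq> \<xi>"
  shows "barrier_profile A B \<xi> z > 0"
proof (cases "fst z = fst \<xi>")
  case True
  then have "snd z \<noteq> snd \<xi>" using assms(3) by (simp add: prod_eq_iff)
  then show ?thesis using assms True by (simp add: barrier_profile_def infnorm_0)
next
  case False
  then have "infnorm (fst z - fst \<xi>) > 0" by (simp add: infnorm_pos_lt)
  then have "A * (exp (infnorm (fst z - fst \<xi>)) - 1) > 0" using assms by simp
  then show ?thesis using assms by (simp add: barrier_profile_def add_pos_nonneg)
qed

lemma barrier_profile_continuous: "continuous_on S (barrier_profile A B \<xi>)"
  unfolding barrier_profile_def[abs_def] continuous_on_def by (auto intro!: tendsto_intros)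

text \<open>The displacement in space or in time is at least \<open>1 / (2 * k)\<close>. In space
  the passage from Euclidean to maximum norm costs \<open>sqrt n\<close>, in time the square is at
  least \<open>1 / (4 * k^2)\<close>; the bounds on \<open>A\<close> and \<open>B\<close> make
  either contribution at least \<open>k\<close>.\<close>

lemma barrier_profile_ge:
  fixes \<xi> z :: "(real ^ 'n) \<times> real"
  assumes k: "k \<ge> 1" and A: "A \<ge> 2 * (real k)\<^sup>2 * sqrt (real CARD('n))" and B: "B \<ge> 4 * real k ^ 3"
    and far: "dist z \<xi> \<ge> 1 / real k"
  shows "barrier_profile A B \<xi> z \<ge> real k"
proof -
  let ?s = "sqrt (real CARD('n))"
  have s: "?s > 0" and k0: "real k > 0" using k by simp_all
  have A0: "A \<ge> 0" and B0: "B \<ge> 0" using A B s k0 by (auto intro: order_trans[rotated])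
  have "exp (infnorm (fst z - fst \<xi>)) - 1 \<ge> infnorm (fst z - fst \<xi>)" using exp_ge_add_one_self[of "infnorm (fst z - fst \<xi>)"] by linarith
  from mult_left_mono[OF this A0] have 1: "barrier_profile A B \<xi> z \<ge> A * infnorm (fst z - fst \<xi>) + B * (snd z - snd \<xi>)\<^sup>2"
    by (simp add: barrier_profile_def)
  have "dist z \<xi> \<le> norm (fst z - fst \<xi>) + \<bar>snd z - snd \<xi>\<bar>"
    using norm_Pair_le[of "fst (z - \<xi>)" "snd (z - \<xi>)", unfolded prod.collapse] by (simp only: dist_norm fst_diff snd_diff real_norm_def)
  moreover have half: "1 / (2 * real k) = 1 / real k / 2" by simp
  ultimately have "norm (fst z - fst \<xi>) \<ge> 1 / (2 * real k) \<or> \<bar>snd z - snd \<xi>\<bar> \<ge> 1 / (2 * real k)"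
    using far unfolding half by linarith
  then consider "norm (fst z - fst \<xi>) \<ge> 1 / (2 * real k)" | "\<bar>snd z - snd \<xi>\<bar> \<ge> 1 / (2 * real k)" by blast
  then show ?thesis
  proof cases
    case 1
    have "1 / (2 * real k) \<le> ?s * infnorm (fst z - fst \<xi>)" using 1 norm_le_infnorm[of "fst z - fst \<xi>"] by simp
    then have "2 * (real k)\<^sup>2 * (1 / (2 * real k)) \<le> 2 * (real k)\<^sup>2 * (?s * infnorm (fst z - fst \<xi>))" by (intro mult_left_mono) auto
    also have "\<dots> \<le> A * infnorm (fst z - fst \<xi>)" using mult_right_mono[OF A infnorm_pos_le[of "fst z - fst \<xi>"]] by (simp add: mult.assoc)
    also have "2 * (real k)\<^sup>2 * (1 / (2 * real k)) = real k" using k0 by (simp add: power2_eq_square)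
    finally show ?thesis using \<open>barrier_profile A B \<xi> z \<ge> _\<close> B0 by (meson add_increasing2 order_trans mult_nonneg_nonneg zero_le_power2)
  next
    case 2
    have "(1 / (2 * real k))\<^sup>2 \<le> (snd z - snd \<xi>)\<^sup>2" using power_mono[OF 2, of 2] k0 by simp
    then have "4 * real k ^ 3 * (1 / (2 * real k))\<^sup>2 \<le> B * (snd z - snd \<xi>)\<^sup>2" using B B0 by (intro mult_mono) auto
    moreover have "4 * real k ^ 3 * (1 / (2 * real k))\<^sup>2 = real k" using k0 by (simp add: power2_eq_square power3_eq_cube)
    ultimately show ?thesis using \<open>barrier_profile A B \<xi> z \<ge> _\<close> mult_nonneg_nonneg[OF A0 infnorm_pos_le[of "fst z - fst \<xi>"]] by simp
  qed
qed

section \<open>From regularity to barriers\<close>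

text \<open>One function for each \<open>k\<close>, from data \<open>h\<close> that are at least
  \<open>k\<close> at distance \<open>1 / k\<close>. Passing to the envelope secures lower
  semicontinuity, and since \<open>h\<close> is continuous the bound \<open>h \<le> u\<close> for
  all members survives; it gives positivity and the lower limits at the boundary.\<close>

lemma regular_imp_barrier:
  fixes \<Theta> :: "((real ^ 'n) \<times> real) set" and \<xi>\<^sub>0 :: "(real ^ 'n) \<times> real"
  assumes p: "p > 1" and q: "q > 1" and op: "open \<Theta>" and bd: "bounded \<Theta>" and \<xi>0: "\<xi>\<^sub>0 \<in> frontier \<Theta>"
    and reg: "regular_point p q \<Theta> \<xi>\<^sub>0" and k: "k \<ge> 1"
  shows "\<exists>w. (\<forall>\<zeta>\<in>\<Theta>. 0 < w \<zeta>) \<and> viscosity_supersolution p q \<Theta> w \<and> (w \<longlongrightarrow> 0) (at \<xi>\<^sub>0 within \<Theta>) \<and>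
    (\<forall>\<xi>\<in>frontier \<Theta>. dist \<xi> \<xi>\<^sub>0 \<ge> 1 / real k \<longrightarrow> Liminf (at \<xi> within \<Theta>) w \<ge> ereal (real k))"
proof -
  obtain d where d: "\<And>z. z \<in> \<Theta> \<Longrightarrow> dist z \<xi>\<^sub>0 \<le> d" using bd bounded_any_center[of \<Theta> \<xi>\<^sub>0] by (metis dist_commute)
  define B where "B = 4 * real k ^ 3"
  \<comment> \<open>\<open>B\<close> is fixed by \<open>k\<close> alone; then \<open>A\<close> is
    taken so large that \<open>(A * exp (- d)) powr (q - 1) \<ge> R\<close>, which yields
    \<open>large\<close>.\<close>
  define R where "R = (\<bar>2 * B * d\<bar> + 1) / (p - 1)"
  define A where "A = max (2 * (real k)\<^sup>2 * sqrt (real CARD('n))) (exp d * R powr (1 / (q - 1)))"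
  have B: "B > 0" "B \<ge> 4 * real k ^ 3" using k by (auto simp: B_def)
  have A: "A > 0" "A \<ge> 2 * (real k)\<^sup>2 * sqrt (real CARD('n))" using k by (auto simp: A_def less_max_iff_disj)
  have R: "R > 0" using p by (simp add: R_def)
  have large: "2 * B * d < (p - 1) * (A * exp (- d)) powr (q - 1)"
  proof -
    have "R powr (1 / (q - 1)) = exp d * R powr (1 / (q - 1)) * exp (- d)" by (simp add: exp_minus)
    also have "\<dots> \<le> A * exp (- d)" by (intro mult_right_mono) (auto simp: A_def)
    finally have "(R powr (1 / (q - 1))) powr (q - 1) \<le> (A * exp (- d)) powr (q - 1)" using q by (intro powr_mono2) auto
    then have "R \<le> (A * exp (- d)) powr (q - 1)" using q R by (simp add: powr_powr)
    then have "(p - 1) * R \<le> (p - 1) * (A * exp (- d)) powr (q - 1)" using p by (intro mult_left_mono) auto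
    moreover have "(p - 1) * R = \<bar>2 * B * d\<bar> + 1" using p by (simp add: R_def)
    ultimately show ?thesis by linarith
  qed
  define h where "h = barrier_profile A B \<xi>\<^sub>0"
  have hc: "continuous_on S h" for S unfolding h_def by (rule barrier_profile_continuous)
  have h0: "h \<xi>\<^sub>0 = 0" by (simp add: h_def barrier_profile_def infnorm_0)
  have hpos: "h z > 0" if "z \<in> \<Theta>" for z
  proof -
    have "\<xi>\<^sub>0 \<notin> \<Theta>" using \<xi>0 op by (simp add: frontier_def interior_open)
    then show ?thesis unfolding h_def using that by (intro barrier_profile_pos A B) auto
  qed
  have h_le: "ereal (h z) \<le> u z" if "u \<in> upper_class p q \<Theta> h" "z \<in> \<Theta>" for u z
    unfolding h_def by (rule barrier_profile_le_supersolution[OF p op bd A(1) B(1) d large q that(1)[unfolded h_def] that(2)])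
  have "compact (frontier \<Theta>)" "frontier \<Theta> \<noteq> {}" using bd \<xi>0 by (auto intro: compact_frontier_bounded)
  from continuous_attains_sup[OF this hc] obtain c where c: "\<And>\<xi>. \<xi> \<in> frontier \<Theta> \<Longrightarrow> h \<xi> \<le> c" by blast
  interpret supersolution_family p q 0 c \<Theta> "upper_class p q \<Theta> h"
  proof
    show "open \<Theta>" by (rule op)
    show "viscosity_supersolution p q \<Theta> u" if "u \<in> upper_class p q \<Theta> h" for u using that by (simp add: upper_class_def)
    show "ereal 0 \<le> u z" if "u \<in> upper_class p q \<Theta> h" "z \<in> \<Theta>" for u z
      using hpos[OF that(2)] by (intro order_trans[OF _ h_le[OF that]]) simp
    show "(\<lambda>z. ereal c) \<in> upper_class p q \<Theta> h"
      using c unfolding upper_class_def by (auto intro!: constant_supersolution[OF op] Liminf_bounded exI[of _ c])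
  qed
  have env_ge: "ereal (h z) \<le> env z" if z: "z \<in> \<Theta>" for z
    unfolding env_def by (rule lsc_envelope_ge_continuous[OF op z hc]) (auto intro!: INF_greatest h_le)
  have env_le: "env z \<le> upper_perron p q \<Theta> h z" if "z \<in> \<Theta>" for z
    unfolding upper_perron_def env_def by (rule lsc_envelope_le)
  have in\<Theta>: "\<forall>\<^sub>F z in at \<xi> within \<Theta>. z \<in> \<Theta>" for \<xi> by (simp add: eventually_at_filter)
  have lim: "(upper_perron p q \<Theta> h \<longlongrightarrow> 0) (at \<xi>\<^sub>0 within \<Theta>)"
    using reg hc h0 unfolding regular_point_def by (metis zero_ereal_def)
  have "\<forall>\<zeta>\<in>\<Theta>. 0 < env \<zeta>"
  proof
    fix \<zeta> assume "\<zeta> \<in> \<Theta>"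
    then show "0 < env \<zeta>" using hpos[of \<zeta>] by (intro less_le_trans[OF _ env_ge]) auto
  qed
  moreover have "(env \<longlongrightarrow> 0) (at \<xi>\<^sub>0 within \<Theta>)"
  proof (rule tendsto_sandwich[OF _ _ tendsto_const lim])
    show "\<forall>\<^sub>F z in at \<xi>\<^sub>0 within \<Theta>. 0 \<le> env z"
    proof -
      have "0 \<le> env z" if "z \<in> \<Theta>" for z using env_bounds(1)[OF that] unfolding zero_ereal_def .
      then show ?thesis by (rule eventually_mono[OF in\<Theta>])
    qed
    show "\<forall>\<^sub>F z in at \<xi>\<^sub>0 within \<Theta>. env z \<le> upper_perron p q \<Theta> h z"
      using in\<Theta> by eventually_elim (rule env_le)
  qed
  moreover have "Liminf (at \<xi> within \<Theta>) env \<ge> ereal (real k)" if far: "dist \<xi> \<xi>\<^sub>0 \<ge> 1 / real k" for \<xi>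
    unfolding le_Liminf_iff
  proof (intro allI impI)
    fix y assume y: "y < ereal (real k)"
    have "real k \<le> h \<xi>" unfolding h_def by (rule barrier_profile_ge[OF k A(2) B(2) far])
    then have "y < ereal (h \<xi>)" using y by (auto intro: less_le_trans)
    moreover have "((\<lambda>z. ereal (h z)) \<longlongrightarrow> ereal (h \<xi>)) (at \<xi> within \<Theta>)"
      using hc[of "insert \<xi> \<Theta>"] by (intro tendsto_intros) (auto simp: continuous_on_def intro: tendsto_within_subset)
    ultimately have "\<forall>\<^sub>F z in at \<xi> within \<Theta>. y < ereal (h z)" using order_tendstoD(1) by blast
    then show "\<forall>\<^sub>F z in at \<xi> within \<Theta>. y < env z"
      using in\<Theta> by eventually_elim (rule less_le_trans[OF _ env_ge])
  qed
  ultimately show ?thesis using env_supersolution by blast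
qed

section \<open>From barriers to regularity\<close>

text \<open>Given \<open>\<epsilon>\<close>, one barrier whose height \<open>k\<close> exceeds the
  oscillation of \<open>f\<close> has boundary limits that dominate
  \<open>|f - f \<xi>\<^sub>0| - \<epsilon>\<close>: away from \<open>\<xi>\<^sub>0\<close> by its
  height, near it by continuity of \<open>f\<close> and positivity of the barrier.\<close>

lemma barrier_imp_regular:
  fixes \<Theta> :: "((real ^ 'n) \<times> real) set" and \<xi>\<^sub>0 :: "(real ^ 'n) \<times> real"
  assumes p: "p > 1" and q: "q > 1" and op: "open \<Theta>" and bd: "bounded \<Theta>" and \<xi>0: "\<xi>\<^sub>0 \<in> frontier \<Theta>"
    and bar: "barrier_family p q \<Theta> \<xi>\<^sub>0 w"
  shows "regular_point p q \<Theta> \<xi>\<^sub>0"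
  unfolding regular_point_def
proof (intro allI impI)
  fix f :: "(real ^ 'n) \<times> real \<Rightarrow> real" assume f: "continuous_on (frontier \<Theta>) f"
  have K: "compact (frontier \<Theta>)" using bd by (rule compact_frontier_bounded)
  obtain M where M: "\<And>\<xi>. \<xi> \<in> frontier \<Theta> \<Longrightarrow> \<bar>f \<xi>\<bar> \<le> M"
    using compact_imp_bounded[OF compact_continuous_image[OF f K]] unfolding bounded_iff by auto
  have key: "\<forall>\<^sub>F \<zeta> in at \<xi>\<^sub>0 within \<Theta>. ereal (f \<xi>\<^sub>0 - 3 * \<epsilon>) \<le> upper_perron p q \<Theta> f \<zeta> \<and> upper_perron p q \<Theta> f \<zeta> \<le> ereal (f \<xi>\<^sub>0 + 3 * \<epsilon>)"
    if \<epsilon>: "\<epsilon> > 0" for \<epsilon> :: real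
  proof -
    obtain \<delta> where \<delta>: "\<delta> > 0" "\<And>\<xi>. \<xi> \<in> frontier \<Theta> \<Longrightarrow> dist \<xi> \<xi>\<^sub>0 < \<delta> \<Longrightarrow> dist (f \<xi>) (f \<xi>\<^sub>0) < \<epsilon>"
      using f \<xi>0 \<epsilon> unfolding continuous_on_iff by blast
    obtain k1 :: nat where k1: "1 / \<delta> < real k1" using reals_Archimedean2 by blast
    obtain k2 :: nat where k2: "2 * M < real k2" using reals_Archimedean2 by blast
    \<comment> \<open>\<open>2 * M\<close> bounds the oscillation of \<open>f\<close>, and
      \<open>1 / k < \<delta>\<close> lets the two regions of the boundary overlap.\<close>
    define k where "k = max 1 (max k1 k2)"
    have k: "k \<ge> 1" "2 * M < real k" "1 / \<delta> < real k" using k1 k2 by (auto simp: k_def)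
    have k\<delta>: "1 / real k < \<delta>" using k(1,3) \<delta>(1) by (simp add: field_simps)
    obtain j where j: "j \<ge> 1" and far: "\<And>\<xi>. \<xi> \<in> frontier \<Theta> \<Longrightarrow> dist \<xi> \<xi>\<^sub>0 \<ge> 1 / real k \<Longrightarrow> Liminf (at \<xi> within \<Theta>) (w j) \<ge> ereal (real k)"
      using bar k(1) unfolding barrier_family_def by blast
    have wpos: "\<And>\<zeta>. \<zeta> \<in> \<Theta> \<Longrightarrow> 0 < w j \<zeta>" and wsup: "viscosity_supersolution p q \<Theta> (w j)" and wlim: "(w j \<longlongrightarrow> 0) (at \<xi>\<^sub>0 within \<Theta>)"
      using bar j unfolding barrier_family_def by blast+
    have in\<Theta>: "\<forall>\<^sub>F z in at \<xi> within \<Theta>. z \<in> \<Theta>" for \<xi> by (simp add: eventually_at_filter)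
    \<comment> \<open>The lower limit of a sum with a constant, stated through eventual lower bounds
      so that it serves both \<open>w0\<close> and \<open>wk\<close>.\<close>
    have wshift: "ereal (c + r) \<le> Liminf (at \<xi> within \<Theta>) (\<lambda>z. ereal c + w j z)"
      if "\<And>y. y < r \<Longrightarrow> \<forall>\<^sub>F z in at \<xi> within \<Theta>. ereal y < w j z" for c r \<xi>
      unfolding le_Liminf_iff
    proof (intro allI impI)
      fix x assume x: "x < ereal (c + r)"
      obtain y where y: "x \<le> ereal (c + y)" "y < r"
      proof (cases x)
        case (real s)
        then show ?thesis using that[of "s - c"] x by simp
      next
        case MInf
        then show ?thesis using that[of "r - 1"] by simp
      qed (use x in simp)
      have "x < ereal c + v" if "ereal y < v" for v
        using y(1) that by (cases v; cases x) auto
      then show "\<forall>\<^sub>F z in at \<xi> within \<Theta>. x < ereal c + w j z"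
        using that[OF y(2)] by (auto elim: eventually_mono)
    qed
    have w0: "\<forall>\<^sub>F z in at \<xi> within \<Theta>. ereal y < w j z" if "y < 0" for y \<xi>
      using in\<Theta> by eventually_elim (use wpos that in \<open>auto intro: less_trans[of _ 0]\<close>)
    have wk: "\<forall>\<^sub>F z in at \<xi> within \<Theta>. ereal y < w j z" if "\<xi> \<in> frontier \<Theta>" "dist \<xi> \<xi>\<^sub>0 \<ge> 1 / real k" "y < real k" for y \<xi>
      by (rule less_LiminfD[OF less_le_trans[OF _ far[OF that(1,2)]]]) (use that in simp)
    \<comment> \<open>Both signs of \<open>f \<xi> - f \<xi>\<^sub>0\<close> at once: one places the
      shifted barrier in the upper class, the other feeds the comparison.\<close>
    have wbnd: "\<exists>b. ereal b \<le> Liminf (at \<xi> within \<Theta>) (\<lambda>z. ereal c + w j z) \<and> f \<xi> - f \<xi>\<^sub>0 - \<epsilon> \<le> b - c \<and> f \<xi>\<^sub>0 - f \<xi> - \<epsilon> \<le> b - c" if \<xi>: "\<xi> \<in> frontier \<Theta>" for \<xi> c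
    proof (cases "dist \<xi> \<xi>\<^sub>0 \<ge> 1 / real k")
      case True
      have "ereal (c + real k) \<le> Liminf (at \<xi> within \<Theta>) (\<lambda>z. ereal c + w j z)" by (rule wshift[OF wk[OF \<xi> True]])
      moreover have "\<bar>f \<xi> - f \<xi>\<^sub>0\<bar> \<le> real k" using M[OF \<xi>] M[OF \<xi>0] k(2) by linarith
      ultimately show ?thesis using \<epsilon> by (intro exI[of _ "c + real k"]) auto
    next
      case False
      then have "\<bar>f \<xi> - f \<xi>\<^sub>0\<bar> < \<epsilon>" using \<delta>(2)[OF \<xi>] k\<delta> by (simp add: dist_real_def)
      moreover have "ereal (c + 0) \<le> Liminf (at \<xi> within \<Theta>) (\<lambda>z. ereal c + w j z)" by (rule wshift[OF w0])
      ultimately show ?thesis by (intro exI[of _ "c + 0"]) auto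
    qed
    have low: "ereal c \<le> ereal c + w j z" if "z \<in> \<Theta>" for z c
      using wpos[OF that] by (cases "w j z") auto
    have up: "(\<lambda>z. ereal (f \<xi>\<^sub>0 + \<epsilon>) + w j z) \<in> upper_class p q \<Theta> f"
      unfolding upper_class_def
    proof (intro CollectI conjI ballI)
      show "viscosity_supersolution p q \<Theta> (\<lambda>z. ereal (f \<xi>\<^sub>0 + \<epsilon>) + w j z)" by (rule supersolution_add_const[OF op wsup])
      show "\<exists>m::real. \<forall>\<eta>\<in>\<Theta>. ereal m \<le> ereal (f \<xi>\<^sub>0 + \<epsilon>) + w j \<eta>" using low by blast
      fix \<xi> assume "\<xi> \<in> frontier \<Theta>"
      from wbnd[OF this, of "f \<xi>\<^sub>0 + \<epsilon>"] obtain b where b: "ereal b \<le> Liminf (at \<xi> within \<Theta>) (\<lambda>z. ereal (f \<xi>\<^sub>0 + \<epsilon>) + w j z)" "f \<xi> \<le> b" by auto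
      then show "ereal (f \<xi>) \<le> Liminf (at \<xi> within \<Theta>) (\<lambda>z. ereal (f \<xi>\<^sub>0 + \<epsilon>) + w j z)"
        by (intro order_trans[OF _ b(1)]) simp
    qed
    \<comment> \<open>The constant carries \<open>2 * \<epsilon>\<close>, so that the boundary
      limits sum to at least \<open>\<epsilon>\<close>; \<open>comparison\<close> needs a strictly
      positive sum.\<close>
    have lo: "0 \<le> u \<zeta> + (ereal (2 * \<epsilon> - f \<xi>\<^sub>0) + w j \<zeta>)" if u: "u \<in> upper_class p q \<Theta> f" and \<zeta>: "\<zeta> \<in> \<Theta>" for u \<zeta>
    proof -
      have us: "viscosity_supersolution p q \<Theta> u" and ub: "\<And>\<xi>. \<xi> \<in> frontier \<Theta> \<Longrightarrow> ereal (f \<xi>) \<le> Liminf (at \<xi> within \<Theta>) u"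
        using u by (auto simp: upper_class_def)
      obtain m where m: "\<And>z. z \<in> \<Theta> \<Longrightarrow> ereal m \<le> u z" using u unfolding upper_class_def by blast
      define m' where "m' = min m (2 * \<epsilon> - f \<xi>\<^sub>0)"
      show ?thesis
      proof (rule comparison[OF p q op bd us supersolution_add_const[OF op wsup] _ _ _ \<zeta>])
        show "ereal m' \<le> u z" if "z \<in> \<Theta>" for z by (rule order_trans[OF _ m[OF that]]) (simp add: m'_def)
        show "ereal m' \<le> ereal (2 * \<epsilon> - f \<xi>\<^sub>0) + w j z" if "z \<in> \<Theta>" for z by (rule order_trans[OF _ low[OF that]]) (simp add: m'_def)
        fix \<xi> assume \<xi>: "\<xi> \<in> frontier \<Theta>"
        from wbnd[OF \<xi>, of "2 * \<epsilon> - f \<xi>\<^sub>0"] obtain b where b: "ereal b \<le> Liminf (at \<xi> within \<Theta>) (\<lambda>z. ereal (2 * \<epsilon> - f \<xi>\<^sub>0) + w j z)"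
          "f \<xi>\<^sub>0 - f \<xi> - \<epsilon> \<le> b - (2 * \<epsilon> - f \<xi>\<^sub>0)" by auto
        then show "\<exists>a b. 0 < a + b \<and> ereal a \<le> Liminf (at \<xi> within \<Theta>) u \<and> ereal b \<le> Liminf (at \<xi> within \<Theta>) (\<lambda>z. ereal (2 * \<epsilon> - f \<xi>\<^sub>0) + w j z)"
          using ub[OF \<xi>] \<epsilon> by (intro exI[of _ "f \<xi>"] exI[of _ b]) auto
      qed
    qed
    have "\<forall>\<^sub>F \<zeta> in at \<xi>\<^sub>0 within \<Theta>. w j \<zeta> < ereal \<epsilon>" by (rule order_tendstoD(2)[OF wlim]) (use \<epsilon> in simp)
    then show ?thesis using in\<Theta>
    proof eventually_elim
      case (elim \<zeta>)
      obtain s where s: "w j \<zeta> = ereal s" "s < \<epsilon>" using elim(1) wpos[OF elim(2)] by (cases "w j \<zeta>") auto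
      have "upper_perron p q \<Theta> f \<zeta> \<le> ereal (f \<xi>\<^sub>0 + \<epsilon>) + w j \<zeta>" unfolding upper_perron_def by (rule INF_lower[OF up])
      also have "\<dots> \<le> ereal (f \<xi>\<^sub>0 + 3 * \<epsilon>)" using s \<epsilon> by simp
      finally have "upper_perron p q \<Theta> f \<zeta> \<le> ereal (f \<xi>\<^sub>0 + 3 * \<epsilon>)" .
      moreover have "ereal (f \<xi>\<^sub>0 - 3 * \<epsilon>) \<le> upper_perron p q \<Theta> f \<zeta>"
        unfolding upper_perron_def
      proof (rule INF_greatest)
        fix u assume "u \<in> upper_class p q \<Theta> f"
        from lo[OF this elim(2)] show "ereal (f \<xi>\<^sub>0 - 3 * \<epsilon>) \<le> u \<zeta>" using s by (cases "u \<zeta>") auto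
      qed
      ultimately show ?case by simp
    qed
  qed
  show "(upper_perron p q \<Theta> f \<longlongrightarrow> ereal (f \<xi>\<^sub>0)) (at \<xi>\<^sub>0 within \<Theta>)"
  proof (rule order_tendstoI)
    fix a assume "a < ereal (f \<xi>\<^sub>0)"
    then obtain s where s: "a < ereal s" "s < f \<xi>\<^sub>0" using ereal_dense2 by (metis ereal_less_eq(3) less_ereal.simps(1))
    have "(f \<xi>\<^sub>0 - s) / 3 > 0" and eq: "f \<xi>\<^sub>0 - 3 * ((f \<xi>\<^sub>0 - s) / 3) = s" using s(2) by (simp_all add: diff_divide_distrib)
    from key[OF this(1), unfolded eq] have "\<forall>\<^sub>F \<zeta> in at \<xi>\<^sub>0 within \<Theta>. ereal s \<le> upper_perron p q \<Theta> f \<zeta>"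
      by (rule eventually_mono) simp
    then show "\<forall>\<^sub>F \<zeta> in at \<xi>\<^sub>0 within \<Theta>. a < upper_perron p q \<Theta> f \<zeta>"
      by (rule eventually_mono) (rule less_le_trans[OF s(1)])
  next
    fix a assume "ereal (f \<xi>\<^sub>0) < a"
    then obtain s where s: "ereal s < a" "f \<xi>\<^sub>0 < s" using ereal_dense2 by (metis less_ereal.simps(1))
    have "(s - f \<xi>\<^sub>0) / 3 > 0" and eq: "f \<xi>\<^sub>0 + 3 * ((s - f \<xi>\<^sub>0) / 3) = s" using s(2) by (simp_all add: diff_divide_distrib)
    from key[OF this(1), unfolded eq] have "\<forall>\<^sub>F \<zeta> in at \<xi>\<^sub>0 within \<Theta>. upper_perron p q \<Theta> f \<zeta> \<le> ereal s"
      by (rule eventually_mono) simp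
    then show "\<forall>\<^sub>F \<zeta> in at \<xi>\<^sub>0 within \<Theta>. upper_perron p q \<Theta> f \<zeta> < a"
      by (rule eventually_mono) (rule le_less_trans[OF _ s(1)])
  qed
qed

theorem theorem5p5:
  fixes p q :: real
    and \<Theta> :: "((real ^ 'n) \<times> real) set"
    and \<xi>\<^sub>0 :: "(real ^ 'n) \<times> real"
  assumes "p > 1" and "q > 1"
    and "open \<Theta>" and "bounded \<Theta>"
    and "\<xi>\<^sub>0 \<in> frontier \<Theta>"
  shows "regular_point p q \<Theta> \<xi>\<^sub>0 \<longleftrightarrow> (\<exists>w. barrier_family p q \<Theta> \<xi>\<^sub>0 w)"
proof
  assume reg: "regular_point p q \<Theta> \<xi>\<^sub>0"
  have "\<forall>k\<in>{1..}. \<exists>w. (\<forall>\<zeta>\<in>\<Theta>. 0 < w \<zeta>) \<and> viscosity_supersolution p q \<Theta> w \<and> (w \<longlongrightarrow> 0) (at \<xi>\<^sub>0 within \<Theta>) \<and>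
    (\<forall>\<xi>\<in>frontier \<Theta>. dist \<xi> \<xi>\<^sub>0 \<ge> 1 / real k \<longrightarrow> Liminf (at \<xi> within \<Theta>) w \<ge> ereal (real k))"
    using regular_imp_barrier[OF assms reg] by simp
  from bchoice[OF this] obtain w where w: "\<forall>k\<in>{1..}. (\<forall>\<zeta>\<in>\<Theta>. 0 < w k \<zeta>) \<and> viscosity_supersolution p q \<Theta> (w k) \<and> (w k \<longlongrightarrow> 0) (at \<xi>\<^sub>0 within \<Theta>) \<and>
    (\<forall>\<xi>\<in>frontier \<Theta>. dist \<xi> \<xi>\<^sub>0 \<ge> 1 / real k \<longrightarrow> Liminf (at \<xi> within \<Theta>) (w k) \<ge> ereal (real k))"
    by (elim exE) (rule that)
  have "barrier_family p q \<Theta> \<xi>\<^sub>0 w" unfolding barrier_family_def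
  proof (intro conjI allI impI)
    \<comment> \<open>The index \<open>j = k\<close> serves, as \<open>w k\<close> was chosen for
      height \<open>k\<close> and distance \<open>1 / k\<close>.\<close>
    fix k :: nat assume k: "k \<ge> 1"
    show "\<exists>j\<ge>1. \<forall>\<xi>\<in>frontier \<Theta>. dist \<xi> \<xi>\<^sub>0 \<ge> 1 / real k \<longrightarrow> Liminf (at \<xi> within \<Theta>) (w j) \<ge> ereal (real k)"
      using w k by (intro exI[of _ k]) auto
  qed (use w in auto)
  then show "\<exists>w. barrier_family p q \<Theta> \<xi>\<^sub>0 w" by (rule exI[of _ w])
next
  assume "\<exists>w. barrier_family p q \<Theta> \<xi>\<^sub>0 w"
  then show "regular_point p q \<Theta> \<xi>\<^sub>0" using barrier_imp_regular[OF assms] by blast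
qed

end
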